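(* There is an algorithm that, given an undirected graph $G=(V,E)$, a weight function $\omega:V\rightarrow\mathbb{R}_+$ and an integer $k$, finds a minimum-weight connected vertex cover of $G$ among those of cardinality at most $k$ (or reports that no connected vertex cover of cardinality at most $k$ exists), in $O(2^k k(|V|+|E|))$ time and $O(2^k k)$ space.
   Context: A vertex cover of $G$ is a set $X\subseteq V$ containing at least one endpoint of every edge. It is a connected vertex cover if moreover the induced subgraph $G[X]$ is connected. The weight of a set $X$ is $\sum_{v\in X}\omega(v)$. This problem is called Weighted Connected Vertex Cover. Running times are in the standard RAM model where arithmetic operations and comparisons on weights take unit time. *)

theory Defs
  imports Complex_Main
begin

section \<open>Connected vertex covers\<close>

definition graph :: "'a set \<Rightarrow> 'a set set \<Rightarrow> bool" where
  "graph V E \<longleftrightarrow> finite V \<and> (\<forall>e\<in>E. e \<subseteq> V \<and> card e = 2)"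

definition vertex_cover :: "'a set \<Rightarrow> 'a set set \<Rightarrow> 'a set \<Rightarrow> bool" where
  "vertex_cover V E X \<longleftrightarrow> X \<subseteq> V \<and> (\<forall>e\<in>E. e \<inter> X \<noteq> {})"

text \<open>Connectedness of the subgraph induced by \<open>X\<close>. The empty subgraph counts as connected, so the
  empty set is a connected vertex cover of an edgeless graph.\<close>

definition induced_connected :: "'a set set \<Rightarrow> 'a set \<Rightarrow> bool" where
  "induced_connected E X \<longleftrightarrow>
     (\<forall>u\<in>X. \<forall>v\<in>X. (u, v) \<in> {(a, b). a \<in> X \<and> b \<in> X \<and> {a, b} \<in> E}\<^sup>*)"

definition connected_vertex_cover :: "'a set \<Rightarrow> 'a set set \<Rightarrow> 'a set \<Rightarrow> bool" where
  "connected_vertex_cover V E X \<longleftrightarrow> vertex_cover V E X \<and> induced_connected E X"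

definition weight :: "('a \<Rightarrow> real) \<Rightarrow> 'a set \<Rightarrow> real" where
  "weight \<omega> X = (\<Sum>v\<in>X. \<omega> v)"

definition min_weight_cvc ::
  "'a set \<Rightarrow> 'a set set \<Rightarrow> ('a \<Rightarrow> real) \<Rightarrow> int \<Rightarrow> 'a set \<Rightarrow> bool" where
  "min_weight_cvc V E \<omega> k X \<longleftrightarrow>
     connected_vertex_cover V E X \<and> int (card X) \<le> k \<and>
     (\<forall>Y. connected_vertex_cover V E Y \<and> int (card Y) \<le> k \<longrightarrow> weight \<omega> X \<le> weight \<omega> Y)"


section \<open>Random access machine\<close>

text \<open>
  A machine has two random access working memories, one holding integer words and one holding
  weights (reals), and two input arrays, one of each kind, that can only be read. Every
  instruction takes one unit of time. Integers and weights never get converted into each other.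
  Operands \<open>a b c\<close> are numbers of working cells (direct addressing); \<open>l\<close> is a program location.
  The instructions \<open>Load\<close>, \<open>Store\<close>, \<open>Input\<close> and their weight versions address indirectly:
  \<open>Load a b\<close> is \<open>M[a] := M[M[b]]\<close>, \<open>Store a b\<close> is \<open>M[M[a]] := M[b]\<close>, and \<open>Input a b\<close> reads
  into \<open>M[a]\<close> the input cell with number \<open>M[b]\<close>.
\<close>

datatype arith = Plus | Minus | Times | Divide

datatype instr =
    Const nat int
  | Op arith nat nat nat
  | Load nat nat
  | Store nat nat
  | Input nat nat
  | Jump nat
  | JumpLess nat nat nat
  | JumpEq nat nat nat
  | WOp arith nat nat nat
  | WLoad nat nat
  | WStore nat nat
  | WInput nat nat
  | WJumpLess nat nat nat
  | WJumpEq nat nat nat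

fun int_arith :: "arith \<Rightarrow> int \<Rightarrow> int \<Rightarrow> int" where
  "int_arith Plus x y = x + y"
| "int_arith Minus x y = x - y"
| "int_arith Times x y = x * y"
| "int_arith Divide x y = x div y"

fun real_arith :: "arith \<Rightarrow> real \<Rightarrow> real \<Rightarrow> real" where
  "real_arith Plus x y = x + y"
| "real_arith Minus x y = x - y"
| "real_arith Times x y = x * y"
| "real_arith Divide x y = x / y"

text \<open>A configuration consists of the program counter, the integer memory and the weight memory.\<close>

type_synonym config = "nat \<times> int list \<times> real list"

definition in_range :: "int \<Rightarrow> 'a list \<Rightarrow> bool" where
  "in_range i xs \<longleftrightarrow> 0 \<le> i \<and> i < int (length xs)"

text \<open>
  \<open>exec B I W i s s'\<close>: instruction \<open>i\<close> leads from \<open>s\<close> to \<open>s'\<close> on a machine with input arrays \<open>I\<close>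
  and \<open>W\<close> whose integer words hold only values of magnitude at most \<open>B\<close>. There is no successor
  if a cell outside the memories or the input is accessed, or if a result does not fit into a
  word. The lengths of the memories never change, so they bound the space used by a run.
\<close>

inductive exec :: "int \<Rightarrow> int list \<Rightarrow> real list \<Rightarrow> instr \<Rightarrow> config \<Rightarrow> config \<Rightarrow> bool"
  for B :: int and I :: "int list" and W :: "real list" where
  "\<lbrakk>a < length M; \<bar>x\<bar> \<le> B\<rbrakk>
    \<Longrightarrow> exec B I W (Const a x) (pc, M, R) (Suc pc, M[a := x], R)"
| "\<lbrakk>a < length M; b < length M; c < length M; x = int_arith f (M ! b) (M ! c); \<bar>x\<bar> \<le> B\<rbrakk>
    \<Longrightarrow> exec B I W (Op f a b c) (pc, M, R) (Suc pc, M[a := x], R)"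
| "\<lbrakk>a < length M; b < length M; in_range (M ! b) M\<rbrakk>
    \<Longrightarrow> exec B I W (Load a b) (pc, M, R) (Suc pc, M[a := M ! nat (M ! b)], R)"
| "\<lbrakk>a < length M; b < length M; in_range (M ! a) M\<rbrakk>
    \<Longrightarrow> exec B I W (Store a b) (pc, M, R) (Suc pc, M[nat (M ! a) := M ! b], R)"
| "\<lbrakk>a < length M; b < length M; in_range (M ! b) I; x = I ! nat (M ! b); \<bar>x\<bar> \<le> B\<rbrakk>
    \<Longrightarrow> exec B I W (Input a b) (pc, M, R) (Suc pc, M[a := x], R)"
| "exec B I W (Jump l) (pc, M, R) (l, M, R)"
| "\<lbrakk>a < length M; b < length M\<rbrakk>
    \<Longrightarrow> exec B I W (JumpLess a b l) (pc, M, R) (if M ! a < M ! b then l else Suc pc, M, R)"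
| "\<lbrakk>a < length M; b < length M\<rbrakk>
    \<Longrightarrow> exec B I W (JumpEq a b l) (pc, M, R) (if M ! a = M ! b then l else Suc pc, M, R)"
| "\<lbrakk>a < length R; b < length R; c < length R\<rbrakk>
    \<Longrightarrow> exec B I W (WOp f a b c) (pc, M, R) (Suc pc, M, R[a := real_arith f (R ! b) (R ! c)])"
| "\<lbrakk>a < length R; b < length M; in_range (M ! b) R\<rbrakk>
    \<Longrightarrow> exec B I W (WLoad a b) (pc, M, R) (Suc pc, M, R[a := R ! nat (M ! b)])"
| "\<lbrakk>a < length M; b < length R; in_range (M ! a) R\<rbrakk>
    \<Longrightarrow> exec B I W (WStore a b) (pc, M, R) (Suc pc, M, R[nat (M ! a) := R ! b])"
| "\<lbrakk>a < length R; b < length M; in_range (M ! b) W\<rbrakk>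
    \<Longrightarrow> exec B I W (WInput a b) (pc, M, R) (Suc pc, M, R[a := W ! nat (M ! b)])"
| "\<lbrakk>a < length R; b < length R\<rbrakk>
    \<Longrightarrow> exec B I W (WJumpLess a b l) (pc, M, R) (if R ! a < R ! b then l else Suc pc, M, R)"
| "\<lbrakk>a < length R; b < length R\<rbrakk>
    \<Longrightarrow> exec B I W (WJumpEq a b l) (pc, M, R) (if R ! a = R ! b then l else Suc pc, M, R)"

definition step ::
  "int \<Rightarrow> int list \<Rightarrow> real list \<Rightarrow> instr list \<Rightarrow> config \<Rightarrow> config \<Rightarrow> bool" where
  "step B I W p s s' \<longleftrightarrow> fst s < length p \<and> exec B I W (p ! fst s) s s'"

text \<open>
  \<open>halts_in p B S I W t M\<close>: started with \<open>S\<close> zeroed cells in each of the two memories, \<open>p\<close> makes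
  exactly \<open>t\<close> steps and then stops, by reaching the end of the program, with \<open>M\<close> in its integer
  memory.
\<close>

definition halts_in ::
  "instr list \<Rightarrow> int \<Rightarrow> nat \<Rightarrow> int list \<Rightarrow> real list \<Rightarrow> nat \<Rightarrow> int list \<Rightarrow> bool" where
  "halts_in p B S I W t M \<longleftrightarrow>
     (\<exists>R. (step B I W p ^^ t) (0, replicate S 0, replicate S 0) (length p, M, R))"


section \<open>Input and output conventions\<close>

text \<open>
  \<open>vs\<close> lists the vertices in an arbitrary order, and \<open>adj ! i\<close> lists, again in an arbitrary order,
  the positions in \<open>vs\<close> of the neighbours of \<open>vs ! i\<close>.
\<close>

definition adjacency_lists ::
  "'a set \<Rightarrow> 'a set set \<Rightarrow> 'a list \<Rightarrow> nat list list \<Rightarrow> bool" where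
  "adjacency_lists V E vs adj \<longleftrightarrow>
     distinct vs \<and> set vs = V \<and> length adj = length vs \<and>
     (\<forall>i<length vs. distinct (adj ! i) \<and>
        set (adj ! i) = {j. j < length vs \<and> {vs ! i, vs ! j} \<in> E})"

text \<open>
  With \<open>n\<close> vertices, the integer input array consists of \<open>k\<close>, \<open>n\<close>, offsets \<open>o\<^sub>0, \<dots>, o\<^sub>n\<close>, and the
  concatenation of the adjacency lists; the list of vertex \<open>i\<close> takes up the positions from \<open>o\<^sub>i\<close>
  (inclusive) to \<open>o\<^sub>i\<^sub>+\<^sub>1\<close> (exclusive) of this concatenation.
\<close>

definition input_words :: "int \<Rightarrow> nat list list \<Rightarrow> int list" where
  "input_words k adj =
     [k, int (length adj)]
     @ map (\<lambda>i. int (length (concat (take i adj)))) [0..<Suc (length adj)]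
     @ map int (concat adj)"

text \<open>
  The answer is found at the beginning of the integer memory: \<open>-1\<close> if there is no solution,
  otherwise the number of vertices of the solution followed by their positions in \<open>vs\<close>.
\<close>

definition outputs_none :: "int list \<Rightarrow> bool" where
  "outputs_none M \<longleftrightarrow> (\<exists>rest. M = -1 # rest)"

definition outputs_set :: "'a list \<Rightarrow> int list \<Rightarrow> 'a set \<Rightarrow> bool" where
  "outputs_set vs M X \<longleftrightarrow>
     (\<exists>js rest. M = int (length js) # map int js @ rest \<and>
        distinct js \<and> set js \<subseteq> {..<length vs} \<and> X = (\<lambda>j. vs ! j) ` set js)"


section \<open>Resource bounds\<close>

text \<open>
  The factors \<open>k\<close> and \<open>|V| + |E|\<close> are replaced by 1 where they would be smaller (no
  program runs in zero time or returns its answer in zero space); elsewhere the bounds are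
  literally \<open>2\<^sup>k k (|V| + |E|)\<close> and \<open>2\<^sup>k k\<close>.
\<close>

definition time_bound :: "'a set \<Rightarrow> 'a set set \<Rightarrow> int \<Rightarrow> nat" where
  "time_bound V E k = 2 ^ nat k * max 1 (nat k) * max 1 (card V + card E)"

definition space_bound :: "int \<Rightarrow> nat" where
  "space_bound k = 2 ^ nat k * max 1 (nat k)"

text \<open>
  Words have \<open>O(|k| + log (|V| + |E|))\<close> bits: enough for the input and for addresses, but not for
  packing large amounts of data into one cell.
\<close>

definition word_bound :: "nat \<Rightarrow> 'a set \<Rightarrow> 'a set set \<Rightarrow> int \<Rightarrow> int" where
  "word_bound c V E k = (2 ^ nat \<bar>k\<bar> * (int (card V + card E) + 2)) ^ c"

end

theory Submission imports Defs "HOL-Library.FuncSet" begin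

text \<open>
  First a set \<open>Q\<close> of pairs of adjacent vertices is grown: as long as some edge avoids \<open>Q\<close>, connectivity
  of every cover yields an edge that avoids \<open>Q\<close> but has an endpoint adjacent to \<open>Q\<close>. Every cover hits each
  of these disjoint edges, so more than \<open>k\<close> of them exclude a solution, and otherwise \<open>Q\<close> is a
  connected cover. Iterative compression then gives the pairs back one at a time. In each stage \<open>R\<close> consists
  of the remaining pairs, all of which stay in the solution, and a connected cover \<open>R \<union> Y\<close> with
  \<open>card Y \<le> k - j + 1\<close> is known, \<open>j\<close> being the number of remaining pairs. For each of the \<open>2 ^ card Y\<close> sets \<open>A \<subseteq> Y\<close> one looks for the
  lightest \<open>X\<close> with \<open>X \<inter> Y = A\<close>: the neighbours of \<open>Y - A\<close> are forced into \<open>X\<close>, and the other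
  vertices only have to connect the \<open>cc\<close> components of \<open>R \<union> A\<close> and the forced vertices, which is a
  dynamic program over sets of components, with \<open>2 ^ cc\<close> of them. A set of components corresponds to a consistent
  labeling of \<open>R \<union> Y\<close> with the labels outside, left and right; growing such labelings along the connected
  graph on \<open>R \<union> Y\<close> shows that there are at most \<open>3 * 2 ^ card Y\<close> in total. Summing over the stages is a geometric series.
  The algorithm is written in a small imperative language whose compiler to the machine is proved correct.
\<close>

text \<open>The working space must not depend on \<open>n\<close>, so no array may be indexed by the
  vertices of the graph. Only the current cover is stored, a list of at most
  \<open>2 * k + 2\<close> vertex numbers, and every question about a vertex is answered by
  searching it, at cost \<open>O(k)\<close> per adjacency entry. That is the factor \<open>k\<close>
  of the time bound, so each component set can afford only one pass over the graph. A transition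
  only adds components; therefore sets coded as binary numbers can be treated in numerical order.
  Whole pairs are kept for two reasons: \<open>R\<close> is then connected and acts as a single
  class, and every cover has a vertex in each of the \<open>j\<close> pairs, so at most
  \<open>k - j\<close> vertices remain outside \<open>R\<close>. Covers of intermediate stages may
  be larger than \<open>k\<close>; only for \<open>j = 0\<close> are size and weight those of the
  original problem. Labelings are counted because \<open>cc \<le> card A + 1\<close> alone would
  give about \<open>3 ^ k\<close>; only the sum of \<open>2 ^ cc\<close> over all \<open>A\<close>
  is known to be small enough. The answer has to appear in the very cells that hold the variables,
  so a short piece of plain machine code follows the compiled program.\<close>

section \<open>An imperative language and its compiler\<close>

datatype iexp = N int | V nat | Bin arith iexp iexp | Arr nat iexp | Inp iexp

datatype bexp = Less iexp iexp | Eq iexp iexp | RLess nat nat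

datatype com =
    Skip
  | Asg nat iexp
  | Put nat iexp iexp
  | RZero nat
  | RMov nat nat
  | RAdd nat nat nat
  | RGet nat iexp
  | RPut iexp nat
  | RInp nat iexp
  | Seq com com  (infixr ";;" 60)
  | Cond bexp com com
  | For nat iexp com

text \<open>The component \<open>tm\<close> is a ghost clock without counterpart on the machine. It
  accumulates an upper bound on the steps made, so that running times become ordinary
  postconditions.\<close>

record state =
  iv :: "nat \<Rightarrow> int"
  ia :: "nat \<Rightarrow> nat \<Rightarrow> int"
  rv :: "nat \<Rightarrow> real"
  ra :: "nat \<Rightarrow> real"
  tm :: nat

text \<open>Memory layout: variables occupy the cells below 60, the next ten cells are scratch space
  for expressions, and the arrays start at cell 70.\<close>

abbreviation tb :: nat where "tb \<equiv> 60"
abbreviation nv :: nat where "nv \<equiv> 70"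

primrec esize :: "iexp \<Rightarrow> nat" where
  "esize (N x) = 1"
| "esize (V v) = 2"
| "esize (Bin f a b) = esize a + esize b + 1"
| "esize (Arr a e) = esize e + 5"
| "esize (Inp e) = esize e + 1"

primrec bsize :: "bexp \<Rightarrow> nat" where
  "bsize (Less a b) = esize a + esize b + 1"
| "bsize (Eq a b) = esize a + esize b + 1"
| "bsize (RLess a b) = 1"

primrec csize :: "com \<Rightarrow> nat" where
  "csize Skip = 0"
| "csize (Asg v e) = esize e + 2"
| "csize (Put a i e) = esize i + esize e + 5"
| "csize (RZero r) = 1"
| "csize (RMov r a) = 2"
| "csize (RAdd r a b) = 1"
| "csize (RGet r e) = esize e + 3"
| "csize (RPut e r) = esize e + 3"
| "csize (RInp r e) = esize e + 1"
| "csize (Seq c d) = csize c + csize d"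
| "csize (Cond b c d) = bsize b + csize d + 1 + csize c"
| "csize (For x e c) = esize e + 8 + csize c"

primrec wv :: "com \<Rightarrow> nat set" where
  "wv Skip = {}"
| "wv (Asg v e) = {v}"
| "wv (Put a i e) = {}"
| "wv (RZero r) = {}"
| "wv (RMov r a) = {}"
| "wv (RAdd r a b) = {}"
| "wv (RGet r e) = {}"
| "wv (RPut e r) = {}"
| "wv (RInp r e) = {}"
| "wv (Seq c d) = wv c \<union> wv d"
| "wv (Cond b c d) = wv c \<union> wv d"
| "wv (For x e c) = {x, Suc x} \<union> wv c"

primrec wa :: "com \<Rightarrow> nat set" where
  "wa Skip = {}"
| "wa (Asg v e) = {}"
| "wa (Put a i e) = {a}"
| "wa (RZero r) = {}"
| "wa (RMov r a) = {}"
| "wa (RAdd r a b) = {}"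
| "wa (RGet r e) = {}"
| "wa (RPut e r) = {}"
| "wa (RInp r e) = {}"
| "wa (Seq c d) = wa c \<union> wa d"
| "wa (Cond b c d) = wa c \<union> wa d"
| "wa (For x e c) = wa c"

primrec wr :: "com \<Rightarrow> nat set" where
  "wr Skip = {}"
| "wr (Asg v e) = {}"
| "wr (Put a i e) = {}"
| "wr (RZero r) = {r}"
| "wr (RMov r a) = {r}"
| "wr (RAdd r a b) = {r}"
| "wr (RGet r e) = {r}"
| "wr (RPut e r) = {}"
| "wr (RInp r e) = {r}"
| "wr (Seq c d) = wr c \<union> wr d"
| "wr (Cond b c d) = wr c \<union> wr d"
| "wr (For x e c) = wr c"

primrec wra :: "com \<Rightarrow> bool" where
  "wra Skip = False"
| "wra (Asg v e) = False"
| "wra (Put a i e) = False"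
| "wra (RZero r) = False"
| "wra (RMov r a) = False"
| "wra (RAdd r a b) = False"
| "wra (RGet r e) = False"
| "wra (RPut e r) = True"
| "wra (RInp r e) = False"
| "wra (Seq c d) = (wra c \<or> wra d)"
| "wra (Cond b c d) = (wra c \<or> wra d)"
| "wra (For x e c) = wra c"

text \<open>The number \<open>d\<close> is the height of the evaluation stack: the value ends up in
  cell \<open>tb + d\<close>, and the cell above it is used for operands and addresses. The bound 9
  keeps both inside the scratch cells.\<close>

primrec wfe :: "nat \<Rightarrow> nat \<Rightarrow> iexp \<Rightarrow> bool" where
  "wfe na d (N x) = (d < 9)"
| "wfe na d (V v) = (d < 9 \<and> v < tb)"
| "wfe na d (Bin f a b) = (d < 9 \<and> wfe na d a \<and> wfe na (Suc d) b)"
| "wfe na d (Arr a e) = (d < 9 \<and> wfe na d e \<and> a < na)"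
| "wfe na d (Inp e) = (d < 9 \<and> wfe na d e)"

primrec wfb :: "nat \<Rightarrow> bexp \<Rightarrow> bool" where
  "wfb na (Less a b) = (wfe na 0 a \<and> wfe na 1 b)"
| "wfb na (Eq a b) = (wfe na 0 a \<and> wfe na 1 b)"
| "wfb na (RLess a b) = (a < 9 \<and> b < 9)"

text \<open>A loop body must leave alone the counter and the next cell, which stores the bound; so
  the number of rounds is fixed on entry. Weight registers stay below 9 because register 9 serves as
  the zero needed for moves.\<close>

primrec wf :: "nat \<Rightarrow> com \<Rightarrow> bool" where
  "wf na Skip = True"
| "wf na (Asg v e) = (wfe na 0 e \<and> v < tb)"
| "wf na (Put a i e) = (wfe na 0 i \<and> wfe na 1 e \<and> a < na)"
| "wf na (RZero r) = (r < 9)"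
| "wf na (RMov r a) = (r < 9 \<and> a < 9)"
| "wf na (RAdd r a b) = (r < 9 \<and> a < 9 \<and> b < 9)"
| "wf na (RGet r e) = (wfe na 0 e \<and> r < 9)"
| "wf na (RPut e r) = (wfe na 0 e \<and> r < 9)"
| "wf na (RInp r e) = (wfe na 0 e \<and> r < 9)"
| "wf na (Seq c d) = (wf na c \<and> wf na d)"
| "wf na (Cond b c d) = (wfb na b \<and> wf na c \<and> wf na d)"
| "wf na (For x e c) = (wfe na 0 e \<and> Suc x < tb \<and> wf na c \<and> x \<notin> wv c \<and> Suc x \<notin> wv c)"

definition acode :: "nat \<Rightarrow> nat \<Rightarrow> nat \<Rightarrow> instr list" where
  "acode na d a = [Const (tb + Suc d) (int na), Op Times (tb + d) (tb + d) (tb + Suc d),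
      Const (tb + Suc d) (int (nv + a)), Op Plus (tb + d) (tb + d) (tb + Suc d)]"

text \<open>Element \<open>i\<close> of array \<open>a\<close> lives in cell \<open>nv + na * i + a\<close>: interleaving the arrays makes
  all addresses independent of the array length.\<close>

primrec ecomp :: "nat \<Rightarrow> nat \<Rightarrow> iexp \<Rightarrow> instr list" where
  "ecomp na d (N x) = [Const (tb + d) x]"
| "ecomp na d (V v) = [Const (tb + d) 0, Op Plus (tb + d) v (tb + d)]"
| "ecomp na d (Bin f a b) = ecomp na d a @ ecomp na (Suc d) b @ [Op f (tb + d) (tb + d) (tb + Suc d)]"
| "ecomp na d (Arr a e) = ecomp na d e @ acode na d a @ [Load (tb + d) (tb + d)]"
| "ecomp na d (Inp e) = ecomp na d e @ [Input (tb + d) (tb + d)]"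

primrec bcomp :: "nat \<Rightarrow> nat \<Rightarrow> bexp \<Rightarrow> instr list" where
  "bcomp na l (Less a b) = ecomp na 0 a @ ecomp na 1 b @ [JumpLess tb (Suc tb) l]"
| "bcomp na l (Eq a b) = ecomp na 0 a @ ecomp na 1 b @ [JumpEq tb (Suc tb) l]"
| "bcomp na l (RLess a b) = [WJumpLess a b l]"

text \<open>The machine has no plain copy instruction, so a move is the addition of a zero produced
  on the spot; for weights this zero is a register minus itself. Jump targets are absolute, hence
  the argument \<open>pc\<close>. In a conditional the code of the else branch comes first, since
  the test jumps when it succeeds.\<close>

primrec ccomp :: "nat \<Rightarrow> nat \<Rightarrow> com \<Rightarrow> instr list" where
  "ccomp na pc Skip = []"
| "ccomp na pc (Asg v e) = ecomp na 0 e @ [Const (Suc tb) 0, Op Plus v tb (Suc tb)]"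
| "ccomp na pc (Put a i e) = ecomp na 0 i @ acode na 0 a @ ecomp na 1 e @ [Store tb (Suc tb)]"
| "ccomp na pc (RZero r) = [WOp Minus r r r]"
| "ccomp na pc (RMov r a) = [WOp Minus 9 9 9, WOp Plus r a 9]"
| "ccomp na pc (RAdd r a b) = [WOp Plus r a b]"
| "ccomp na pc (RGet r e) = ecomp na 0 e @ [Const (Suc tb) 10, Op Plus tb tb (Suc tb), WLoad r tb]"
| "ccomp na pc (RPut e r) = ecomp na 0 e @ [Const (Suc tb) 10, Op Plus tb tb (Suc tb), WStore tb r]"
| "ccomp na pc (RInp r e) = ecomp na 0 e @ [WInput r tb]"
| "ccomp na pc (Seq c d) = ccomp na pc c @ ccomp na (pc + csize c) d"
| "ccomp na pc (Cond b c d) =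
     bcomp na (pc + bsize b + csize d + 1) b @ ccomp na (pc + bsize b) d @
     [Jump (pc + bsize b + csize d + 1 + csize c)] @ ccomp na (pc + bsize b + csize d + 1) c"
| "ccomp na pc (For x e c) =
     ecomp na 0 e @ [Const (Suc tb) 0, Op Plus (Suc x) tb (Suc tb), Const x 0] @
     [JumpLess x (Suc x) (pc + esize e + 5), Jump (pc + esize e + 8 + csize c)] @
     ccomp na (pc + esize e + 5) c @
     [Const tb 1, Op Plus x x tb, Jump (pc + esize e + 3)]"

lemma length_acode [simp]: "length (acode na d a) = 4"
  by (simp add: acode_def)

lemma length_ecomp [simp]: "length (ecomp na d e) = esize e"
  by (induction e arbitrary: d) auto

lemma length_bcomp [simp]: "length (bcomp na l b) = bsize b"
  by (cases b) auto

lemma length_ccomp [simp]: "length (ccomp na pc c) = csize c"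
  by (induction c arbitrary: pc) auto

text \<open>The four steps charged per round are the loop test and the three instructions that
  increment the counter and jump back. Setting the counter to \<open>Suc i\<close> agrees with
  incrementing it because the body does not write it.\<close>

primrec loop :: "nat \<Rightarrow> (state \<Rightarrow> state) \<Rightarrow> nat \<Rightarrow> state \<Rightarrow> state" where
  "loop x f 0 s = s"
| "loop x f (Suc i) s = (let t = f (loop x f i s)
     in t\<lparr>iv := (iv t)(x := int (Suc i)), tm := tm t + 4\<rparr>)"

definition code_at :: "instr list \<Rightarrow> nat \<Rightarrow> instr list \<Rightarrow> bool" where
  "code_at p pc c \<longleftrightarrow> (\<exists>pre post. p = pre @ c @ post \<and> length pre = pc)"

lemma code_at_append: "code_at p pc (a @ b) \<longleftrightarrow> code_at p pc a \<and> code_at p (pc + length a) b"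
proof
  assume "code_at p pc (a @ b)"
  then obtain pre post where *: "p = pre @ (a @ b) @ post" "length pre = pc"
    unfolding code_at_def by blast
  have "p = pre @ a @ (b @ post)" "p = (pre @ a) @ b @ post" using * by auto
  then show "code_at p pc a \<and> code_at p (pc + length a) b"
    unfolding code_at_def using *(2) by (metis length_append)
next
  assume "code_at p pc a \<and> code_at p (pc + length a) b"
  then obtain pre post pre' post' where *: "p = pre @ a @ post" "length pre = pc"
    "p = pre' @ b @ post'" "length pre' = pc + length a"
    unfolding code_at_def by blast
  have "pre' = take (pc + length a) p" using * by (metis append_eq_conv_conj)
  also have "\<dots> = pre @ a" using *(1,2) by auto
  finally have "p = pre @ (a @ b) @ post'" using *(3) by simp
  then show "code_at p pc (a @ b)" unfolding code_at_def using *(2) by blast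
qed

lemma code_at_Cons: "code_at p pc (i # c) \<longleftrightarrow> code_at p pc [i] \<and> code_at p (Suc pc) c"
  using code_at_append[of p pc "[i]" c] by simp

lemma code_at_single: "code_at p pc [i] \<Longrightarrow> pc < length p \<and> p ! pc = i"
  unfolding code_at_def by (auto simp: nth_append)

lemma in_range_int: "in_range (int q) xs \<longleftrightarrow> q < length xs"
  by (simp add: in_range_def)

text \<open>All arrays share the length \<open>L\<close>, the single weight array included. The
  assumption \<open>room\<close> makes every array address computed by compiled code fit into a
  word.\<close>

locale machine =
  fixes B :: int and I :: "int list" and W :: "real list" and na :: nat and L :: nat
  assumes room: "int (nv + na * L) \<le> B" and na_pos: "0 < na"
begin

primrec eval :: "iexp \<Rightarrow> state \<Rightarrow> int" where
  "eval (N x) s = x"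
| "eval (V v) s = iv s v"
| "eval (Bin f a b) s = int_arith f (eval a s) (eval b s)"
| "eval (Arr a e) s = ia s a (nat (eval e s))"
| "eval (Inp e) s = I ! nat (eval e s)"

primrec esafe :: "iexp \<Rightarrow> state \<Rightarrow> bool" where
  "esafe (N x) s = (\<bar>x\<bar> \<le> B)"
| "esafe (V v) s = True"
| "esafe (Bin f a b) s = (esafe a s \<and> esafe b s \<and> \<bar>int_arith f (eval a s) (eval b s)\<bar> \<le> B)"
| "esafe (Arr a e) s = (esafe e s \<and> 0 \<le> eval e s \<and> eval e s < int L)"
| "esafe (Inp e) s = (esafe e s \<and> in_range (eval e s) I \<and> \<bar>I ! nat (eval e s)\<bar> \<le> B)"

primrec evalb :: "bexp \<Rightarrow> state \<Rightarrow> bool" where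
  "evalb (Less a b) s = (eval a s < eval b s)"
| "evalb (Eq a b) s = (eval a s = eval b s)"
| "evalb (RLess a b) s = (rv s a < rv s b)"

primrec bsafe :: "bexp \<Rightarrow> state \<Rightarrow> bool" where
  "bsafe (Less a b) s = (esafe a s \<and> esafe b s)"
| "bsafe (Eq a b) s = (esafe a s \<and> esafe b s)"
| "bsafe (RLess a b) s = True"

text \<open>A total function: accesses out of range get some value here and are excluded by
  \<open>safe\<close> instead, so that final states can be computed by rewriting. A conditional is
  charged one step more than its test, for the jump that ends the else branch.\<close>

primrec sem :: "com \<Rightarrow> state \<Rightarrow> state" where
  "sem Skip = (\<lambda>s. s)"
| "sem (Asg v e) = (\<lambda>s. s\<lparr>iv := (iv s)(v := eval e s), tm := tm s + (esize e + 2)\<rparr>)"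
| "sem (Put a i e) = (\<lambda>s. s\<lparr>ia := (ia s)(a := (ia s a)(nat (eval i s) := eval e s)),
     tm := tm s + (esize i + esize e + 5)\<rparr>)"
| "sem (RZero r) = (\<lambda>s. s\<lparr>rv := (rv s)(r := 0), tm := tm s + 1\<rparr>)"
| "sem (RMov r a) = (\<lambda>s. s\<lparr>rv := (rv s)(r := rv s a), tm := tm s + 2\<rparr>)"
| "sem (RAdd r a b) = (\<lambda>s. s\<lparr>rv := (rv s)(r := rv s a + rv s b), tm := tm s + 1\<rparr>)"
| "sem (RGet r e) = (\<lambda>s. s\<lparr>rv := (rv s)(r := ra s (nat (eval e s))), tm := tm s + (esize e + 3)\<rparr>)"
| "sem (RPut e r) = (\<lambda>s. s\<lparr>ra := (ra s)(nat (eval e s) := rv s r), tm := tm s + (esize e + 3)\<rparr>)"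
| "sem (RInp r e) = (\<lambda>s. s\<lparr>rv := (rv s)(r := W ! nat (eval e s)), tm := tm s + (esize e + 1)\<rparr>)"
| "sem (Seq c d) = (\<lambda>s. sem d (sem c s))"
| "sem (Cond b c d) = (\<lambda>s. let t = s\<lparr>tm := tm s + (bsize b + 1)\<rparr> in
     if evalb b s then sem c t else sem d t)"
| "sem (For x e c) = (\<lambda>s. let t = loop x (sem c) (nat (eval e s))
       (s\<lparr>iv := (iv s)(Suc x := eval e s, x := 0), tm := tm s + (esize e + 3)\<rparr>)
     in t\<lparr>tm := tm t + 2\<rparr>)"

primrec safe :: "com \<Rightarrow> state \<Rightarrow> bool" where
  "safe Skip = (\<lambda>s. True)"
| "safe (Asg v e) = (\<lambda>s. esafe e s)"
| "safe (Put a i e) = (\<lambda>s. esafe i s \<and> esafe e s \<and> 0 \<le> eval i s \<and> eval i s < int L)"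
| "safe (RZero r) = (\<lambda>s. True)"
| "safe (RMov r a) = (\<lambda>s. True)"
| "safe (RAdd r a b) = (\<lambda>s. True)"
| "safe (RGet r e) = (\<lambda>s. esafe e s \<and> 0 \<le> eval e s \<and> eval e s < int L)"
| "safe (RPut e r) = (\<lambda>s. esafe e s \<and> 0 \<le> eval e s \<and> eval e s < int L)"
| "safe (RInp r e) = (\<lambda>s. esafe e s \<and> in_range (eval e s) W)"
| "safe (Seq c d) = (\<lambda>s. safe c s \<and> safe d (sem c s))"
| "safe (Cond b c d) = (\<lambda>s. bsafe b s \<and> (let t = s\<lparr>tm := tm s + (bsize b + 1)\<rparr> in
     if evalb b s then safe c t else safe d t))"
| "safe (For x e c) = (\<lambda>s. esafe e s \<and> (\<forall>i < nat (eval e s). safe c (loop x (sem c) i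
       (s\<lparr>iv := (iv s)(Suc x := eval e s, x := 0), tm := tm s + (esize e + 3)\<rparr>))))"

text \<open>Scratch cells and weight register 9 are left open, and the memories may be longer than
  the part described. Every integer cell has to fit into a word because moving a value is an
  arithmetic operation whose result is checked.\<close>

definition rep :: "state \<Rightarrow> int list \<Rightarrow> real list \<Rightarrow> bool" where
  "rep s M R \<longleftrightarrow> nv + na * L \<le> length M \<and> 10 + L \<le> length R \<and>
     (\<forall>v<tb. M ! v = iv s v) \<and> (\<forall>a<na. \<forall>i<L. M ! (nv + na * i + a) = ia s a i) \<and>
     (\<forall>x\<in>set M. \<bar>x\<bar> \<le> B) \<and>
     (\<forall>r<9. R ! r = rv s r) \<and> (\<forall>i<L. R ! (10 + i) = ra s i)"

lemma B_ge: "70 \<le> B"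
  using room by linarith

lemma rep_tm [simp]: "rep (s\<lparr>tm := x\<rparr>) M R = rep s M R"
  by (simp add: rep_def)

lemma rep_temp:
  assumes "rep s M R" "tb \<le> v" "v < nv" "\<bar>x\<bar> \<le> B"
  shows "rep s (M[v := x]) R"
  using assms by (auto simp: rep_def dest!: subsetD[OF set_update_subset_insert])

lemma rep_var:
  assumes "rep s M R" "v < tb" "\<bar>x\<bar> \<le> B"
  shows "rep (s\<lparr>iv := (iv s)(v := x)\<rparr>) (M[v := x]) R"
  using assms by (auto simp: rep_def nth_list_update dest!: subsetD[OF set_update_subset_insert])

lemma slot_inj:
  assumes "a < na" "b < na" shows "na * i + a = na * j + b \<longleftrightarrow> i = j \<and> a = b"
proof
  assume *: "na * i + a = na * j + b"
  have "(na * i + a) div na = i" "(na * j + b) div na = j" using assms by auto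
  then have "i = j" using * by simp
  then show "i = j \<and> a = b" using * by simp
qed simp

lemma slot_lt:
  assumes "a < na" "i < L" shows "na * i + a < na * L"
proof -
  have "na * i + a < na * Suc i" using assms by simp
  also have "\<dots> \<le> na * L" using assms by (intro mult_le_mono2) simp
  finally show ?thesis .
qed

lemma rep_arr:
  assumes "rep s M R" "a < na" "i < L" "\<bar>x\<bar> \<le> B"
  shows "rep (s\<lparr>ia := (ia s)(a := (ia s a)(i := x))\<rparr>) (M[nv + na * i + a := x]) R"
proof -
  have "nv + (na * i + a) < length M" using slot_lt[OF assms(2,3)] assms(1) by (simp add: rep_def)
  then show ?thesis using assms
    by (auto simp: rep_def nth_list_update slot_inj add.assoc dest!: subsetD[OF set_update_subset_insert])
qed

lemma rep_rvar:
  assumes "rep s M R" "r < 9"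
  shows "rep (s\<lparr>rv := (rv s)(r := x)\<rparr>) M (R[r := x])"
  using assms by (auto simp: rep_def nth_list_update)

lemma rep_rarr:
  assumes "rep s M R" "i < L"
  shows "rep (s\<lparr>ra := (ra s)(i := x)\<rparr>) M (R[10 + i := x])"
  using assms by (auto simp: rep_def nth_list_update)

lemma rep_rtemp:
  assumes "rep s M R"
  shows "rep s M (R[9 := x])"
  using assms by (auto simp: rep_def nth_list_update)

lemma rep_length: "rep s M R \<Longrightarrow> nv \<le> length M \<and> 10 \<le> length R"
  by (auto simp: rep_def)

lemma rep_bound: "rep s M R \<Longrightarrow> v < length M \<Longrightarrow> \<bar>M ! v\<bar> \<le> B"
  by (auto simp: rep_def)

definition runs :: "instr list \<Rightarrow> nat \<Rightarrow> config \<Rightarrow> config \<Rightarrow> bool" where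
  "runs p t c c' \<longleftrightarrow> (step B I W p ^^ t) c c'"

lemma runs_0 [simp]: "runs p 0 c c' \<longleftrightarrow> c = c'"
  by (simp add: runs_def)

lemma runs_trans: "runs p t c c' \<Longrightarrow> runs p t' c' c'' \<Longrightarrow> runs p (t + t') c c''"
  unfolding runs_def by (auto simp: relpowp_add)

lemma runs_step:
  assumes "code_at p pc [i]" "exec B I W i (pc, M, R) c'"
  shows "runs p 1 (pc, M, R) c'"
  using code_at_single[OF assms(1)] assms(2) by (auto simp: runs_def step_def)

lemma runs_Suc:
  assumes "code_at p pc [i]" "exec B I W i (pc, M, R) c'" "runs p t c' c''"
  shows "runs p (Suc t) (pc, M, R) c''"
  using runs_trans[OF runs_step[OF assms(1,2)] assms(3)] by simp

lemma acode_runs: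
  assumes "code_at p pc (acode na d a)" "rep s M R" "M ! (tb + d) = int i" "a < na" "i < L" "d < 9"
  shows "\<exists>M'. runs p 4 (pc, M, R) (pc + 4, M', R) \<and> rep s M' R \<and>
     M' ! (tb + d) = int (nv + na * i + a) \<and> (\<forall>d'<d. M' ! (tb + d') = M ! (tb + d')) \<and> length M' = length M"
proof -
  have c: "code_at p pc [Const (tb + Suc d) (int na)]"
    "code_at p (Suc pc) [Op Times (tb + d) (tb + d) (tb + Suc d)]"
    "code_at p (Suc (Suc pc)) [Const (tb + Suc d) (int (nv + a))]"
    "code_at p (Suc (Suc (Suc pc))) [Op Plus (tb + d) (tb + d) (tb + Suc d)]"
    using assms(1) unfolding acode_def by (auto simp: code_at_Cons[of p _ "_::instr" "_ # _"])
  have l: "nv \<le> length M" using rep_length[OF assms(2)] by simp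
  have lt: "na * i + a < na * L" using slot_lt assms by blast
  have "na * i \<le> na * L" using assms(5) by simp
  then have b1: "int (na * i) \<le> B" using room by linarith
  have "na * 1 \<le> na * L" using assms(5) by (intro mult_le_mono2) simp
  then have b2: "int na \<le> B" "int (nv + a) \<le> B" using room assms(4) by linarith+
  have b3: "int (nv + na * i + a) \<le> B" using room lt by linarith
  define M2 where "M2 = M[tb + Suc d := int na]"
  define M3 where "M3 = M2[tb + d := int (na * i)]"
  define M4 where "M4 = M3[tb + Suc d := int (nv + a)]"
  define M5 where "M5 = M4[tb + d := int (nv + na * i + a)]"
  have b: "\<bar>int na\<bar> \<le> B" "\<bar>int (na * i)\<bar> \<le> B" "\<bar>int (nv + a)\<bar> \<le> B" "\<bar>int (nv + na * i + a)\<bar> \<le> B"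
    using b1 b2 b3 by (simp_all only: abs_of_nat)
  have r5: "rep s M5 R" unfolding M5_def M4_def M3_def M2_def
    by (intro rep_temp assms(2) b) (use assms(6) in auto)
  have 1: "exec B I W (Const (tb + Suc d) (int na)) (pc, M, R) (Suc pc, M2, R)"
    unfolding M2_def by (intro exec.intros b) (use l assms in auto)
  have 2: "exec B I W (Op Times (tb + d) (tb + d) (tb + Suc d)) (Suc pc, M2, R) (Suc (Suc pc), M3, R)"
    unfolding M3_def by (intro exec.intros b) (use l assms in \<open>auto simp: M2_def\<close>)
  have 3: "exec B I W (Const (tb + Suc d) (int (nv + a))) (Suc (Suc pc), M3, R) (Suc (Suc (Suc pc)), M4, R)"
    unfolding M4_def by (intro exec.intros b) (use l assms in \<open>auto simp: M2_def M3_def\<close>)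
  have 4: "exec B I W (Op Plus (tb + d) (tb + d) (tb + Suc d)) (Suc (Suc (Suc pc)), M4, R)
     (Suc (Suc (Suc (Suc pc))), M5, R)"
    unfolding M5_def by (intro exec.intros b) (use l assms in \<open>auto simp: M2_def M3_def M4_def\<close>)
  have "runs p (Suc (Suc (Suc 1))) (pc, M, R) (Suc (Suc (Suc (Suc pc))), M5, R)"
    by (rule runs_Suc[OF c(1) 1 runs_Suc[OF c(2) 2 runs_Suc[OF c(3) 3 runs_step[OF c(4) 4]]]])
  then have "runs p 4 (pc, M, R) (pc + 4, M5, R)" by (simp add: eval_nat_numeral)
  then show ?thesis using r5 l assms(6)
    by (intro exI[of _ M5]) (auto simp: M5_def M4_def M3_def M2_def)
qed

text \<open>That the cells from \<open>tb\<close> up to \<open>tb + d\<close> stay unchanged is part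
  of the claim because a binary operation keeps its left operand there while the right one is
  evaluated.\<close>

lemma ecomp_runs:
  assumes "code_at p pc (ecomp na d e)" "rep s M R" "esafe e s" "wfe na d e"
  shows "\<exists>M'. runs p (esize e) (pc, M, R) (pc + esize e, M', R) \<and> rep s M' R \<and>
     M' ! (tb + d) = eval e s \<and> (\<forall>d'<d. M' ! (tb + d') = M ! (tb + d')) \<and> length M' = length M"
  using assms
proof (induction e arbitrary: pc d M)
  case (N x)
  then have "exec B I W (Const (tb + d) x) (pc, M, R) (Suc pc, M[tb + d := x], R)"
    using rep_length[of s M R] by (intro exec.intros) auto
  from runs_step[OF _ this] N have "runs p 1 (pc, M, R) (Suc pc, M[tb + d := x], R)" by simp
  then show ?case using N rep_length[of s M R]
    by (intro exI[of _ "M[tb + d := x]"]) (auto intro!: rep_temp)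
next
  case (V v)
  define M1 where "M1 = M[tb + d := 0]"
  define M2 where "M2 = M1[tb + d := M ! v]"
  have l: "nv \<le> length M" using rep_length V by blast
  have c: "code_at p pc [Const (tb + d) 0]" "code_at p (Suc pc) [Op Plus (tb + d) v (tb + d)]"
    using V(1) code_at_Cons[of p pc _ "[Op Plus (tb + d) v (tb + d)]"] by auto
  have b: "\<bar>M ! v\<bar> \<le> B" using rep_bound V l by simp
  have 1: "exec B I W (Const (tb + d) 0) (pc, M, R) (Suc pc, M1, R)"
    using l V B_ge unfolding M1_def by (intro exec.intros) auto
  have 2: "exec B I W (Op Plus (tb + d) v (tb + d)) (Suc pc, M1, R) (Suc (Suc pc), M2, R)"
    using l V b unfolding M2_def by (intro exec.intros) (auto simp: M1_def)
  have "runs p 2 (pc, M, R) (Suc (Suc pc), M2, R)"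
    using runs_Suc[OF c(1) 1 runs_step[OF c(2) 2]] by (simp add: numeral_2_eq_2)
  moreover have "rep s M2 R" unfolding M2_def M1_def using V b B_ge
    by (intro rep_temp) auto
  moreover have "M ! v = iv s v" using V by (simp add: rep_def)
  ultimately show ?case using V l by (intro exI[of _ M2]) (auto simp: M2_def M1_def)
next
  case (Bin f a b)
  have c: "code_at p pc (ecomp na d a)" "code_at p (pc + esize a) (ecomp na (Suc d) b)"
    "code_at p (pc + esize a + esize b) [Op f (tb + d) (tb + d) (tb + Suc d)]"
    using Bin.prems(1) by (auto simp: code_at_append add.assoc)
  obtain M1 where M1: "runs p (esize a) (pc, M, R) (pc + esize a, M1, R)" "rep s M1 R"
     "M1 ! (tb + d) = eval a s" "\<forall>d'<d. M1 ! (tb + d') = M ! (tb + d')" "length M1 = length M"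
    using Bin.IH(1)[OF c(1) Bin.prems(2)] Bin.prems by auto
  obtain M2 where M2: "runs p (esize b) (pc + esize a, M1, R) (pc + esize a + esize b, M2, R)" "rep s M2 R"
     "M2 ! (tb + Suc d) = eval b s" "\<forall>d'<Suc d. M2 ! (tb + d') = M1 ! (tb + d')" "length M2 = length M1"
    using Bin.IH(2)[OF c(2) M1(2)] Bin.prems by auto
  define M3 where "M3 = M2[tb + d := int_arith f (eval a s) (eval b s)]"
  have l: "nv \<le> length M2" using rep_length M2 by blast
  have 3: "exec B I W (Op f (tb + d) (tb + d) (tb + Suc d)) (pc + esize a + esize b, M2, R)
     (Suc (pc + esize a + esize b), M3, R)"
    unfolding M3_def using l Bin.prems M2 M1 by (intro exec.intros) auto
  have "runs p (esize a + esize b + 1) (pc, M, R) (Suc (pc + esize a + esize b), M3, R)"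
    by (rule runs_trans[OF runs_trans[OF M1(1) M2(1)] runs_step[OF c(3) 3]])
  moreover have "rep s M3 R" unfolding M3_def using M2 Bin.prems by (intro rep_temp) auto
  ultimately show ?case using M1 M2 l Bin.prems by (intro exI[of _ M3]) (auto simp: M3_def add.assoc)
next
  case (Arr a e)
  let ?pc = "pc + esize e"
  have c: "code_at p pc (ecomp na d e)" "code_at p ?pc (acode na d a)"
    "code_at p (?pc + 4) [Load (tb + d) (tb + d)]"
    using Arr.prems(1) by (auto simp: code_at_append add.assoc)
  obtain M1 where M1: "runs p (esize e) (pc, M, R) (?pc, M1, R)" "rep s M1 R"
     "M1 ! (tb + d) = eval e s" "\<forall>d'<d. M1 ! (tb + d') = M ! (tb + d')" "length M1 = length M"
    using Arr.IH[OF c(1) Arr.prems(2)] Arr.prems by auto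
  define i where "i = nat (eval e s)"
  have i: "i < L" "eval e s = int i" using Arr.prems by (auto simp: i_def)
  have a: "a < na" "d < 9" using Arr.prems by auto
  obtain M5 where M5: "runs p 4 (?pc, M1, R) (?pc + 4, M5, R)" "rep s M5 R"
     "M5 ! (tb + d) = int (nv + na * i + a)" "\<forall>d'<d. M5 ! (tb + d') = M1 ! (tb + d')" "length M5 = length M1"
    using acode_runs[OF c(2) M1(2) _ a(1) i(1) a(2)] M1(3) i(2) by auto
  have l: "nv \<le> length M5" "nv + na * L \<le> length M5" using M5(2) by (auto simp: rep_def)
  have lt: "na * i + a < na * L" using slot_lt a i by blast
  define M6 where "M6 = M5[tb + d := ia s a i]"
  have v5: "M5 ! (nv + na * i + a) = ia s a i" using M5(2) a i by (simp add: rep_def)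
  have b5: "\<bar>ia s a i\<bar> \<le> B" using rep_bound[OF M5(2), of "nv + na * i + a"] v5 l lt by simp
  have r5: "in_range (M5 ! (tb + d)) M5" unfolding M5(3) in_range_int using l lt by linarith
  have "exec B I W (Load (tb + d) (tb + d)) (?pc + 4, M5, R)
     (Suc (?pc + 4), M5[tb + d := M5 ! nat (M5 ! (tb + d))], R)"
    using l a r5 by (intro exec.intros) auto
  moreover have "M5 ! nat (M5 ! (tb + d)) = ia s a i" unfolding M5(3) using v5
    by (metis nat_int)
  ultimately have 5: "exec B I W (Load (tb + d) (tb + d)) (?pc + 4, M5, R) (Suc (?pc + 4), M6, R)"
    by (simp add: M6_def)
  from runs_trans[OF M1(1) runs_trans[OF M5(1) runs_step[OF c(3) 5]]]
  have "runs p (esize e + 5) (pc, M, R) (pc + (esize e + 5), M6, R)" by (simp add: eval_nat_numeral)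
  moreover have "rep s M6 R" unfolding M6_def using M5(2) b5 a by (intro rep_temp) auto
  ultimately show ?case using l a M1 M5 i_def
    by (intro exI[of _ M6]) (auto simp: M6_def)
next
  case (Inp e)
  let ?pc = "pc + esize e"
  have c: "code_at p pc (ecomp na d e)" "code_at p ?pc [Input (tb + d) (tb + d)]"
    using Inp.prems(1) by (auto simp: code_at_append)
  obtain M1 where M1: "runs p (esize e) (pc, M, R) (?pc, M1, R)" "rep s M1 R"
     "M1 ! (tb + d) = eval e s" "\<forall>d'<d. M1 ! (tb + d') = M ! (tb + d')" "length M1 = length M"
    using Inp.IH[OF c(1) Inp.prems(2)] Inp.prems by auto
  define M2 where "M2 = M1[tb + d := I ! nat (eval e s)]"
  have l: "nv \<le> length M1" using rep_length M1 by blast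
  have 2: "exec B I W (Input (tb + d) (tb + d)) (?pc, M1, R) (Suc ?pc, M2, R)"
    unfolding M2_def using l Inp.prems M1 by (intro exec.intros) auto
  have "runs p (esize e + 1) (pc, M, R) (Suc ?pc, M2, R)"
    by (rule runs_trans[OF M1(1) runs_step[OF c(2) 2]])
  moreover have "rep s M2 R" unfolding M2_def using M1 Inp.prems by (intro rep_temp) auto
  ultimately show ?case using M1 l Inp.prems by (intro exI[of _ M2]) (auto simp: M2_def)
qed

lemma bcomp_runs:
  assumes "code_at p pc (bcomp na l b)" "rep s M R" "bsafe b s" "wfb na b"
  shows "\<exists>M'. runs p (bsize b) (pc, M, R) (if evalb b s then l else pc + bsize b, M', R) \<and>
     rep s M' R \<and> length M' = length M"
proof -
  have two: "\<exists>M'. runs p (esize x + esize y) (pc, M, R) (pc + esize x + esize y, M', R) \<and>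
     rep s M' R \<and> length M' = length M \<and> M' ! tb = eval x s \<and> M' ! Suc tb = eval y s"
    if h: "code_at p pc (ecomp na 0 x)" "code_at p (pc + esize x) (ecomp na 1 y)"
      "esafe x s" "esafe y s" "wfe na 0 x" "wfe na 1 y" for x y
  proof -
    obtain M1 where M1: "runs p (esize x) (pc, M, R) (pc + esize x, M1, R)" "rep s M1 R"
       "M1 ! tb = eval x s" "length M1 = length M"
      using ecomp_runs[OF h(1) assms(2) h(3,5)] by auto
    obtain M2 where M2: "runs p (esize y) (pc + esize x, M1, R) (pc + esize x + esize y, M2, R)" "rep s M2 R"
       "M2 ! Suc tb = eval y s" "M2 ! tb = M1 ! tb" "length M2 = length M1"
      using ecomp_runs[OF h(2) M1(2) h(4,6)] by auto
    show ?thesis using runs_trans[OF M1(1) M2(1)] M1 M2 by (intro exI[of _ M2]) auto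
  qed
  show ?thesis
  proof (cases b)
    case (Less x y)
    have c: "code_at p pc (ecomp na 0 x)" "code_at p (pc + esize x) (ecomp na 1 y)"
      "code_at p (pc + esize x + esize y) [JumpLess tb (Suc tb) l]"
      using assms(1) Less by (auto simp: code_at_append add.assoc)
    obtain M' where M': "runs p (esize x + esize y) (pc, M, R) (pc + esize x + esize y, M', R)"
     "rep s M' R" "length M' = length M" "M' ! tb = eval x s" "M' ! Suc tb = eval y s"
      using two[OF c(1,2)] assms Less by auto
    have "exec B I W (JumpLess tb (Suc tb) l) (pc + esize x + esize y, M', R)
       (if M' ! tb < M' ! Suc tb then l else Suc (pc + esize x + esize y), M', R)"
      using rep_length[OF M'(2)] by (intro exec.intros) auto
    from runs_trans[OF M'(1) runs_step[OF c(3) this]] M' Less show ?thesis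
      by (intro exI[of _ M']) (auto simp: add.assoc split: if_splits)
  next
    case (Eq x y)
    have c: "code_at p pc (ecomp na 0 x)" "code_at p (pc + esize x) (ecomp na 1 y)"
      "code_at p (pc + esize x + esize y) [JumpEq tb (Suc tb) l]"
      using assms(1) Eq by (auto simp: code_at_append add.assoc)
    obtain M' where M': "runs p (esize x + esize y) (pc, M, R) (pc + esize x + esize y, M', R)"
     "rep s M' R" "length M' = length M" "M' ! tb = eval x s" "M' ! Suc tb = eval y s"
      using two[OF c(1,2)] assms Eq by auto
    have "exec B I W (JumpEq tb (Suc tb) l) (pc + esize x + esize y, M', R)
       (if M' ! tb = M' ! Suc tb then l else Suc (pc + esize x + esize y), M', R)"
      using rep_length[OF M'(2)] by (intro exec.intros) auto
    from runs_trans[OF M'(1) runs_step[OF c(3) this]] M' Eq show ?thesis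
      by (intro exI[of _ M']) (auto simp: add.assoc split: if_splits)
  next
    case (RLess x y)
    have "exec B I W (WJumpLess x y l) (pc, M, R) (if R ! x < R ! y then l else Suc pc, M, R)"
      using rep_length[OF assms(2)] assms RLess by (intro exec.intros) auto
    moreover have "R ! x = rv s x" "R ! y = rv s y" using assms RLess by (auto simp: rep_def)
    ultimately show ?thesis using runs_step assms RLess
      by (intro exI[of _ M]) (auto split: if_splits)
  qed
qed

lemma loop_frame:
  assumes "\<And>t. g (f t) = g t" "\<And>t y w. g (t\<lparr>iv := (iv t)(x := y), tm := w\<rparr>) = g t"
  shows "g (loop x f n s) = g s"
  using assms by (induction n) (auto simp: Let_def)

lemma frame_iv: "v \<notin> wv c \<Longrightarrow> iv (sem c s) v = iv s v"
proof (induction c arbitrary: s)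
  case (For x e c)
  then show ?case
    using loop_frame[of "\<lambda>t. iv t v" "sem c" x] by (simp add: Let_def)
qed (auto simp: Let_def)

lemma frame_ia: "a \<notin> wa c \<Longrightarrow> ia (sem c s) a = ia s a"
proof (induction c arbitrary: s)
  case (For x e c)
  then show ?case
    using loop_frame[of "\<lambda>t. ia t a" "sem c" x] by (simp add: Let_def)
qed (auto simp: Let_def)

lemma frame_rv: "r \<notin> wr c \<Longrightarrow> rv (sem c s) r = rv s r"
proof (induction c arbitrary: s)
  case (For x e c)
  then show ?case
    using loop_frame[of "\<lambda>t. rv t r" "sem c" x] by (simp add: Let_def)
qed (auto simp: Let_def)

lemma frame_ra: "\<not> wra c \<Longrightarrow> ra (sem c s) = ra s"
proof (induction c arbitrary: s)
  case (For x e c)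
  then show ?case
    using loop_frame[of "\<lambda>t. ra t" "sem c" x] by (simp add: Let_def)
qed (auto simp: Let_def)

lemma asg_tail:
  assumes "code_at p pc [Const (Suc tb) 0, Op Plus v tb (Suc tb)]" "rep s M R" "v < tb"
  shows "\<exists>M'. runs p 2 (pc, M, R) (pc + 2, M', R) \<and> rep (s\<lparr>iv := (iv s)(v := M ! tb)\<rparr>) M' R \<and> length M' = length M"
proof -
  have c: "code_at p pc [Const (Suc tb) 0]" "code_at p (Suc pc) [Op Plus v tb (Suc tb)]"
    using assms(1) by (auto simp: code_at_Cons[of p _ "_::instr" "_ # _"])
  have l: "nv \<le> length M" using rep_length[OF assms(2)] by simp
  have b: "\<bar>M ! tb\<bar> \<le> B" using rep_bound[OF assms(2)] l by simp
  define M1 where "M1 = M[Suc tb := 0]"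
  define M2 where "M2 = M1[v := M ! tb]"
  have 1: "exec B I W (Const (Suc tb) 0) (pc, M, R) (Suc pc, M1, R)"
    unfolding M1_def using l B_ge by (intro exec.intros) auto
  have 2: "exec B I W (Op Plus v tb (Suc tb)) (Suc pc, M1, R) (Suc (Suc pc), M2, R)"
    unfolding M2_def using l assms(3) b by (intro exec.intros) (auto simp: M1_def)
  have "rep s M1 R" unfolding M1_def using assms B_ge by (intro rep_temp) auto
  from rep_var[OF this assms(3) b] runs_Suc[OF c(1) 1 runs_step[OF c(2) 2]]
  show ?thesis by (intro exI[of _ M2]) (auto simp: M2_def M1_def numeral_2_eq_2)
qed

lemma raddr_runs:
  assumes "code_at p pc [Const (Suc tb) 10, Op Plus tb tb (Suc tb)]" "rep s M R" "M ! tb = int i" "i < L"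
  shows "\<exists>M'. runs p 2 (pc, M, R) (pc + 2, M', R) \<and> rep s M' R \<and> length M' = length M \<and> M' ! tb = int (10 + i)"
proof -
  have c: "code_at p pc [Const (Suc tb) 10]" "code_at p (Suc pc) [Op Plus tb tb (Suc tb)]"
    using assms(1) by (auto simp: code_at_Cons[of p _ "_::instr" "_ # _"])
  have l: "nv \<le> length M" using rep_length[OF assms(2)] by simp
  have "1 * L \<le> na * L" using na_pos by (intro mult_le_mono1) simp
  then have b: "int (10 + i) \<le> B" using room assms(4) by linarith
  define M1 where "M1 = M[Suc tb := 10]"
  define M2 where "M2 = M1[tb := int (10 + i)]"
  have 1: "exec B I W (Const (Suc tb) 10) (pc, M, R) (Suc pc, M1, R)"
    unfolding M1_def using l B_ge by (intro exec.intros) auto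
  have 2: "exec B I W (Op Plus tb tb (Suc tb)) (Suc pc, M1, R) (Suc (Suc pc), M2, R)"
    unfolding M2_def using l assms(3) b by (intro exec.intros) (auto simp: M1_def)
  have "rep s M2 R" unfolding M1_def M2_def using assms B_ge b by (intro rep_temp) auto
  with runs_Suc[OF c(1) 1 runs_step[OF c(2) 2]] l
  show ?thesis by (intro exI[of _ M2]) (auto simp: M2_def M1_def numeral_2_eq_2)
qed

text \<open>Simulation by induction on the command. The clock bounds the steps only from above,
  since a conditional pays for the closing jump even when its then branch is taken.\<close>

lemma ccomp_runs:
  assumes "code_at p pc (ccomp na pc c)" "rep s M R" "safe c s" "wf na c"
  shows "\<exists>t M' R'. t + tm s \<le> tm (sem c s) \<and> runs p t (pc, M, R) (pc + csize c, M', R') \<and>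
    rep (sem c s) M' R' \<and> length M' = length M \<and> length R' = length R"
  using assms
proof (induction c arbitrary: pc s M R)
  case Skip
  then show ?case by (intro exI[of _ 0]) auto
next
  case (Asg v e)
  have c: "code_at p pc (ecomp na 0 e)" "code_at p (pc + esize e) [Const (Suc tb) 0, Op Plus v tb (Suc tb)]"
    using Asg.prems(1) by (auto simp: code_at_append)
  obtain M1 where M1: "runs p (esize e) (pc, M, R) (pc + esize e, M1, R)" "rep s M1 R"
     "M1 ! tb = eval e s" "length M1 = length M"
    using ecomp_runs[OF c(1) Asg.prems(2)] Asg.prems by auto
  obtain M2 where M2: "runs p 2 (pc + esize e, M1, R) (pc + esize e + 2, M2, R)"
      "rep (s\<lparr>iv := (iv s)(v := M1 ! tb)\<rparr>) M2 R" "length M2 = length M1"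
    using asg_tail[OF c(2) M1(2)] Asg.prems by auto
  have "rep (sem (Asg v e) s) M2 R" using M2(2) M1(3) by (simp add: rep_def)
  then show ?case using runs_trans[OF M1(1) M2(1)] M1 M2
    by (intro exI[of _ "esize e + 2"] exI[of _ M2] exI[of _ R]) (auto simp: add.assoc)
next
  case (Put a i e)
  let ?q = "pc + esize i"
  have c: "code_at p pc (ecomp na 0 i)" "code_at p ?q (acode na 0 a)"
    "code_at p (?q + 4) (ecomp na 1 e)" "code_at p (?q + 4 + esize e) [Store tb (Suc tb)]"
    using Put.prems(1) by (auto simp: code_at_append add.assoc)
  define j where "j = nat (eval i s)"
  have j: "j < L" "eval i s = int j" "a < na" using Put.prems by (auto simp: j_def)
  obtain M1 where M1: "runs p (esize i) (pc, M, R) (?q, M1, R)" "rep s M1 R"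
     "M1 ! tb = eval i s" "length M1 = length M"
    using ecomp_runs[OF c(1) Put.prems(2)] Put.prems by auto
  obtain M2 where M2: "runs p 4 (?q, M1, R) (?q + 4, M2, R)" "rep s M2 R"
     "M2 ! tb = int (nv + na * j + a)" "length M2 = length M1"
    using acode_runs[OF c(2) M1(2), of j] M1(3) j by auto
  obtain M3 where M3: "runs p (esize e) (?q + 4, M2, R) (?q + 4 + esize e, M3, R)" "rep s M3 R"
     "M3 ! Suc tb = eval e s" "M3 ! tb = M2 ! tb" "length M3 = length M2"
    using ecomp_runs[OF c(3) M2(2)] Put.prems by auto
  define M4 where "M4 = M3[nv + na * j + a := eval e s]"
  have l: "nv + na * L \<le> length M3" using M3(2) by (simp add: rep_def)
  have lt: "na * j + a < na * L" using slot_lt j by blast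
  have r3: "in_range (M3 ! tb) M3" unfolding M3(4) M2(3) in_range_int using l lt by linarith
  have "exec B I W (Store tb (Suc tb)) (?q + 4 + esize e, M3, R)
    (Suc (?q + 4 + esize e), M3[nat (M3 ! tb) := M3 ! Suc tb], R)"
    using l r3 by (intro exec.intros) auto
  moreover have "nat (M3 ! tb) = nv + na * j + a" unfolding M3(4) M2(3) by (rule nat_int)
  ultimately have 4: "exec B I W (Store tb (Suc tb)) (?q + 4 + esize e, M3, R)
    (Suc (?q + 4 + esize e), M4, R)" using M3(3) by (simp only: M4_def)
  have b: "\<bar>eval e s\<bar> \<le> B" using rep_bound[OF M3(2), of "Suc tb"] M3(3) l by simp
  have "rep (sem (Put a i e) s) M4 R" using rep_arr[OF M3(2) j(3,1) b]
    by (simp add: M4_def j_def rep_def)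
  moreover have "runs p (esize i + (4 + (esize e + 1))) (pc, M, R) (Suc (?q + 4 + esize e), M4, R)"
    by (rule runs_trans[OF M1(1) runs_trans[OF M2(1) runs_trans[OF M3(1) runs_step[OF c(4) 4]]]])
  ultimately show ?case using M1 M2 M3
    by (intro exI[of _ "esize i + (4 + (esize e + 1))"] exI[of _ M4] exI[of _ R])
      (auto simp: M4_def eval_nat_numeral add.assoc)
next
  case (RZero r)
  have e: "exec B I W (WOp Minus r r r) (pc, M, R) (Suc pc, M, R[r := real_arith Minus (R ! r) (R ! r)])"
    using RZero.prems rep_length[of s M R] by (intro exec.intros) auto
  have "rep (sem (RZero r) s) M (R[r := 0])" using rep_rvar[OF RZero.prems(2), of r 0] RZero.prems
    by (simp add: rep_def)
  with runs_step[OF _ e] RZero.prems show ?case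
    by (intro exI[of _ 1] exI[of _ M] exI[of _ "R[r := 0]"]) auto
next
  case (RMov r a)
  have c: "code_at p pc [WOp Minus 9 9 9]" "code_at p (Suc pc) [WOp Plus r a 9]"
    using RMov.prems(1) by (auto simp: code_at_Cons[of p _ "_::instr" "_ # _"])
  define R1 where "R1 = R[9 := 0]"
  define R2 where "R2 = R1[r := R ! a]"
  have l: "10 \<le> length R" using rep_length[OF RMov.prems(2)] by simp
  have e: "exec B I W (WOp Minus 9 9 9) (pc, M, R) (Suc pc, M, R[9 := real_arith Minus (R ! 9) (R ! 9)])"
    using l by (intro exec.intros) auto
  have f: "exec B I W (WOp Plus r a 9) (Suc pc, M, R1) (Suc (Suc pc), M, R1[r := real_arith Plus (R1 ! a) (R1 ! 9)])"
    using l RMov.prems by (intro exec.intros) (auto simp: R1_def)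
  have "R ! a = rv s a" using RMov.prems by (simp add: rep_def)
  then have "rep (sem (RMov r a) s) M R2"
    using rep_rvar[OF rep_rtemp[OF RMov.prems(2)], of r "R ! a" 0] RMov.prems
    by (simp add: rep_def R2_def R1_def)
  with runs_Suc[OF c(1) e[simplified, folded R1_def] runs_step[OF c(2) f]] RMov.prems l show ?case
    by (intro exI[of _ 2] exI[of _ M] exI[of _ R2]) (auto simp: R2_def R1_def numeral_2_eq_2)
next
  case (RAdd r a b)
  have e: "exec B I W (WOp Plus r a b) (pc, M, R) (Suc pc, M, R[r := real_arith Plus (R ! a) (R ! b)])"
    using RAdd.prems rep_length[of s M R] by (intro exec.intros) auto
  have "R ! a = rv s a" "R ! b = rv s b" using RAdd.prems by (auto simp: rep_def)
  then have "rep (sem (RAdd r a b) s) M (R[r := R ! a + R ! b])"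
    using rep_rvar[OF RAdd.prems(2), of r "R ! a + R ! b"] RAdd.prems by (simp add: rep_def)
  with runs_step[OF _ e] RAdd.prems show ?case
    by (intro exI[of _ 1] exI[of _ M] exI[of _ "R[r := R ! a + R ! b]"]) auto
next
  case (RGet r e)
  let ?q = "pc + esize e"
  have c: "code_at p pc (ecomp na 0 e)" "code_at p ?q [Const (Suc tb) 10, Op Plus tb tb (Suc tb)]"
    "code_at p (?q + 2) [WLoad r tb]"
    using RGet.prems(1) code_at_append[of p ?q "[Const (Suc tb) 10, Op Plus tb tb (Suc tb)]" "[WLoad r tb]"]
    by (auto simp: code_at_append[of p pc])
  define j where "j = nat (eval e s)"
  have j: "j < L" "eval e s = int j" using RGet.prems by (auto simp: j_def)
  obtain M1 where M1: "runs p (esize e) (pc, M, R) (?q, M1, R)" "rep s M1 R"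
     "M1 ! tb = eval e s" "length M1 = length M"
    using ecomp_runs[OF c(1) RGet.prems(2)] RGet.prems by auto
  obtain M2 where M2: "runs p 2 (?q, M1, R) (?q + 2, M2, R)" "rep s M2 R" "length M2 = length M1"
     "M2 ! tb = int (10 + j)"
    using raddr_runs[OF c(2) M1(2)] M1(3) j by auto
  have l: "nv \<le> length M2" "10 + L \<le> length R" using M2(2) by (auto simp: rep_def)
  have e: "exec B I W (WLoad r tb) (?q + 2, M2, R) (Suc (?q + 2), M2, R[r := R ! nat (M2 ! tb)])"
    using RGet.prems l M2 j by (intro exec.intros) (auto simp: in_range_def)
  have "R ! nat (M2 ! tb) = ra s j" using M2(2) j unfolding M2(4) nat_int by (simp add: rep_def)
  then have "rep (sem (RGet r e) s) M2 (R[r := R ! nat (M2 ! tb)])"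
    using rep_rvar[OF M2(2), of r "ra s j"] RGet.prems by (simp add: rep_def j_def)
  with runs_trans[OF M1(1) runs_trans[OF M2(1) runs_step[OF c(3) e]]] M1 M2 show ?case
    by (intro exI[of _ "esize e + (2 + 1)"] exI[of _ M2] exI[of _ "R[r := R ! nat (M2 ! tb)]"])
      (auto simp: eval_nat_numeral)
next
  case (RPut e r)
  let ?q = "pc + esize e"
  have c: "code_at p pc (ecomp na 0 e)" "code_at p ?q [Const (Suc tb) 10, Op Plus tb tb (Suc tb)]"
    "code_at p (?q + 2) [WStore tb r]"
    using RPut.prems(1) code_at_append[of p ?q "[Const (Suc tb) 10, Op Plus tb tb (Suc tb)]" "[WStore tb r]"]
    by (auto simp: code_at_append[of p pc])
  define j where "j = nat (eval e s)"
  have j: "j < L" "eval e s = int j" using RPut.prems by (auto simp: j_def)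
  obtain M1 where M1: "runs p (esize e) (pc, M, R) (?q, M1, R)" "rep s M1 R"
     "M1 ! tb = eval e s" "length M1 = length M"
    using ecomp_runs[OF c(1) RPut.prems(2)] RPut.prems by auto
  obtain M2 where M2: "runs p 2 (?q, M1, R) (?q + 2, M2, R)" "rep s M2 R" "length M2 = length M1"
     "M2 ! tb = int (10 + j)"
    using raddr_runs[OF c(2) M1(2)] M1(3) j by auto
  have l: "nv \<le> length M2" "10 + L \<le> length R" using M2(2) by (auto simp: rep_def)
  have e: "exec B I W (WStore tb r) (?q + 2, M2, R) (Suc (?q + 2), M2, R[nat (M2 ! tb) := R ! r])"
    using RPut.prems l M2 j by (intro exec.intros) (auto simp: in_range_def)
  have n: "nat (M2 ! tb) = 10 + j" unfolding M2(4) by (rule nat_int)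
  have "R ! r = rv s r" using M2(2) RPut.prems by (simp add: rep_def)
  then have "rep (sem (RPut e r) s) M2 (R[nat (M2 ! tb) := R ! r])"
    using rep_rarr[OF M2(2) j(1), of "rv s r"] unfolding n by (simp add: rep_def j_def)
  with runs_trans[OF M1(1) runs_trans[OF M2(1) runs_step[OF c(3) e]]] M1 M2 show ?case
    by (intro exI[of _ "esize e + (2 + 1)"] exI[of _ M2] exI[of _ "R[nat (M2 ! tb) := R ! r]"])
      (auto simp: eval_nat_numeral)
next
  case (RInp r e)
  let ?q = "pc + esize e"
  have c: "code_at p pc (ecomp na 0 e)" "code_at p ?q [WInput r tb]"
    using RInp.prems(1) by (auto simp: code_at_append[of p pc])
  obtain M1 where M1: "runs p (esize e) (pc, M, R) (?q, M1, R)" "rep s M1 R"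
     "M1 ! tb = eval e s" "length M1 = length M"
    using ecomp_runs[OF c(1) RInp.prems(2)] RInp.prems by auto
  have l: "nv \<le> length M1" "10 \<le> length R" using rep_length[OF M1(2)] by auto
  have e: "exec B I W (WInput r tb) (?q, M1, R) (Suc ?q, M1, R[r := W ! nat (M1 ! tb)])"
    using RInp.prems l M1(3) by (intro exec.intros) auto
  have "rep (sem (RInp r e) s) M1 (R[r := W ! nat (M1 ! tb)])"
    using rep_rvar[OF M1(2), of r "W ! nat (M1 ! tb)"] RInp.prems M1(3) by (simp add: rep_def)
  with runs_trans[OF M1(1) runs_step[OF c(2) e]] M1 show ?case
    by (intro exI[of _ "esize e + 1"] exI[of _ M1] exI[of _ "R[r := W ! nat (M1 ! tb)]"]) auto
next
  case (Seq c1 c2)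
  have c: "code_at p pc (ccomp na pc c1)" "code_at p (pc + csize c1) (ccomp na (pc + csize c1) c2)"
    using Seq.prems(1) by (auto simp: code_at_append)
  obtain t1 M1 R1 where 1: "t1 + tm s \<le> tm (sem c1 s)" "runs p t1 (pc, M, R) (pc + csize c1, M1, R1)"
    "rep (sem c1 s) M1 R1" "length M1 = length M" "length R1 = length R"
    using Seq.IH(1)[OF c(1) Seq.prems(2)] Seq.prems by auto
  obtain t2 M2 R2 where 2: "t2 + tm (sem c1 s) \<le> tm (sem c2 (sem c1 s))"
    "runs p t2 (pc + csize c1, M1, R1) (pc + csize c1 + csize c2, M2, R2)"
    "rep (sem c2 (sem c1 s)) M2 R2" "length M2 = length M1" "length R2 = length R1"
    using Seq.IH(2)[OF c(2) 1(3)] Seq.prems by auto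
  show ?case using runs_trans[OF 1(2) 2(2)] 1 2
    by (intro exI[of _ "t1 + t2"] exI[of _ M2] exI[of _ R2]) (auto simp: add.assoc)
next
  case (Cond b c1 c2)
  let ?l = "pc + bsize b + csize c2 + 1" and ?q = "pc + bsize b" and ?t = "s\<lparr>tm := tm s + (bsize b + 1)\<rparr>"
  let ?e = "pc + bsize b + csize c2 + 1 + csize c1"
  have c: "code_at p pc (bcomp na ?l b)" "code_at p ?q (ccomp na ?q c2)"
    "code_at p (?q + csize c2) [Jump ?e]" "code_at p ?l (ccomp na ?l c1)"
    using Cond.prems(1) code_at_Cons[of p "?q + csize c2" "Jump ?e" "ccomp na ?l c1"]
    by (auto simp: code_at_append add.assoc)
  obtain M1 where M1: "runs p (bsize b) (pc, M, R) (if evalb b s then ?l else ?q, M1, R)"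
     "rep s M1 R" "length M1 = length M"
    using bcomp_runs[OF c(1) Cond.prems(2)] Cond.prems by auto
  show ?case
  proof (cases "evalb b s")
    case True
    obtain t2 M2 R2 where 2: "t2 + tm ?t \<le> tm (sem c1 ?t)"
      "runs p t2 (?l, M1, R) (?l + csize c1, M2, R2)"
      "rep (sem c1 ?t) M2 R2" "length M2 = length M1" "length R2 = length R"
      using Cond.IH(1)[OF c(4), of ?t M1 R] Cond.prems True M1 by auto
    have r: "runs p (bsize b + t2) (pc, M, R) (?l + csize c1, M2, R2)"
      by (rule runs_trans[OF _ 2(2)]) (use M1(1) True in auto)
    have "bsize b + t2 + tm s \<le> tm (sem (Cond b c1 c2) s)" using 2(1) True by (simp add: Let_def)
    then show ?thesis using r 2 M1(3) True
      by (intro exI[of _ "bsize b + t2"] exI[of _ M2] exI[of _ R2]) (auto simp: add.assoc Let_def)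
  next
    case False
    obtain t2 M2 R2 where 2: "t2 + tm ?t \<le> tm (sem c2 ?t)"
      "runs p t2 (?q, M1, R) (?q + csize c2, M2, R2)"
      "rep (sem c2 ?t) M2 R2" "length M2 = length M1" "length R2 = length R"
      using Cond.IH(2)[OF c(2), of ?t M1 R] Cond.prems False M1 by auto
    have j: "exec B I W (Jump ?e) (?q + csize c2, M2, R2) (?e, M2, R2)" by (rule exec.intros)
    have r: "runs p (bsize b + (t2 + 1)) (pc, M, R) (?e, M2, R2)"
      by (rule runs_trans[OF _ runs_trans[OF 2(2) runs_step[OF c(3) j]]]) (use M1(1) False in auto)
    have "bsize b + (t2 + 1) + tm s \<le> tm (sem (Cond b c1 c2) s)" using 2(1) False by (simp add: Let_def)
    then show ?thesis using r 2 M1(3) False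
      by (intro exI[of _ "bsize b + (t2 + 1)"] exI[of _ M2] exI[of _ R2]) (auto simp: add.assoc Let_def)
  qed
next
  case (For x e c)
  let ?q = "pc + esize e" and ?h = "pc + esize e + 3" and ?b = "pc + esize e + 5"
  let ?e = "pc + esize e + 8 + csize c"
  have n3: "pc + (esize e + 3) = Suc (Suc (Suc (pc + esize e)))"
    and n5: "pc + (esize e + 5) = Suc (Suc (Suc (Suc (Suc (pc + esize e)))))"
    "pc + (esize e + (5 + csize c)) = Suc (Suc (Suc (Suc (Suc (pc + (esize e + csize c))))))" by simp_all
  have c: "code_at p pc (ecomp na 0 e)"
    "code_at p ?q [Const (Suc tb) 0, Op Plus (Suc x) tb (Suc tb), Const x 0]"
    "code_at p ?h [JumpLess x (Suc x) ?b, Jump ?e]"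
    "code_at p ?b (ccomp na ?b c)"
    "code_at p (?b + csize c) [Const tb 1, Op Plus x x tb, Jump ?h]"
    using For.prems(1) unfolding ccomp.simps code_at_append by (auto simp: add.assoc n3 n5)
  have c2: "code_at p ?q [Const (Suc tb) 0, Op Plus (Suc x) tb (Suc tb)]" "code_at p (?q + 2) [Const x 0]"
    using c(2) code_at_append[of p ?q "[Const (Suc tb) 0, Op Plus (Suc x) tb (Suc tb)]" "[Const x 0]"] by auto
  have c3: "code_at p ?h [JumpLess x (Suc x) ?b]" "code_at p (Suc ?h) [Jump ?e]"
    using c(3) code_at_Cons[of p ?h _ "[Jump ?e]"] by auto
  have c5: "code_at p (?b + csize c) [Const tb 1]" "code_at p (Suc (?b + csize c)) [Op Plus x x tb]"
    "code_at p (Suc (Suc (?b + csize c))) [Jump ?h]"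
    using c(5) by (auto simp: code_at_Cons[of p _ "_::instr" "_ # _"])
  define s0 where "s0 = s\<lparr>iv := (iv s)(Suc x := eval e s, x := 0), tm := tm s + (esize e + 3)\<rparr>"
  define n where "n = nat (eval e s)"
  define S where "S i = loop x (sem c) i s0" for i
  have x: "Suc x < tb" "x \<notin> wv c" "Suc x \<notin> wv c" "wf na c" using For.prems by auto
  have Sx: "iv (S i) x = int i" for i
    using x by (cases i) (auto simp: S_def s0_def Let_def)
  have SSx: "iv (S i) (Suc x) = eval e s" for i
    unfolding S_def using loop_frame[of "\<lambda>t. iv t (Suc x)" "sem c" x i s0] x
    by (simp add: frame_iv s0_def)
  have sf: "safe c (S i)" if "i < n" for i
    using For.prems that by (simp add: S_def s0_def n_def)
  have SS: "S (Suc i) = (sem c (S i))\<lparr>iv := (iv (sem c (S i)))(x := int (Suc i)), tm := tm (sem c (S i)) + 4\<rparr>" for i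
    by (simp add: S_def Let_def)
  \<comment> \<open>After \<open>i\<close> rounds the machine stands at the loop test, located at
    \<open>?h\<close>, with memories that represent \<open>S i\<close>.\<close>
  have inv: "\<exists>t M' R'. t + tm s \<le> tm (S i) \<and> runs p t (pc, M, R) (?h, M', R') \<and> rep (S i) M' R' \<and>
    length M' = length M \<and> length R' = length R" if "i \<le> n" for i
    using that
  proof (induction i)
    case 0
    obtain M1 where M1: "runs p (esize e) (pc, M, R) (?q, M1, R)" "rep s M1 R"
       "M1 ! tb = eval e s" "length M1 = length M"
      using ecomp_runs[OF c(1) For.prems(2)] For.prems by auto
    obtain M2 where M2: "runs p 2 (?q, M1, R) (?q + 2, M2, R)"
       "rep (s\<lparr>iv := (iv s)(Suc x := M1 ! tb)\<rparr>) M2 R" "length M2 = length M1"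
      using asg_tail[OF c2(1) M1(2)] x by auto
    have e: "exec B I W (Const x 0) (?q + 2, M2, R) (Suc (?q + 2), M2[x := 0], R)"
      using rep_length[OF M2(2)] x B_ge by (intro exec.intros) auto
    have "rep (S 0) (M2[x := 0]) R" using rep_var[OF M2(2), of x 0] x B_ge M1(3)
      by (simp add: S_def s0_def rep_def)
    with runs_trans[OF M1(1) runs_trans[OF M2(1) runs_step[OF c2(2) e]]] M1 M2 show ?case
      by (intro exI[of _ "esize e + (2 + 1)"] exI[of _ "M2[x := 0]"] exI[of _ R])
        (auto simp: S_def s0_def eval_nat_numeral)
  next
    case (Suc i)
    then obtain t1 M1 R1 where 1: "t1 + tm s \<le> tm (S i)" "runs p t1 (pc, M, R) (?h, M1, R1)" "rep (S i) M1 R1"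
       "length M1 = length M" "length R1 = length R" by auto
    have l: "nv \<le> length M1" using rep_length[OF 1(3)] by simp
    have v: "M1 ! x = int i" "M1 ! Suc x = eval e s" using 1(3) Sx[of i] SSx[of i] x by (auto simp: rep_def)
    have lt: "int i < eval e s" using Suc.prems by (simp add: n_def)
    have "exec B I W (JumpLess x (Suc x) ?b) (?h, M1, R1) (if M1 ! x < M1 ! Suc x then ?b else Suc ?h, M1, R1)"
      using l x by (intro exec.intros) auto
    then have e1: "exec B I W (JumpLess x (Suc x) ?b) (?h, M1, R1) (?b, M1, R1)" using v lt by simp
    obtain t2 M2 R2 where 2: "t2 + tm (S i) \<le> tm (sem c (S i))" "runs p t2 (?b, M1, R1) (?b + csize c, M2, R2)"
       "rep (sem c (S i)) M2 R2" "length M2 = length M1" "length R2 = length R1"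
      using For.IH[OF c(4) 1(3) sf x(4)] Suc.prems by auto
    have l2: "nv \<le> length M2" using rep_length[OF 2(3)] by simp
    have v2: "M2 ! x = int i" using 2(3) Sx[of i] x by (simp add: rep_def frame_iv)
    \<comment> \<open>The incremented counter does not exceed the loop bound, which is stored in a
      cell and therefore fits into a word.\<close>
    have b: "\<bar>int (Suc i)\<bar> \<le> B"
      using rep_bound[OF 1(3), of "Suc x"] v(2) lt l x by simp
    have e2: "exec B I W (Const tb 1) (?b + csize c, M2, R2) (Suc (?b + csize c), M2[tb := 1], R2)"
      using l2 B_ge by (intro exec.intros) auto
    define M3 where "M3 = M2[tb := 1, x := int (Suc i)]"
    have e3: "exec B I W (Op Plus x x tb) (Suc (?b + csize c), M2[tb := 1], R2) (Suc (Suc (?b + csize c)), M3, R2)"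
      unfolding M3_def using l2 x b v2 by (intro exec.intros) auto
    have e4: "exec B I W (Jump ?h) (Suc (Suc (?b + csize c)), M3, R2) (?h, M3, R2)" by (rule exec.intros)
    have "rep (sem c (S i)) (M2[tb := 1]) R2" by (rule rep_temp[OF 2(3)]) (use B_ge in auto)
    then have r3: "rep (S (Suc i)) M3 R2" using rep_var[OF _ _ b, of "sem c (S i)" "M2[tb := 1]" R2 x] x
      by (simp add: SS M3_def rep_def)
    have "runs p (t1 + (1 + (t2 + Suc (Suc 1)))) (pc, M, R) (?h, M3, R2)"
      by (rule runs_trans[OF 1(2) runs_trans[OF runs_step[OF c3(1) e1] runs_trans[OF 2(2)
          runs_Suc[OF c5(1) e2 runs_Suc[OF c5(2) e3 runs_step[OF c5(3) e4]]]]]])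
    moreover have "t1 + (1 + (t2 + Suc (Suc 1))) + tm s \<le> tm (S (Suc i))"
      using 1(1) 2(1) by (simp add: SS)
    ultimately show ?case using r3 1 2
      by (intro exI[of _ "t1 + (1 + (t2 + Suc (Suc 1)))"] exI[of _ M3] exI[of _ R2]) (auto simp: M3_def)
  qed
  obtain t1 M1 R1 where 1: "t1 + tm s \<le> tm (S n)" "runs p t1 (pc, M, R) (?h, M1, R1)" "rep (S n) M1 R1"
     "length M1 = length M" "length R1 = length R" using inv[of n] by auto
  have v: "M1 ! x = int n" "M1 ! Suc x = eval e s" using 1(3) Sx[of n] SSx[of n] x by (auto simp: rep_def)
  have "exec B I W (JumpLess x (Suc x) ?b) (?h, M1, R1) (if M1 ! x < M1 ! Suc x then ?b else Suc ?h, M1, R1)"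
    using rep_length[OF 1(3)] x by (intro exec.intros) auto
  moreover have "\<not> M1 ! x < M1 ! Suc x" unfolding v by (simp add: n_def)
  ultimately have e1: "exec B I W (JumpLess x (Suc x) ?b) (?h, M1, R1) (Suc ?h, M1, R1)"
    by (simp only: if_False)
  have e2: "exec B I W (Jump ?e) (Suc ?h, M1, R1) (?e, M1, R1)" by (rule exec.intros)
  have "sem (For x e c) s = (S n)\<lparr>tm := tm (S n) + 2\<rparr>" by (simp add: S_def n_def s0_def Let_def)
  with runs_trans[OF 1(2) runs_Suc[OF c3(1) e1 runs_step[OF c3(2) e2]]] 1 show ?case
    by (intro exI[of _ "t1 + Suc 1"] exI[of _ M1] exI[of _ R1]) (auto simp: add.assoc)
qed

end

section \<open>Connectedness and covers of graphs on vertex numbers\<close>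

locale adj_graph =
  fixes n :: nat and ad :: "nat \<Rightarrow> nat \<Rightarrow> bool"
  assumes ad_lt: "ad u v \<Longrightarrow> u < n" and ad_sym: "ad u v \<Longrightarrow> ad v u" and ad_irr: "\<not> ad u u"
begin

text \<open>The formulation by cuts suits the arguments to come, which take a set defined by some
  property and need an edge that leaves it. The empty set counts as connected.\<close>

definition conn :: "nat set \<Rightarrow> bool" where
  "conn X \<longleftrightarrow> (\<forall>S. S \<subseteq> X \<and> S \<noteq> {} \<and> S \<noteq> X \<longrightarrow> (\<exists>u\<in>S. \<exists>v\<in>X - S. ad u v))"

definition cover :: "nat set \<Rightarrow> bool" where
  "cover X \<longleftrightarrow> X \<subseteq> {..<n} \<and> (\<forall>u v. ad u v \<longrightarrow> u \<in> X \<or> v \<in> X)"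

abbreviation edges :: "nat set \<Rightarrow> (nat \<times> nat) set" where
  "edges X \<equiv> {(a, b). a \<in> X \<and> b \<in> X \<and> ad a b}"

lemma connD: "conn X \<Longrightarrow> S \<subseteq> X \<Longrightarrow> S \<noteq> {} \<Longrightarrow> S \<noteq> X \<Longrightarrow> \<exists>u\<in>S. \<exists>v\<in>X - S. ad u v"
  by (auto simp: conn_def)

text \<open>From cuts to paths, the cut to consider is the set of vertices reachable from
  \<open>u\<close>; conversely a path that starts in \<open>S\<close> cannot leave it without an
  edge across the cut.\<close>

lemma conn_iff_rtrancl: "conn X \<longleftrightarrow> (\<forall>u\<in>X. \<forall>v\<in>X. (u, v) \<in> (edges X)\<^sup>*)"
proof
  assume c: "conn X"
  show "\<forall>u\<in>X. \<forall>v\<in>X. (u, v) \<in> (edges X)\<^sup>*"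
  proof (intro ballI, rule ccontr)
    fix u v assume uv: "u \<in> X" "v \<in> X" "(u, v) \<notin> (edges X)\<^sup>*"
    let ?S = "{w \<in> X. (u, w) \<in> (edges X)\<^sup>*}"
    have "u \<in> ?S" "v \<notin> ?S" using uv by auto
    then obtain a b where ab: "a \<in> ?S" "b \<in> X - ?S" "ad a b" using connD[OF c, of ?S] uv(2) by blast
    then have "(a, b) \<in> edges X" by auto
    then have "(u, b) \<in> (edges X)\<^sup>*" using ab(1) by (auto intro: rtrancl_into_rtrancl)
    then show False using ab(2) by auto
  qed
next
  assume r: "\<forall>u\<in>X. \<forall>v\<in>X. (u, v) \<in> (edges X)\<^sup>*"
  show "conn X" unfolding conn_def
  proof (intro allI impI, rule ccontr)
    fix S assume S: "S \<subseteq> X \<and> S \<noteq> {} \<and> S \<noteq> X" and no: "\<not> (\<exists>u\<in>S. \<exists>v\<in>X - S. ad u v)"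
    obtain u v where uv: "u \<in> S" "v \<in> X" "v \<notin> S" using S by blast
    have "(u, v) \<in> (edges X)\<^sup>*" using r uv S by blast
    then have "v \<in> S" using uv(1)
      by (induction rule: rtrancl_induct) (use no S in auto)
    then show False using uv by simp
  qed
qed

lemma conn_empty [simp]: "conn {}"
  by (simp add: conn_def)

text \<open>A cut without crossing edges contains all or nothing of each part, and the common vertex
  forces the same choice for both.\<close>

lemma conn_Un:
  assumes "conn X" "conn Y" "X \<inter> Y \<noteq> {}" shows "conn (X \<union> Y)"
  unfolding conn_def
proof (intro allI impI, rule ccontr)
  fix S assume S: "S \<subseteq> X \<union> Y \<and> S \<noteq> {} \<and> S \<noteq> X \<union> Y" and no: "\<not> (\<exists>u\<in>S. \<exists>v\<in>X \<union> Y - S. ad u v)"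
  have a: "S \<inter> X = {} \<or> X \<subseteq> S" using connD[OF assms(1), of "S \<inter> X"] no by blast
  have b: "S \<inter> Y = {} \<or> Y \<subseteq> S" using connD[OF assms(2), of "S \<inter> Y"] no by blast
  show False using a b assms(3) S by blast
qed

lemma conn_pair: "ad u v \<Longrightarrow> conn {u, v}"
  unfolding conn_def using ad_sym by blast

lemma conn_insert: "conn X \<Longrightarrow> u \<in> X \<Longrightarrow> ad u v \<Longrightarrow> conn (insert v X)"
  using conn_Un[of X "{u, v}"] conn_pair[of u v] by (simp add: insert_absorb)

lemma cover_mono: "cover X \<Longrightarrow> X \<subseteq> Y \<Longrightarrow> Y \<subseteq> {..<n} \<Longrightarrow> cover Y"
  unfolding cover_def by blast

section \<open>Labelings\<close>

text \<open>Label \<open>0\<close> marks the vertices outside the cover, labels \<open>1\<close> and \<open>2\<close> tell on which side of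
  a cut a vertex of the cover lies; a cut must not separate adjacent vertices of the cover.\<close>

definition lab :: "nat set \<Rightarrow> nat set \<Rightarrow> (nat \<Rightarrow> nat) set" where
  "lab R S = {f \<in> S \<rightarrow>\<^sub>E {0, 1, 2}. (\<forall>u\<in>S \<inter> R. f u \<noteq> 0) \<and>
     (\<forall>u\<in>S. \<forall>v\<in>S. ad u v \<longrightarrow> (f u = 0 \<longrightarrow> f v \<noteq> 0) \<and> (f u \<noteq> 0 \<longrightarrow> f v \<noteq> 0 \<longrightarrow> f u = f v))}"

lemma finite_lab: "finite S \<Longrightarrow> finite (lab R S)"
  unfolding lab_def by (rule finite_subset[OF _ finite_PiE[of S "\<lambda>_. {0, 1, 2}"]]) auto

lemma lab_restrict:
  assumes "f \<in> lab R S" "T \<subseteq> S" shows "restrict f T \<in> lab R T"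
proof -
  have "f \<in> S \<rightarrow>\<^sub>E {0, 1, 2}" "\<forall>u\<in>S \<inter> R. f u \<noteq> 0"
    and e: "\<forall>u\<in>S. \<forall>v\<in>S. ad u v \<longrightarrow> (f u = 0 \<longrightarrow> f v \<noteq> 0) \<and> (f u \<noteq> 0 \<longrightarrow> f v \<noteq> 0 \<longrightarrow> f u = f v)"
    using assms(1) unfolding lab_def by blast+
  then have "restrict f T \<in> T \<rightarrow>\<^sub>E {0, 1, 2}" "\<forall>u\<in>T \<inter> R. restrict f T u \<noteq> 0"
    using assms(2) by (auto simp: PiE_def Pi_def)
  moreover have "(restrict f T u = 0 \<longrightarrow> restrict f T v \<noteq> 0) \<and>
     (restrict f T u \<noteq> 0 \<longrightarrow> restrict f T v \<noteq> 0 \<longrightarrow> restrict f T u = restrict f T v)"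
    if "u \<in> T" "v \<in> T" "ad u v" for u v
    using that e assms(2) unfolding restrict_apply'[OF that(1)] restrict_apply'[OF that(2)] by blast
  ultimately show ?thesis unfolding lab_def by blast
qed

text \<open>A labeled neighbor \<open>u\<close> leaves two values for \<open>v\<close>: 1 or 2 if
  \<open>u\<close> has label 0, and 0 or the label of \<open>u\<close> otherwise. The Boolean in
  \<open>?h\<close> tells which of the two is taken.\<close>

lemma card_lab_insert:
  assumes "finite S" "u \<in> S" "ad u v" "v \<notin> S"
  shows "card (lab R (insert v S)) \<le> 2 * card (lab R S)"
proof -
  let ?h = "\<lambda>f. (restrict f S, f v = (if f u = 0 then 1 else 0))"
  have inj: "inj_on ?h (lab R (insert v S))"
  proof (rule inj_onI)
    fix f g assume f: "f \<in> lab R (insert v S)" and g: "g \<in> lab R (insert v S)" and h: "?h f = ?h g"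
    have r: "f w = g w" if "w \<in> S" for w using h that by (metis prod.inject restrict_apply')
    have e: "(f u = 0 \<longrightarrow> f v \<noteq> 0) \<and> (f u \<noteq> 0 \<longrightarrow> f v \<noteq> 0 \<longrightarrow> f u = f v)"
       "(g u = 0 \<longrightarrow> g v \<noteq> 0) \<and> (g u \<noteq> 0 \<longrightarrow> g v \<noteq> 0 \<longrightarrow> g u = g v)"
       "f v \<in> {0, 1, 2}" "g v \<in> {0, 1, 2}"
      using f g assms by (auto simp: lab_def PiE_def Pi_def)
    have "f v = g v" using e h r[OF assms(2)] by (auto split: if_splits)
    then have "f w = g w" if "w \<in> insert v S" for w using r that by auto
    then show "f = g" using f g by (intro ext) (metis (no_types, lifting) PiE_arb lab_def mem_Collect_eq)
  qed
  have "?h ` lab R (insert v S) \<subseteq> lab R S \<times> UNIV"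
    using lab_restrict[of _ R "insert v S" S] by auto
  then have "card (lab R (insert v S)) \<le> card (lab R S \<times> (UNIV :: bool set))"
    using finite_lab[OF assms(1)] by (intro card_inj_on_le[OF inj]) auto
  then show ?thesis by (simp add: card_cartesian_product)
qed

text \<open>Connectedness always supplies an edge from the labeled part \<open>S\<close> to a new
  vertex, so every missing vertex contributes a factor of at most 2.\<close>

lemma card_lab_grow:
  assumes "conn Q" "finite Q" "S \<subseteq> Q" "S \<noteq> {}"
  shows "card (lab R Q) \<le> 2 ^ card (Q - S) * card (lab R S)"
  using assms(3,4)
proof (induction "card (Q - S)" arbitrary: S)
  case 0
  then have "S = Q" using assms(2) by auto
  then show ?case by simp
next
  case (Suc k)
  then have "S \<noteq> Q" by auto
  then obtain u v where uv: "u \<in> S" "v \<in> Q - S" "ad u v" using connD[OF assms(1)] Suc.prems by blast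
  have k: "card (Q - insert v S) = k" using Suc.hyps(2) uv assms(2)
    by (metis DiffD2 Diff_insert card_Diff_singleton diff_Suc_1 uv(2))
  have "card (lab R Q) \<le> 2 ^ k * card (lab R (insert v S))"
    using Suc.hyps(1)[of "insert v S"] k uv Suc.prems by auto
  also have "\<dots> \<le> 2 ^ k * (2 * card (lab R S))"
    using card_lab_insert[of S u v R] uv Suc.prems assms(2) finite_subset by (intro mult_le_mono2) auto
  finally show ?case unfolding Suc.hyps(2)[symmetric] by (simp add: mult_ac)
qed

text \<open>The growth starts from \<open>R\<close> if that is nonempty: label 0 is forbidden there,
  adjacent nonzero labels agree and \<open>R\<close> is connected, so only two constant labelings
  remain. For empty \<open>R\<close> it starts from one vertex of \<open>Y\<close> with three
  labels.\<close>

lemma card_lab: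
  assumes "conn (R \<union> Y)" "conn R" "finite (R \<union> Y)" "R \<inter> Y = {}"
  shows "card (lab R (R \<union> Y)) \<le> 3 * 2 ^ card Y"
proof (cases "R = {}")
  case True
  show ?thesis
  proof (cases "Y = {}")
    case True
    have "lab {} {} \<subseteq> {\<lambda>_. undefined}" by (auto simp: lab_def)
    then have "card (lab {} {}) \<le> card {\<lambda>_::nat. undefined :: nat}" by (intro card_mono) auto
    then show ?thesis using True \<open>R = {}\<close> by simp
  next
    case False
    then obtain y where y: "y \<in> Y" by blast
    have "lab {} {y} \<subseteq> {y} \<rightarrow>\<^sub>E {0, 1, 2}" by (auto simp: lab_def)
    then have "card (lab {} {y}) \<le> card ({y} \<rightarrow>\<^sub>E {0, 1, 2::nat})" by (intro card_mono finite_PiE) auto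
    then have "card (lab {} {y}) \<le> 3" by (simp add: card_PiE)
    moreover have "card (lab R (R \<union> Y)) \<le> 2 ^ card (Y - {y}) * card (lab {} {y})"
      using card_lab_grow[of Y "{y}" "{}"] assms y True by auto
    moreover have "(2::nat) ^ card (Y - {y}) \<le> 2 ^ card Y"
      using assms(3) by (intro power_increasing card_mono) auto
    ultimately have "card (lab R (R \<union> Y)) \<le> 2 ^ card Y * 3"
      by (meson le_trans mult_le_mono)
    then show ?thesis by simp
  qed
next
  case False
  then obtain r where r: "r \<in> R" by blast
  have "inj_on (\<lambda>f. f r) (lab R R)"
  proof (rule inj_onI)
    have const: "f w = f r" if f: "f \<in> lab R R" and w: "w \<in> R" for f w
    proof -
      have "(r, w) \<in> (edges R)\<^sup>*" using assms(2) r w by (simp add: conn_iff_rtrancl)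
      then show ?thesis
        by (induction rule: rtrancl_induct) (use f in \<open>auto simp: lab_def\<close>)
    qed
    fix f g assume f: "f \<in> lab R R" and g: "g \<in> lab R R" and h: "f r = g r"
    have "f w = g w" if "w \<in> R" for w using const[OF f that] const[OF g that] h by simp
    then show "f = g" using f g by (intro ext) (metis (no_types, lifting) PiE_arb lab_def mem_Collect_eq)
  qed
  moreover have "(\<lambda>f. f r) ` lab R R \<subseteq> {1, 2}"
  proof (rule image_subsetI)
    fix f assume "f \<in> lab R R"
    then have "f r \<in> {0, 1, 2}" "f r \<noteq> 0" using r unfolding lab_def by blast+
    then show "f r \<in> {1, 2}" by simp
  qed
  ultimately have "card (lab R R) \<le> card {1::nat, 2}" by (intro card_inj_on_le) auto
  then have two: "card (lab R R) \<le> 2" by simp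
  have "R \<union> Y - R = Y" using assms(4) by auto
  then have "card (lab R (R \<union> Y)) \<le> 2 ^ card Y * card (lab R R)"
    using card_lab_grow[of "R \<union> Y" R R] assms False by simp
  also have "\<dots> \<le> 2 ^ card Y * 2" by (rule mult_le_mono2[OF two])
  finally show ?thesis by simp
qed

end

section \<open>Splitting a connected cover along a given one\<close>

text \<open>The assumption \<open>nontriv\<close> excludes, for empty \<open>R\<close>, solutions
  that consist of a single vertex outside \<open>Y\<close>. With it \<open>R \<union> A\<close> is
  nonempty for every feasible \<open>A\<close>, so there is a component to start from.\<close>

locale cover_split = adj_graph +
  fixes R Y :: "nat set"
  assumes cov: "cover (R \<union> Y)" and conQ: "conn (R \<union> Y)" and conR: "conn R" and disj: "R \<inter> Y = {}"
    and nontriv: "R = {} \<Longrightarrow> \<exists>u\<in>Y. \<exists>v\<in>Y. ad u v"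
begin

definition sol :: "nat set \<Rightarrow> bool" where
  "sol X \<longleftrightarrow> X \<inter> R = {} \<and> cover (R \<union> X) \<and> conn (R \<union> X)"

definition forced :: "nat set \<Rightarrow> nat set" where
  "forced A = {v. v \<notin> R \<union> Y \<and> (\<exists>u\<in>Y - A. ad v u)}"

text \<open>Both conditions are necessary for a solution with trace \<open>A\<close>. For the
  second, vertices outside \<open>R \<union> Y\<close> are pairwise nonadjacent, so a forced vertex
  can be joined to the rest only through \<open>R \<union> A\<close>.\<close>

definition feas :: "nat set \<Rightarrow> bool" where
  "feas A \<longleftrightarrow> (\<forall>u\<in>Y - A. \<forall>v\<in>Y - A. \<not> ad u v) \<and> (\<forall>v\<in>forced A. \<exists>u\<in>R \<union> A. ad v u)"

lemma ad_out: "ad u v \<Longrightarrow> u \<notin> R \<union> Y \<Longrightarrow> v \<in> R \<union> Y"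
  using cov by (auto simp: cover_def)

lemma finQ: "finite (R \<union> Y)"
  using cov by (meson cover_def finite_lessThan finite_subset)

lemma forced_lt: "forced A \<subseteq> {..<n}"
  using ad_lt by (auto simp: forced_def)

lemma sol_feas:
  assumes X: "sol X" shows "feas (X \<inter> Y)" "X \<inter> Y \<union> forced (X \<inter> Y) \<subseteq> X"
proof -
  let ?A = "X \<inter> Y"
  have cX: "\<And>u v. ad u v \<Longrightarrow> u \<in> R \<union> X \<or> v \<in> R \<union> X" using X by (auto simp: sol_def cover_def)
  have f: "v \<in> X" if "v \<in> forced ?A" for v
    using that cX disj by (auto simp: forced_def)
  then show "?A \<union> forced ?A \<subseteq> X" by auto
  have "\<exists>u\<in>R \<union> ?A. ad v u" if v: "v \<in> forced ?A" for v
  proof (rule ccontr)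
    assume no: "\<not> ?thesis"
    have vX: "v \<in> R \<union> X" using f v by blast
    have vQ: "v \<notin> R \<union> Y" using v by (simp add: forced_def)
    \<comment> \<open>All neighbors of \<open>v\<close> lie in \<open>R \<union> Y\<close>, so
      without one in \<open>R \<union> A\<close> it is isolated in the connected set
      \<open>R \<union> X\<close>. A one-element cover outside \<open>Y\<close> then misses the edge
      inside \<open>Y\<close>.\<close>
    have RX: "R \<union> X = {v}"
    proof (rule ccontr)
      assume "R \<union> X \<noteq> {v}"
      then obtain w where w: "w \<in> R \<union> X - {v}" "ad v w"
        using X connD[of "R \<union> X" "{v}"] vX by (auto simp: sol_def)
      then have "w \<in> R \<union> ?A" using ad_out[OF w(2) vQ] by blast
      then show False using no w by blast
    qed
    have "R = {}" using vQ RX by (metis Un_iff Un_upper1 singletonI subset_singletonD)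
    have "X = {v}" using RX \<open>R = {}\<close> by simp
    obtain a b where "a \<in> Y" "b \<in> Y" "ad a b" using nontriv[OF \<open>R = {}\<close>] by blast
    then have "a \<in> X \<or> b \<in> X" using cX[of a b] \<open>R = {}\<close> by blast
    then have "v \<in> Y" using \<open>X = {v}\<close> \<open>a \<in> Y\<close> \<open>b \<in> Y\<close> by blast
    then show False using vQ by blast
  qed
  moreover have "\<not> ad u v" if "u \<in> Y - ?A" "v \<in> Y - ?A" for u v
    using cX[of u v] that disj by auto
  ultimately show "feas ?A" unfolding feas_def by blast
qed

text \<open>Every edge has an endpoint in \<open>R \<union> Y\<close>. If that endpoint is missed it
  lies in \<open>Y - A\<close>, and then the other end is in \<open>A\<close> by independence of
  \<open>Y - A\<close>, or in \<open>R\<close>, or forced.\<close>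

lemma feas_cover:
  assumes A: "A \<subseteq> Y" "feas A" and X: "A \<union> forced A \<subseteq> X" "X \<subseteq> {..<n}" shows "cover (R \<union> X)"
proof -
  have "u \<in> R \<union> X \<or> v \<in> R \<union> X" if uv: "ad u v" for u v
  proof (rule ccontr)
    assume no: "\<not> ?thesis"
    have *: "False" if "u \<in> R \<union> Y" "ad u v" "u \<notin> R \<union> X" "v \<notin> R \<union> X" for u v
    proof (cases "v \<in> Y")
      case True
      then show False using that A X unfolding feas_def by blast
    next
      case False
      then have "v \<in> forced A" using that X ad_sym[OF that(2)] by (auto simp: forced_def)
      then show False using that X by blast
    qed
    show False using ad_out[OF uv] *[of u v] *[of v u] no uv ad_sym[OF uv] by blast
  qed
  moreover have "R \<subseteq> {..<n}" using cov by (auto simp: cover_def)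
  ultimately show ?thesis using X unfolding cover_def by blast
qed

definition lab_of :: "nat set \<Rightarrow> (nat \<Rightarrow> nat) set" where
  "lab_of A = {f \<in> lab R (R \<union> Y). {u \<in> Y. f u = 0} = Y - A}"

text \<open>The zeros of a labeling inside \<open>Y\<close> determine \<open>A\<close>, so the sets
  \<open>lab_of A\<close> are disjoint parts of the labelings counted before.\<close>

lemma sum_lab_of: "(\<Sum>A\<in>Pow Y. card (lab_of A)) \<le> 3 * 2 ^ card Y"
proof -
  have fin: "finite (lab R (R \<union> Y))" using finite_lab finQ by blast
  have "(\<Sum>A\<in>Pow Y. card (lab_of A)) = card (\<Union>A\<in>Pow Y. lab_of A)"
  proof (rule card_UN_disjoint[symmetric])
    show "finite (Pow Y)" using finQ by simp
    show "\<forall>A\<in>Pow Y. finite (lab_of A)" using fin by (auto simp: lab_of_def)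
    show "\<forall>A\<in>Pow Y. \<forall>B\<in>Pow Y. A \<noteq> B \<longrightarrow> lab_of A \<inter> lab_of B = {}"
    proof (intro ballI impI)
      fix A B assume AB: "A \<in> Pow Y" "B \<in> Pow Y" "A \<noteq> B"
      then have "Y - A \<noteq> Y - B" by blast
      then show "lab_of A \<inter> lab_of B = {}" unfolding lab_of_def by blast
    qed
  qed
  also have "\<dots> \<le> card (lab R (R \<union> Y))" using fin by (intro card_mono) (auto simp: lab_of_def)
  also have "\<dots> \<le> 3 * 2 ^ card Y" using card_lab[OF conQ conR finQ disj] .
  finally show ?thesis .
qed

end

section \<open>Connecting the components by outside vertices\<close>

text \<open>On \<open>R \<union> A\<close> the map \<kappa> numbers the connected components of the
  subgraph induced by \<open>R \<union> A \<union> forced A\<close>: \<open>snd\<close> says that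
  equal numbers imply a path, while \<open>adj\<kappa>\<close> and \<open>fc\<kappa>\<close> say
  that edges and forced vertices never join different numbers.\<close>

locale split_comps = cover_split +
  fixes A :: "nat set" and \<kappa> :: "nat \<Rightarrow> nat" and cc :: nat
  assumes AY: "A \<subseteq> Y" and fA: "feas A" and img: "\<kappa> ` (R \<union> A) = {..<cc}"
    and snd: "\<lbrakk>u \<in> R \<union> A; w \<in> R \<union> A; \<kappa> u = \<kappa> w\<rbrakk> \<Longrightarrow> (u, w) \<in> (edges (R \<union> A \<union> forced A))\<^sup>*"
    and adj\<kappa>: "\<lbrakk>u \<in> R \<union> A; w \<in> R \<union> A; ad u w\<rbrakk> \<Longrightarrow> \<kappa> u = \<kappa> w"
    and fc\<kappa>: "\<lbrakk>v \<in> forced A; u \<in> R \<union> A; w \<in> R \<union> A; ad v u; ad v w\<rbrakk> \<Longrightarrow> \<kappa> u = \<kappa> w"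
begin

definition nbc :: "nat \<Rightarrow> nat set" where
  "nbc v = \<kappa> ` {u \<in> R \<union> A. ad v u}"

text \<open>Component 0 is an arbitrary root. The component set must grow strictly with every
  vertex: this keeps the list free of repetitions and makes the numerical codes of the sets
  increase.\<close>

inductive reach :: "nat set \<Rightarrow> nat list \<Rightarrow> bool" where
  reach0: "reach {0} []"
| reachS: "\<lbrakk>reach S T; v < n; v \<notin> R \<union> Y; nbc v \<inter> S \<noteq> {}; \<not> nbc v \<subseteq> S\<rbrakk> \<Longrightarrow> reach (S \<union> nbc v) (v # T)"

lemma RA_nonempty: "R \<union> A \<noteq> {}"
  using nontriv fA AY unfolding feas_def by blast

lemma cc_pos: "0 < cc"
  using RA_nonempty img by (metis image_is_empty lessThan_empty_iff neq0_conv)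

lemma nbc_lt: "nbc v \<subseteq> {..<cc}"
  using img by (auto simp: nbc_def)

lemma nbcE:
  assumes "i \<in> nbc v" obtains u where "u \<in> R \<union> A" "ad v u" "i = \<kappa> u"
  using assms unfolding nbc_def by blast

lemma forced_nbc:
  assumes "v \<in> forced A" "nbc v \<inter> S \<noteq> {}" shows "nbc v \<subseteq> S"
proof
  fix i assume "i \<in> nbc v"
  then obtain u where u: "u \<in> R \<union> A" "ad v u" "i = \<kappa> u" by (rule nbcE)
  obtain j where j: "j \<in> nbc v" "j \<in> S" using assms(2) by blast
  obtain w where "w \<in> R \<union> A" "ad v w" "j = \<kappa> w" using j(1) by (rule nbcE)
  then show "i \<in> S" using fc\<kappa>[OF assms(1) u(1)] u j by metis
qed

lemma reach_lt: "reach S T \<Longrightarrow> S \<subseteq> {..<cc}"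
  by (induction rule: reach.induct) (use cc_pos nbc_lt in auto)

text \<open>A vertex already in the list, like any forced vertex, has all its components inside
  \<open>S\<close> as soon as one of them is, so strict growth excludes both.\<close>

lemma reach_list: "reach S T \<Longrightarrow> distinct T \<and> set T \<subseteq> {..<n} - (R \<union> Y) - forced A \<and> (\<forall>v\<in>set T. nbc v \<subseteq> S \<and> nbc v \<noteq> {})"
  by (induction rule: reach.induct) (use forced_nbc in auto)

text \<open>By induction any two vertices of \<open>R \<union> A\<close> in reached components are
  joined, a newly reached component being entered through the new vertex \<open>v\<close>. Forced
  and chosen vertices are then attached by an edge to \<open>R \<union> A\<close>.\<close>

lemma reach_conn:
  assumes "reach {..<cc} T" shows "conn (R \<union> (A \<union> forced A \<union> set T))"
proof -
  let ?H = "R \<union> A \<union> forced A"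
  have main: "reach S T \<Longrightarrow> u \<in> R \<union> A \<Longrightarrow> w \<in> R \<union> A \<Longrightarrow> \<kappa> u \<in> S \<Longrightarrow> \<kappa> w \<in> S \<Longrightarrow>
    (u, w) \<in> (edges (?H \<union> set T))\<^sup>*" for S T u w
  proof (induction arbitrary: u w rule: reach.induct)
    case reach0
    then show ?case using snd[of u w] by simp
  next
    case (reachS S T v)
    let ?E = "edges (?H \<union> set (v # T))"
    have mono: "(edges (?H \<union> set T))\<^sup>* \<subseteq> ?E\<^sup>*" "(edges ?H)\<^sup>* \<subseteq> ?E\<^sup>*"
      by (rule rtrancl_mono; auto)+
    have old: "(u, w) \<in> ?E\<^sup>*" if "u \<in> R \<union> A" "w \<in> R \<union> A" "\<kappa> u \<in> S" "\<kappa> w \<in> S" for u w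
      using reachS.IH[OF that] mono by blast
    have same: "(u, w) \<in> ?E\<^sup>*" if "u \<in> R \<union> A" "w \<in> R \<union> A" "\<kappa> u = \<kappa> w" for u w
      using snd[OF that] mono by blast
    obtain z where z: "z \<in> R \<union> A" "ad v z" "\<kappa> z \<in> S" using reachS.hyps by (auto simp: nbc_def)
    have sz: "(z, v) \<in> ?E" "(v, z) \<in> ?E" using z ad_sym by auto
    have tov: "(u, v) \<in> ?E\<^sup>* \<and> (v, u) \<in> ?E\<^sup>*" if u: "u \<in> R \<union> A" "\<kappa> u \<in> S \<union> nbc v" for u
    proof (cases "\<kappa> u \<in> S")
      case True
      have "(u, z) \<in> ?E\<^sup>*" "(z, u) \<in> ?E\<^sup>*"
        using old[OF u(1) z(1) True z(3)] old[OF z(1) u(1) z(3) True] by blast+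
      then show ?thesis
        using rtrancl_into_rtrancl[OF _ sz(1)] converse_rtrancl_into_rtrancl[OF sz(2)] by blast
    next
      case False
      then obtain x where x: "x \<in> R \<union> A" "ad v x" "\<kappa> x = \<kappa> u" using u by (metis UnE nbcE)
      have sx: "(x, v) \<in> ?E" "(v, x) \<in> ?E" using x ad_sym by auto
      have "(u, x) \<in> ?E\<^sup>*" "(x, u) \<in> ?E\<^sup>*"
        using same[OF u(1) x(1) x(3)[symmetric]] same[OF x(1) u(1) x(3)] by blast+
      then show ?thesis
        using rtrancl_into_rtrancl[OF _ sx(1)] converse_rtrancl_into_rtrancl[OF sx(2)] by blast
    qed
    show ?case
      by (rule rtrancl_trans[OF conjunct1[OF tov[of u]] conjunct2[OF tov[of w]]]) (use reachS.prems in auto)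
  qed
  let ?X = "R \<union> (A \<union> forced A \<union> set T)"
  have E: "edges (?H \<union> set T) = edges ?X" by (simp add: Un_assoc)
  have core: "(u, w) \<in> (edges ?X)\<^sup>*" if "u \<in> R \<union> A" "w \<in> R \<union> A" for u w
    using main[OF assms that] that img unfolding E by blast
  have hook: "\<exists>z\<in>R \<union> A. (u, z) \<in> (edges ?X)\<^sup>* \<and> (z, u) \<in> (edges ?X)\<^sup>*" if "u \<in> ?X" for u
  proof (cases "u \<in> R \<union> A")
    case True
    then show ?thesis by blast
  next
    case False
    have "\<exists>z\<in>R \<union> A. ad u z"
    proof (cases "u \<in> forced A")
      case True
      then show ?thesis using fA unfolding feas_def by blast
    next
      case F: False
      then have "nbc u \<noteq> {}" using that False reach_list[OF assms] by blast
      then show ?thesis by (meson all_not_in_conv nbcE)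
    qed
    then obtain z where z: "z \<in> R \<union> A" "ad u z" by blast
    then have "(u, z) \<in> edges ?X" "(z, u) \<in> edges ?X" using that ad_sym by auto
    then show ?thesis using z(1) by blast
  qed
  show ?thesis unfolding conn_iff_rtrancl
  proof (intro ballI)
    fix u w assume uw: "u \<in> ?X" "w \<in> ?X"
    obtain a where a: "a \<in> R \<union> A" "(u, a) \<in> (edges ?X)\<^sup>*" using hook[OF uw(1)] by blast
    obtain b where b: "b \<in> R \<union> A" "(b, w) \<in> (edges ?X)\<^sup>*" using hook[OF uw(2)] by blast
    show "(u, w) \<in> (edges ?X)\<^sup>*" using a(2) core[OF a(1) b(1)] b(2) by (meson rtrancl_trans)
  qed
qed

lemma reach_sol:
  assumes "reach {..<cc} T" shows "sol (A \<union> forced A \<union> set T)"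
proof -
  have l: "set T \<subseteq> {..<n}" "set T \<inter> R = {}" using reach_list[OF assms] by auto
  have "A \<subseteq> {..<n}" using AY cov by (auto simp: cover_def)
  then have "cover (R \<union> (A \<union> forced A \<union> set T))"
    using forced_lt l by (intro feas_cover[OF AY fA]) auto
  moreover have "(A \<union> forced A \<union> set T) \<inter> R = {}" using AY disj l by (auto simp: forced_def)
  ultimately show ?thesis using reach_conn[OF assms] by (simp add: sol_def)
qed

text \<open>Among the component sets reachable with vertices of \<open>X\<close> alone a maximal one
  is taken. If it is not everything, connectedness of \<open>R \<union> X\<close> yields a vertex of
  \<open>X\<close> that enlarges it.\<close>

lemma sol_reach:
  assumes X: "sol X" "X \<inter> Y = A"
  shows "\<exists>T. reach {..<cc} T \<and> set T \<subseteq> X - (A \<union> forced A)"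
proof -
  let ?P = "\<lambda>S. \<exists>T. reach S T \<and> set T \<subseteq> X - (A \<union> forced A)"
  have "{S. ?P S} \<subseteq> Pow {..<cc}" using reach_lt by blast
  then have fin: "finite {S. ?P S}" by (rule finite_subset) simp
  have "?P {0}" using reach0 by (intro exI[of _ "[]"]) simp
  then have ne: "{S. ?P S} \<noteq> {}" by blast
  obtain S where S: "S \<in> {S. ?P S}" "\<forall>S'\<in>{S. ?P S}. S \<le> S' \<longrightarrow> S = S'"
    using finite_has_maximal[OF fin ne] by blast
  have max: "S' = S" if "?P S'" "S \<subseteq> S'" for S' using S(2) that by blast
  obtain T where T: "reach S T" "set T \<subseteq> X - (A \<union> forced A)" using S(1) by blast
  have "0 \<in> S" using T(1) by (induction rule: reach.induct) auto
  have "S = {..<cc}"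
  proof (rule ccontr)
    assume ne: "S \<noteq> {..<cc}"
    then obtain i where i: "i < cc" "i \<notin> S" using reach_lt[OF T(1)] by blast
    obtain w where w: "w \<in> R \<union> A" "\<kappa> w = i" using i img by (metis imageE lessThan_iff)
    obtain z where z: "z \<in> R \<union> A" "\<kappa> z = 0" using cc_pos img by (metis imageE lessThan_iff)
    \<comment> \<open>The part of \<open>R \<union> X\<close> attached to \<open>S\<close>: cover
      vertices in components of \<open>S\<close>, and outside vertices adjacent to such a component.
      An edge leaving it must run from an outside vertex to a component not in
      \<open>S\<close>.\<close>
    let ?U = "{u \<in> R \<union> X. (u \<in> R \<union> Y \<longrightarrow> \<kappa> u \<in> S) \<and> (u \<notin> R \<union> Y \<longrightarrow> nbc u \<inter> S \<noteq> {})}"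
    have "z \<in> ?U" using z AY \<open>0 \<in> S\<close> X by auto
    moreover have "w \<in> R \<union> X" "w \<notin> ?U" using w AY i X by auto
    ultimately obtain a b where ab: "a \<in> ?U" "b \<in> R \<union> X - ?U" "ad a b"
      using X connD[of "R \<union> X" ?U] by (auto simp: sol_def)
    have QA: "u \<in> R \<union> A" if "u \<in> R \<union> Y" "u \<in> R \<union> X" for u using that X by blast
    show False
    proof (cases "a \<in> R \<union> Y")
      case aQ: True
      then have a: "a \<in> R \<union> A" "\<kappa> a \<in> S" using ab QA by blast+
      show False
      proof (cases "b \<in> R \<union> Y")
        case True
        then have "b \<in> R \<union> A" "\<kappa> b \<notin> S" using ab QA by blast+
        then show False using adj\<kappa>[OF a(1) _ ab(3)] a by auto
      next
        case False
        then have "\<kappa> a \<in> nbc b" using a ad_sym[OF ab(3)] by (auto simp: nbc_def)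
        then show False using ab(2) False a by blast
      qed
    next
      case aO: False
      then have bQ: "b \<in> R \<union> Y" using ad_out[OF ab(3)] by blast
      then have b: "b \<in> R \<union> A" "\<kappa> b \<notin> S" using ab QA by blast+
      have a: "nbc a \<inter> S \<noteq> {}" "a \<in> X" using ab aO by auto
      have ns: "\<not> nbc a \<subseteq> S" using b ab(3) by (auto simp: nbc_def)
      then have "a \<notin> A \<union> forced A" using forced_nbc[of a S] a aO AY by blast
      then have "?P (S \<union> nbc a)"
        using reachS[OF T(1) ad_lt[OF ab(3)] aO a(1) ns] T(2) a(2) by (intro exI[of _ "a # T"]) auto
      then show False using max ns by blast
    qed
  qed
  then show ?thesis using T by blast
qed

text \<open>Every set of components, coded by \<open>D\<close>, is a labeling: label 2 on its
  components, 1 on the others, 0 on \<open>Y - A\<close>. It is consistent because edges inside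
  \<open>R \<union> A\<close> stay within a component and \<open>Y - A\<close> is independent. The
  rows of the dynamic program can thus be charged to labelings.\<close>

lemma pow_le_lab_of: "2 ^ cc \<le> card (lab_of A)"
proof -
  let ?f = "\<lambda>D::nat. \<lambda>u. if u \<in> R \<union> A then 1 + of_bool (bit D (\<kappa> u)) else if u \<in> Y then 0 else undefined :: nat"
  have "inj_on ?f {..<2 ^ cc}"
  proof (rule inj_onI)
    fix D E :: nat assume D: "D \<in> {..<2 ^ cc}" and E: "E \<in> {..<2 ^ cc}" and eq: "?f D = ?f E"
    have "bit D i = bit E i" for i
    proof (cases "i < cc")
      case True
      then obtain w where w: "w \<in> R \<union> A" "\<kappa> w = i" using img by (metis imageE lessThan_iff)
      then show ?thesis using fun_cong[OF eq, of w] by (simp add: of_bool_def split: if_splits)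
    next
      case False
      have "bit x i \<Longrightarrow> x < 2 ^ cc \<Longrightarrow> False" for x :: nat
      proof -
        assume "bit x i" "x < 2 ^ cc"
        then have "2 ^ i \<le> x" by (metis bit_nat_iff div_less linorder_not_less even_zero bit_iff_odd)
        moreover have "(2::nat) ^ cc \<le> 2 ^ i" using False by (intro power_increasing) auto
        ultimately show False using \<open>x < 2 ^ cc\<close> by linarith
      qed
      then show ?thesis using D E by auto
    qed
    then show "D = E" by (simp add: bit_eq_iff)
  qed
  moreover have "?f D \<in> lab_of A" for D
  proof -
    have "?f D \<in> R \<union> Y \<rightarrow>\<^sub>E {0, 1, 2}"
      by (intro PiE_I) (use AY in \<open>auto simp: of_bool_def\<close>)
    moreover have "(?f D u = 0 \<longrightarrow> ?f D v \<noteq> 0) \<and> (?f D u \<noteq> 0 \<longrightarrow> ?f D v \<noteq> 0 \<longrightarrow> ?f D u = ?f D v)"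
      if "u \<in> R \<union> Y" "v \<in> R \<union> Y" "ad u v" for u v
    proof (cases "u \<in> R \<union> A")
      case True
      then show ?thesis using adj\<kappa>[OF True _ that(3)] that by auto
    next
      case False
      then have "u \<in> Y - A" using that by blast
      then have "v \<in> R \<union> A" using fA that unfolding feas_def by blast
      then show ?thesis using False that by simp
    qed
    ultimately have "?f D \<in> lab R (R \<union> Y)" unfolding lab_def by simp
    moreover have "{u \<in> Y. ?f D u = 0} = Y - A" using disj by auto
    ultimately show ?thesis by (simp add: lab_of_def)
  qed
  moreover have "finite (lab_of A)" using finite_lab[OF finQ] by (auto simp: lab_of_def)
  ultimately show ?thesis using card_inj_on_le[of ?f "{..<2 ^ cc}" "lab_of A"] by auto
qed

end

section \<open>Weakest preconditions and frames\<close>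

context machine
begin

definition ok :: "com \<Rightarrow> state \<Rightarrow> (state \<Rightarrow> bool) \<Rightarrow> bool" where
  "ok c s Q \<longleftrightarrow> safe c s \<and> Q (sem c s)"

definition fr :: "com \<Rightarrow> state \<Rightarrow> state \<Rightarrow> bool" where
  "fr c s t \<longleftrightarrow> (\<forall>v. v \<notin> wv c \<longrightarrow> iv t v = iv s v) \<and> (\<forall>a. a \<notin> wa c \<longrightarrow> ia t a = ia s a) \<and>
     (\<forall>r. r \<notin> wr c \<longrightarrow> rv t r = rv s r) \<and> (\<not> wra c \<longrightarrow> ra t = ra s)"

lemma fr_iv: "fr c s t \<Longrightarrow> v \<notin> wv c \<Longrightarrow> iv t v = iv s v"
  and fr_ia: "fr c s t \<Longrightarrow> a \<notin> wa c \<Longrightarrow> ia t a = ia s a"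
  and fr_rv: "fr c s t \<Longrightarrow> r \<notin> wr c \<Longrightarrow> rv t r = rv s r"
  and fr_ra: "fr c s t \<Longrightarrow> \<not> wra c \<Longrightarrow> ra t = ra s"
  by (auto simp: fr_def)

lemmas frs = fr_iv fr_ia fr_rv fr_ra

lemma fr_sem: "fr c s (sem c s)"
  by (simp add: fr_def frame_iv frame_ia frame_rv frame_ra)

text \<open>The postcondition may use the frame for free, so a specification only has to mention
  what changes.\<close>

lemma ok_mono: "ok c s Q \<Longrightarrow> (\<And>t. fr c s t \<Longrightarrow> Q t \<Longrightarrow> Q' t) \<Longrightarrow> ok c s Q'"
  using fr_sem by (auto simp: ok_def)

lemma ok_Skip [simp]: "ok Skip s Q = Q s"
  and ok_Asg [simp]: "ok (Asg v e) s Q = (esafe e s \<and> Q (s\<lparr>iv := (iv s)(v := eval e s), tm := tm s + (esize e + 2)\<rparr>))"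
  and ok_Put [simp]: "ok (Put a i e) s Q = (esafe i s \<and> esafe e s \<and> 0 \<le> eval i s \<and> eval i s < int L \<and>
     Q (s\<lparr>ia := (ia s)(a := (ia s a)(nat (eval i s) := eval e s)), tm := tm s + (esize i + esize e + 5)\<rparr>))"
  and ok_RZero [simp]: "ok (RZero r) s Q = Q (s\<lparr>rv := (rv s)(r := 0), tm := tm s + 1\<rparr>)"
  and ok_RMov [simp]: "ok (RMov r a) s Q = Q (s\<lparr>rv := (rv s)(r := rv s a), tm := tm s + 2\<rparr>)"
  and ok_RAdd [simp]: "ok (RAdd r a a') s Q = Q (s\<lparr>rv := (rv s)(r := rv s a + rv s a'), tm := tm s + 1\<rparr>)"
  and ok_RGet [simp]: "ok (RGet r e) s Q = (esafe e s \<and> 0 \<le> eval e s \<and> eval e s < int L \<and>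
     Q (s\<lparr>rv := (rv s)(r := ra s (nat (eval e s))), tm := tm s + (esize e + 3)\<rparr>))"
  and ok_RPut [simp]: "ok (RPut e r) s Q = (esafe e s \<and> 0 \<le> eval e s \<and> eval e s < int L \<and>
     Q (s\<lparr>ra := (ra s)(nat (eval e s) := rv s r), tm := tm s + (esize e + 3)\<rparr>))"
  and ok_RInp [simp]: "ok (RInp r e) s Q = (esafe e s \<and> in_range (eval e s) W \<and>
     Q (s\<lparr>rv := (rv s)(r := W ! nat (eval e s)), tm := tm s + (esize e + 1)\<rparr>))"
  and ok_Seq [simp]: "ok (c ;; d) s Q = ok c s (\<lambda>t. ok d t Q)"
  and ok_Cond [simp]: "ok (Cond b c d) s Q = (bsafe b s \<and> (if evalb b s then ok c (s\<lparr>tm := tm s + (bsize b + 1)\<rparr>) Q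
     else ok d (s\<lparr>tm := tm s + (bsize b + 1)\<rparr>) Q))"
  by (auto simp: ok_def Let_def)

text \<open>Keeps the simplifier out of the postcondition, so that it executes a program from left to right.\<close>

lemma ok_cong [cong]: "s = s' \<Longrightarrow> ok c s Q = ok c s' Q"
  by simp

lemma B_num [simp]: "x \<le> 70 \<Longrightarrow> x \<le> B"
  using B_ge by linarith

lemma fr_refl: "fr c s s"
  by (simp add: fr_def)

text \<open>By \<open>ins\<close> the invariant must ignore counter, bound and clock, which the loop
  itself changes between rounds. The cost adds 4 steps per round, 3 for the setup and 2 for leaving,
  to those of the bound and the body.\<close>

lemma ok_For:
  assumes e: "esafe e s" "eval e s = int n" and x: "x \<notin> wv c" "Suc x \<notin> wv c"
    and init: "J 0 s"
    and ins: "\<And>i t y z w. J i t \<Longrightarrow> J i (t\<lparr>iv := (iv t)(x := y, Suc x := z), tm := w\<rparr>)"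
    and step: "\<And>i t. i < n \<Longrightarrow> fr (For x e c) s t \<Longrightarrow> iv t x = int i \<Longrightarrow> J i t \<Longrightarrow>
       ok c t (\<lambda>t'. J (Suc i) t' \<and> tm t' \<le> tm t + T i)"
    and fin: "\<And>t. J n t \<Longrightarrow> fr (For x e c) s t \<Longrightarrow> tm t \<le> tm s + esize e + 5 + (\<Sum>i<n. T i + 4) \<Longrightarrow> Q t"
  shows "ok (For x e c) s Q"
proof -
  define s0 where "s0 = s\<lparr>iv := (iv s)(Suc x := eval e s, x := 0), tm := tm s + (esize e + 3)\<rparr>"
  have upd: "t\<lparr>iv := (iv t)(x := y), tm := w\<rparr> = t\<lparr>iv := (iv t)(x := y, Suc x := iv t (Suc x)), tm := w\<rparr>" for t y w
  proof -
    have "(iv t)(x := y) = (iv t)(x := y, Suc x := iv t (Suc x))" by (auto simp: fun_eq_iff)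
    then show ?thesis by simp
  qed
  have inv: "i \<le> n \<Longrightarrow> J i (loop x (sem c) i s0) \<and> fr (For x e c) s (loop x (sem c) i s0) \<and>
     iv (loop x (sem c) i s0) x = int i \<and> tm (loop x (sem c) i s0) \<le> tm s + esize e + 3 + (\<Sum>i<i. T i + 4)" for i
  proof (induction i)
    case 0
    have "s0 = s\<lparr>iv := (iv s)(x := 0, Suc x := eval e s), tm := tm s + (esize e + 3)\<rparr>"
      by (simp add: s0_def fun_upd_twist)
    then have "J 0 s0" using ins[OF init] by simp
    then show ?case by (simp add: s0_def fr_def)
  next
    case (Suc i)
    let ?t = "loop x (sem c) i s0"
    have "ok c ?t (\<lambda>t'. J (Suc i) t' \<and> tm t' \<le> tm ?t + T i)" using Suc by (intro step) auto
    then have j: "J (Suc i) (sem c ?t)" "tm (sem c ?t) \<le> tm ?t + T i" by (auto simp: ok_def)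
    have "loop x (sem c) (Suc i) s0 = (sem c ?t)\<lparr>iv := (iv (sem c ?t))(x := int (Suc i)), tm := tm (sem c ?t) + 4\<rparr>"
      by (simp add: Let_def)
    then have "J (Suc i) (loop x (sem c) (Suc i) s0)" using ins[OF j(1)] unfolding upd by simp
    moreover have "fr (For x e c) s (loop x (sem c) (Suc i) s0)"
      using Suc fr_sem[of c ?t] by (auto simp: fr_def Let_def)
    ultimately show ?case using j(2) Suc by (simp add: Let_def)
  qed
  have "safe c (loop x (sem c) i s0)" if "i < n" for i
    using step[OF that] inv[of i] that by (auto simp: ok_def)
  then have "safe (For x e c) s" using e by (simp add: s0_def)
  moreover have "sem (For x e c) s = (loop x (sem c) n s0)\<lparr>tm := tm (loop x (sem c) n s0) + 2\<rparr>"
    using e by (simp add: s0_def Let_def)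
  moreover have "Q ((loop x (sem c) n s0)\<lparr>tm := tm (loop x (sem c) n s0) + 2\<rparr>)"
  proof (rule fin)
    let ?t = "loop x (sem c) n s0"
    have "?t\<lparr>tm := tm ?t + 2\<rparr> = ?t\<lparr>iv := (iv ?t)(x := iv ?t x, Suc x := iv ?t (Suc x)), tm := tm ?t + 2\<rparr>"
      by simp
    then show "J n (?t\<lparr>tm := tm ?t + 2\<rparr>)" using ins[of n ?t] inv[of n] by (metis order_refl)
  qed (use inv[of n] in \<open>auto simp: fr_def\<close>)
  ultimately show ?thesis by (simp add: ok_def)
qed

end

section \<open>The program\<close>

abbreviation (input) vcnt :: nat where "vcnt \<equiv> 0"
abbreviation (input) vk :: nat where "vk \<equiv> 1"
abbreviation (input) vn :: nat where "vn \<equiv> 2"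
abbreviation (input) vl :: nat where "vl \<equiv> 3"
abbreviation (input) vj :: nat where "vj \<equiv> 4"
abbreviation (input) vbase :: nat where "vbase \<equiv> 5"
abbreviation (input) vlen :: nat where "vlen \<equiv> 6"
abbreviation (input) vny :: nat where "vny \<equiv> 7"
abbreviation (input) vKB :: nat where "vKB \<equiv> 8"
abbreviation (input) vP :: nat where "vP \<equiv> 9"
abbreviation (input) vbest :: nat where "vbest \<equiv> 10"
abbreviation (input) vmask :: nat where "vmask \<equiv> 11"
abbreviation (input) vd :: nat where "vd \<equiv> 13"
abbreviation (input) vt :: nat where "vt \<equiv> 14"
abbreviation (input) vv :: nat where "vv \<equiv> 16"
abbreviation (input) ve :: nat where "ve \<equiv> 18"
abbreviation (input) vu :: nat where "vu \<equiv> 20"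
abbreviation (input) vc :: nat where "vc \<equiv> 21"
abbreviation (input) vb :: nat where "vb \<equiv> 22"
abbreviation (input) vst :: nat where "vst \<equiv> 23"
abbreviation (input) va :: nat where "va \<equiv> 24"
abbreviation (input) vx :: nat where "vx \<equiv> 25"
abbreviation (input) vy :: nat where "vy \<equiv> 26"
abbreviation (input) vi :: nat where "vi \<equiv> 27"
abbreviation (input) vok :: nat where "vok \<equiv> 29"
abbreviation (input) vtc :: nat where "vtc \<equiv> 30"
abbreviation (input) vp :: nat where "vp \<equiv> 31"
abbreviation (input) vD :: nat where "vD \<equiv> 32"
abbreviation (input) vE :: nat where "vE \<equiv> 34"
abbreviation (input) vtch :: nat where "vtch \<equiv> 35"
abbreviation (input) vg :: nat where "vg \<equiv> 36"
abbreviation (input) vcc :: nat where "vcc \<equiv> 37"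
abbreviation (input) vbc :: nat where "vbc \<equiv> 39"
abbreviation (input) vsc :: nat where "vsc \<equiv> 40"
abbreviation (input) vq :: nat where "vq \<equiv> 41"
abbreviation (input) vfound :: nat where "vfound \<equiv> 42"
abbreviation (input) vbad :: nat where "vbad \<equiv> 43"
abbreviation (input) vhas :: nat where "vhas \<equiv> 44"
abbreviation (input) vfr :: nat where "vfr \<equiv> 45"
abbreviation (input) vrf :: nat where "vrf \<equiv> 46"
abbreviation (input) vo :: nat where "vo \<equiv> 47"
abbreviation (input) vupd :: nat where "vupd \<equiv> 49"
abbreviation (input) vz :: nat where "vz \<equiv> 50"

abbreviation (input) aLV :: nat where "aLV \<equiv> 0"
abbreviation (input) aal :: nat where "aal \<equiv> 1"
abbreviation (input) acomp :: nat where "acomp \<equiv> 2"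
abbreviation (input) abit :: nat where "abit \<equiv> 3"
abbreviation (input) acb :: nat where "acb \<equiv> 4"
abbreviation (input) aTX :: nat where "aTX \<equiv> 5"
abbreviation (input) aSV :: nat where "aSV \<equiv> 6"
abbreviation (input) apv :: nat where "apv \<equiv> 7"
abbreviation (input) apd :: nat where "apd \<equiv> 8"
abbreviation (input) aOUT :: nat where "aOUT \<equiv> 9"

abbreviation (input) rtot :: nat where "rtot \<equiv> 0"
abbreviation (input) rwt :: nat where "rwt \<equiv> 1"
abbreviation (input) rnew :: nat where "rnew \<equiv> 2"
abbreviation (input) rbest :: nat where "rbest \<equiv> 3"
abbreviation (input) rtmp :: nat where "rtmp \<equiv> 4"

abbreviation add (infixl "\<oplus>" 65) where "a \<oplus> b \<equiv> Bin Plus a b"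
abbreviation sub (infixl "\<ominus>" 65) where "a \<ominus> b \<equiv> Bin Minus a b"
abbreviation mul (infixl "\<otimes>" 70) where "a \<otimes> b \<equiv> Bin Times a b"
abbreviation quo (infixl "\<oslash>" 70) where "a \<oslash> b \<equiv> Bin Divide a b"
abbreviation When :: "bexp \<Rightarrow> com \<Rightarrow> com" where "When b c \<equiv> Cond b c Skip"
abbreviation Unless :: "bexp \<Rightarrow> com \<Rightarrow> com" where "Unless b c \<equiv> Cond b Skip c"

section \<open>Classifying vertices and running through neighbors\<close>

text \<open>A linear search replaces a table indexed by vertices, for which there is no space. The
  result is -1 outside the cover, 0 for all vertices of the first \<open>vbase\<close> positions
  together, and otherwise a number of its own from 1 on. Treating \<open>R\<close> as one class is
  justified by its connectedness.\<close>

definition LOOK :: com where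
  "LOOK = Asg vd (N (-1)) ;;
     For vt (V vlen) (When (Eq (Arr aLV (V vt)) (V vu)) (Asg vd (V vt))) ;;
     Unless (Less (V vd) (N 0))
       (Cond (Less (V vd) (V vbase)) (Asg vd (N 0)) (Asg vd (V vd \<ominus> V vbase \<oplus> N 1)))"

text \<open>In the input array the offsets begin at cell 2 and the concatenated adjacency lists at
  cell \<open>n + 3\<close>.\<close>

definition FORNB :: "com \<Rightarrow> com" where
  "FORNB c = For ve (Inp (V vv \<oplus> N 3) \<ominus> Inp (V vv \<oplus> N 2))
     (Asg vu (Inp (V vn \<oplus> N 3 \<oplus> Inp (V vv \<oplus> N 2) \<oplus> V ve)) ;; LOOK ;; c)"

lemma w_LOOK [simp]: "wv LOOK = {13, 14, 15}" "wa LOOK = {}" "wr LOOK = {}" "wra LOOK = False"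
  by (auto simp: LOOK_def)

lemma w_FORNB [simp]: "wv (FORNB c) = {13, 14, 15, 18, 19, 20} \<union> wv c" "wa (FORNB c) = wa c"
  "wr (FORNB c) = wr c" "wra (FORNB c) = wra c"
  by (auto simp: FORNB_def)

definition cl :: "(nat \<Rightarrow> nat) \<Rightarrow> nat \<Rightarrow> nat \<Rightarrow> nat \<Rightarrow> int" where
  "cl lv len base u = (if u \<in> lv ` {..<len} then
     let t = inv_into {..<len} lv u in (if t < base then 0 else int (t - base + 1)) else -1)"

lemma cl_in: "inj_on lv {..<len} \<Longrightarrow> t < len \<Longrightarrow> cl lv len base (lv t) = (if t < base then 0 else int (t - base + 1))"
  by (auto simp: cl_def Let_def inv_into_f_f)

lemma cl_neg: "u \<notin> lv ` {..<len} \<Longrightarrow> cl lv len base u = -1"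
  by (simp add: cl_def)

lemma cl_neg_iff: "cl lv len base u < 0 \<longleftrightarrow> u \<notin> lv ` {..<len}"
  by (simp add: cl_def Let_def)

text \<open>The length \<open>bigL\<close> leaves room for the table of the dynamic program: up to
  \<open>2 ^ (k + 2)\<close> component sets with \<open>k + 1\<close> entries each, plus some slack.
  The exponent comes from at most \<open>k + 2\<close> classes.\<close>

locale prog = machine B "input_words (int k) adj" W 10 L
  for B :: int and k :: nat and adj :: "nat list list" and W :: "real list" and L :: nat +
  assumes adj_lt: "i < length adj \<Longrightarrow> set (adj ! i) \<subseteq> {..<length adj}"
    and adj_sym: "i < length adj \<Longrightarrow> j \<in> set (adj ! i) \<Longrightarrow> i \<in> set (adj ! j)"
    and adj_irr: "i < length adj \<Longrightarrow> i \<notin> set (adj ! i)"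
    and adj_dist: "i < length adj \<Longrightarrow> distinct (adj ! i)"
    and lenW: "length W = length adj"
    and W_pos: "i < length W \<Longrightarrow> 0 \<le> W ! i"
    and bigB: "int (length adj + length (concat adj) + k + 100) \<le> B"
    and bigL: "2 ^ (k + 3) * (k + 2) \<le> L"
begin

abbreviation n :: nat where "n \<equiv> length adj"

definition ad :: "nat \<Rightarrow> nat \<Rightarrow> bool" where
  "ad u v \<longleftrightarrow> u < n \<and> v \<in> set (adj ! u)"

sublocale adj_graph n ad
  using adj_lt adj_sym adj_irr by unfold_locales (auto simp: ad_def)

abbreviation deg :: "nat \<Rightarrow> nat" where "deg v \<equiv> length (adj ! v)"
abbreviation off :: "nat \<Rightarrow> nat" where "off v \<equiv> length (concat (take v adj))"
abbreviation I :: "int list" where "I \<equiv> input_words (int k) adj"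

lemma len_I: "length I = 3 + n + length (concat adj)"
  by (simp add: input_words_def)

lemma I_0: "I ! 0 = int k" and I_1: "I ! Suc 0 = int n"
  by (simp_all add: input_words_def)

lemma I_off: "v \<le> n \<Longrightarrow> I ! (2 + v) = int (off v)"
  by (simp add: input_words_def nth_append nth_Cons' del: upt_Suc)

lemma I_2 [simp]: "v \<le> n \<Longrightarrow> I ! Suc (Suc v) = int (off v)"
  and I_3 [simp]: "v < n \<Longrightarrow> I ! (v + 3) = int (off (Suc v))"
  using I_off[of v] I_off[of "Suc v"] by (simp_all add: numeral_3_eq_3)

lemma I_adj: "p < length (concat adj) \<Longrightarrow> I ! (3 + n + p) = int (concat adj ! p)"
  by (simp add: input_words_def nth_append nth_Cons' del: upt_Suc)

lemma off_Suc: "v < n \<Longrightarrow> off (Suc v) = off v + deg v"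
  by (simp add: take_Suc_conv_app_nth)

lemma off_le: "v \<le> n \<Longrightarrow> off v \<le> length (concat adj)"
  by (metis append_take_drop_id concat_append le_add1 length_append)

lemma concat_nth: "v < n \<Longrightarrow> e < deg v \<Longrightarrow> concat adj ! (off v + e) = adj ! v ! e \<and> off v + e < length (concat adj)"
proof -
  assume v: "v < n" "e < deg v"
  have "concat adj = concat (take v adj) @ adj ! v @ concat (drop (Suc v) adj)"
    by (metis v(1) concat.simps(2) concat_append id_take_nth_drop)
  then show ?thesis using v by (simp add: nth_append)
qed

lemma adj_nth_lt: "v < n \<Longrightarrow> e < deg v \<Longrightarrow> adj ! v ! e < n"
  using adj_lt nth_mem by fastforce

definition lvs :: "(nat \<Rightarrow> nat) \<Rightarrow> nat \<Rightarrow> nat \<Rightarrow> state \<Rightarrow> bool" where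
  "lvs lv len base s \<longleftrightarrow> iv s vk = int k \<and> iv s vn = int n \<and> iv s vlen = int len \<and> iv s vbase = int base \<and>
     base \<le> len \<and> len \<le> L \<and> (\<forall>t<len. ia s aLV t = int (lv t)) \<and> inj_on lv {..<len}"

lemma L_B: "int L + 70 \<le> B" using room by simp

lemma lvs_fr: "lvs lv len base s \<Longrightarrow> fr c s t \<Longrightarrow> wv c \<inter> {1, 2, 5, 6} = {} \<Longrightarrow> 0 \<notin> wa c \<Longrightarrow> lvs lv len base t"
  by (auto simp: lvs_def fr_def)

definition CL :: "nat \<Rightarrow> nat" where "CL len = 60 + 30 * len"

lemma LOOK_ok:
  assumes l: "lvs lv len base s" and u: "iv s vu = int u"
  shows "ok LOOK s (\<lambda>t. iv t vd = cl lv len base u \<and> tm t \<le> tm s + CL len)"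
proof -
  have inj: "inj_on lv {..<len}" and LV: "\<And>t. t < len \<Longrightarrow> ia s 0 t = int (lv t)"
    and ll: "len \<le> L" "base \<le> len" "iv s 6 = int len" "iv s 5 = int base" using l by (auto simp: lvs_def)
  have i: "u \<in> lv ` {..<len} \<Longrightarrow> inv_into {..<len} lv u < len" using inv_into_into[of u lv "{..<len}"] by simp
  have e: "(\<exists>t<len. lv t = u) \<longleftrightarrow> u \<in> lv ` {..<len}" by auto
  show ?thesis
    unfolding LOOK_def
  proof (simp, rule ok_For[where n = len and T = "\<lambda>_. 15" and
      J = "\<lambda>i t. iv t 13 = (if \<exists>t<i. lv t = u then int (inv_into {..<len} lv u) else -1)"], goal_cases)
    case (7 i t)
    have "ia t 0 i = int (lv i)" "iv t 20 = int u" using frs[OF 7(2)] LV 7(1) u by auto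
    moreover have "lv i = u \<Longrightarrow> inv_into {..<len} lv u = i" using inj 7(1) by (auto simp: inv_into_f_f)
    ultimately show ?case using 7 ll by (auto simp: less_Suc_eq)
  next
    case (8 t)
    have "iv t 5 = int base" using frs[OF 8(2)] ll by simp
    then show ?case using 8(1,3) L_B i ll unfolding e by (auto simp: cl_def Let_def CL_def)
  qed (use ll in auto)
qed

text \<open>The invariant has to survive changes of the variables 13 to 15 and 18 to 20, which
  belong to the enumeration and the lookup. The body finds the neighbor in \<open>vu\<close> and its
  class in \<open>vd\<close>.\<close>

lemma ok_FORNB:
  assumes l: "lvs lv len base s" and v: "iv s vv = int v" "v < n"
    and w: "wv c \<inter> {1, 2, 5, 6, 16, 18, 19} = {}" "0 \<notin> wa c"
    and init: "J 0 s"
    and ins: "\<And>i t t'. J i t \<Longrightarrow> (\<And>v. v \<notin> {13, 14, 15, 18, 19, 20} \<Longrightarrow> iv t' v = iv t v) \<Longrightarrow>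
        ia t' = ia t \<Longrightarrow> rv t' = rv t \<Longrightarrow> ra t' = ra t \<Longrightarrow> J i t'"
    and step: "\<And>i t. i < deg v \<Longrightarrow> fr (FORNB c) s t \<Longrightarrow> iv t vd = cl lv len base (adj ! v ! i) \<Longrightarrow>
        iv t vu = int (adj ! v ! i) \<Longrightarrow> J i t \<Longrightarrow>
        ok c t (\<lambda>t'. J (Suc i) t' \<and> tm t' \<le> tm t + T)"
    and fin: "\<And>t. J (deg v) t \<Longrightarrow> fr (FORNB c) s t \<Longrightarrow> tm t \<le> tm s + 20 + deg v * (T + CL len + 30) \<Longrightarrow> Q t"
  shows "ok (FORNB c) s Q"
proof -
  show ?thesis
  unfolding FORNB_def
proof (rule ok_For[where n = "deg v" and T = "\<lambda>_. T + CL len + 26" and J = J], goal_cases)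
  case 1
  have "int (off v) \<le> int (length (concat adj))" "int (off (Suc v)) \<le> int (length (concat adj))" using off_le[of v] off_le[of "Suc v"] v by auto
  then show ?case using v bigB by (simp add: in_range_def len_I nat_add_distrib)
next
  case 2
  show ?case using v off_Suc[OF v(2)] by (simp add: nat_add_distrib)
next
  case 3
  then show ?case using w by auto
next
  case 4
  then show ?case using w by auto
next
  case 5
  then show ?case using init .
next
  case (6 i t y z w)
  then show ?case by (intro ins[OF 6]) auto
next
  case (7 i t)
  have f: "fr (FORNB c) s t" using 7 by (simp add: FORNB_def)
  let ?s = "t\<lparr>iv := (iv t)(20 := int (adj ! v ! i)), tm := tm t + 16\<rparr>"
  have c: "concat adj ! (off v + i) = adj ! v ! i" "off v + i < length (concat adj)"
    using concat_nth[OF v(2) 7(1)] by auto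
  have vars: "iv t 2 = int n" "iv t 16 = int v" using fr_iv[OF f, of 2] fr_iv[OF f, of 16] w l v by (auto simp: lvs_def)
  have nat1: "nat (int n + 3 + int (off v) + int i) = 3 + n + (off v + i)" by simp
  have u: "I ! nat (int n + 3 + int (off v) + int i) = int (adj ! v ! i)"
    unfolding nat1 I_adj[OF c(2)] c(1) ..
  have lt: "adj ! v ! i < n" using adj_nth_lt[OF v(2) 7(1)] .
  have "lvs lv len base t" using lvs_fr[OF l f] w by auto
  then have l': "lvs lv len base ?s" by (simp add: lvs_def)
  have "ok LOOK ?s (\<lambda>t'. ok c t' (\<lambda>t'. J (Suc i) t' \<and> tm t' \<le> tm t + (T + CL len + 26)))"
  proof (rule ok_mono[OF LOOK_ok[OF l']])
    show "iv ?s vu = int (adj ! v ! i)" by simp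
  next
    fix t' assume ft: "fr LOOK ?s t'" and t': "iv t' 13 = cl lv len base (adj ! v ! i) \<and> tm t' \<le> tm ?s + CL len"
    have "fr (FORNB c) s t'" using f ft by (auto simp: fr_def)
    moreover have "J i t'" by (rule ins[OF 7(4)]) (use ft in \<open>auto simp: fr_def\<close>)
    moreover have "iv t' 20 = int (adj ! v ! i)" using frs[OF ft] by simp
    ultimately have "ok c t' (\<lambda>t''. J (Suc i) t'' \<and> tm t'' \<le> tm t' + T)" using step[OF 7(1)] t' by blast
    then show "ok c t' (\<lambda>t''. J (Suc i) t'' \<and> tm t'' \<le> tm t + (T + CL len + 26))"
      by (rule ok_mono) (use t' in auto)
  qed
  moreover have "int (off v + i) \<le> int (length (concat adj))" using c(2) by simp
  ultimately show ?case using vars 7 bigB u lt c(2) v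
    by (simp add: in_range_def len_I nat_add_distrib)
next
  case (8 t)
  show ?case by (rule fin[OF 8(1)]) (use 8 in \<open>auto simp: FORNB_def algebra_simps\<close>)
qed
qed

end

section \<open>One pass over the graph for a fixed subset\<close>

text \<open>A union of two label classes by renaming. Its cost is linear in the number of classes,
  no more than that of the lookup that precedes it up to a constant.\<close>

definition MERGE :: com where
  "MERGE = Asg vx (Arr acomp (V vd)) ;; Asg vy (Arr acomp (V va)) ;;
     For vi (V vny \<oplus> N 1) (When (Eq (Arr acomp (V vi)) (V vx)) (Put acomp (V vi) (V vy)))"

definition HASB :: com where
  "HASB = Unless (Less (V vd) (N 0)) (When (Eq (Arr aal (V vd)) (N 0)) (Asg vb (N 1)))"

definition LINK :: com where
  "LINK = Unless (Less (V vd) (N 0)) (When (Eq (Arr aal (V vd)) (N 1))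
     (Cond (Less (V va) (N 0)) (Asg va (V vd)) MERGE))"

definition STATUS :: com where
  "STATUS = Asg vst (N 0) ;; Cond (Less (V vc) (N 0)) (Asg vst (V vb))
     (Cond (Eq (Arr aal (V vc)) (N 1)) (Asg vst (N 1)) (When (Eq (V vb) (N 1)) (Asg vok (N 0))))"

text \<open>Only \<open>KB\<close> entries are stored, but the counter goes on, so that an excess
  over the budget is noticed afterwards. Vertices of \<open>R\<close> have class 0 and are neither
  listed nor weighed.\<close>

definition COLLECT :: com where
  "COLLECT = Unless (Eq (V vc) (N 0))
     (When (Less (V vtc) (V vKB)) (Put aTX (V vtc) (V vv)) ;; Asg vtc (V vtc \<oplus> N 1) ;;
      RInp rwt (V vv) ;; RAdd rtot rtot rwt)"

text \<open>The variable \<open>va\<close> holds the class of an anchor, a vertex of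
  \<open>R \<union> A\<close> that equals or neighbors the current vertex. If it is still negative
  after the loop, a forced vertex has no neighbor in \<open>R \<union> A\<close> and the subset
  fails.\<close>

definition VERT2 :: com where
  "VERT2 = Asg va (V vc) ;; FORNB LINK ;; When (Less (V va) (N 0)) (Asg vok (N 0)) ;; COLLECT"

definition VERT :: com where
  "VERT = Asg vu (V vv) ;; LOOK ;; Asg vc (V vd) ;; Asg vb (N 0) ;; FORNB HASB ;; STATUS ;;
     When (Eq (V vst) (N 1)) VERT2"

lemma w_MERGE [simp]: "wv MERGE = {25, 26, 27, 28}" "wa MERGE = {2}" "wr MERGE = {}" "wra MERGE = False"
  by (auto simp: MERGE_def)
lemma w_HASB [simp]: "wv HASB = {22}" "wa HASB = {}" "wr HASB = {}" "wra HASB = False"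
  by (auto simp: HASB_def)
lemma w_LINK [simp]: "wv LINK = {24, 25, 26, 27, 28}" "wa LINK = {2}" "wr LINK = {}" "wra LINK = False"
  by (auto simp: LINK_def)
lemma w_STATUS [simp]: "wv STATUS = {23, 29}" "wa STATUS = {}" "wr STATUS = {}" "wra STATUS = False"
  by (auto simp: STATUS_def)
lemma w_COLLECT [simp]: "wv COLLECT = {30}" "wa COLLECT = {5}" "wr COLLECT = {0, 1}" "wra COLLECT = False"
  by (auto simp: COLLECT_def)
lemma w_VERT2 [simp]: "wv VERT2 = {13, 14, 15, 18, 19, 20, 24, 25, 26, 27, 28, 29, 30}" "wa VERT2 = {2, 5}"
   "wr VERT2 = {0, 1}" "wra VERT2 = False"
  by (auto simp: VERT2_def)
lemma w_VERT [simp]: "wv VERT = {13, 14, 15, 18, 19, 20, 21, 22, 23, 24, 25, 26, 27, 28, 29, 30}" "wa VERT = {2, 5}"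
   "wr VERT = {0, 1}" "wra VERT = False"
  by (auto simp: VERT_def)

text \<open>One compression stage. The first \<open>base\<close> list entries form \<open>R\<close>,
  the others \<open>Y\<close>, and \<open>KB\<close> is the budget outside \<open>R\<close>. The
  known cover may exceed the budget by one, since releasing a pair moves two vertices to
  \<open>Y\<close> but raises the budget by one only; hence the \<open>k + 1\<close>.\<close>

locale solve = prog +
  fixes lv :: "nat \<Rightarrow> nat" and len base KB :: nat
  assumes inj_lv: "inj_on lv {..<len}" and base_len: "base \<le> len" and KB_k: "KB \<le> k"
    and ny_k: "len - base \<le> k + 1" and len_k: "len \<le> 2 * k + 2"
    and split: "cover_split n ad (lv ` {..<base}) (lv ` {base..<len})"
begin

definition ny :: nat where "ny = len - base"
definition R :: "nat set" where "R = lv ` {..<base}"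
definition Y :: "nat set" where "Y = lv ` {base..<len}"
abbreviation clu :: "nat \<Rightarrow> int" where "clu \<equiv> cl lv len base"
definition c :: "nat \<Rightarrow> nat" where "c u = nat (clu u)"

sublocale cover_split n ad R Y unfolding R_def Y_def by (rule split)

text \<open>Tells whether class \<open>i\<close> belongs to \<open>R \<union> A\<close> for the
  subset with bit mask \<open>m\<close>. Bits are shifted by one position because class 0 stands for
  \<open>R\<close>, which may be empty.\<close>

definition AL :: "nat \<Rightarrow> nat \<Rightarrow> bool" where
  "AL m i = (if i = 0 then 0 < base else bit m (i - 1))"

definition A :: "nat \<Rightarrow> nat set" where
  "A m = (\<lambda>i. lv (base + i)) ` {i. i < ny \<and> bit m i}"

lemma Q_eq: "R \<union> Y = lv ` {..<len}"
  using base_len by (simp add: R_def Y_def image_Un[symmetric] ivl_disj_un)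

lemma A_Y: "A m \<subseteq> Y"
  using base_len by (auto simp: A_def Y_def ny_def)

lemma clu_neg: "clu u < 0 \<longleftrightarrow> u \<notin> R \<union> Y"
  unfolding Q_eq by (rule cl_neg_iff)

lemma clu_out: "u \<notin> R \<union> Y \<Longrightarrow> clu u = -1"
  unfolding Q_eq by (rule cl_neg)

lemma clu_R: "u \<in> R \<Longrightarrow> clu u = 0"
  using cl_in[OF inj_lv] base_len by (force simp: R_def)

lemma clu_Y: "base \<le> t \<Longrightarrow> t < len \<Longrightarrow> clu (lv t) = int (t - base + 1)"
  using cl_in[OF inj_lv, of t base] by simp

lemma c_le: "c u \<le> ny"
proof (cases "u \<in> R \<union> Y")
  case True
  then show ?thesis using clu_R clu_Y by (auto simp: R_def Y_def c_def ny_def)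
qed (simp add: clu_out c_def)

lemma clu_c: "u \<in> R \<union> Y \<Longrightarrow> clu u = int (c u)"
  using clu_neg[of u] by (simp add: c_def)

lemma c_0: "u \<in> R \<union> Y \<Longrightarrow> c u = 0 \<longleftrightarrow> u \<in> R"
  using disj clu_R[of u] clu_Y by (cases "u \<in> R") (auto simp: Y_def c_def)

lemma lv_A: "base \<le> t \<Longrightarrow> t < len \<Longrightarrow> lv t \<in> A m \<longleftrightarrow> bit m (t - base)"
proof
  assume t: "base \<le> t" "t < len" and "lv t \<in> A m"
  then obtain i where i: "i < ny" "bit m i" "lv t = lv (base + i)" by (auto simp: A_def)
  then have "t = base + i" using inj_lv t by (auto simp: ny_def dest: inj_onD)
  then show "bit m (t - base)" using i by simp
next
  assume t: "base \<le> t" "t < len" and "bit m (t - base)"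
  then show "lv t \<in> A m" by (auto simp: A_def ny_def intro!: image_eqI[of _ _ "t - base"])
qed

lemma AL_c: "u \<in> R \<union> Y \<Longrightarrow> AL m (c u) \<longleftrightarrow> u \<in> R \<union> A m"
proof -
  assume u: "u \<in> R \<union> Y"
  show ?thesis
  proof (cases "u \<in> R")
    case True
    then have "0 < base" by (auto simp: R_def)
    then show ?thesis using clu_R[OF True] True by (simp add: AL_def c_def)
  next
    case False
    then have "u \<in> Y" using u by simp
    then obtain t where t: "base \<le> t" "t < len" "u = lv t" by (auto simp: Y_def)
    have "c u = Suc (t - base)" using clu_Y[OF t(1,2)] t(3) by (simp add: c_def)
    then show ?thesis using lv_A[OF t(1,2)] t(3) False by (simp add: AL_def)
  qed
qed

lemma AL_ex: "i \<le> ny \<Longrightarrow> AL m i \<Longrightarrow> \<exists>u\<in>R \<union> A m. c u = i"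
proof (cases "i = 0")
  case True
  assume "i \<le> ny" "AL m i"
  then have "lv 0 \<in> R" using True by (auto simp: AL_def R_def)
  then show ?thesis using clu_R True by (intro bexI[of _ "lv 0"]) (auto simp: c_def)
next
  case False
  assume i: "i \<le> ny" "AL m i"
  then have "lv (base + (i - 1)) \<in> A m" "c (lv (base + (i - 1))) = i"
    using False lv_A[of "base + (i - 1)" m] clu_Y[of "base + (i - 1)"] by (auto simp: AL_def c_def ny_def)
  then show ?thesis by blast
qed

lemma c_inj: "u \<in> R \<union> Y \<Longrightarrow> w \<in> R \<union> Y \<Longrightarrow> c u = c w \<Longrightarrow> u = w \<or> u \<in> R \<and> w \<in> R"
proof -
  assume u: "u \<in> R \<union> Y" and w: "w \<in> R \<union> Y" and e: "c u = c w"
  show ?thesis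
  proof (cases "u \<in> R \<or> w \<in> R")
    case True
    then show ?thesis using c_0[OF u] c_0[OF w] e by auto
  next
    case False
    then obtain s t where "base \<le> s" "s < len" "u = lv s" "base \<le> t" "t < len" "w = lv t" using u w by (auto simp: Y_def)
    then show ?thesis using clu_Y[of s] clu_Y[of t] e by (auto simp: eq_nat_nat_iff c_def)
  qed
qed

abbreviation H :: "nat \<Rightarrow> nat set" where "H m \<equiv> R \<union> A m \<union> forced (A m)"

text \<open>Labels are themselves classes, each being its own label, so every label class has a
  representative. Only soundness with respect to paths is an invariant; completeness is obtained
  vertex by vertex during the pass.\<close>

definition cgood :: "nat \<Rightarrow> (nat \<Rightarrow> nat) \<Rightarrow> bool" where
  "cgood m cp \<longleftrightarrow> (\<forall>i\<le>ny. cp i \<le> ny \<and> cp (cp i) = cp i \<and> (AL m i \<longrightarrow> AL m (cp i))) \<and>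
     (\<forall>u\<in>R \<union> A m. \<forall>w\<in>R \<union> A m. cp (c u) = cp (c w) \<longrightarrow> (u, w) \<in> (edges (H m))\<^sup>*)"

definition relab :: "(nat \<Rightarrow> nat) \<Rightarrow> nat \<Rightarrow> nat \<Rightarrow> nat \<Rightarrow> nat" where
  "relab cp a d i = (if cp i = cp d then cp a else cp i)"

text \<open>Class 0 is the only class that can contain several vertices, and these are the vertices
  of the connected set \<open>R\<close>.\<close>

lemma cgood_id: "cgood m (\<lambda>i. i)"
proof -
  have "(u, w) \<in> (edges (H m))\<^sup>*" if "u \<in> R \<union> A m" "w \<in> R \<union> A m" "c u = c w" for u w
  proof -
    have "u = w \<or> u \<in> R \<and> w \<in> R" using that A_Y by (intro c_inj) auto
    moreover have "(edges R)\<^sup>* \<subseteq> (edges (H m))\<^sup>*" by (rule rtrancl_mono) auto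
    ultimately show ?thesis using conR by (auto simp: conn_iff_rtrancl)
  qed
  then show ?thesis by (auto simp: cgood_def)
qed

lemma edges_sym: "(u, w) \<in> (edges X)\<^sup>* \<Longrightarrow> (w, u) \<in> (edges X)\<^sup>*"
proof -
  have "sym (edges X)" using ad_sym by (auto simp: sym_def)
  then show "(u, w) \<in> (edges X)\<^sup>* \<Longrightarrow> (w, u) \<in> (edges X)\<^sup>*" by (metis sym_rtrancl symD)
qed

text \<open>Two vertices whose labels become equal had equal labels already, or carry the two merged
  labels; in the latter case the given path between \<open>za\<close> and \<open>zd\<close> links
  them.\<close>

lemma cgood_relab:
  assumes g: "cgood m cp" and z: "za \<in> R \<union> A m" "zd \<in> R \<union> A m" "(za, zd) \<in> (edges (H m))\<^sup>*"
  shows "cgood m (relab cp (c za) (c zd))"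
proof -
  let ?a = "c za" and ?d = "c zd"
  have zQ: "za \<in> R \<union> Y" "zd \<in> R \<union> Y" using z(1,2) A_Y by blast+
  have al: "AL m ?a" "AL m ?d" using AL_c[OF zQ(1)] AL_c[OF zQ(2)] z(1,2) by blast+
  have le: "?a \<le> ny" "?d \<le> ny" by (rule c_le)+
  have dz: "(zd, za) \<in> (edges (H m))\<^sup>*" using edges_sym[OF z(3)] .
  have S: "(u, w) \<in> (edges (H m))\<^sup>*" if "u \<in> R \<union> A m" "w \<in> R \<union> A m" "cp (c u) = cp (c w)" for u w
    using g that unfolding cgood_def by blast
  have "(u, w) \<in> (edges (H m))\<^sup>*"
    if uw: "u \<in> R \<union> A m" "w \<in> R \<union> A m" "relab cp ?a ?d (c u) = relab cp ?a ?d (c w)" for u w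
  proof -
    consider "cp (c u) = cp (c w)" | "cp (c u) = cp ?d" "cp (c w) = cp ?a" | "cp (c u) = cp ?a" "cp (c w) = cp ?d"
      using uw(3) by (auto simp: relab_def split: if_splits)
    then show ?thesis
    proof cases
      case 1
      then show ?thesis by (rule S[OF uw(1,2)])
    next
      case 2
      have "(u, zd) \<in> (edges (H m))\<^sup>*" "(za, w) \<in> (edges (H m))\<^sup>*"
        using S[OF uw(1) z(2) 2(1)] S[OF z(1) uw(2) 2(2)[symmetric]] by auto
      then show ?thesis using dz by (meson rtrancl_trans)
    next
      case 3
      have "(u, za) \<in> (edges (H m))\<^sup>*" "(zd, w) \<in> (edges (H m))\<^sup>*"
        using S[OF uw(1) z(1) 3(1)] S[OF z(2) uw(2) 3(2)[symmetric]] by auto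
      then show ?thesis using z(3) by (meson rtrancl_trans)
    qed
  qed
  moreover have "\<forall>i\<le>ny. relab cp ?a ?d i \<le> ny \<and> relab cp ?a ?d (relab cp ?a ?d i) = relab cp ?a ?d i \<and>
      (AL m i \<longrightarrow> AL m (relab cp ?a ?d i))"
    using g le al unfolding cgood_def relab_def by simp
  ultimately show ?thesis unfolding cgood_def by blast
qed

definition base_st :: "state \<Rightarrow> bool" where
  "base_st s \<longleftrightarrow> lvs lv len base s \<and> iv s vny = int ny \<and> iv s vKB = int KB"

definition alst :: "nat \<Rightarrow> state \<Rightarrow> bool" where
  "alst m s \<longleftrightarrow> (\<forall>i\<le>ny. ia s aal i = (if AL m i then 1 else 0))"

definition cpst :: "(nat \<Rightarrow> nat) \<Rightarrow> state \<Rightarrow> bool" where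
  "cpst cp s \<longleftrightarrow> (\<forall>i\<le>ny. ia s acomp i = int (cp i))"

lemma base_st_fr: "base_st s \<Longrightarrow> fr p s t \<Longrightarrow> wv p \<inter> {1, 2, 5, 6, 7, 8} = {} \<Longrightarrow> 0 \<notin> wa p \<Longrightarrow> base_st t"
  unfolding base_st_def using lvs_fr[of lv len base s p t] by (auto simp: fr_def)

lemma alst_fr: "alst m s \<Longrightarrow> fr p s t \<Longrightarrow> 1 \<notin> wa p \<Longrightarrow> alst m t"
  by (auto simp: alst_def fr_def)

lemma k_L: "2 * k + 4 \<le> L"
proof -
  have "8 * (k + 2) \<le> 2 ^ (k + 3) * (k + 2)"
    by (intro mult_le_mono1) (simp add: power_add)
  then have "8 * (k + 2) \<le> L" using bigL by (rule order_trans)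
  then show ?thesis by simp
qed

lemma ny_L: "ny < L" "int ny + 1 \<le> B" "ny \<le> k + 1"
  using ny_k k_L L_B unfolding ny_def by linarith+

lemma MERGE_ok:
  assumes s: "base_st s" "cpst cp s" and a: "iv s va = int a" "iv s vd = int d" "a \<le> ny" "d \<le> ny"
  shows "ok MERGE s (\<lambda>t. cpst (relab cp a d) t \<and> tm t \<le> tm s + 60 + 30 * ny)"
proof -
  have v: "iv s 7 = int ny" "ia s 2 a = int (cp a)" "ia s 2 d = int (cp d)"
    using s a by (auto simp: base_st_def cpst_def)
  show ?thesis
    unfolding MERGE_def
  proof (simp add: v a less_imp_le[THEN le_less_trans] le_less_trans[OF _ ny_L(1)], rule ok_For[where n = "ny + 1" and T = "\<lambda>_. 22" and
      J = "\<lambda>i t. \<forall>j\<le>ny. ia t 2 j = int (if j < i then relab cp a d j else cp j)"], goal_cases)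
    case 1
    then show ?case using ny_L v by simp
  next
    case (7 i t)
    have "iv t 25 = int (cp d)" "iv t 26 = int (cp a)" using frs[OF 7(2)] v a by auto
    moreover have "ia t 2 i = int (cp i)" using 7(1,4) by simp
    ultimately show ?case using 7 ny_L(1) by (auto simp: relab_def less_Suc_eq)
  next
    case (8 t)
    then show ?case by (auto simp: cpst_def)
  qed (use s v in \<open>auto simp: cpst_def\<close>)
qed

lemma HASB_ok:
  assumes s: "base_st s" "alst m s" "iv s vd = clu u" "iv s vb = of_bool b"
  shows "ok HASB s (\<lambda>t. iv t vb = of_bool (b \<or> u \<in> Y - A m) \<and> tm t \<le> tm s + 30)"
proof (cases "u \<in> R \<union> Y")
  case True
  have "ia s 1 (c u) = (if u \<in> R \<union> A m then 1 else 0)" using s AL_c[OF True] c_le by (auto simp: alst_def)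
  moreover have "u \<in> Y - A m \<longleftrightarrow> u \<notin> R \<union> A m" using True disj A_Y by auto
  ultimately show ?thesis using s ny_L c_le[of u] clu_c[OF True] unfolding HASB_def by auto
next
  case False
  then show ?thesis using s clu_out[OF False] unfolding HASB_def by auto
qed

lemma ad_nth: "v < n \<Longrightarrow> ad v u \<longleftrightarrow> (\<exists>i<deg v. adj ! v ! i = u)"
  by (auto simp: ad_def in_set_conv_nth)

lemma FORNB_HASB_ok:
  assumes s: "base_st s" "alst m s" "iv s vv = int v" "v < n" "iv s vb = 0"
  shows "ok (FORNB HASB) s (\<lambda>t. iv t vb = of_bool (\<exists>u\<in>Y - A m. ad v u) \<and>
     tm t \<le> tm s + 20 + deg v * (60 + CL len))"
proof (rule ok_FORNB[where lv = lv and len = len and base = base and v = v and T = 30 and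
    J = "\<lambda>i t. iv t vb = of_bool (\<exists>i'<i. adj ! v ! i' \<in> Y - A m)"], goal_cases)
  case (8 i t)
  have "base_st t" by (rule base_st_fr[OF s(1) 8(2)]) auto
  moreover have "alst m t" by (rule alst_fr[OF s(2) 8(2)]) auto
  ultimately have "ok HASB t (\<lambda>t'. iv t' vb = of_bool ((\<exists>i'<i. adj ! v ! i' \<in> Y - A m) \<or> adj ! v ! i \<in> Y - A m) \<and> tm t' \<le> tm t + 30)"
    using 8(3,5) by (intro HASB_ok)
  then show ?case by (rule ok_mono) (auto simp: less_Suc_eq)
next
  case (9 t)
  then show ?case using ad_nth[OF s(4)] by (auto simp: Bex_def)
qed (use s(1) in \<open>simp add: base_st_def\<close>, simp_all add: s)

text \<open>Local completeness of the labels: for \<open>v\<close> in \<open>R \<union> A\<close> it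
  says that edges join equal labels, for forced \<open>v\<close> that all neighbors in
  \<open>R \<union> A\<close> have the same label.\<close>

definition agree :: "nat \<Rightarrow> (nat \<Rightarrow> nat) \<Rightarrow> nat \<Rightarrow> bool" where
  "agree m cp v \<longleftrightarrow> (\<forall>u\<in>R \<union> A m. \<forall>w\<in>R \<union> A m. (u = v \<or> ad v u) \<longrightarrow> (w = v \<or> ad v w) \<longrightarrow> cp (c u) = cp (c w))"

lemma link_path:
  assumes "v \<in> H m" "z \<in> R \<union> A m" "z = v \<or> ad v z" "u \<in> R \<union> A m" "ad v u"
  shows "(z, u) \<in> (edges (H m))\<^sup>*"
proof -
  have "(v, u) \<in> edges (H m)" using assms by auto
  moreover have "z = v \<or> (z, v) \<in> edges (H m)" using assms ad_sym by auto
  ultimately show ?thesis by (meson converse_rtrancl_into_rtrancl r_into_rtrancl)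
qed

text \<open>Merging never separates labels, so the agreement reached at earlier vertices survives
  all later merges.\<close>

definition coarser :: "(nat \<Rightarrow> nat) \<Rightarrow> (nat \<Rightarrow> nat) \<Rightarrow> bool" where
  "coarser cp cp' \<longleftrightarrow> (\<forall>x y. cp x = cp y \<longrightarrow> cp' x = cp' y)"

lemma coarser_refl [simp]: "coarser cp cp"
  by (simp add: coarser_def)

lemma coarser_trans: "coarser cp cp' \<Longrightarrow> coarser cp' cp'' \<Longrightarrow> coarser cp cp''"
  unfolding coarser_def by blast

lemma coarserD: "coarser cp cp' \<Longrightarrow> cp x = cp y \<Longrightarrow> cp' x = cp' y"
  unfolding coarser_def by blast

lemma coarser_relab: "coarser cp (relab cp a d)"
  unfolding coarser_def relab_def by presburger

text \<open>Loop invariant after \<open>i\<close> neighbors: a negative \<open>a\<close> means that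
  neither \<open>v\<close> nor any of these neighbors lies in \<open>R \<union> A\<close>; otherwise
  \<open>a\<close> is the class of an anchor \<open>z\<close> with which those that do have been
  merged.\<close>

definition linked :: "nat \<Rightarrow> (nat \<Rightarrow> nat) \<Rightarrow> nat \<Rightarrow> nat \<Rightarrow> int \<Rightarrow> (nat \<Rightarrow> nat) \<Rightarrow> bool" where
  "linked m cp v i a cp' \<longleftrightarrow> cgood m cp' \<and> coarser cp cp' \<and>
     (a < 0 \<longrightarrow> v \<notin> R \<union> A m \<and> (\<forall>i'<i. adj ! v ! i' \<notin> R \<union> A m)) \<and>
     (0 \<le> a \<longrightarrow> (\<exists>z\<in>R \<union> A m. a = int (c z) \<and> (z = v \<or> ad v z) \<and> (v \<in> R \<union> A m \<longrightarrow> cp' (c v) = cp' (c z)) \<and>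
        (\<forall>i'<i. adj ! v ! i' \<in> R \<union> A m \<longrightarrow> cp' (c (adj ! v ! i')) = cp' (c z))))"

lemma linked_skip:
  "linked m cp v i a cp' \<Longrightarrow> adj ! v ! i \<notin> R \<union> A m \<Longrightarrow> linked m cp v (Suc i) a cp'"
  by (simp add: linked_def All_less_Suc)

lemma LINK_ok:
  assumes s: "base_st s" "alst m s" "cpst cp' s" and l: "linked m cp v i (iv s va) cp'"
    and v: "v \<in> H m" "v < n" "i < deg v" "iv s vd = clu (adj ! v ! i)"
  shows "ok LINK s (\<lambda>t. (\<exists>cp'. cpst cp' t \<and> linked m cp v (Suc i) (iv t va) cp') \<and> tm t \<le> tm s + 120 + 30 * ny)"
proof -
  let ?u = "adj ! v ! i"
  have adu: "ad v ?u" using v ad_nth by blast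
  show ?thesis
  proof (cases "?u \<in> R \<union> Y")
    case False
    then have "?u \<notin> R \<union> A m" using A_Y by auto
    then have "linked m cp v (Suc i) (iv s va) cp'" by (rule linked_skip[OF l])
    then show ?thesis using s(3) v(4) clu_out[OF False] unfolding LINK_def by (auto simp: cpst_def)
  next
    case True
    have d: "iv s vd = int (c ?u)" "c ?u \<le> ny" using v(4) clu_c[OF True] c_le by simp_all
    have al: "ia s 1 (c ?u) = (if ?u \<in> R \<union> A m then 1 else 0)" using s AL_c[OF True] c_le by (auto simp: alst_def)
    show ?thesis
    proof (cases "?u \<in> R \<union> A m")
      case F: False
      then have "linked m cp v (Suc i) (iv s va) cp'" by (rule linked_skip[OF l])
      moreover have "ia s 1 (c ?u) = 0" using al F by simp
      ultimately show ?thesis using s(3) d ny_L(1) unfolding LINK_def by (auto simp: cpst_def)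
    next
      case uA: True
      show ?thesis
      proof (cases "iv s va < 0")
        case neg: True
        then have h: "v \<notin> R \<union> A m" "\<forall>i'<i. adj ! v ! i' \<notin> R \<union> A m" "cgood m cp'" "coarser cp cp'"
          using l by (simp_all add: linked_def)
        have "linked m cp v (Suc i) (int (c ?u)) cp'"
          unfolding linked_def
        proof (intro conjI[OF h(3)] conjI[OF h(4)] conjI impI bexI[OF _ uA])
          show "\<forall>i'<Suc i. adj ! v ! i' \<in> R \<union> A m \<longrightarrow> cp' (c (adj ! v ! i')) = cp' (c ?u)"
            using h(2) by (auto simp: All_less_Suc)
        qed (use adu h(1) in auto)
        moreover have "ia s 1 (c ?u) = 1" using al uA by simp
        ultimately show ?thesis using s(3) d neg ny_L(1) unfolding LINK_def by (auto simp: cpst_def)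
      next
        case pos: False
        obtain z where z: "z \<in> R \<union> A m" "iv s va = int (c z)" "z = v \<or> ad v z"
          "v \<in> R \<union> A m \<longrightarrow> cp' (c v) = cp' (c z)"
          "\<forall>i'<i. adj ! v ! i' \<in> R \<union> A m \<longrightarrow> cp' (c (adj ! v ! i')) = cp' (c z)"
          and g: "cgood m cp'" "coarser cp cp'"
          using l pos unfolding linked_def by (simp add: not_less) blast
        let ?cp = "relab cp' (c z) (c ?u)"
        note pres = coarserD[OF coarser_relab[of cp' "c z" "c ?u"]]
        have new: "?cp (c ?u) = ?cp (c z)" by (auto simp: relab_def)
        have g': "cgood m ?cp" by (rule cgood_relab[OF g(1) z(1) uA link_path[OF v(1) z(1,3) uA adu]])
        have "linked m cp v (Suc i) (int (c z)) ?cp"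
          unfolding linked_def
        proof (intro conjI impI bexI[OF _ z(1)])
          show "\<forall>i'<Suc i. adj ! v ! i' \<in> R \<union> A m \<longrightarrow> ?cp (c (adj ! v ! i')) = ?cp (c z)"
            using z(5) pres new unfolding All_less_Suc by blast
          show "v \<in> R \<union> A m \<Longrightarrow> ?cp (c v) = ?cp (c z)" using z(4) pres by blast
        qed (use g' coarser_trans[OF g(2) coarser_relab] z(3) in auto)
        note lk = this
        have "ok MERGE (s\<lparr>tm := w\<rparr>) (\<lambda>t. (\<exists>cp'. cpst cp' t \<and> linked m cp v (Suc i) (iv t va) cp') \<and>
            tm t \<le> tm s + 120 + 30 * ny)" if w: "w \<le> tm s + 60" for w
        proof (rule ok_mono[OF MERGE_ok[of "s\<lparr>tm := w\<rparr>" cp' "c z" "c ?u"]])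
          fix t assume f: "fr MERGE (s\<lparr>tm := w\<rparr>) t" and t: "cpst ?cp t \<and> tm t \<le> tm (s\<lparr>tm := w\<rparr>) + 60 + 30 * ny"
          have "iv t va = int (c z)" using fr_iv[OF f, of va] z(2) by simp
          then have "cpst ?cp t \<and> linked m cp v (Suc i) (iv t va) ?cp" using lk t by simp
          then show "(\<exists>cp'. cpst cp' t \<and> linked m cp v (Suc i) (iv t va) cp') \<and> tm t \<le> tm s + 120 + 30 * ny"
            using t w by auto
        qed (use s z(2) d c_le in \<open>auto simp: base_st_def lvs_def cpst_def\<close>)
        moreover have "ia s 1 (c ?u) = 1" using al uA by simp
        ultimately show ?thesis using d pos ny_L(1) unfolding LINK_def by simp
      qed
    qed
  qed
qed

lemma FORNB_LINK_ok:
  assumes s: "base_st s" "alst m s" "cpst cp s" "cgood m cp" "iv s vv = int v" "v < n" "v \<in> H m"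
    and a: "iv s va = clu v"
  shows "ok (FORNB LINK) s (\<lambda>t. (\<exists>cp'. cpst cp' t \<and> cgood m cp' \<and> coarser cp cp' \<and> agree m cp' v) \<and>
      (iv t va < 0 \<longleftrightarrow> v \<notin> R \<union> A m \<and> (\<forall>u\<in>R \<union> A m. \<not> ad v u)) \<and>
      tm t \<le> tm s + 20 + deg v * (150 + 30 * ny + CL len))"
proof (rule ok_FORNB[where lv = lv and len = len and base = base and v = v and T = "120 + 30 * ny" and
    J = "\<lambda>i t. \<exists>cp'. cpst cp' t \<and> linked m cp v i (iv t va) cp'"], goal_cases)
  case 6
  \<comment> \<open>A vertex of \<open>R \<union> A\<close> is its own anchor. A forced vertex lies
    outside the list, so its class -1 says that an anchor is still missing.\<close>
  have "linked m cp v 0 (clu v) cp"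
  proof (cases "v \<in> R \<union> Y")
    case True
    then have "v \<in> R \<union> A m" using s(7) by (auto simp: forced_def)
    then show ?thesis using s(4) clu_c[OF True] by (auto simp: linked_def intro!: bexI[of _ v])
  next
    case False
    then show ?thesis using s(4) clu_out[OF False] A_Y by (auto simp: linked_def)
  qed
  then show ?case using s a by auto
next
  case (7 i t t')
  then show ?case by (simp add: cpst_def)
next
  case (8 i t)
  have "base_st t" by (rule base_st_fr[OF s(1) 8(2)]) auto
  moreover have "alst m t" by (rule alst_fr[OF s(2) 8(2)]) auto
  moreover obtain cp' where "cpst cp' t" "linked m cp v i (iv t va) cp'" using 8(5) by blast
  ultimately have "ok LINK t (\<lambda>t'. (\<exists>cp'. cpst cp' t' \<and> linked m cp v (Suc i) (iv t' va) cp') \<and> tm t' \<le> tm t + 120 + 30 * ny)"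
    using 8(1,3) s by (intro LINK_ok)
  then show ?case by (rule ok_mono) auto
next
  case (9 t)
  then obtain cp' where cp': "cpst cp' t" "linked m cp v (deg v) (iv t va) cp'" by blast
  have "agree m cp' v \<and> (iv t va < 0 \<longleftrightarrow> v \<notin> R \<union> A m \<and> (\<forall>u\<in>R \<union> A m. \<not> ad v u))"
    (is "_ \<and> ?b")
  proof (cases "iv t va < 0")
    case True
    then have "v \<notin> R \<union> A m" "\<forall>u\<in>R \<union> A m. \<not> ad v u" using cp'(2) ad_nth[OF s(6)] by (auto simp: linked_def)
    then show ?thesis using True by (auto simp: agree_def)
  next
    case False
    then obtain z where z: "z \<in> R \<union> A m" "z = v \<or> ad v z" "v \<in> R \<union> A m \<longrightarrow> cp' (c v) = cp' (c z)"
      "\<forall>i'<deg v. adj ! v ! i' \<in> R \<union> A m \<longrightarrow> cp' (c (adj ! v ! i')) = cp' (c z)"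
      using cp'(2) by (auto simp: linked_def)
    have e: "cp' (c u) = cp' (c z)" if u: "u \<in> R \<union> A m" "u = v \<or> ad v u" for u
    proof (cases "u = v")
      case True
      then show ?thesis using z(3) u by blast
    next
      case False
      then obtain i' where "i' < deg v" "adj ! v ! i' = u" using u ad_nth[OF s(6)] by blast
      then show ?thesis using z(4) u by blast
    qed
    have "agree m cp' v" unfolding agree_def
      by (intro ballI impI) (rule trans[OF e e[symmetric]])
    moreover have "\<not> (v \<notin> R \<union> A m \<and> (\<forall>u\<in>R \<union> A m. \<not> ad v u))" using z(1,2) by blast
    ultimately show ?thesis using False by simp
  qed
  moreover have "cgood m cp'" "coarser cp cp'" using cp'(2) by (simp_all add: linked_def)
  moreover have "tm t \<le> tm s + 20 + deg v * (150 + 30 * ny + CL len)" using 9(3) by (simp add: algebra_simps)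
  ultimately show ?case using cp'(1) by blast
qed (use s(1) in \<open>simp add: base_st_def\<close>, simp_all add: s)

lemma STATUS_ok:
  assumes s: "base_st s" "alst m s" "iv s vc = clu v" "v < n" and b: "iv s vb = of_bool (\<exists>u\<in>Y - A m. ad v u)"
    and o: "iv s vok = of_bool g"
  shows "ok STATUS s (\<lambda>t. iv t vst = of_bool (v \<in> H m) \<and>
    iv t vok = of_bool (g \<and> (v \<in> Y - A m \<longrightarrow> (\<forall>u\<in>Y - A m. \<not> ad v u))) \<and> tm t \<le> tm s + 60)"
proof (cases "v \<in> R \<union> Y")
  case True
  have al: "ia s 1 (c v) = (if v \<in> R \<union> A m then 1 else 0)" using s AL_c[OF True] c_le by (auto simp: alst_def)
  have H: "v \<in> H m \<longleftrightarrow> v \<in> R \<union> A m" using True by (auto simp: forced_def)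
  have YA: "v \<in> Y - A m \<longleftrightarrow> v \<notin> R \<union> A m" using True disj A_Y by auto
  show ?thesis unfolding H YA STATUS_def using s clu_c[OF True] c_le[of v] al b o ny_L(1) by auto
next
  case False
  then have H: "v \<in> H m \<longleftrightarrow> (\<exists>u\<in>Y - A m. ad v u)" using A_Y by (auto simp: forced_def)
  have "v \<notin> Y - A m" using False by blast
  then show ?thesis unfolding H STATUS_def using s clu_out[OF False] b o by auto
qed

end

definition NUM1 :: com where
  "NUM1 = Asg vp (N 1) ;; For vi (V vny \<oplus> N 1) (When (Eq (Arr aal (V vi)) (N 1))
     (When (Eq (Arr acomp (V vi)) (V vi)) (Put abit (V vi) (V vp) ;; Asg vp (V vp \<otimes> N 2))))"

text \<open>A class outside \<open>R \<union> A\<close> gets the value 0, which is no power of two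
  and later stands for the absence of a component.\<close>

definition NUM2 :: com where
  "NUM2 = For vi (V vny \<oplus> N 1) (Cond (Eq (Arr aal (V vi)) (N 1))
     (Put acb (V vi) (Arr abit (Arr acomp (V vi)))) (Put acb (V vi) (N 0)))"

lemma w_NUM1 [simp]: "wv NUM1 = {27, 28, 31}" "wa NUM1 = {3}" "wr NUM1 = {}" "wra NUM1 = False"
  by (auto simp: NUM1_def)
lemma w_NUM2 [simp]: "wv NUM2 = {27, 28}" "wa NUM2 = {4}" "wr NUM2 = {}" "wra NUM2 = False"
  by (auto simp: NUM2_def)

context solve
begin

text \<open>Hides a long postcondition behind an arbitrary \<open>Q\<close>, so that a program can
  be executed by the simplifier before the postcondition is looked at.\<close>

lemma ok_gen: "(\<And>Q. (\<And>t. P t \<Longrightarrow> Q t) \<Longrightarrow> ok p s Q) \<Longrightarrow> ok p s P"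
  by blast

lemma COLLECT_ok:
  assumes s: "base_st s" "iv s vc = clu v" "iv s vv = int v" "v < n" "v \<in> H m"
    and x: "iv s vtc = int (length xs)" "length xs \<le> n" "\<forall>i<length xs. i < KB \<longrightarrow> ia s aTX i = int (xs ! i)"
      "rv s rtot = (\<Sum>x\<leftarrow>xs. W ! x)"
  shows "ok COLLECT s (\<lambda>t. let ys = (if v \<in> R then xs else xs @ [v]) in
    iv t vtc = int (length ys) \<and> (\<forall>i<length ys. i < KB \<longrightarrow> ia t aTX i = int (ys ! i)) \<and>
    rv t rtot = (\<Sum>x\<leftarrow>ys. W ! x) \<and> tm t \<le> tm s + 60)"
proof (cases "v \<in> R")
  case True
  then show ?thesis using s x clu_R[of v] unfolding COLLECT_def by (simp add: Let_def)
next
  case False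
  then have "clu v \<noteq> 0" using s(5) clu_c[of v] c_0[of v] clu_out[of v] by (cases "v \<in> R \<union> Y") auto
  moreover have "iv s 8 = int KB" "KB < L" "int (length xs) + 1 \<le> B" "in_range (int v) W"
    using s KB_k k_L bigB x(2) lenW by (auto simp: base_st_def in_range_def)
  ultimately show ?thesis using False s x unfolding COLLECT_def
    by (auto simp: Let_def nth_append less_Suc_eq)
qed

lemma VERT2_ok:
  assumes s: "base_st s" "alst m s" "cpst cp s" "cgood m cp" "iv s vv = int v" "v < n" "v \<in> H m"
    and a: "iv s vc = clu v" and g: "iv s vok = of_bool g"
    and x: "iv s vtc = int (length xs)" "length xs \<le> n" "\<forall>i<length xs. i < KB \<longrightarrow> ia s aTX i = int (xs ! i)"
      "rv s rtot = (\<Sum>x\<leftarrow>xs. W ! x)"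
  shows "ok VERT2 s (\<lambda>t. (\<exists>cp'. cpst cp' t \<and> cgood m cp' \<and> coarser cp cp' \<and> agree m cp' v) \<and>
    iv t vok = of_bool (g \<and> (v \<in> forced (A m) \<longrightarrow> (\<exists>u\<in>R \<union> A m. ad v u))) \<and>
    (let ys = (if v \<in> R then xs else xs @ [v]) in
    iv t vtc = int (length ys) \<and> (\<forall>i<length ys. i < KB \<longrightarrow> ia t aTX i = int (ys ! i)) \<and>
    rv t rtot = (\<Sum>x\<leftarrow>ys. W ! x)) \<and> tm t \<le> tm s + 100 + deg v * (150 + 30 * ny + CL len))"
  unfolding VERT2_def
proof (rule ok_gen, simp (no_asm), rule ok_mono[OF FORNB_LINK_ok[of _ m cp v]], goal_cases)
  case (9 Q t)
  note Qp = 9(1) and 9 = 9(2,3)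
  define b where "b \<longleftrightarrow> (v \<in> forced (A m) \<longrightarrow> (\<exists>u\<in>R \<union> A m. ad v u))"
  have b: "iv t va < 0 \<longleftrightarrow> \<not> b"
    using 9(2) s(7) A_Y unfolding b_def by (auto simp: forced_def)
  have base: "base_st t" by (rule base_st_fr[OF _ 9(1)]) (use s in \<open>auto simp: base_st_def lvs_def\<close>)
  obtain cp' where cp': "cpst cp' t" "cgood m cp'" "coarser cp cp'" "agree m cp' v" using 9(2) by blast
  have vars: "iv t vok = of_bool g" "iv t vc = clu v" "iv t vv = int v" "iv t vtc = int (length xs)"
      "ia t aTX = ia s aTX" "rv t rtot = rv s rtot" using frs[OF 9(1)] s a g x by auto
  have fin: "ok COLLECT u Q"
    if u: "iv u vok = of_bool (g \<and> b)" "\<And>w. w \<noteq> vok \<Longrightarrow> iv u w = iv t w" "ia u = ia t" "rv u = rv t" "tm u \<le> tm t + 12" for u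
  proof (rule ok_mono[OF COLLECT_ok[of u v m xs]])
    fix w assume f: "fr COLLECT u w" and w: "let ys = (if v \<in> R then xs else xs @ [v]) in
       iv w vtc = int (length ys) \<and> (\<forall>i<length ys. i < KB \<longrightarrow> ia w aTX i = int (ys ! i)) \<and>
       rv w rtot = (\<Sum>x\<leftarrow>ys. W ! x) \<and> tm w \<le> tm u + 60"
    have c1: "cpst cp' w" using frs[OF f] u cp'(1) by (simp add: cpst_def)
    show "Q w"
    proof (rule Qp, intro conjI)
      show "\<exists>cp'. cpst cp' w \<and> cgood m cp' \<and> coarser cp cp' \<and> agree m cp' v" using c1 cp' by blast
      show "iv w vok = of_bool (g \<and> (v \<in> forced (A m) \<longrightarrow> (\<exists>u\<in>R \<union> A m. ad v u)))"
        using frs[OF f] u unfolding b_def by simp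
      show "tm w \<le> tm s + 100 + deg v * (150 + 30 * ny + CL len)" using w u 9(2) by (simp add: Let_def)
      show "let ys = (if v \<in> R then xs else xs @ [v]) in iv w vtc = int (length ys) \<and>
          (\<forall>i<length ys. i < KB \<longrightarrow> ia w aTX i = int (ys ! i)) \<and> rv w rtot = (\<Sum>x\<leftarrow>ys. W ! x)"
        using w unfolding Let_def by blast
    qed
  qed (use u vars x s base in \<open>auto simp: base_st_def lvs_def\<close>)
  show ?case
  proof (cases b)
    case True
    then show ?thesis using b vars by (simp, intro fin) auto
  next
    case False
    then show ?thesis using b vars by (simp, intro fin) auto
  qed
qed (use s a in \<open>auto simp: base_st_def lvs_def alst_def cpst_def\<close>)

text \<open>Feasibility broken up into conditions on single vertices, which one pass over the graph
  can check.\<close>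

definition okv :: "nat \<Rightarrow> nat \<Rightarrow> bool" where
  "okv m v \<longleftrightarrow> (v \<in> Y - A m \<longrightarrow> (\<forall>u\<in>Y - A m. \<not> ad v u)) \<and> (v \<in> forced (A m) \<longrightarrow> (\<exists>u\<in>R \<union> A m. ad v u))"

definition XL :: "nat \<Rightarrow> nat \<Rightarrow> nat list" where
  "XL m h = filter (\<lambda>v. v \<in> A m \<union> forced (A m)) [0..<h]"

lemma XL_0: "XL m 0 = []" and XL_Suc: "XL m (Suc v) = (if v \<in> A m \<union> forced (A m) then XL m v @ [v] else XL m v)"
  by (simp_all add: XL_def)

lemma XL_le: "length (XL m h) \<le> h"
  unfolding XL_def by (rule order_trans[OF length_filter_le]) simp

definition scan :: "nat \<Rightarrow> nat \<Rightarrow> state \<Rightarrow> bool" where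
  "scan m h s \<longleftrightarrow> (\<exists>cp. cpst cp s \<and> cgood m cp \<and> (\<forall>v<h. v \<in> H m \<longrightarrow> agree m cp v)) \<and>
     iv s vok = of_bool (\<forall>v<h. okv m v) \<and> iv s vtc = int (length (XL m h)) \<and>
     (\<forall>i<length (XL m h). i < KB \<longrightarrow> ia s aTX i = int (XL m h ! i)) \<and> rv s rtot = (\<Sum>x\<leftarrow>XL m h. W ! x)"

lemma coarser_agree: "coarser cp cp' \<Longrightarrow> agree m cp v \<Longrightarrow> agree m cp' v"
  unfolding agree_def by (meson coarserD)

lemma H_notR: "v \<in> H m \<Longrightarrow> v \<in> R \<longleftrightarrow> v \<notin> A m \<union> forced (A m)"
  using disj A_Y by (auto simp: forced_def)

lemma VERT_ok:
  assumes s: "base_st s" "alst m s" "scan m v s" "iv s vv = int v" "v < n"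
  shows "ok VERT s (\<lambda>t. scan m (Suc v) t \<and> tm t \<le> tm s + (300 + CL len + deg v * (300 + 30 * ny + 2 * CL len)))"
  unfolding VERT_def
proof (simp, rule ok_mono[OF LOOK_ok[of lv len base _ v]], goal_cases)
  case 1
  then show ?case using s(1) by (simp add: base_st_def lvs_def)
next
  case 2
  then show ?case using s by simp
next
  case (3 t)
  have B3: "base_st t" by (rule base_st_fr[OF _ 3(1)]) (use s in \<open>auto simp: base_st_def lvs_def\<close>)
  have A3: "alst m t" by (rule alst_fr[OF _ 3(1)]) (use s in \<open>auto simp: alst_def\<close>)
  let ?bb = "\<exists>u\<in>Y - A m. ad v u"
  show ?case
  proof (simp, rule ok_mono[OF FORNB_HASB_ok[of _ m v]], goal_cases)
    case (6 t')
    have B6: "base_st t'" by (rule base_st_fr[OF _ 6(1)]) (use B3 in \<open>auto simp: base_st_def lvs_def\<close>)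
    have A6: "alst m t'" by (rule alst_fr[OF _ 6(1)]) (use A3 in \<open>auto simp: alst_def\<close>)
    have e6: "iv t' vc = clu v" "iv t' vok = iv s vok" "iv t' vtc = iv s vtc" "ia t' aTX = ia s aTX"
       "ia t' acomp = ia s acomp" "rv t' rtot = rv s rtot" "iv t' vv = int v"
      using frs[OF 6(1)] frs[OF 3(1)] 3(2) s by auto
    show ?case
      unfolding ok_Seq
    proof (rule ok_mono[OF STATUS_ok[of _ m v "\<forall>w<v. okv m w"]], goal_cases)
      case (7 t'')
      have B7: "base_st t''" by (rule base_st_fr[OF B6 7(1)]) auto
      have A7: "alst m t''" by (rule alst_fr[OF A6 7(1)]) auto
      have e7: "iv t'' vc = clu v" "iv t'' vtc = iv s vtc" "ia t'' aTX = ia s aTX"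
       "ia t'' acomp = ia s acomp" "rv t'' rtot = rv s rtot" "iv t'' vv = int v"
        using frs[OF 7(1)] e6 by auto
      have T: "tm t'' \<le> tm s + 120 + CL len + deg v * (60 + CL len)" using 7(2) 6(2) 3(2) by simp
      obtain cp where cp: "cpst cp s" "cgood m cp" "\<forall>w<v. w \<in> H m \<longrightarrow> agree m cp w"
        using s(3) by (auto simp: scan_def)
      have cp7: "cpst cp t''" using cp(1) e7 by (simp add: cpst_def)
      show ?case
      proof (cases "v \<in> H m")
        case False
        have "okv m v \<longleftrightarrow> (v \<in> Y - A m \<longrightarrow> (\<forall>u\<in>Y - A m. \<not> ad v u))" using False by (auto simp: okv_def)
        then have "iv t'' vok = of_bool (\<forall>w<Suc v. okv m w)" using 7(2) by (simp add: All_less_Suc conj_commute)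
        moreover have "XL m (Suc v) = XL m v" using False by (simp add: XL_Suc)
        moreover have "\<forall>w<Suc v. w \<in> H m \<longrightarrow> agree m cp w" using cp(3) False by (simp add: All_less_Suc)
        ultimately have "scan m (Suc v) t''" using cp7 cp(2) s(3) e7 unfolding scan_def by auto
        moreover have "iv t'' vst = 0" using 7(2) False by simp
        ultimately show ?thesis using T by (simp add: algebra_simps scan_def cpst_def)
      next
        case True
        define u where "u = t''\<lparr>tm := tm t'' + 5\<rparr>"
        have "ok VERT2 (t''\<lparr>tm := tm t'' + w\<rparr>) (\<lambda>t. scan m (Suc v) t \<and> tm t \<le> tm s + (300 + CL len + deg v * (300 + 30 * ny + 2 * CL len)))"
          if w: "w \<le> 20" for w
        proof (rule ok_mono[OF VERT2_ok[of _ m cp v "(\<forall>w<v. okv m w) \<and> (v \<in> Y - A m \<longrightarrow> (\<forall>u\<in>Y - A m. \<not> ad v u))" "XL m v"]], goal_cases)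
          case (14 r)
          obtain cp' where cp': "cpst cp' r" "cgood m cp'" "coarser cp cp'" "agree m cp' v" using 14(2) by blast
          have "\<forall>w<Suc v. w \<in> H m \<longrightarrow> agree m cp' w"
            using cp(3) cp'(4) coarser_agree[OF cp'(3)] unfolding All_less_Suc by blast
          moreover have "iv r vok = of_bool (\<forall>w<Suc v. okv m w)"
            using 14(2) unfolding okv_def[of m v, symmetric] All_less_Suc by (simp add: okv_def[of m v] conj_ac)
          moreover have "(if v \<in> R then XL m v else XL m v @ [v]) = XL m (Suc v)"
            using H_notR[OF True] by (simp add: XL_Suc)
          ultimately have "scan m (Suc v) r" using 14(2) cp' unfolding scan_def Let_def by auto
          then show ?case using 14(2) T w by (simp add: algebra_simps Let_def)
        qed (use B7 A7 cp7 cp(2) e7 s True 7(2) XL_le[of m v] in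
            \<open>auto simp: base_st_def lvs_def alst_def cpst_def scan_def\<close>)
        moreover have "iv t'' vst = 1" using conjunct1[OF 7(2)] True by (simp only: of_bool_eq)
        ultimately show ?thesis by simp
      qed
    qed (use B6 A6 e6 s 6(2) in \<open>auto simp: base_st_def lvs_def alst_def scan_def\<close>)
  qed (use B3 A3 frs[OF 3(1)] s in \<open>auto simp: base_st_def lvs_def alst_def\<close>)
qed

definition scanT :: nat where
  "scanT = 20 + (\<Sum>v<n. (300 + CL len + deg v * (300 + 30 * ny + 2 * CL len)) + 4)"

lemma SCAN_ok:
  assumes s: "base_st s" "alst m s" "scan m 0 s"
  shows "ok (For vv (V vn) VERT) s (\<lambda>t. scan m n t \<and> tm t \<le> tm s + scanT)"
proof (rule ok_For[where n = n and T = "\<lambda>v. 300 + CL len + deg v * (300 + 30 * ny + 2 * CL len)" and J = "scan m"], goal_cases)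
  case (7 v t)
  have "base_st t" by (rule base_st_fr[OF s(1) 7(2)]) auto
  moreover have "alst m t" by (rule alst_fr[OF s(2) 7(2)]) auto
  ultimately show ?case using 7 by (intro VERT_ok)
next
  case (8 t)
  then show ?case by (simp add: scanT_def)
qed (use s in \<open>auto simp: scan_def cpst_def base_st_def lvs_def\<close>)

lemma feas_okv: "feas (A m) \<longleftrightarrow> (\<forall>v<n. okv m v)"
proof -
  have "Y \<subseteq> {..<n}" using cov by (auto simp: cover_def)
  then show ?thesis using forced_lt[of "A m"] unfolding feas_def okv_def by blast
qed

definition rp :: "nat \<Rightarrow> (nat \<Rightarrow> nat) \<Rightarrow> nat \<Rightarrow> bool" where
  "rp m cp i \<longleftrightarrow> AL m i \<and> cp i = i"

text \<open>The rank of a representative among all representatives, which turns labels with gaps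
  into consecutive component numbers.\<close>

definition nu :: "nat \<Rightarrow> (nat \<Rightarrow> nat) \<Rightarrow> nat \<Rightarrow> nat" where
  "nu m cp i = card {j. j < i \<and> rp m cp j}"

lemma nu_0: "nu m cp 0 = 0" by (simp add: nu_def)

lemma nu_Suc: "nu m cp (Suc i) = (if rp m cp i then Suc (nu m cp i) else nu m cp i)"
proof -
  have "{j. j < Suc i \<and> rp m cp j} = (if rp m cp i then insert i {j. j < i \<and> rp m cp j} else {j. j < i \<and> rp m cp j})"
    by (auto simp: less_Suc_eq)
  then show ?thesis by (simp add: nu_def)
qed

lemma nu_le: "nu m cp i \<le> i"
  by (induction i) (auto simp: nu_0 nu_Suc)

lemma nu_img: "nu m cp ` {j. j < i \<and> rp m cp j} = {..<nu m cp i}"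
proof (induction i)
  case (Suc i)
  have "{j. j < Suc i \<and> rp m cp j} = (if rp m cp i then insert i {j. j < i \<and> rp m cp j} else {j. j < i \<and> rp m cp j})"
    by (auto simp: less_Suc_eq)
  then show ?case using Suc by (auto simp: nu_Suc lessThan_Suc)
qed (simp add: nu_0)

lemma nu_inj: "inj_on (nu m cp) {j. j < i \<and> rp m cp j}"
  by (rule eq_card_imp_inj_on) (auto simp: nu_img, simp add: nu_def)

text \<open>With \<open>i \<le> ny + 1 \<le> k + 2\<close> a table of \<open>2 ^ i\<close> rows with
  \<open>k + 1\<close> columns fits into an array, and so does the last power of two computed by the
  numbering.\<close>

lemma pow_bounds: "i \<le> ny + 1 \<Longrightarrow> 2 ^ i * (k + 1) + k + 2 \<le> L" "i \<le> ny + 1 \<Longrightarrow> (2::nat) ^ i * 2 \<le> L"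
proof -
  assume i: "i \<le> ny + 1"
  have e: "(2::nat) ^ i \<le> 2 ^ (k + 2)" using i ny_L(3) by (intro power_increasing) auto
  have "1 * (k + 2) \<le> 2 ^ (k + 2) * (k + 2)" by (rule mult_le_mono1) simp
  then have "2 ^ i * (k + 1) + (k + 2) \<le> (2::nat) ^ (k + 2) * (k + 1) + 2 ^ (k + 2) * (k + 2)"
    using mult_le_mono1[OF e, of "k + 1"] by (intro add_mono) simp_all
  also have "\<dots> \<le> 2 ^ (k + 3) * (k + 2)" by (simp add: power_add algebra_simps)
  finally show "2 ^ i * (k + 1) + k + 2 \<le> L" using bigL by linarith
  have "(2::nat) ^ i * 2 \<le> 2 ^ (k + 2) * 2" using e by simp
  also have "\<dots> \<le> 2 ^ (k + 3) * (k + 2)" by (simp add: power_add)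
  finally show "2 ^ i * 2 \<le> L" using bigL by linarith
qed

lemma NUM1_ok:
  assumes s: "base_st s" "alst m s" "cpst cp s" "cgood m cp"
  shows "ok NUM1 s (\<lambda>t. iv t vp = 2 ^ nu m cp (Suc ny) \<and> (\<forall>i\<le>ny. rp m cp i \<longrightarrow> ia t abit i = 2 ^ nu m cp i) \<and>
     tm t \<le> tm s + 100 + 60 * ny)"
proof -
  have v: "iv s 7 = int ny" using s by (auto simp: base_st_def)
  show ?thesis unfolding NUM1_def
  proof (simp, rule ok_For[where n = "ny + 1" and T = "\<lambda>_. 40" and
      J = "\<lambda>i t. iv t vp = 2 ^ nu m cp i \<and> (\<forall>j<i. rp m cp j \<longrightarrow> ia t abit j = 2 ^ nu m cp j)"], goal_cases)
    case (7 i t)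
    have a: "ia t 1 i = (if AL m i then 1 else 0)" "ia t 2 i = int (cp i)"
      using frs[OF 7(2)] s 7(1) by (auto simp: alst_def cpst_def)
    have "nu m cp i \<le> ny + 1" using nu_le[of m cp i] 7(1) by simp
    then have p: "int (2 ^ nu m cp i * 2) \<le> int L" using pow_bounds(2) by (simp only: of_nat_le_iff)
    then have p: "(2::int) ^ nu m cp i * 2 \<le> int L" by simp
    have z: "(2::int) ^ nu m cp i \<ge> 0" by simp
    show ?case using 7 a p z ny_L(1) L_B by (auto simp: nu_Suc rp_def less_Suc_eq)
  next
    case (8 t)
    then show ?case by (auto simp: less_Suc_eq_le)
  qed (use s v ny_L in \<open>auto simp: nu_0\<close>)
qed

lemma NUM2_ok:
  assumes s: "base_st s" "alst m s" "cpst cp s" "cgood m cp"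
    and b: "\<forall>i\<le>ny. rp m cp i \<longrightarrow> ia s abit i = 2 ^ nu m cp i"
  shows "ok NUM2 s (\<lambda>t. (\<forall>i\<le>ny. ia t acb i = (if AL m i then 2 ^ nu m cp (cp i) else 0)) \<and> tm t \<le> tm s + 100 + 60 * ny)"
proof -
  have v: "iv s 7 = int ny" using s by (auto simp: base_st_def)
  show ?thesis unfolding NUM2_def
  proof (rule ok_For[where n = "ny + 1" and T = "\<lambda>_. 40" and
      J = "\<lambda>i t. \<forall>j<i. ia t acb j = (if AL m j then 2 ^ nu m cp (cp j) else 0)"], goal_cases)
    case (7 i t)
    have g: "cp i \<le> ny" "AL m i \<Longrightarrow> rp m cp (cp i)" using s(4) 7(1) by (auto simp: cgood_def rp_def)
    have a: "ia t 1 i = (if AL m i then 1 else 0)" "ia t 2 i = int (cp i)"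
      using frs[OF 7(2)] s 7(1) by (auto simp: alst_def cpst_def)
    have "AL m i \<Longrightarrow> ia t 3 (cp i) = 2 ^ nu m cp (cp i)" using frs[OF 7(2)] g b by simp
    then show ?case using 7 a ny_L(1) g(1) by (auto simp: less_Suc_eq)
  next
    case (8 t)
    then show ?case by (auto simp: less_Suc_eq_le)
  qed (use s v ny_L in auto)
qed

text \<open>Soundness of the component numbers is part of \<open>cgood\<close>; the two completeness
  conditions come from agreement at every vertex of \<open>R \<union> A m\<close> and at every
  forced vertex. Ranks are injective on representatives, so passing to them loses nothing.\<close>

lemma split_compsI:
  assumes g: "cgood m cp" and f: "feas (A m)" and ag: "\<forall>v<n. v \<in> H m \<longrightarrow> agree m cp v"
  shows "split_comps n ad R Y (A m) (\<lambda>u. nu m cp (cp (c u))) (nu m cp (Suc ny))"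
proof unfold_locales
  have HA: "R \<union> A m \<subseteq> {..<n}" using A_Y cov by (auto simp: cover_def)
  have rpc: "rp m cp (cp (c u)) \<and> cp (c u) < Suc ny" if "u \<in> R \<union> A m" for u
    using g AL_c[of u m] c_le[of u] that A_Y[of m] unfolding cgood_def rp_def by auto
  show "A m \<subseteq> Y" by (rule A_Y)
  show "feas (A m)" by (rule f)
  show "(\<lambda>u. nu m cp (cp (c u))) ` (R \<union> A m) = {..<nu m cp (Suc ny)}"
  proof -
    have "(\<lambda>u. cp (c u)) ` (R \<union> A m) = {j. j < Suc ny \<and> rp m cp j}"
    proof (intro equalityI subsetI)
      fix j assume "j \<in> {j. j < Suc ny \<and> rp m cp j}"
      then have j: "j \<le> ny" "AL m j" "cp j = j" by (auto simp: rp_def)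
      then obtain u where "u \<in> R \<union> A m" "c u = j" using AL_ex by blast
      then show "j \<in> (\<lambda>u. cp (c u)) ` (R \<union> A m)" using j by (auto intro!: image_eqI[of _ _ u])
    qed (use rpc in auto)
    then show ?thesis using nu_img[of m cp "Suc ny"] by (metis image_image)
  qed
  show "(u, w) \<in> (edges (R \<union> A m \<union> forced (A m)))\<^sup>*" if "u \<in> R \<union> A m" "w \<in> R \<union> A m"
    "nu m cp (cp (c u)) = nu m cp (cp (c w))" for u w
  proof -
    have "cp (c u) = cp (c w)" using nu_inj[of m cp "Suc ny"] rpc that by (auto dest: inj_onD)
    then show ?thesis using g that unfolding cgood_def by blast
  qed
  have agv: "agree m cp v" if "v \<in> H m" for v using ag HA forced_lt[of "A m"] that by blast
  show "nu m cp (cp (c u)) = nu m cp (cp (c w))" if "u \<in> R \<union> A m" "w \<in> R \<union> A m" "ad u w" for u w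
  proof -
    have "agree m cp u" using agv that by blast
    then have "cp (c u) = cp (c w)" using that unfolding agree_def by blast
    then show ?thesis by simp
  qed
  show "nu m cp (cp (c u)) = nu m cp (cp (c w))"
    if "v \<in> forced (A m)" "u \<in> R \<union> A m" "w \<in> R \<union> A m" "ad v u" "ad v w" for v u w
  proof -
    have "agree m cp v" using agv that by blast
    then have "cp (c u) = cp (c w)" using that unfolding agree_def by blast
    then show ?thesis by simp
  qed
qed

end

section \<open>The dynamic program over component sets\<close>

definition Parity :: "iexp \<Rightarrow> iexp" where "Parity e = e \<ominus> (e \<oslash> N 2) \<otimes> N 2"

lemma esize_Parity [simp]: "esize (Parity e) = 2 * esize e + 5"
  and wfe_Parity [simp]: "wfe a d (Parity e) = (wfe a d e \<and> wfe a (Suc d) e \<and> d < 7)"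
  by (auto simp: Parity_def)

lemma (in machine) eval_Parity [simp]: "eval (Parity e) s = eval e s mod 2"
  by (simp add: Parity_def minus_div_mult_eq_mod)

lemma (in machine) esafe_Parity [simp]:
  assumes "0 \<le> eval e s" "eval e s \<le> B" shows "esafe (Parity e) s = esafe e s"
proof -
  have "\<bar>y\<bar> \<le> B \<and> \<bar>y div 2\<bar> \<le> B \<and> \<bar>y div 2 * 2\<bar> \<le> B \<and> \<bar>y - y div 2 * 2\<bar> \<le> B" if "0 \<le> y" "y \<le> B" for y :: int
    using that by presburger
  from this[OF assms] show ?thesis by (auto simp: Parity_def)
qed

text \<open>Testing a bit is division by its power of two followed by a parity check. For a class
  without component the divisor is 0; since division by zero yields 0, the parity is even and
  nothing is touched. Only the extension of \<open>vE\<close> needs an explicit guard.\<close>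

definition TOUCH :: com where
  "TOUCH = Unless (Less (V vd) (N 0)) (Asg vg (Arr acb (V vd)) ;;
     When (Eq (Parity (V vD \<oslash> V vg)) (N 1)) (Asg vtch (N 1)) ;;
     When (Less (N 0) (V vg)) (When (Eq (Parity (V vE \<oslash> V vg)) (N 0)) (Asg vE (V vE \<oplus> V vg))))"

text \<open>A negative predecessor marks an empty entry. The weight cell of an empty entry may hold
  anything and is never compared, which is why the decision to overwrite goes through the flag
  \<open>vupd\<close>.\<close>

definition RELAX1 :: com where
  "RELAX1 = Asg vx (V vD \<otimes> (V vk \<oplus> N 1) \<oplus> V vcc) ;;
     Unless (Less (Arr apv (V vx)) (N 0)) (
       RGet rnew (V vx) ;; RAdd rnew rnew rwt ;;
       Asg vy (V vE \<otimes> (V vk \<oplus> N 1) \<oplus> V vcc \<oplus> N 1) ;; Asg vupd (N 0) ;;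
       Cond (Less (Arr apv (V vy)) (N 0)) (Asg vupd (N 1))
         (RGet rtmp (V vy) ;; When (RLess rnew rtmp) (Asg vupd (N 1))) ;;
       When (Eq (V vupd) (N 1)) (RPut (V vy) rnew ;; Put apv (V vy) (V vv) ;; Put apd (V vy) (V vD)))"

text \<open>The two conditions of a transition are tested numerically: \<open>vtch\<close> records
  that some component of \<open>D\<close> is adjacent, and \<open>vD < vE\<close> that a new one is,
  as \<open>vE\<close> arises from \<open>vD\<close> by adding bits.\<close>

definition EXPAND :: com where
  "EXPAND = Asg vu (V vv) ;; LOOK ;; When (Less (V vd) (N 0))
     (Asg vtch (N 0) ;; Asg vE (V vD) ;; FORNB TOUCH ;;
      When (Eq (V vtch) (N 1)) (When (Less (V vD) (V vE)) (RInp rwt (V vv) ;; For vcc (V vKB) RELAX1)))"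

text \<open>The starting entry is the set that contains component 0 only, coded by 1, with no
  vertices used; in rows of length \<open>k + 1\<close> its index is \<open>k + 1\<close>.\<close>

definition DPINIT :: com where
  "DPINIT = For vD (V vp) (For vcc (V vKB \<oplus> N 1) (Put apv (V vD \<otimes> (V vk \<oplus> N 1) \<oplus> V vcc) (N (-1)))) ;;
     Put apv (V vk \<oplus> N 1) (N 0) ;; RZero rtmp ;; RPut (V vk \<oplus> N 1) rtmp"

text \<open>Transitions lead to numerically larger sets, so each row is final by the time it is
  expanded.\<close>

definition DPMAIN :: com where
  "DPMAIN = For vD (V vp) (For vv (V vn) EXPAND)"

lemma w_TOUCH [simp]: "wv TOUCH = {34, 35, 36}" "wa TOUCH = {}" "wr TOUCH = {}" "wra TOUCH = False"
  by (auto simp: TOUCH_def)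
lemma w_RELAX1 [simp]: "wv RELAX1 = {25, 26, 49}" "wa RELAX1 = {7, 8}" "wr RELAX1 = {2, 4}" "wra RELAX1 = True"
  by (auto simp: RELAX1_def)
lemma w_EXPAND [simp]: "wv EXPAND = {13, 14, 15, 18, 19, 20, 25, 26, 34, 35, 36, 37, 38, 49}" "wa EXPAND = {7, 8}"
  "wr EXPAND = {1, 2, 4}" "wra EXPAND = True"
  by (auto simp: EXPAND_def)
lemma w_DPINIT [simp]: "wv DPINIT = {32, 33, 37, 38}" "wa DPINIT = {7}" "wr DPINIT = {4}" "wra DPINIT = True"
  by (auto simp: DPINIT_def)
lemma w_DPMAIN [simp]: "wv DPMAIN = {13, 14, 15, 16, 17, 18, 19, 20, 25, 26, 32, 33, 34, 35, 36, 37, 38, 49}" "wa DPMAIN = {7, 8}"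
  "wr DPMAIN = {1, 2, 4}" "wra DPMAIN = True"
  by (auto simp: DPMAIN_def)

definition bits :: "nat \<Rightarrow> nat set" where "bits D = {q. bit D q}"

lemma bits_eq: "bits D = bits E \<longleftrightarrow> D = E"
  by (auto simp: bits_def bit_eq_iff set_eq_iff)

lemma bits_lt: "D < 2 ^ r \<longleftrightarrow> bits D \<subseteq> {..<r}"
proof -
  have "D < 2 ^ r \<longleftrightarrow> take_bit r D = D" by (simp add: take_bit_nat_eq_self_iff)
  also have "\<dots> \<longleftrightarrow> bits D \<subseteq> {..<r}" by (auto simp: bits_def bit_eq_iff bit_take_bit_iff)
  finally show ?thesis .
qed

lemma bits_1: "bits 1 = {0}"
  unfolding bits_def bit_1_iff by simp

text \<open>Adding an absent power of two causes no carry and therefore acts as a bitwise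
  or.\<close>

lemma bits_add: "q \<notin> bits E \<Longrightarrow> bits (E + 2 ^ q) = insert q (bits E)"
proof -
  assume "q \<notin> bits E"
  then have "E + 2 ^ q = or E (2 ^ q)"
    by (intro disjunctive_add) (auto simp: bits_def bit_exp_iff)
  then show ?thesis by (auto simp: bits_def bit_or_iff bit_exp_iff)
qed

lemma bits_ex: "finite F \<Longrightarrow> \<exists>E. bits E = F"
proof (induction F rule: finite_induct)
  case empty
  show ?case by (rule exI[of _ 0]) (simp add: bits_def)
next
  case (insert q F)
  then show ?case using bits_add by metis
qed

lemma odd_div: "int D div 2 ^ q mod 2 = of_bool (q \<in> bits D)"
proof -
  have "int D div 2 ^ q = int (D div 2 ^ q)" by (simp add: zdiv_int)
  then have "int D div 2 ^ q mod 2 = int (D div 2 ^ q mod 2)" by (simp add: zmod_int)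
  also have "\<dots> = of_bool (q \<in> bits D)" by (auto simp: bits_def bit_iff_odd odd_iff_mod_2_eq_one)
  finally show ?thesis .
qed

locale dp = solve +
  fixes m :: nat and \<kappa> :: "nat \<Rightarrow> nat" and cc :: nat
  assumes sc: "split_comps n ad R Y (A m) \<kappa> cc" and cc_ny: "cc \<le> ny + 1"
begin

sublocale sc: split_comps n ad R Y "A m" \<kappa> cc by (rule sc)

abbreviation p :: nat where "p \<equiv> 2 ^ cc"

definition dpst :: "state \<Rightarrow> bool" where
  "dpst s \<longleftrightarrow> base_st s \<and> (\<forall>u\<in>R \<union> Y. ia s acb (c u) = (if u \<in> R \<union> A m then 2 ^ \<kappa> u else 0)) \<and> iv s vp = int p"

lemma dpst_fr: "dpst s \<Longrightarrow> fr q s t \<Longrightarrow> wv q \<inter> {1, 2, 5, 6, 7, 8, 31} = {} \<Longrightarrow> wa q \<inter> {0, 4} = {} \<Longrightarrow> dpst t"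
  unfolding dpst_def using base_st_fr[of s q t] by (auto simp: fr_def)

lemma p_L: "p * (k + 1) + k + 2 \<le> L" "p < L"
proof -
  show 1: "p * (k + 1) + k + 2 \<le> L" using pow_bounds(1)[OF cc_ny] .
  have "p * 1 \<le> p * (k + 1)" by (rule mult_le_mono2) simp
  then show "p < L" using 1 by linarith
qed

lemma p_ge: "2 \<le> p"
  using sc.cc_pos by (cases cc) auto

lemma \<kappa>_lt: "u \<in> R \<union> A m \<Longrightarrow> \<kappa> u < cc"
  using sc.img by blast

lemma TOUCH_ok:
  assumes s: "dpst s" "iv s vd = clu u" "u \<in> R \<union> Y"
    and D: "iv s vD = int D" "D < p" and E: "iv s vE = int E" "E < p" and b: "iv s vtch = of_bool b"
  shows "ok TOUCH s (\<lambda>t. iv t vtch = of_bool (b \<or> u \<in> R \<union> A m \<and> \<kappa> u \<in> bits D) \<and>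
    (\<exists>E'. iv t vE = int E' \<and> E' < p \<and> E \<le> E' \<and> bits E' = bits E \<union> (if u \<in> R \<union> A m then {\<kappa> u} else {})) \<and>
    tm t \<le> tm s + 100)"
proof -
  have d: "iv s vd = int (c u)" "c u < L" using s clu_c c_le[of u] ny_L by auto
  have DB: "int D \<le> B" "int E \<le> B" using D E p_L(2) L_B by linarith+
  show ?thesis
  proof (cases "u \<in> R \<union> A m")
    case False
    then have "ia s 4 (c u) = 0" using s by (auto simp: dpst_def)
    then show ?thesis using False d D E b unfolding TOUCH_def by auto
  next
    case True
    then have g: "ia s 4 (c u) = 2 ^ \<kappa> u" using s by (auto simp: dpst_def)
    have q: "0 \<le> int x div 2 ^ \<kappa> u" "int x div 2 ^ \<kappa> u \<le> B" if "int x \<le> B" for x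
    proof -
      have e: "int x div 2 ^ \<kappa> u = int (x div 2 ^ \<kappa> u)" by (simp add: zdiv_int)
      have "x div 2 ^ \<kappa> u \<le> x" by (rule div_le_dividend)
      then show "0 \<le> int x div 2 ^ \<kappa> u" "int x div 2 ^ \<kappa> u \<le> B" using that unfolding e by linarith+
    qed
    show ?thesis
    proof (cases "\<kappa> u \<in> bits E")
      case bE: True
      then have "insert (\<kappa> u) (bits E) = bits E" by auto
      then show ?thesis using True d D E b g q[OF DB(1)] q[OF DB(2)] odd_div[of D "\<kappa> u"] odd_div[of E "\<kappa> u"] bE
        unfolding TOUCH_def by (cases "\<kappa> u \<in> bits D") (auto intro!: exI[of _ E])
    next
      case bE: False
      have n: "bits (E + 2 ^ \<kappa> u) = insert (\<kappa> u) (bits E)" by (rule bits_add[OF bE])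
      then have lt: "E + 2 ^ \<kappa> u < p" using E(2) \<kappa>_lt[OF True] unfolding bits_lt by auto
      then have "int (E + 2 ^ \<kappa> u) \<le> B" using p_L(2) L_B by linarith
      then have sb: "int E + 2 ^ \<kappa> u \<le> B" by simp
      show ?thesis using True d D E b g q[OF DB(1)] q[OF DB(2)] odd_div[of D "\<kappa> u"] odd_div[of E "\<kappa> u"] bE n lt sb
        unfolding TOUCH_def by (cases "\<kappa> u \<in> bits D") (auto intro!: exI[of _ "E + 2 ^ \<kappa> u"])
    qed
  qed
qed

lemma FORNB_TOUCH_ok:
  assumes s: "dpst s" "iv s vv = int v" "v < n" "v \<notin> R \<union> Y"
    and D: "iv s vD = int D" "D < p" "iv s vE = int D" "iv s vtch = 0"
  shows "ok (FORNB TOUCH) s (\<lambda>t. iv t vtch = of_bool (sc.nbc v \<inter> bits D \<noteq> {}) \<and>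
    (\<exists>E. iv t vE = int E \<and> E < p \<and> D \<le> E \<and> bits E = bits D \<union> sc.nbc v) \<and> tm t \<le> tm s + 20 + deg v * (130 + CL len))"
proof -
  define J where "J i t \<longleftrightarrow> iv t vtch = of_bool (\<exists>i'<i. adj ! v ! i' \<in> R \<union> A m \<and> \<kappa> (adj ! v ! i') \<in> bits D) \<and>
    (\<exists>E. iv t vE = int E \<and> E < p \<and> D \<le> E \<and> bits E = bits D \<union> \<kappa> ` {u \<in> R \<union> A m. \<exists>i'<i. adj ! v ! i' = u})" for i and t :: state
  show ?thesis
  proof (rule ok_FORNB[where lv = lv and len = len and base = base and v = v and T = 100 and J = J], goal_cases)
    case 6
    then show ?case using D by (simp add: J_def)
  next
    case (7 i t t')
    then show ?case by (simp add: J_def)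
  next
    case (8 i t)
    let ?u = "adj ! v ! i"
    have u: "?u \<in> R \<union> Y" using ad_out[of v ?u] ad_nth[OF s(3)] s(4) 8(1) by blast
    obtain E where E: "iv t vE = int E" "E < p" "D \<le> E"
      "bits E = bits D \<union> \<kappa> ` {u \<in> R \<union> A m. \<exists>i'<i. adj ! v ! i' = u}" using 8(5) by (auto simp: J_def)
    have "dpst t" by (rule dpst_fr[OF s(1) 8(2)]) auto
    moreover have "iv t vD = int D" using frs[OF 8(2)] D by simp
    ultimately have "ok TOUCH t (\<lambda>t'. iv t' vtch = of_bool ((\<exists>i'<i. adj ! v ! i' \<in> R \<union> A m \<and> \<kappa> (adj ! v ! i') \<in> bits D) \<or> ?u \<in> R \<union> A m \<and> \<kappa> ?u \<in> bits D) \<and>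
    (\<exists>E'. iv t' vE = int E' \<and> E' < p \<and> E \<le> E' \<and> bits E' = bits E \<union> (if ?u \<in> R \<union> A m then {\<kappa> ?u} else {})) \<and>
    tm t' \<le> tm t + 100)"
      using 8(3,5) E u D(2) by (intro TOUCH_ok) (auto simp: J_def)
    then show ?case
    proof (rule ok_mono)
      fix t' :: state assume t': "iv t' vtch = of_bool ((\<exists>i'<i. adj ! v ! i' \<in> R \<union> A m \<and> \<kappa> (adj ! v ! i') \<in> bits D) \<or> ?u \<in> R \<union> A m \<and> \<kappa> ?u \<in> bits D) \<and>
    (\<exists>E'. iv t' vE = int E' \<and> E' < p \<and> E \<le> E' \<and> bits E' = bits E \<union> (if ?u \<in> R \<union> A m then {\<kappa> ?u} else {})) \<and>
    tm t' \<le> tm t + 100"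
      then obtain E' where E': "iv t' vE = int E'" "E' < p" "E \<le> E'" "bits E' = bits E \<union> (if ?u \<in> R \<union> A m then {\<kappa> ?u} else {})" by blast
      have "{u \<in> R \<union> A m. \<exists>i'<Suc i. adj ! v ! i' = u} = {u \<in> R \<union> A m. \<exists>i'<i. adj ! v ! i' = u} \<union> (if ?u \<in> R \<union> A m then {?u} else {})"
        by (auto simp: less_Suc_eq)
      then have "bits E' = bits D \<union> \<kappa> ` {u \<in> R \<union> A m. \<exists>i'<Suc i. adj ! v ! i' = u}" using E'(4) E(4) by auto
      moreover have "iv t' vtch = of_bool (\<exists>i'<Suc i. adj ! v ! i' \<in> R \<union> A m \<and> \<kappa> (adj ! v ! i') \<in> bits D)"
        using conjunct1[OF t'] unfolding Ex_less_Suc by (simp only: disj_commute)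
      ultimately show "J (Suc i) t' \<and> tm t' \<le> tm t + 100" using t' E' E(3) unfolding J_def by (meson le_trans)
    qed
  next
    case (9 t)
    have e: "{u \<in> R \<union> A m. \<exists>i'<deg v. adj ! v ! i' = u} = {u \<in> R \<union> A m. ad v u}" using ad_nth[OF s(3)] by auto
    have "(\<exists>i'<deg v. adj ! v ! i' \<in> R \<union> A m \<and> \<kappa> (adj ! v ! i') \<in> bits D) \<longleftrightarrow> sc.nbc v \<inter> bits D \<noteq> {}"
      unfolding sc.nbc_def e[symmetric] by blast
    then show ?case using 9(1,3) unfolding J_def e sc.nbc_def by (simp add: algebra_simps)
  qed (use s in \<open>auto simp: dpst_def base_st_def\<close>)
qed

text \<open>The growth step of \<open>reach\<close>, with component sets coded as numbers. Together
  with \<open>v\<close> the row \<open>D\<close> determines \<open>E\<close>.\<close>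

definition stp :: "nat \<Rightarrow> nat \<Rightarrow> nat \<Rightarrow> bool" where
  "stp D v E \<longleftrightarrow> v < n \<and> v \<notin> R \<union> Y \<and> sc.nbc v \<inter> bits D \<noteq> {} \<and> \<not> sc.nbc v \<subseteq> bits D \<and> bits E = bits D \<union> sc.nbc v"

text \<open>\<open>pv D c < 0\<close> means that no \<open>c\<close> vertices reach the component set \<open>D\<close>; \<open>P\<close> holds for the
  transitions that have been relaxed.\<close>

definition INV :: "(nat \<Rightarrow> nat \<Rightarrow> int) \<Rightarrow> (nat \<Rightarrow> nat \<Rightarrow> int) \<Rightarrow> (nat \<Rightarrow> nat \<Rightarrow> real) \<Rightarrow> nat \<Rightarrow> (nat \<Rightarrow> nat \<Rightarrow> nat \<Rightarrow> bool) \<Rightarrow> bool" where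
  "INV pv pd dw D0 P \<longleftrightarrow>
    (\<forall>D<p. \<forall>c\<le>KB. 0 \<le> pv D c \<longrightarrow> c = 0 \<and> D = 1 \<and> dw D c = 0 \<or>
       (\<exists>c' D' v. c = Suc c' \<and> pv D c = int v \<and> pd D c = int D' \<and> D' < D \<and> D' \<le> D0 \<and> stp D' v D \<and> 0 \<le> pv D' c' \<and>
          dw D c = dw D' c' + W ! v)) \<and>
    0 \<le> pv 1 0 \<and> dw 1 0 = 0 \<and>
    (\<forall>D v c E. D < p \<longrightarrow> c < KB \<longrightarrow> P D v c \<longrightarrow> stp D v E \<longrightarrow> 0 \<le> pv D c \<longrightarrow>
       0 \<le> pv E (Suc c) \<and> dw E (Suc c) \<le> dw D c + W ! v)"

definition tabs :: "state \<Rightarrow> (nat \<Rightarrow> nat \<Rightarrow> int) \<Rightarrow> (nat \<Rightarrow> nat \<Rightarrow> int) \<Rightarrow> (nat \<Rightarrow> nat \<Rightarrow> real) \<Rightarrow> bool" where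
  "tabs t pv pd dw \<longleftrightarrow> (\<forall>D<p. \<forall>c\<le>KB. ia t apv (D * (k + 1) + c) = pv D c \<and> ia t apd (D * (k + 1) + c) = pd D c \<and>
     ra t (D * (k + 1) + c) = dw D c)"

lemma idx_inj: "i \<le> KB \<Longrightarrow> j \<le> KB \<Longrightarrow> D * (k + 1) + i = E * (k + 1) + j \<longleftrightarrow> D = E \<and> i = j"
proof
  assume i: "i \<le> KB" "j \<le> KB" and e: "D * (k + 1) + i = E * (k + 1) + j"
  have "(D * (k + 1) + i) div (k + 1) = D + i div (k + 1)" "(E * (k + 1) + j) div (k + 1) = E + j div (k + 1)"
    by (rule div_mult_self3, simp)+
  then have "(D * (k + 1) + i) div (k + 1) = D" "(E * (k + 1) + j) div (k + 1) = E" using i KB_k by simp_all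
  then have "D = E" using e by simp
  then show "D = E \<and> i = j" using e by simp
qed simp

lemma idx_lt: "D < p \<Longrightarrow> i \<le> KB \<Longrightarrow> D * (k + 1) + i < L" "D < p \<Longrightarrow> D * (k + 1) \<le> L"
proof -
  assume D: "D < p"
  have "D * (k + 1) + (k + 1) = Suc D * (k + 1)" by simp
  also have "\<dots> \<le> p * (k + 1)" using D by (intro mult_le_mono1) simp
  finally have "D * (k + 1) + (k + 1) \<le> L" using p_L(1) by linarith
  then show "i \<le> KB \<Longrightarrow> D * (k + 1) + i < L" "D * (k + 1) \<le> L" using KB_k by linarith+
qed

text \<open>All relaxed transitions and all recorded predecessors start in rows up to
  \<open>D0\<close>, while the changed entry lies in the larger row \<open>E\<close>. So no relaxed
  transition or recorded predecessor starts from the changed entry, and an entry made nonempty or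
  lighter keeps the inequalities that point to it.\<close>

lemma INV_step:
  assumes I: "INV pv pd dw D0 P" and P: "\<And>D v c. P D v c \<Longrightarrow> D \<le> D0"
    and D0: "D0 < E" "E < p" "stp D0 v E" "i < KB" "0 \<le> pv D0 i"
    and upd: "pv E (Suc i) < 0 \<or> dw D0 i + W ! v < dw E (Suc i)"
  shows "INV (pv(E := (pv E)(Suc i := int v))) (pd(E := (pd E)(Suc i := int D0))) (dw(E := (dw E)(Suc i := dw D0 i + W ! v))) D0
    (\<lambda>D v' c. P D v' c \<or> D = D0 \<and> v' = v \<and> c = i)" (is "INV ?pv ?pd ?dw _ _")
  unfolding INV_def
proof (intro conjI allI impI)
  fix D j assume D: "D < p" "j \<le> KB" "0 \<le> ?pv D j"
  show "j = 0 \<and> D = 1 \<and> ?dw D j = 0 \<or> (\<exists>c' D' v. j = Suc c' \<and> ?pv D j = int v \<and> ?pd D j = int D' \<and> D' < D \<and> D' \<le> D0 \<and> stp D' v D \<and> 0 \<le> ?pv D' c' \<and>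
          ?dw D j = ?dw D' c' + W ! v)"
  proof (cases "D = E \<and> j = Suc i")
    case True
    then show ?thesis using D0 by (auto intro!: exI[of _ i] exI[of _ D0] exI[of _ v])
  next
    case False
    then have e: "?pv D j = pv D j" "?dw D j = dw D j" "?pd D j = pd D j" by auto
    have "j = 0 \<and> D = 1 \<and> dw D j = 0 \<or> (\<exists>c' D' v. j = Suc c' \<and> pv D j = int v \<and> pd D j = int D' \<and> D' < D \<and> D' \<le> D0 \<and> stp D' v D \<and> 0 \<le> pv D' c' \<and>
          dw D j = dw D' c' + W ! v)" using I D unfolding e INV_def by blast
    then show ?thesis
    proof
      assume "\<exists>c' D' v. j = Suc c' \<and> pv D j = int v \<and> pd D j = int D' \<and> D' < D \<and> D' \<le> D0 \<and> stp D' v D \<and> 0 \<le> pv D' c' \<and>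
          dw D j = dw D' c' + W ! v"
      then obtain c' D' v where h: "j = Suc c'" "pv D j = int v" "pd D j = int D'" "D' < D" "D' \<le> D0" "stp D' v D" "0 \<le> pv D' c'"
          "dw D j = dw D' c' + W ! v" by blast
      have "D' \<noteq> E" using h(5) D0(1) by simp
      then show ?thesis using h unfolding e by (intro disjI2 exI[of _ c'] exI[of _ D'] exI[of _ v]) simp
    next
      assume "j = 0 \<and> D = 1 \<and> dw D j = 0"
      then show ?thesis unfolding e by blast
    qed
  qed
next
  show "0 \<le> ?pv 1 0" "?dw 1 0 = 0" using I by (auto simp: INV_def)
next
  fix D v' j F assume h: "D < p" "j < KB" "P D v' j \<or> D = D0 \<and> v' = v \<and> j = i" "stp D v' F" "0 \<le> ?pv D j"
  have "D \<noteq> E" using h(3) P D0(1) by fastforce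
  then have e: "?pv D j = pv D j" "?dw D j = dw D j" by auto
  show "0 \<le> ?pv F (Suc j)"
  proof (cases "P D v' j")
    case True
    then show ?thesis using I h unfolding e INV_def by (cases "F = E \<and> j = i") auto
  next
    case False
    then have e': "D = D0" "v' = v" "j = i" using h(3) by blast+
    then have "bits F = bits E" using h(4) D0(3) by (simp add: stp_def)
    then have "F = E" by (simp only: bits_eq)
    then show ?thesis using e' by simp
  qed
  show "?dw F (Suc j) \<le> ?dw D j + W ! v'"
  proof (cases "P D v' j")
    case True
    then have "0 \<le> pv F (Suc j) \<and> dw F (Suc j) \<le> dw D j + W ! v'" using I h unfolding e INV_def by blast
    then show ?thesis using upd unfolding e by (cases "F = E \<and> j = i") auto
  next
    case False
    then have e': "D = D0" "v' = v" "j = i" using h(3) by blast+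
    then have "bits F = bits E" using h(4) D0(3) by (simp add: stp_def)
    then have "F = E" by (simp only: bits_eq)
    then show ?thesis using e' e by simp
  qed
qed

lemma INV_D:
  assumes "INV pv pd dw D0 P"
  shows "\<forall>D<p. \<forall>c\<le>KB. 0 \<le> pv D c \<longrightarrow> c = 0 \<and> D = 1 \<and> dw D c = 0 \<or>
       (\<exists>c' D' v. c = Suc c' \<and> pv D c = int v \<and> pd D c = int D' \<and> D' < D \<and> D' \<le> D0 \<and> stp D' v D \<and> 0 \<le> pv D' c' \<and>
          dw D c = dw D' c' + W ! v)"
    and "0 \<le> pv 1 0" "dw 1 0 = 0"
    and "\<lbrakk>D < p; j < KB; P D v j; stp D v E; 0 \<le> pv D j\<rbrakk> \<Longrightarrow> 0 \<le> pv E (Suc j) \<and> dw E (Suc j) \<le> dw D j + W ! v"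
proof -
  note h = assms[unfolded INV_def]
  show "\<forall>D<p. \<forall>c\<le>KB. 0 \<le> pv D c \<longrightarrow> c = 0 \<and> D = 1 \<and> dw D c = 0 \<or>
       (\<exists>c' D' v. c = Suc c' \<and> pv D c = int v \<and> pd D c = int D' \<and> D' < D \<and> D' \<le> D0 \<and> stp D' v D \<and> 0 \<le> pv D' c' \<and>
          dw D c = dw D' c' + W ! v)" by (rule conjunct1[OF h])
  show "0 \<le> pv 1 0" "dw 1 0 = 0" using conjunct2[OF h] by blast+
  show "\<lbrakk>D < p; j < KB; P D v j; stp D v E; 0 \<le> pv D j\<rbrakk> \<Longrightarrow> 0 \<le> pv E (Suc j) \<and> dw E (Suc j) \<le> dw D j + W ! v"
    using conjunct2[OF conjunct2[OF conjunct2[OF h]]] by blast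
qed

text \<open>A transition whose source is empty, or whose target is already light enough, counts as
  relaxed without any change to the tables.\<close>

lemma INV_keep:
  assumes I: "INV pv pd dw D0 P"
    and D0: "\<And>E'. stp D0 v E' \<Longrightarrow> 0 \<le> pv D0 i \<Longrightarrow> 0 \<le> pv E' (Suc i) \<and> dw E' (Suc i) \<le> dw D0 i + W ! v"
  shows "INV pv pd dw D0 (\<lambda>D v' c. P D v' c \<or> D = D0 \<and> v' = v \<and> c = i)"
proof -
  have *: "0 \<le> pv E (Suc j) \<and> dw E (Suc j) \<le> dw D j + W ! v'"
    if "D < p" "j < KB" "P D v' j \<or> D = D0 \<and> v' = v \<and> j = i" "stp D v' E" "0 \<le> pv D j" for D v' j E
    using that(3)
  proof
    assume "P D v' j"
    then show ?thesis using INV_D(4)[OF I] that by blast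
  next
    assume "D = D0 \<and> v' = v \<and> j = i"
    then show ?thesis using D0 that by blast
  qed
  show ?thesis unfolding INV_def
    by (rule conjI[OF INV_D(1)[OF I] conjI[OF INV_D(2)[OF I] conjI[OF INV_D(3)[OF I]]]]) (use * in blast)
qed

lemma INV_weaken:
  assumes I: "INV pv pd dw D0 P" and le: "D0 \<le> D1"
    and PQ: "\<And>D v c E. D < p \<Longrightarrow> c < KB \<Longrightarrow> Q D v c \<Longrightarrow> stp D v E \<Longrightarrow> P D v c"
  shows "INV pv pd dw D1 Q"
proof -
  have L: "\<forall>D<p. \<forall>c\<le>KB. 0 \<le> pv D c \<longrightarrow> c = 0 \<and> D = 1 \<and> dw D c = 0 \<or>
       (\<exists>c' D' v. c = Suc c' \<and> pv D c = int v \<and> pd D c = int D' \<and> D' < D \<and> D' \<le> D1 \<and> stp D' v D \<and> 0 \<le> pv D' c' \<and>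
          dw D c = dw D' c' + W ! v)"
    using INV_D(1)[OF I] le by (meson le_trans)
  have *: "0 \<le> pv E (Suc j) \<and> dw E (Suc j) \<le> dw D j + W ! v"
    if "D < p" "j < KB" "Q D v j" "stp D v E" "0 \<le> pv D j" for D v j E
    using INV_D(4)[OF I] PQ that by blast
  show ?thesis unfolding INV_def
    by (rule conjI[OF L conjI[OF INV_D(2)[OF I] conjI[OF INV_D(3)[OF I]]]]) (use * in blast)
qed

fun tr :: "(nat \<Rightarrow> nat \<Rightarrow> int) \<Rightarrow> (nat \<Rightarrow> nat \<Rightarrow> int) \<Rightarrow> nat \<Rightarrow> nat \<Rightarrow> nat list" where
  "tr pv pd D 0 = []"
| "tr pv pd D (Suc j) = nat (pv D (Suc j)) # tr pv pd (nat (pd D (Suc j))) j"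

text \<open>Nonempty entries stand for real derivations: following the predecessors loses one vertex
  per step and ends in the starting entry, because entry count 0 is possible only for the set coded
  by 1.\<close>

lemma tr_reach:
  assumes I: "INV pv pd dw D0 P"
  shows "D < p \<Longrightarrow> j \<le> KB \<Longrightarrow> 0 \<le> pv D j \<Longrightarrow>
    sc.reach (bits D) (tr pv pd D j) \<and> length (tr pv pd D j) = j \<and> (\<Sum>v\<leftarrow>tr pv pd D j. W ! v) = dw D j"
proof (induction j arbitrary: D)
  case 0
  then have D: "D = Suc 0" "dw D 0 = 0" using I unfolding INV_def by fastforce+
  have "bits D = {0}" using bits_1 D(1) by simp
  then show ?case using sc.reach0 D(2) by simp
next
  case (Suc j)
  have "Suc j = 0 \<and> D = 1 \<and> dw D (Suc j) = 0 \<or> (\<exists>c' D' v. Suc j = Suc c' \<and> pv D (Suc j) = int v \<and> pd D (Suc j) = int D' \<and> D' < D \<and> D' \<le> D0 \<and> stp D' v D \<and> 0 \<le> pv D' c' \<and>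
          dw D (Suc j) = dw D' c' + W ! v)" using I Suc.prems unfolding INV_def by blast
  then obtain D' v where h: "pv D (Suc j) = int v" "pd D (Suc j) = int D'" "D' < D" "stp D' v D" "0 \<le> pv D' j"
     "dw D (Suc j) = dw D' j + W ! v" by auto
  have IH: "sc.reach (bits D') (tr pv pd D' j)" "length (tr pv pd D' j) = j" "(\<Sum>v\<leftarrow>tr pv pd D' j. W ! v) = dw D' j"
    using Suc.IH[of D'] h Suc.prems by auto
  have "sc.reach (bits D' \<union> sc.nbc v) (v # tr pv pd D' j)"
    using h(4) by (intro sc.reachS[OF IH(1)]) (auto simp: stp_def)
  then show ?case using h IH by (simp add: stp_def)
qed

text \<open>The converse, once all transitions have been relaxed: by induction along a derivation,
  each step is dominated by a table entry for the same set and number of vertices.\<close>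

lemma reach_tab:
  assumes I: "INV pv pd dw D0 (\<lambda>D v c. v < n)"
  shows "sc.reach S T \<Longrightarrow> length T \<le> KB \<Longrightarrow> \<exists>D<p. bits D = S \<and> 0 \<le> pv D (length T) \<and> dw D (length T) \<le> (\<Sum>v\<leftarrow>T. W ! v)"
proof (induction rule: sc.reach.induct)
  case reach0
  then show ?case using I bits_1 p_ge unfolding INV_def by (intro exI[of _ 1]) auto
next
  case (reachS S T v)
  then obtain D where D: "D < p" "bits D = S" "0 \<le> pv D (length T)" "dw D (length T) \<le> (\<Sum>v\<leftarrow>T. W ! v)" by auto
  have sub: "S \<union> sc.nbc v \<subseteq> {..<cc}" using sc.reach_lt[OF reachS.hyps(1)] sc.nbc_lt by blast
  obtain E where E: "bits E = S \<union> sc.nbc v" using bits_ex[OF finite_subset[OF sub]] by auto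
  then have "E < p" using sub bits_lt by simp
  have "stp D v E" using reachS.hyps D E by (simp add: stp_def)
  then have "0 \<le> pv E (Suc (length T)) \<and> dw E (Suc (length T)) \<le> dw D (length T) + W ! v"
    using I D reachS.hyps reachS.prems unfolding INV_def by simp
  then show ?case using E \<open>E < p\<close> D(4) by (intro exI[of _ E]) auto
qed

text \<open>Progress of the three nested loops in lexicographic order of row, vertex and number of
  vertices used.\<close>

definition Pm :: "nat \<Rightarrow> nat \<Rightarrow> nat \<Rightarrow> nat \<Rightarrow> nat \<Rightarrow> nat \<Rightarrow> bool" where
  "Pm D0 v i = (\<lambda>D v' j. D < D0 \<or> D = D0 \<and> (v' < v \<or> v' = v \<and> j < i))"

lemma Pm_Suc: "Pm D0 v (Suc i) = (\<lambda>D v' j. Pm D0 v i D v' j \<or> D = D0 \<and> v' = v \<and> j = i)"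
  by (auto simp: Pm_def fun_eq_iff less_Suc_eq)

lemma RELAX1_ok:
  assumes s: "dpst s" "iv s vD = int D" "iv s vE = int E" "iv s vv = int v" "iv s vcc = int i" "rv s rwt = W ! v"
    and D: "E < p" "D < E" "stp D v E" "i < KB"
    and t: "tabs s pv pd dw" "INV pv pd dw D (Pm D v i)"
  shows "ok RELAX1 s (\<lambda>t. (\<exists>pv pd dw. tabs t pv pd dw \<and> INV pv pd dw D (Pm D v (Suc i))) \<and> tm t \<le> tm s + 140)"
proof -
  define x where "x = D * (k + 1) + i"
  define y where "y = E * (k + 1) + Suc i"
  have x: "int D * (int k + 1) + int i = int x" and y: "int E * (int k + 1) + int i + 1 = int y"
    and y': "int E * (int k + 1) + int i = int y - 1"
    by (simp_all add: x_def y_def algebra_simps)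
  have lt: "x < L" "y < L" using idx_lt(1)[of D i] idx_lt(1)[of E "Suc i"] D by (auto simp: x_def y_def)
  have m: "int D * (int k + 1) \<le> int L" "int E * (int k + 1) \<le> int L"
    using idx_lt(2)[of D] idx_lt(2)[of E] D by (simp_all flip: of_nat_Suc of_nat_mult add: algebra_simps of_nat_le_iff[symmetric])
  have m0: "0 \<le> int D * (int k + 1)" "0 \<le> int E * (int k + 1)" by simp_all
  have bd: "int x \<le> B" "int y \<le> B" "int D * (int k + 1) \<le> B" "int E * (int k + 1) \<le> B" "int k + 1 \<le> B"
    using lt m L_B k_L by linarith+
  have k: "iv s (Suc 0) = int k" using s(1) by (simp add: dpst_def base_st_def lvs_def)
  have tx: "ia s 7 x = pv D i" "ra s x = dw D i" "ia s 7 y = pv E (Suc i)" "ra s y = dw E (Suc i)"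
    using t(1)[unfolded tabs_def, rule_format, of D i] t(1)[unfolded tabs_def, rule_format, of E "Suc i"] D
    unfolding x_def y_def by auto
  have xy: "x \<noteq> y" using idx_inj[of i "Suc i" D E] D by (auto simp: x_def y_def)
  show ?thesis
  proof (cases "pv D i < 0")
    case True
    have "INV pv pd dw D (Pm D v (Suc i))" unfolding Pm_Suc by (rule INV_keep[OF t(2)]) (use True in auto)
    then have I: "(\<exists>pv pd dw. tabs u pv pd dw \<and> INV pv pd dw D (Pm D v (Suc i)))" if "ia u = ia s" "ra u = ra s" for u :: state
      using that t(1) unfolding tabs_def by metis
    show ?thesis
    proof (rule ok_gen)
      fix Q assume Q: "\<And>t. (\<exists>pv pd dw. tabs t pv pd dw \<and> INV pv pd dw D (Pm D v (Suc i))) \<and> tm t \<le> tm s + 140 \<Longrightarrow> Q t"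
      have q: "Q u" if "ia u = ia s" "ra u = ra s" "tm u \<le> tm s + 140" for u
        using Q I[OF that(1,2)] that(3) by blast
      show "ok RELAX1 s Q" unfolding RELAX1_def
        using True lt bd m0 tx k s by (auto simp: x intro!: q)
    qed
  next
    case False
    show ?thesis
    proof (cases "pv E (Suc i) < 0 \<or> dw D i + W ! v < dw E (Suc i)")
      case True
      let ?pv = "pv(E := (pv E)(Suc i := int v))" and ?pd = "pd(E := (pd E)(Suc i := int D))"
      let ?dw = "dw(E := (dw E)(Suc i := dw D i + W ! v))"
      have I: "INV ?pv ?pd ?dw D (Pm D v (Suc i))" unfolding Pm_Suc
        by (rule INV_step[OF t(2)]) (use D True False in \<open>auto simp: Pm_def\<close>)
      have T: "tabs u ?pv ?pd ?dw" if "ia u = (ia s)(7 := (ia s 7)(y := int v), 8 := (ia s 8)(y := int D))"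
         "ra u = (ra s)(y := dw D i + W ! v)" for u :: state
        unfolding tabs_def
      proof (intro allI impI)
        fix D' j assume "D' < p" "j \<le> KB"
        then show "ia u 7 (D' * (k + 1) + j) = ?pv D' j \<and> ia u 8 (D' * (k + 1) + j) = ?pd D' j \<and> ra u (D' * (k + 1) + j) = ?dw D' j"
          using t(1) that idx_inj[of j "Suc i" D' E] D(4) unfolding tabs_def y_def by auto
      qed
      show ?thesis
      proof (rule ok_gen)
        fix Q assume Q: "\<And>t. (\<exists>pv pd dw. tabs t pv pd dw \<and> INV pv pd dw D (Pm D v (Suc i))) \<and> tm t \<le> tm s + 140 \<Longrightarrow> Q t"
        have q: "Q u" if "ia u = (ia s)(7 := (ia s 7)(y := int v), 8 := (ia s 8)(y := int D))"
         "ra u = (ra s)(y := dw D i + W ! v)" "tm u \<le> tm s + 140" for u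
          using Q T[OF that(1,2)] I that(3) by blast
        show "ok RELAX1 s Q" unfolding RELAX1_def
          using True False lt bd m0 tx k s xy by (auto simp: x y y' intro!: q)
      qed
    next
      case no: False
      have "INV pv pd dw D (Pm D v (Suc i))" unfolding Pm_Suc
      proof (rule INV_keep[OF t(2)])
        fix E' assume "stp D v E'"
        then have "bits E' = bits E" using D(3) by (simp add: stp_def)
        then have "E' = E" by (simp only: bits_eq)
        then show "0 \<le> pv E' (Suc i) \<and> dw E' (Suc i) \<le> dw D i + W ! v" using no by auto
      qed
      then have I: "INV pv pd dw D (Pm D v (Suc i))" "tabs u pv pd dw" if "ia u = ia s" "ra u = ra s" for u :: state
        using that t(1) by (auto simp: tabs_def)
      show ?thesis
      proof (rule ok_gen)
        fix Q assume Q: "\<And>t. (\<exists>pv pd dw. tabs t pv pd dw \<and> INV pv pd dw D (Pm D v (Suc i))) \<and> tm t \<le> tm s + 140 \<Longrightarrow> Q t"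
        have q: "Q u" if "ia u = ia s" "ra u = ra s" "tm u \<le> tm s + 140" for u
          using Q I[OF that(1,2)] that(3) by blast
        show "ok RELAX1 s Q" unfolding RELAX1_def
          using no False lt bd m0 tx k s xy by (auto simp: x y y' intro!: q)
      qed
    qed
  qed
qed

lemma RELAX_ok:
  assumes s: "dpst s" "iv s vD = int D" "iv s vE = int E" "iv s vv = int v" "rv s rwt = W ! v"
    and D: "E < p" "D < E" "stp D v E"
    and t: "tabs s pv pd dw" "INV pv pd dw D (Pm D v 0)"
  shows "ok (For vcc (V vKB) RELAX1) s (\<lambda>t. (\<exists>pv pd dw. tabs t pv pd dw \<and> INV pv pd dw D (Pm D (Suc v) 0)) \<and>
    tm t \<le> tm s + 10 + 144 * KB)"
proof (rule ok_For[where n = KB and T = "\<lambda>_. 140" and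
    J = "\<lambda>i t. \<exists>pv pd dw. tabs t pv pd dw \<and> INV pv pd dw D (Pm D v i)"], goal_cases)
  case (7 i t)
  have "dpst t" by (rule dpst_fr[OF s(1) 7(2)]) auto
  then show ?case using frs[OF 7(2)] s D 7 by (auto intro!: RELAX1_ok)
next
  case (8 t)
  then obtain pv pd dw where h: "tabs t pv pd dw" "INV pv pd dw D (Pm D v KB)" by blast
  have "INV pv pd dw D (Pm D (Suc v) 0)" by (rule INV_weaken[OF h(2)]) (auto simp: Pm_def)
  then show ?case using h 8(3) by auto
qed (use s t in \<open>auto simp: dpst_def base_st_def tabs_def\<close>)

definition expT :: "nat \<Rightarrow> nat" where
  "expT v = 150 + CL len + deg v * (130 + CL len) + 144 * KB"

lemma EXPAND_ok:
  assumes s: "dpst s" "iv s vD = int D" "iv s vv = int v" "v < n" "D < p"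
    and t: "tabs s pv pd dw" "INV pv pd dw D (Pm D v 0)"
  shows "ok EXPAND s (\<lambda>t. (\<exists>pv pd dw. tabs t pv pd dw \<and> INV pv pd dw D (Pm D (Suc v) 0)) \<and> tm t \<le> tm s + expT v)"
  unfolding EXPAND_def
proof (simp, rule ok_mono[OF LOOK_ok[of lv len base _ v]], goal_cases)
  case 1
  then show ?case using s by (simp add: dpst_def base_st_def lvs_def)
next
  case 2
  then show ?case using s by simp
next
  case (3 t1)
  have B3: "dpst t1" by (rule dpst_fr[OF _ 3(1)]) (use s in \<open>auto simp: dpst_def base_st_def lvs_def\<close>)
  have tb3: "tabs t1 pv pd dw" using frs[OF 3(1)] t by (simp add: tabs_def)
  have v3: "iv t1 vD = int D" "iv t1 vv = int v" using frs[OF 3(1)] s by auto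
  \<comment> \<open>If \<open>v\<close> allows no transition out of \<open>D\<close>, its turn is
    over without work.\<close>
  have skip: "INV pv pd dw D (Pm D (Suc v) 0)" if "\<And>E. \<not> stp D v E"
    by (rule INV_weaken[OF t(2)]) (use that in \<open>auto simp: Pm_def less_Suc_eq\<close>)
  have tabs_eq: "tabs u pv pd dw" if "ia u = ia t1" "ra u = ra t1" for u :: state
    using tb3 that by (simp add: tabs_def)
  show ?case
  proof (cases "v \<in> R \<union> Y")
    case True
    then have "\<And>E. \<not> stp D v E" by (auto simp: stp_def)
    note sk = skip[OF this]
    have ex: "\<exists>pv pd dw. tabs u pv pd dw \<and> INV pv pd dw D (Pm D (Suc v) 0)" if "ia u = ia t1" "ra u = ra t1" for u :: state
      using sk tabs_eq[OF that] by blast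
    have "\<not> iv t1 13 < 0" using 3(2) clu_c[OF True] by simp
    note nf = this
    show ?thesis
    proof (rule ok_gen, goal_cases)
      case (1 Q)
      have "Q u" if "ia u = ia t1" "ra u = ra t1" "tm u \<le> tm t1 + 10" for u
        by (rule 1, rule conjI[OF ex[OF that(1,2)]]) (use that(3) 3(2) in \<open>simp add: expT_def\<close>)
      then show ?case using nf by simp
    qed
  next
    case out: False
    have n13: "iv t1 13 = -1" using 3(2) clu_out[OF out] by simp
    show ?thesis
    proof (simp add: n13, rule ok_mono[OF FORNB_TOUCH_ok[of _ v D]], goal_cases)
      case (9 t2)
      obtain E where E: "iv t2 vE = int E" "E < p" "D \<le> E" "bits E = bits D \<union> sc.nbc v" using 9(2) by blast
      have B9: "dpst t2" by (rule dpst_fr[OF _ 9(1)]) (use B3 in \<open>auto simp: dpst_def base_st_def lvs_def\<close>)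
      have v9: "iv t2 vD = int D" "iv t2 vv = int v" using frs[OF 9(1)] v3 by auto
      have tb9: "tabs t2 pv pd dw" using frs[OF 9(1)] tb3 by (simp add: tabs_def)
      have tabs_eq: "tabs u pv pd dw" if "ia u = ia t2" "ra u = ra t2" for u :: state
        using tb9 that by (simp add: tabs_def)
      have T: "tm t2 \<le> tm s + 60 + CL len + deg v * (130 + CL len)" using 9(2) 3(2) by simp
      show ?case
      proof (cases "sc.nbc v \<inter> bits D \<noteq> {} \<and> D \<noteq> E")
        case True
        then have st: "stp D v E" using s(4) out E(4) bits_eq[of D E] by (auto simp: stp_def)
        have lt: "D < E" using E(3) True by simp
        have W: "in_range (int v) W" using s(4) lenW by (simp add: in_range_def)
        have tch: "iv t2 35 = 1" using 9(2) True by simp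
        have "ok (For vcc (V vKB) RELAX1) u (\<lambda>t. (\<exists>pv pd dw. tabs t pv pd dw \<and> INV pv pd dw D (Pm D (Suc v) 0)) \<and> tm t \<le> tm s + expT v)"
          if u: "iv u = iv t2" "ia u = ia t2" "ra u = ra t2" "rv u rwt = W ! v" "tm u \<le> tm t2 + 30" for u
        proof (rule ok_mono[OF RELAX_ok[of u D E v pv pd dw]])
          show "dpst u" using B9 u by (simp add: dpst_def base_st_def lvs_def)
          fix w assume "(\<exists>pv pd dw. tabs w pv pd dw \<and> INV pv pd dw D (Pm D (Suc v) 0)) \<and> tm w \<le> tm u + 10 + 144 * KB"
          then show "(\<exists>pv pd dw. tabs w pv pd dw \<and> INV pv pd dw D (Pm D (Suc v) 0)) \<and> tm w \<le> tm s + expT v"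
            using T u(5) by (auto simp: expT_def)
        qed (use u v9 E lt st t tabs_eq in auto)
        then show ?thesis using tch v9 E lt W by simp
      next
        case False
        have "\<not> stp D v E'" for E' using False E(4) by (auto simp: stp_def)
        note sk = skip[OF this]
        have ex: "\<exists>pv pd dw. tabs u pv pd dw \<and> INV pv pd dw D (Pm D (Suc v) 0)" if "ia u = ia t2" "ra u = ra t2" for u :: state
          using sk tabs_eq[OF that] by blast
        show ?thesis
        proof (cases "sc.nbc v \<inter> bits D = {}")
          case True
          then have "iv t2 35 = 0" using 9(2) by simp
          note nf = this
          show ?thesis
          proof (rule ok_gen, goal_cases)
            case (1 Q)
            have "Q u" if "ia u = ia t2" "ra u = ra t2" "tm u \<le> tm t2 + 20" for u
              by (rule 1, rule conjI[OF ex[OF that(1,2)]]) (use that(3) T in \<open>simp add: expT_def\<close>)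
            then show ?case using nf by simp
          qed
        next
          case F: False
          then have "iv t2 35 = 1" "\<not> int D < int E" using 9(2) False by auto
          note nf = this
          show ?thesis
          proof (rule ok_gen, goal_cases)
            case (1 Q)
            have "Q u" if "ia u = ia t2" "ra u = ra t2" "tm u \<le> tm t2 + 20" for u
              by (rule 1, rule conjI[OF ex[OF that(1,2)]]) (use that(3) T in \<open>simp add: expT_def\<close>)
            then show ?case using nf v9 E by simp
          qed
        qed
      qed
    qed (use B3 v3 s out in \<open>auto simp: dpst_def base_st_def lvs_def\<close>)
  qed
qed

definition dpT :: nat where
  "dpT = 20 + (\<Sum>v<n. expT v + 4)"

lemma DPMAIN_ok:
  assumes s: "dpst s" and t: "tabs s pv pd dw" "INV pv pd dw 0 (\<lambda>_ _ _. False)"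
  shows "ok DPMAIN s (\<lambda>t. (\<exists>pv pd dw. tabs t pv pd dw \<and> INV pv pd dw p (\<lambda>D v j. v < n)) \<and> tm t \<le> tm s + 20 + p * (dpT + 4))"
  unfolding DPMAIN_def
proof (rule ok_For[where n = p and T = "\<lambda>_. dpT" and
    J = "\<lambda>D t. \<exists>pv pd dw. tabs t pv pd dw \<and> INV pv pd dw D (Pm D 0 0)"], goal_cases)
  case 5
  have "INV pv pd dw 0 (Pm 0 0 0)" by (rule INV_weaken[OF t(2)]) (auto simp: Pm_def)
  then show ?case using t(1) by blast
next
  case (7 D t1)
  have B: "dpst t1" by (rule dpst_fr[OF s 7(2)]) auto
  show ?case
  proof (rule ok_For[where n = n and T = expT and
    J = "\<lambda>v t. \<exists>pv pd dw. tabs t pv pd dw \<and> INV pv pd dw D (Pm D v 0)"], goal_cases)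
    case (7 v t2)
    have "dpst t2" by (rule dpst_fr[OF B 7(2)]) auto
    moreover have "iv t2 vD = int D" using frs[OF 7(2)] \<open>iv t1 32 = int D\<close> by simp
    ultimately show ?case using 7 \<open>D < p\<close> by (auto intro!: EXPAND_ok)
  next
    case (8 t2)
    then obtain pv pd dw where h: "tabs t2 pv pd dw" "INV pv pd dw D (Pm D n 0)" by blast
    \<comment> \<open>A transition uses a vertex below \<open>n\<close>, so finishing the vertex
      loop completes the row.\<close>
    have "INV pv pd dw (Suc D) (Pm (Suc D) 0 0)" by (rule INV_weaken[OF h(2)]) (auto simp: Pm_def stp_def less_Suc_eq)
    then show ?case using h(1) 8(3) by (auto simp: dpT_def)
  qed (use B 7 in \<open>auto simp: dpst_def base_st_def lvs_def tabs_def\<close>)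
next
  case (8 t1)
  then obtain pv pd dw where h: "tabs t1 pv pd dw" "INV pv pd dw p (Pm p 0 0)" by blast
  have "INV pv pd dw p (\<lambda>D v j. v < n)" by (rule INV_weaken[OF h(2)]) (auto simp: Pm_def)
  then show ?case using h(1) 8(3) by auto
qed (use s in \<open>auto simp: dpst_def tabs_def\<close>)

lemma DPINIT_ok:
  assumes s: "dpst s"
  shows "ok DPINIT s (\<lambda>t. (\<exists>pv pd dw. tabs t pv pd dw \<and> INV pv pd dw 0 (\<lambda>_ _ _. False)) \<and> tm t \<le> tm s + 60 + p * (60 + 40 * KB))"
proof -
  have v: "iv s (Suc 0) = int k" "iv s 8 = int KB" "iv s 31 = int p" using s by (auto simp: dpst_def base_st_def lvs_def)
  have K: "KB < L" "k + 1 < L" "int k + 1 \<le> B" "int KB + 1 \<le> B" using KB_k k_L L_B by linarith+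
  show ?thesis unfolding DPINIT_def
  proof (rule ok_gen, simp (no_asm), rule ok_For[where n = p and T = "\<lambda>_. 50 + 40 * KB" and
      J = "\<lambda>D t. \<forall>D'<D. \<forall>j\<le>KB. ia t 7 (D' * (k + 1) + j) = -1"], goal_cases)
    case (7 Q D t)
    note h = 7(2-5)
    have vt: "iv t (Suc 0) = int k" "iv t 8 = int KB" using frs[OF h(2)] v by auto
    show ?case
    proof (rule ok_For[where n = "KB + 1" and T = "\<lambda>_. 30" and
      J = "\<lambda>i t. \<forall>D'\<le>D. \<forall>j\<le>KB. D' < D \<or> j < i \<longrightarrow> ia t 7 (D' * (k + 1) + j) = -1"], goal_cases)
      case (7 i u)
      have vu: "iv u (Suc 0) = int k" "iv u 32 = int D" "iv u 37 = int i" using frs[OF 7(2)] vt h(3) 7(3) by auto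
      have x: "int D * (int k + 1) + int i = int (D * (k + 1) + i)" by (simp add: algebra_simps)
      have lt: "D * (k + 1) + i < L" using idx_lt(1)[of D i] h(1) 7(1) by simp
      have y: "int D * (int k + 1) = int (D * (k + 1))" by (simp add: algebra_simps)
      have "int (D * (k + 1) + i) < int L" using lt by (simp only: of_nat_less_iff)
      then have bd: "int D * (int k + 1) \<le> B" "int D * (int k + 1) + int i \<le> B" "int D * (int k + 1) + int i < int L"
        "0 \<le> int D * (int k + 1)" "nat (int D * (int k + 1) + int i) = D * (k + 1) + i"
        using L_B unfolding x y by (linarith, linarith, linarith, linarith, simp only: nat_int)
      have "\<forall>D'\<le>D. \<forall>j\<le>KB. D' < D \<or> j < Suc i \<longrightarrow> ((ia u 7)(D * (k + 1) + i := -1)) (D' * (k + 1) + j) = -1"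
      proof (intro allI impI)
        fix D' j assume j: "D' \<le> D" "j \<le> KB" "D' < D \<or> j < Suc i"
        show "((ia u 7)(D * (k + 1) + i := -1)) (D' * (k + 1) + j) = -1"
        proof (cases "D' = D \<and> j = i")
          case False
          then have "D' * (k + 1) + j \<noteq> D * (k + 1) + i" using idx_inj[of j i D' D] j 7(1) by auto
          moreover have "D' < D \<or> j < i" using False j by auto
          ultimately show ?thesis using 7(4) j(1,2) by auto
        qed simp
      qed
      then show ?case using vu bd K by simp
    next
      case (8 u)
      have "\<forall>D'<Suc D. \<forall>j\<le>KB. ia u 7 (D' * (k + 1) + j) = -1" using 8(1) by (auto simp: less_Suc_eq_le)
      then show ?case using 8(3) by simp
    qed (use h vt K in auto)
  next
    case (8 Q t)
    have vt: "iv t (Suc 0) = int k" using frs[OF 8(3)] v by auto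
    let ?pv = "\<lambda>D j. if D = 1 \<and> j = 0 then 0 else -1 :: int"
    \<comment> \<open>Resetting this one cell changes no table entry other than the starting
      one.\<close>
    have i1: "D * (k + 1) + j = k + 1 \<longleftrightarrow> D = 1 \<and> j = 0" if "j \<le> KB" for D j
      using idx_inj[of j 0 D 1] that by simp
    have T: "tabs u ?pv (\<lambda>D j. ia u apd (D * (k + 1) + j)) (\<lambda>D j. ra u (D * (k + 1) + j))"
      if "ia u 7 = (ia t 7)(k + 1 := 0)" for u :: state
      unfolding tabs_def using that i1 8(2) by auto
    have I: "INV ?pv (\<lambda>D j. ia u apd (D * (k + 1) + j)) (\<lambda>D j. ra u (D * (k + 1) + j)) 0 (\<lambda>_ _ _. False)"
      if "ra u (k + 1) = 0" for u :: state
      unfolding INV_def using that by auto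
    have q: "Q u" if "ia u 7 = (ia t 7)(k + 1 := 0)" "ra u (k + 1) = 0" "tm u \<le> tm t + 40" for u
      using 8(1)[of u] T[OF that(1)] I[OF that(2)] that(3) 8(4) by (auto simp: algebra_simps)
    have nk: "nat (int k + 1) = k + 1" by simp
    show ?case using vt K by (auto simp: nk intro!: q)
  qed (use v in auto)
qed

end

section \<open>Selecting and extracting a lightest solution\<close>

definition SEL1 :: com where
  "SEL1 = Asg vx ((V vp \<ominus> N 1) \<otimes> (V vk \<oplus> N 1) \<oplus> V vcc) ;;
     Unless (Less (Arr apv (V vx)) (N 0)) (
       RGet rnew (V vx) ;; RAdd rnew rnew rtot ;; Asg vupd (N 0) ;;
       Cond (Eq (V vbest) (N 0)) (Asg vupd (N 1)) (When (RLess rnew rbest) (Asg vupd (N 1))) ;;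
       When (Eq (V vupd) (N 1)) (Asg vbest (N 1) ;; RMov rbest rnew ;; Asg vbc (V vcc)))"

text \<open>At most \<open>vKB - vtc\<close> further vertices are allowed, since \<open>vtc\<close>
  vertices are already prescribed. The value -1 in \<open>vbc\<close> remains if this subset does
  not improve on the record.\<close>

definition SELECT :: com where
  "SELECT = Asg vbc (N (-1)) ;; For vcc (V vKB \<ominus> V vtc \<oplus> N 1) SEL1"

definition EXT1 :: com where
  "EXT1 = Asg vx (V vE \<otimes> (V vk \<oplus> N 1) \<oplus> (V vbc \<ominus> V vi)) ;; Put aSV (V vtc \<oplus> V vi) (Arr apv (V vx)) ;;
     Asg vE (Arr apd (V vx))"

text \<open>The vertices have to be written out whenever the record improves, because the next
  subset reuses the tables.\<close>

definition EXTRACT :: com where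
  "EXTRACT = For vi (V vtc) (Put aSV (V vi) (Arr aTX (V vi))) ;; Asg vE (V vp \<ominus> N 1) ;;
     For vi (V vbc) EXT1 ;; Asg vsc (V vtc \<oplus> V vbc)"

lemma w_SEL1 [simp]: "wv SEL1 = {10, 25, 39, 49}" "wa SEL1 = {}" "wr SEL1 = {2, 3}" "wra SEL1 = False"
  by (auto simp: SEL1_def)
lemma w_SELECT [simp]: "wv SELECT = {10, 25, 37, 38, 39, 49}" "wa SELECT = {}" "wr SELECT = {2, 3}" "wra SELECT = False"
  by (auto simp: SELECT_def)
lemma w_EXT1 [simp]: "wv EXT1 = {25, 34}" "wa EXT1 = {6}" "wr EXT1 = {}" "wra EXT1 = False"
  by (auto simp: EXT1_def)
lemma w_EXTRACT [simp]: "wv EXTRACT = {25, 27, 28, 34, 40}" "wa EXTRACT = {6}" "wr EXTRACT = {}" "wra EXTRACT = False"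
  by (auto simp: EXTRACT_def)

context dp
begin

definition full :: nat where "full = p - 1"

lemma full_lt: "full < p" and p_full: "int p = int full + 1" by (simp_all add: full_def of_nat_diff)

lemma bits_full: "bits full = {..<cc}"
proof -
  have "bits full = {q. bit (mask cc :: nat) q}" by (simp add: bits_def full_def mask_eq_exp_minus_1)
  then show ?thesis by (auto simp: bit_mask_iff)
qed

text \<open>Relative to the record \<open>b0\<close>, \<open>r0\<close> on entry: either it still
  stands and \<open>vbc\<close> is -1, or \<open>vbc\<close> is the number of added vertices of the
  new record.\<close>

definition seld :: "(nat \<Rightarrow> nat \<Rightarrow> int) \<Rightarrow> (nat \<Rightarrow> nat \<Rightarrow> real) \<Rightarrow> real \<Rightarrow> bool \<Rightarrow> real \<Rightarrow> nat \<Rightarrow> state \<Rightarrow> bool" where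
  "seld pv dw r b0 r0 i t \<longleftrightarrow> (\<exists>b1. iv t vbest = of_bool b1 \<and> (b0 \<longrightarrow> b1 \<and> rv t rbest \<le> r0) \<and>
     (\<forall>j<i. 0 \<le> pv full j \<longrightarrow> b1 \<and> rv t rbest \<le> dw full j + r) \<and>
     (iv t vbc = -1 \<and> b1 = b0 \<and> rv t rbest = r0 \<or>
      (\<exists>j<i. iv t vbc = int j \<and> 0 \<le> pv full j \<and> b1 \<and> rv t rbest = dw full j + r)))"

lemma SEL1_ok:
  assumes s: "dpst s" "tabs s pv pd dw" "iv s vcc = int i" "i \<le> KB" "rv s rtot = r"
    and J: "seld pv dw r b0 r0 i s"
  shows "ok SEL1 s (\<lambda>t. seld pv dw r b0 r0 (Suc i) t \<and> tm t \<le> tm s + 100)"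
proof -
  define x where "x = full * (k + 1) + i"
  note p1 = p_full
  have x: "int full * (int k + 1) + int i = int x" by (simp add: x_def algebra_simps)
  have lt: "x < L" using idx_lt(1)[OF full_lt s(4)] by (simp add: x_def)
  have "full * (k + 1) \<le> L" using idx_lt(2)[OF full_lt] .
  then have "int (full * (k + 1)) \<le> int L" by (simp only: of_nat_le_iff)
  then have m: "int full * (int k + 1) \<le> B" using L_B by (simp add: algebra_simps)
  have m0: "0 \<le> int full * (int k + 1)" by simp
  have bd: "int x \<le> B" "int k + 1 \<le> B" "int full \<le> B" using lt L_B k_L p_L(2) full_lt by linarith+
  have v: "iv s (Suc 0) = int k" "iv s 31 = int full + 1" using s(1) p1 by (simp_all add: dpst_def base_st_def lvs_def)
  have tx: "ia s 7 x = pv full i" "ra s x = dw full i"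
    using s(2)[unfolded tabs_def, rule_format, OF full_lt s(4)] by (auto simp: x_def)
  obtain b1 where b1: "iv s vbest = of_bool b1" "b0 \<longrightarrow> b1 \<and> rv s rbest \<le> r0"
    "\<forall>j<i. 0 \<le> pv full j \<longrightarrow> b1 \<and> rv s rbest \<le> dw full j + r"
    "iv s vbc = -1 \<and> b1 = b0 \<and> rv s rbest = r0 \<or>
      (\<exists>j<i. iv s vbc = int j \<and> 0 \<le> pv full j \<and> b1 \<and> rv s rbest = dw full j + r)" using J unfolding seld_def by blast
  note ev = x v bd m m0 lt tx s(3,5)
  show ?thesis
  proof (rule ok_gen)
    fix Q assume Q: "\<And>t. seld pv dw r b0 r0 (Suc i) t \<and> tm t \<le> tm s + 100 \<Longrightarrow> Q t"
    show "ok SEL1 s Q"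
    proof (cases "0 \<le> pv full i \<and> (b1 \<longrightarrow> dw full i + r < rv s rbest)")
      case True
      have q: "Q u" if "iv u vbest = 1" "iv u vbc = int i" "rv u rbest = dw full i + r" "tm u \<le> tm s + 100" for u
      proof (rule Q, rule conjI[OF _ that(4)], unfold seld_def, intro exI[of _ True] conjI)
        show "b0 \<longrightarrow> True \<and> rv u 3 \<le> r0" using b1(2) True that(3) by auto
        show "\<forall>j<Suc i. 0 \<le> pv full j \<longrightarrow> True \<and> rv u 3 \<le> dw full j + r"
          using b1(3) True that(3) by (auto simp: less_Suc_eq)
        show "iv u 39 = -1 \<and> True = b0 \<and> rv u 3 = r0 \<or> (\<exists>j<Suc i. iv u 39 = int j \<and> 0 \<le> pv full j \<and> True \<and> rv u 3 = dw full j + r)"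
          using that True by auto
      qed (use that in simp)
      show ?thesis unfolding SEL1_def using True b1(1) ev by (cases b1) (auto intro!: q)
    next
      case False
      have q: "Q u" if "iv u vbest = iv s vbest" "iv u vbc = iv s vbc" "rv u rbest = rv s rbest" "tm u \<le> tm s + 100" for u
      proof (rule Q, rule conjI[OF _ that(4)], unfold seld_def, intro exI[of _ b1] conjI)
        show "\<forall>j<Suc i. 0 \<le> pv full j \<longrightarrow> b1 \<and> rv u 3 \<le> dw full j + r"
          using b1(3) False that(3) by (auto simp: less_Suc_eq)
        show "iv u 39 = -1 \<and> b1 = b0 \<and> rv u 3 = r0 \<or> (\<exists>j<Suc i. iv u 39 = int j \<and> 0 \<le> pv full j \<and> b1 \<and> rv u 3 = dw full j + r)"
          using b1(4) that less_Suc_eq by auto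
      qed (use that b1 in auto)
      show ?thesis unfolding SEL1_def using False b1(1) ev by (cases b1) (auto intro!: q)
    qed
  qed
qed

lemma SELECT_ok:
  assumes s: "dpst s" "tabs s pv pd dw" "iv s vtc = int tc" "tc \<le> KB" "rv s rtot = r" "iv s vbest = of_bool b0" "rv s rbest = r0"
  shows "ok SELECT s (\<lambda>t. seld pv dw r b0 r0 (KB - tc + 1) t \<and> tm t \<le> tm s + 150 + 110 * KB)"
proof -
  have v: "iv s 8 = int KB" using s by (simp add: dpst_def base_st_def)
  have K: "int KB + 1 \<le> B" using KB_k k_L L_B by linarith
  show ?thesis unfolding SELECT_def
  proof (simp, rule ok_For[where n = "KB - tc + 1" and T = "\<lambda>_. 100" and J = "seld pv dw r b0 r0"], goal_cases)
    case (7 i t)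
    have "dpst t" by (rule dpst_fr[OF _ 7(2)]) (use s in \<open>auto simp: dpst_def base_st_def lvs_def\<close>)
    moreover have "tabs t pv pd dw" using frs[OF 7(2)] s by (simp add: tabs_def)
    ultimately show ?case using 7 frs[OF 7(2)] s by (intro SEL1_ok) auto
  next
    case (8 t)
    then show ?case using s(4) by (auto simp: algebra_simps)
  qed (use s v K in \<open>auto simp: seld_def of_nat_diff\<close>)
qed

lemma EXTRACT_ok:
  assumes s: "dpst s" "tabs s pv pd dw" "INV pv pd dw D0 P" "iv s vtc = int (length xs)" "iv s vbc = int bc" "length xs + bc \<le> KB"
    "0 \<le> pv full bc" "\<forall>i<length xs. ia s aTX i = int (xs ! i)"
  shows "ok EXTRACT s (\<lambda>t. (\<forall>i<length xs + bc. ia t aSV i = int ((xs @ tr pv pd full bc) ! i)) \<and>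
    iv t vsc = int (length xs + bc) \<and> tm t \<le> tm s + 100 + 100 * KB)"
proof -
  note p1 = p_full
  have v: "iv s (Suc 0) = int k" "iv s 31 = int full + 1" using s(1) p1 by (simp_all add: dpst_def base_st_def lvs_def)
  have K: "KB < L" "int KB \<le> B" using KB_k k_L L_B by linarith+
  have fB: "int full \<le> B" using p_L(2) full_lt L_B by linarith
  let ?T = "tr pv pd full bc"
  have lT: "length ?T = bc" using tr_reach[OF s(3) full_lt _ s(7)] s(6) by simp
  show ?thesis unfolding EXTRACT_def
  proof (rule ok_gen, simp (no_asm), rule ok_For[where n = "length xs" and T = "\<lambda>_. 20" and J = "\<lambda>i t. \<forall>j<i. ia t aSV j = int (xs ! j)"], goal_cases)
    case (7 Q i t)
    have "ia t 5 i = int (xs ! i)" using frs[OF 7(3)] s(8) 7(2) by simp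
    then show ?case using 7 K s(6) by (auto simp: less_Suc_eq)
  next
    case (8 Q t)
    note Q = 8(1) and t = 8(2-4)
    have vt: "iv t (Suc 0) = int k" "iv t 31 = int full + 1" "iv t 39 = int bc" "iv t 30 = int (length xs)" "ia t 7 = ia s 7" "ia t 8 = ia s 8" using frs[OF t(2)] v s by auto
    show ?case
    \<comment> \<open>After \<open>i\<close> rounds the current row \<open>E\<close> and the
      remaining count \<open>bc - i\<close> generate exactly the part of the traceback that is still
      to be written.\<close>
    proof (simp add: vt fB, rule ok_For[where n = bc and T = "\<lambda>_. 70" and J = "\<lambda>i t. \<exists>E<p. iv t vE = int E \<and> 0 \<le> pv E (bc - i) \<and>
        drop i ?T = tr pv pd E (bc - i) \<and> (\<forall>j<i. ia t aSV (length xs + j) = int (?T ! j)) \<and> (\<forall>j<length xs. ia t aSV j = int (xs ! j))"], goal_cases)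
      case 5
      then show ?case using s(7) t full_lt by (intro exI[of _ full]) auto
    next
      case (7 i u)
      obtain E where E: "E < p" "iv u vE = int E" "0 \<le> pv E (bc - i)"
        "drop i ?T = tr pv pd E (bc - i)" "\<forall>j<i. ia u aSV (length xs + j) = int (?T ! j)" "\<forall>j<length xs. ia u aSV j = int (xs ! j)" using 7(4) by blast
      define j where "j = bc - Suc i"
      have bj: "bc - i = Suc j" using 7(1) by (simp add: j_def)
      have jK: "Suc j \<le> KB" using s(6) bj by linarith
      have "Suc j = 0 \<and> E = 1 \<and> dw E (Suc j) = 0 \<or> (\<exists>c' D' v. Suc j = Suc c' \<and> pv E (Suc j) = int v \<and> pd E (Suc j) = int D' \<and> D' < E \<and> D' \<le> D0 \<and> stp D' v E \<and> 0 \<le> pv D' c' \<and>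
          dw E (Suc j) = dw D' c' + W ! v)" using INV_D(1)[OF s(3)] E(1,3) jK bj by metis
      then obtain D' v where D': "pv E (Suc j) = int v" "pd E (Suc j) = int D'" "D' < E" "0 \<le> pv D' j" by auto
      have dr: "drop i ?T = v # tr pv pd D' j" using E(4) D' bj by simp
      have nth: "?T ! i = v" using dr 7(1) lT by (metis hd_drop_conv_nth list.sel(1))
      have dr': "drop (Suc i) ?T = tr pv pd D' j" using dr by (metis drop_Suc list.sel(3) tl_drop)
      define x where "x = E * (k + 1) + Suc j"
      have x: "int E * (int k + 1) + (int bc - int i) = int x" using bj 7(1) by (simp add: x_def algebra_simps)
      have lt: "x < L" using idx_lt(1)[OF E(1) jK] by (simp add: x_def)
      have "int (E * (k + 1)) \<le> int L" using idx_lt(2)[OF E(1)] by (simp only: of_nat_le_iff)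
      then have m: "int E * (int k + 1) \<le> B" using L_B by (simp add: algebra_simps)
      have m0: "0 \<le> int E * (int k + 1)" by simp
      have bd: "int x \<le> B" "int k + 1 \<le> B" "int bc \<le> B" "int (length xs) + int i < int L" "int (length xs) + int i \<le> B" using lt L_B k_L K s(6) 7(1) by linarith+
      have tx: "ia u 7 x = int v" "ia u 8 x = int D'" using s(2)[unfolded tabs_def, rule_format, OF E(1) jK] D' vt frs[OF 7(2)] by (auto simp: x_def)
      have vu: "iv u (Suc 0) = int k" "iv u 39 = int bc" "iv u 30 = int (length xs)" using frs[OF 7(2)] vt by auto
      have na: "nat (int (length xs) + int i) = length xs + i" by simp
      show ?case
      proof (rule ok_gen)
        fix Q' :: "state \<Rightarrow> bool" assume Q': "\<And>t'. (\<exists>E<p. iv t' 34 = int E \<and> 0 \<le> pv E (bc - Suc i) \<and> drop (Suc i) ?T = tr pv pd E (bc - Suc i) \<and>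
           (\<forall>j<Suc i. ia t' 6 (length xs + j) = int (?T ! j)) \<and> (\<forall>j<length xs. ia t' 6 j = int (xs ! j))) \<and> tm t' \<le> tm u + 70 \<Longrightarrow> Q' t'"
        have q: "Q' t'" if "iv t' 34 = int D'" "ia t' 6 = (ia u 6)(length xs + i := int v)" "tm t' \<le> tm u + 70" for t'
          using that D' dr' E(1,5,6) nth by (intro Q' conjI exI[of _ D']) (auto simp: j_def[symmetric] less_Suc_eq)
        show "ok EXT1 u Q'" unfolding EXT1_def using x lt m m0 bd tx vu E(2) 7(3) by (auto simp: na intro!: q)
      qed
    next
      case (8 u)
      have vu: "iv u 39 = int bc" "iv u 30 = int (length xs)" using frs[OF 8(2)] vt by auto
      have SV: "ia u 6 i = int ((xs @ ?T) ! i)" if "i < length xs + bc" for i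
      proof (cases "i < length xs")
        case True
        then show ?thesis using 8(1) by (auto simp: nth_append)
      next
        case False
        have "\<forall>j<bc. ia u 6 (length xs + j) = int (?T ! j)" using 8(1) by blast
        moreover have "i - length xs < bc" using False that by simp
        ultimately have "ia u 6 (length xs + (i - length xs)) = int (?T ! (i - length xs))" by blast
        then show ?thesis using False by (simp add: nth_append)
      qed
      have q: "Q w" if "iv w 40 = int (length xs + bc)" "ia w = ia u" "tm w \<le> tm u + 20" for w
        using that SV 8(3) t(3) s(6) by (intro Q) auto
      have "int (length xs) + int bc \<le> B" using K s(6) by linarith
      then show ?case using vu by (auto intro!: q)
    qed (use vt in auto)
  qed (use s in auto)
qed

end

definition DPALL :: com where
  "DPALL = NUM1 ;; NUM2 ;; DPINIT ;; DPMAIN ;; SELECT ;; Unless (Less (V vbc) (N 0)) EXTRACT"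

lemma w_DPALL [simp]: "wv DPALL = {10, 13, 14, 15, 16, 17, 18, 19, 20, 25, 26, 27, 28, 31, 32, 33, 34, 35, 36, 37, 38, 39, 40, 49}"
  "wa DPALL = {3, 4, 6, 7, 8}" "wr DPALL = {1, 2, 3, 4}" "wra DPALL = True"
  by (auto simp: DPALL_def)

context solve
begin

definition wt :: "nat set \<Rightarrow> real" where "wt X = (\<Sum>v\<in>X. W ! v)"

text \<open>Optimality is recorded per trace on \<open>Y\<close>, since masks below \<open>h\<close>
  stand for the traces already tried.\<close>

definition best :: "nat \<Rightarrow> state \<Rightarrow> bool" where
  "best h t \<longleftrightarrow> (\<exists>b. iv t vbest = of_bool b \<and>
     (\<forall>m<h. \<forall>X. sol X \<longrightarrow> card X \<le> KB \<longrightarrow> X \<inter> Y = A m \<longrightarrow> b \<and> rv t rbest \<le> wt X) \<and>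
     (b \<longrightarrow> (\<exists>xs. distinct xs \<and> length xs \<le> KB \<and> sol (set xs) \<and> rv t rbest = wt (set xs) \<and>
        iv t vsc = int (length xs) \<and> (\<forall>i<length xs. ia t aSV i = int (xs ! i)))))"

text \<open>The cost of one row, stated outside the locale of the dynamic program; it is the same
  for all masks, so it can be factored out of the sum over them.\<close>

definition dpU :: nat where
  "dpU = 20 + (\<Sum>v<n. 150 + CL len + deg v * (130 + CL len) + 144 * KB + 4)"

definition dpallT :: nat where "dpallT = dpU + 800 + 120 * ny + 300 * KB"

lemma XL_set: "set (XL m n) = A m \<union> forced (A m)" and XL_dist: "distinct (XL m n)"
proof -
  have "A m \<union> forced (A m) \<subseteq> {..<n}" using A_Y[of m] cov forced_lt[of "A m"] by (auto simp: cover_def)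
  then show "set (XL m n) = A m \<union> forced (A m)" by (auto simp: XL_def)
  show "distinct (XL m n)" by (simp add: XL_def)
qed

lemma sol_lt: "sol X \<Longrightarrow> X \<subseteq> {..<n}"
  by (auto simp: sol_def cover_def)

lemma wt_mono: "Z \<subseteq> X \<Longrightarrow> X \<subseteq> {..<n} \<Longrightarrow> wt Z \<le> wt X"
  unfolding wt_def using W_pos lenW by (intro sum_mono2) (auto intro: finite_subset)

lemma wt_list: "distinct xs \<Longrightarrow> (\<Sum>x\<leftarrow>xs. W ! x) = wt (set xs)"
  by (simp add: wt_def sum_list_distinct_conv_sum_set)

lemma DPALL_ok:
  assumes s: "base_st s" "alst m s" "scan m n s" "feas (A m)" "length (XL m n) \<le> KB" "best m s"
  shows "ok DPALL s (\<lambda>t. best (Suc m) t \<and> tm t \<le> tm s + dpallT * card (lab_of (A m)))"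
proof -
  obtain cp where cp: "cpst cp s" "cgood m cp" "\<forall>v<n. v \<in> H m \<longrightarrow> agree m cp v" using s(3) by (auto simp: scan_def)
  define \<kappa> where "\<kappa> u = nu m cp (cp (c u))" for u
  define cc where "cc = nu m cp (Suc ny)"
  have sc: "split_comps n ad R Y (A m) \<kappa> cc" unfolding \<kappa>_def cc_def by (rule split_compsI[OF cp(2) s(4) cp(3)])
  interpret dp B k adj W L lv len base KB m \<kappa> cc
    by (rule dp.intro[OF solve_axioms dp_axioms.intro[OF sc]]) (use nu_le[of m cp "Suc ny"] in \<open>simp add: cc_def\<close>)
  have XLs: "iv s vtc = int (length (XL m n))" "\<forall>i<length (XL m n). ia s aTX i = int (XL m n ! i)" "rv s rtot = (\<Sum>x\<leftarrow>XL m n. W ! x)"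
    using s(3,5) by (auto simp: scan_def)
  obtain b0 where b0: "iv s vbest = of_bool b0" "\<forall>m'<m. \<forall>X. sol X \<longrightarrow> card X \<le> KB \<longrightarrow> X \<inter> Y = A m' \<longrightarrow> b0 \<and> rv s rbest \<le> wt X"
    "b0 \<longrightarrow> (\<exists>xs. distinct xs \<and> length xs \<le> KB \<and> sol (set xs) \<and> rv s rbest = wt (set xs) \<and>
        iv s vsc = int (length xs) \<and> (\<forall>i<length xs. ia s aSV i = int (xs ! i)))" using s(6) unfolding best_def by blast
  have dpT: "dpT = dpU" by (simp add: dpT_def dpU_def expT_def)
  have pc: "p \<le> card (lab_of (A m))" by (rule sc.pow_le_lab_of)
  \<comment> \<open>Costs that do not depend on \<open>p\<close> are multiplied by \<open>p\<close>
    as well, which is at least 1; then \<open>p\<close> is replaced by the number of labelings of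
    this subset.\<close>
  have time: "200 + 120 * ny + (60 + p * (60 + 40 * KB)) + (20 + p * (dpT + 4)) + (150 + 110 * KB) + (110 + 100 * KB) \<le> dpallT * card (lab_of (A m))"
  proof -
    have "200 + 120 * ny + (60 + p * (60 + 40 * KB)) + (20 + p * (dpT + 4)) + (150 + 110 * KB) + (110 + 100 * KB)
      \<le> 1 * (540 + 120 * ny + 210 * KB) + p * (64 + 40 * KB + dpT)" by (simp add: algebra_simps)
    also have "\<dots> \<le> p * (540 + 120 * ny + 210 * KB) + p * (64 + 40 * KB + dpT)"
      by (intro add_mono mult_le_mono1) auto
    also have "\<dots> = p * (604 + 120 * ny + 250 * KB + dpU)" by (simp add: dpT algebra_simps)
    also have "\<dots> \<le> card (lab_of (A m)) * dpallT"
      by (intro mult_le_mono pc) (simp add: dpallT_def)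
    finally show ?thesis by (simp add: mult.commute)
  qed
  show ?thesis
  proof (rule ok_gen)
    fix Q assume Q: "\<And>t. best (Suc m) t \<and> tm t \<le> tm s + dpallT * card (lab_of (A m)) \<Longrightarrow> Q t"
    show "ok DPALL s Q" unfolding DPALL_def ok_Seq
    proof (rule ok_mono[OF NUM1_ok[OF s(1,2) cp(1,2)]], goal_cases)
      case (1 t1)
      have B1: "base_st t1" "alst m t1" "cpst cp t1" using base_st_fr[OF s(1) 1(1)] alst_fr[OF s(2) 1(1)] cp(1) frs[OF 1(1)] by (auto simp: cpst_def)
      show ?case
      proof (rule ok_mono[OF NUM2_ok[OF B1 cp(2)]], goal_cases)
        case 1
        then show ?case using \<open>iv t1 31 = _ \<and> _\<close> by blast
      next
        case (2 t2)
        have B2: "base_st t2" using base_st_fr[OF B1(1) 2(1)] by simp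
        have "\<forall>u\<in>R \<union> Y. ia t2 acb (c u) = (if u \<in> R \<union> A m then 2 ^ \<kappa> u else 0)"
          using 2(2) c_le AL_c unfolding \<kappa>_def by auto
        moreover have "iv t2 vp = int p" using frs[OF 2(1)] 1(2) by (simp add: cc_def)
        ultimately have D2: "dpst t2" using B2 by (simp add: dpst_def)
        show ?case
        proof (rule ok_mono[OF DPINIT_ok[OF D2]], goal_cases)
          case (1 t3)
          then obtain pv pd dw where t3: "tabs t3 pv pd dw" "INV pv pd dw 0 (\<lambda>_ _ _. False)" by blast
          have D3: "dpst t3" by (rule dpst_fr[OF D2 1(1)]) auto
          show ?case
          proof (rule ok_mono[OF DPMAIN_ok[OF D3 t3]], goal_cases)
            case (1 t4)
            then obtain pv pd dw where t4: "tabs t4 pv pd dw" "INV pv pd dw p (\<lambda>D v j. v < n)" by blast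
            have D4: "dpst t4" by (rule dpst_fr[OF D3 1(1)]) auto
            have e4: "iv t4 vtc = iv s vtc" "ia t4 aTX = ia s aTX" "rv t4 rtot = rv s rtot" "iv t4 vbest = iv s vbest"
                "rv t4 rbest = rv s rbest" "iv t4 vsc = iv s vsc" "ia t4 aSV = ia s aSV"
              using frs[OF 1(1)] frs[OF \<open>fr DPINIT t2 t3\<close>] frs[OF \<open>fr NUM2 t1 t2\<close>] frs[OF \<open>fr NUM1 s t1\<close>] by auto
            have T4: "tm t4 \<le> tm s + (200 + 120 * ny + (60 + p * (60 + 40 * KB)) + (20 + p * (dpT + 4)))"
              using 1(2) \<open>_ \<and> tm t3 \<le> _\<close> \<open>_ \<and> tm t2 \<le> _\<close> \<open>_ \<and> _ \<and> tm t1 \<le> _\<close> by linarith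
            show ?case
            proof (rule ok_mono[OF SELECT_ok[OF D4 t4(1), of "length (XL m n)" "\<Sum>x\<leftarrow>XL m n. W ! x" b0 "rv s rbest"]], goal_cases)
              case (6 t5)
              obtain b1 where b1: "iv t5 vbest = of_bool b1" "b0 \<longrightarrow> b1 \<and> rv t5 rbest \<le> rv s rbest"
                "\<forall>j<KB - length (XL m n) + 1. 0 \<le> pv full j \<longrightarrow> b1 \<and> rv t5 rbest \<le> dw full j + (\<Sum>x\<leftarrow>XL m n. W ! x)"
                "iv t5 vbc = -1 \<and> b1 = b0 \<and> rv t5 rbest = rv s rbest \<or>
                 (\<exists>j<KB - length (XL m n) + 1. iv t5 vbc = int j \<and> 0 \<le> pv full j \<and> b1 \<and> rv t5 rbest = dw full j + (\<Sum>x\<leftarrow>XL m n. W ! x))"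
                using 6(2) unfolding seld_def by blast
              have e5: "iv t5 vtc = iv s vtc" "ia t5 aTX = ia s aTX" "iv t5 vsc = iv s vsc" "ia t5 aSV = ia s aSV"
                using frs[OF 6(1)] e4 by auto
              \<comment> \<open>The vertices of \<open>A m\<close>, the forced ones and a reaching
                list taken from \<open>X\<close> together form a subset of \<open>X\<close>. It
                obeys the budget and, weights being nonnegative, weighs at most as much as
                \<open>X\<close>, so the table entry for its length does too.\<close>
              have all: "b1 \<and> rv t5 rbest \<le> wt X" if X: "sol X" "card X \<le> KB" "X \<inter> Y = A m'" and m': "m' < Suc m" for X m'
              proof (cases "m' = m")
                case False
                then have "m' < m" using m' by simp
                then have "b0 \<and> rv s rbest \<le> wt X" using b0(2) X by blast
                then show ?thesis using b1(2) by auto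
              next
                case True
                obtain T where T: "sc.reach {..<cc} T" "set T \<subseteq> X - (A m \<union> forced (A m))" using sc.sol_reach[OF X(1)] X(3) True by blast
                have dT: "distinct T" using sc.reach_list[OF T(1)] by blast
                have XLX: "set (XL m n) \<subseteq> X" using sol_feas(2)[OF X(1)] X(3) True XL_set by simp
                have dis: "set (XL m n) \<inter> set T = {}" using T(2) XL_set by blast
                have fX: "finite X" using sol_lt[OF X(1)] finite_subset by blast
                have "card (set (XL m n) \<union> set T) \<le> card X" using XLX T(2) fX by (intro card_mono) auto
                then have len: "length (XL m n) + length T \<le> KB" using X(2) dis dT XL_dist
                  by (simp add: card_Un_disjoint distinct_card)
                then obtain D where D: "D < p" "bits D = {..<cc}" "0 \<le> pv D (length T)" "dw D (length T) \<le> (\<Sum>v\<leftarrow>T. W ! v)"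
                  using reach_tab[OF t4(2) T(1)] by auto
                have "D = full" using D(2) bits_full bits_eq by metis
                have "length T < KB - length (XL m n) + 1" using len by linarith
                moreover have "0 \<le> pv full (length T)" using D(3) \<open>D = full\<close> by simp
                ultimately have "b1 \<and> rv t5 rbest \<le> dw full (length T) + (\<Sum>x\<leftarrow>XL m n. W ! x)" using b1(3) by blast
                moreover have "(\<Sum>v\<leftarrow>T. W ! v) + (\<Sum>x\<leftarrow>XL m n. W ! x) = wt (set T \<union> set (XL m n))"
                  using dis dT XL_dist by (simp add: wt_list wt_def sum.union_disjoint Int_commute)
                moreover have "wt (set T \<union> set (XL m n)) \<le> wt X" using T(2) XLX sol_lt[OF X(1)] by (intro wt_mono) auto
                ultimately show ?thesis using D(4) \<open>D = full\<close> by auto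
              qed
              show ?case
              proof (cases "iv t5 vbc < 0")
                case True
                then have e: "b1 = b0" "rv t5 rbest = rv s rbest" using b1(4) by auto
                have q: "Q u" if "iv u = iv t5" "rv u = rv t5" "ia u = ia t5" "tm u \<le> tm t5 + 20" for u
                proof (rule Q, intro conjI)
                  show "best (Suc m) u" unfolding best_def that
                    by (rule exI[of _ b1]) (use b1(1) all b0(3) e e5 in auto)
                  show "tm u \<le> tm s + dpallT * card (lab_of (A m))" using that(4) 6(2) T4 time by linarith
                qed
                show ?thesis using True by (auto intro!: q)
              next
                case False
                then obtain j where j: "j < KB - length (XL m n) + 1" "iv t5 vbc = int j" "0 \<le> pv full j" "b1"
                   "rv t5 rbest = dw full j + (\<Sum>x\<leftarrow>XL m n. W ! x)" using b1(4) by auto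
                define w where "w = t5\<lparr>tm := tm t5 + 5\<rparr>"
                have D5: "dpst w" unfolding w_def by (rule dpst_fr[OF D4, of SELECT]) (use 6(1) in \<open>auto simp: fr_def\<close>)
                have tb5: "tabs w pv pd dw" using t4(1) frs[OF 6(1)] by (simp add: tabs_def w_def)
                let ?xs = "XL m n @ tr pv pd full j"
                have jK: "length (XL m n) + j \<le> KB" using j(1) s(5) by linarith
                have tr: "sc.reach {..<cc} (tr pv pd full j)" "length (tr pv pd full j) = j" "(\<Sum>v\<leftarrow>tr pv pd full j. W ! v) = dw full j"
                  using tr_reach[OF t4(2) full_lt _ j(3)] jK bits_full by auto
                have dxs: "distinct ?xs" using XL_dist XL_set sc.reach_list[OF tr(1)] A_Y by fastforce
                have sxs: "sol (set ?xs)" using sc.reach_sol[OF tr(1)] XL_set by simp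
                have wxs: "rv t5 rbest = wt (set ?xs)" using j(5) tr(3) wt_list[OF dxs] by simp
                have "ok EXTRACT w Q"
                proof (rule ok_mono[OF EXTRACT_ok[OF D5 tb5 t4(2), of "XL m n" j]], goal_cases)
                  case (6 u)
                  have e6: "iv u vbest = iv t5 vbest" "rv u rbest = rv t5 rbest" using frs[OF 6(1)] by (simp_all add: w_def)
                  show ?case
                  proof (rule Q, intro conjI)
                    have "\<exists>xs. distinct xs \<and> length xs \<le> KB \<and> sol (set xs) \<and> rv u rbest = wt (set xs) \<and>
                       iv u vsc = int (length xs) \<and> (\<forall>i<length xs. ia u aSV i = int (xs ! i))"
                      by (rule exI[of _ ?xs]) (use dxs sxs wxs e6 6(2) tr(2) jK in auto)
                    then show "best (Suc m) u" unfolding best_def using e6 b1(1) all j(4)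
                      by (intro exI[of _ b1]) auto
                    show "tm u \<le> tm s + dpallT * card (lab_of (A m))" using \<open>_ \<and> tm t5 \<le> _\<close> 6(2) T4 time by (simp add: w_def)
                  qed
                qed (use XLs e5 j jK in \<open>auto simp: w_def\<close>)
                then show ?thesis using False by (simp add: w_def)
              qed
            qed (use e4 XLs s(5) b0(1) in auto)
          qed
        qed
      qed
    qed
  qed
qed

end

section \<open>Trying all subsets in one stage\<close>

definition DECODE :: com where
  "DECODE = Put aal (N 0) (N 0) ;; When (Less (N 0) (V vbase)) (Put aal (N 0) (N 1)) ;; Asg vq (V vmask) ;;
     For vi (V vny) (Put aal (V vi \<oplus> N 1) (Parity (V vq)) ;; Asg vq (V vq \<oslash> N 2)) ;;
     For vi (V vny \<oplus> N 1) (Put acomp (V vi) (V vi)) ;; Asg vok (N 1) ;; Asg vtc (N 0) ;; RZero rtot"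

text \<open>The dynamic program runs only if the prescribed vertices fit the budget. This test also
  makes sure that the list in \<open>aTX\<close>, which holds at most \<open>KB\<close> entries, has
  not been cut off.\<close>

definition TRY :: com where
  "TRY = DECODE ;; For vv (V vn) VERT ;; When (Eq (V vok) (N 1)) (Unless (Less (V vKB) (V vtc)) DPALL)"

text \<open>The budget is \<open>k\<close> minus the number of kept pairs. The best solution is
  written into the list right after \<open>R\<close>, where it becomes the known cover for the next
  stage; failure is signaled by \<open>vcnt = -1\<close>.\<close>

definition SOLVE :: com where
  "SOLVE = Asg vny (V vlen \<ominus> V vbase) ;; Asg vKB (V vk \<ominus> V vj) ;; Asg vP (N 1) ;;
     For vi (V vny) (Asg vP (V vP \<otimes> N 2)) ;; Asg vbest (N 0) ;; For vmask (V vP) TRY ;;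
     Cond (Eq (V vbest) (N 1))
       (For vi (V vsc) (Put aLV (V vbase \<oplus> V vi) (Arr aSV (V vi))) ;; Asg vlen (V vbase \<oplus> V vsc))
       (Asg vcnt (N (-1)))"

lemma w_DECODE [simp]: "wv DECODE = {27, 28, 29, 30, 41}" "wa DECODE = {1, 2}" "wr DECODE = {0}" "wra DECODE = False"
  by (auto simp: DECODE_def)
lemma w_TRY [simp]: "wv TRY = {10, 13, 14, 15, 16, 17, 18, 19, 20, 21, 22, 23, 24, 25, 26, 27, 28, 29, 30, 31, 32, 33, 34, 35, 36, 37, 38, 39, 40, 41, 49}"
  "wa TRY = {1, 2, 3, 4, 5, 6, 7, 8}" "wr TRY = {0, 1, 2, 3, 4}" "wra TRY = True"
  by (auto simp: TRY_def)
lemma w_SOLVE [simp]: "wv SOLVE = {0, 6, 7, 8, 9, 11, 12} \<union> wv TRY" "wa SOLVE = {0, 1, 2, 3, 4, 5, 6, 7, 8}"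
  "wr SOLVE = {0, 1, 2, 3, 4}" "wra SOLVE = True"
  by (auto simp: SOLVE_def)

context solve
begin

lemma m_L: "(2::nat) ^ ny < L" "m < 2 ^ ny \<Longrightarrow> int m \<le> B"
proof -
  have "(2::nat) ^ ny * 2 \<le> L" by (rule pow_bounds(2)) simp
  moreover have "0 < (2::nat) ^ ny" by simp
  ultimately show "(2::nat) ^ ny < L" by linarith
  then show "m < 2 ^ ny \<Longrightarrow> int m \<le> B" using L_B by linarith
qed

lemma DECODE_ok:
  assumes s: "base_st s" "iv s vmask = int m" "m < 2 ^ ny"
  shows "ok DECODE s (\<lambda>t. alst m t \<and> scan m 0 t \<and> tm t \<le> tm s + 200 + 100 * ny)"
proof -
  have v: "iv s 5 = int base" "iv s 7 = int ny" using s by (auto simp: base_st_def lvs_def)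
  have mB: "int m \<le> B" using m_L s(3) by blast
  have K: "0 < L" "int ny \<le> B" using ny_L by linarith+
  show ?thesis
  proof (rule ok_gen)
    fix Q assume Q: "\<And>t. alst m t \<and> scan m 0 t \<and> tm t \<le> tm s + 200 + 100 * ny \<Longrightarrow> Q t"
    have main: "ok (Asg vq (V vmask) ;;
     For vi (V vny) (Put aal (V vi \<oplus> N 1) (Parity (V vq)) ;; Asg vq (V vq \<oslash> N 2)) ;;
     For vi (V vny \<oplus> N 1) (Put acomp (V vi) (V vi)) ;; Asg vok (N 1) ;; Asg vtc (N 0) ;; RZero rtot) u Q"
      if u: "iv u = iv s" "ia u 1 0 = (if 0 < base then 1 else 0)" "tm u \<le> tm s + 30" for u
    proof (simp, rule ok_For[where n = ny and T = "\<lambda>_. 40" and J = "\<lambda>i t. iv t vq = int (m div 2 ^ i) \<and>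
        ia t aal 0 = (if 0 < base then 1 else 0) \<and> (\<forall>j<i. ia t aal (Suc j) = of_bool (bit m j))"], goal_cases)
      case (7 i t)
      have "int (m div 2 ^ i) \<le> int m" by (simp add: div_le_dividend del: of_nat_power)
      then have b: "int (m div 2 ^ i) \<le> B" "0 \<le> int (m div 2 ^ i)" using mB by linarith+
      define z where "z = m div 2 ^ i"
      have "odd z \<longleftrightarrow> bit m i" by (simp add: z_def bit_iff_odd)
      then have zm: "z mod 2 = of_bool (bit m i)" by (cases "bit m i") (simp_all add: odd_iff_mod_2_eq_one even_iff_mod_2_eq_zero)
      have z2: "int z mod 2 = of_bool (bit m i)" unfolding zm[symmetric, THEN arg_cong[of _ _ int]] using zm
        by (metis (no_types, lifting) of_nat_numeral of_nat_of_bool zmod_int)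
      have z3: "int z div 2 = int (m div 2 ^ Suc i)"
      proof -
        have "z div 2 = m div 2 ^ Suc i" by (simp add: z_def div_mult2_eq[symmetric] mult.commute)
        then show ?thesis by (metis of_nat_numeral zdiv_int)
      qed
      have "int i + 1 \<le> B" "int i + 1 < int L" using 7(1) ny_L by linarith+
      moreover have "\<bar>int z div 2\<bar> \<le> B" using b unfolding z_def[symmetric] by linarith
      moreover have "nat (int i + 1) = Suc i" by simp
      moreover have "iv t vq = int z" using 7(4) by (simp add: z_def)
      ultimately show ?case using 7(3,4) b z2 z3 unfolding z_def[symmetric] by (auto simp: less_Suc_eq)
    next
      case (8 t)
      have al: "alst m t" unfolding alst_def
      proof (intro allI impI)
        fix i assume "i \<le> ny"
        then show "ia t aal i = (if AL m i then 1 else 0)" using 8(1) by (cases i) (auto simp: AL_def)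
      qed
      have vt: "iv t 7 = int ny" using frs[OF 8(2)] u v by simp
      show ?case
      proof (simp, rule ok_For[where n = "ny + 1" and T = "\<lambda>_. 20" and J = "\<lambda>i t. \<forall>j<i. ia t acomp j = int j"], goal_cases)
        case (7 i w)
        then show ?case using ny_L by (auto simp: less_Suc_eq)
      next
        case (8 w)
        have alw: "alst m w" by (rule alst_fr[OF al 8(2)]) simp
        have cp: "cpst (\<lambda>i. i) w" using 8(1) by (simp add: cpst_def)
        show ?case
        proof (simp, rule Q, intro conjI, goal_cases)
          case 1 then show ?case using alw by (simp add: alst_def)
        next
          case 2
          have "cpst (\<lambda>i. i) (w\<lparr>iv := (iv w)(29 := 1, 30 := 0), tm := Suc (tm w + 6), rv := (rv w)(0 := 0)\<rparr>)"
            using cp by (simp add: cpst_def)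
          then show ?case using cgood_id[of m] cp by (auto simp: scan_def XL_0 cpst_def intro!: exI[of _ "\<lambda>i. i"])
        next
          case 3 then show ?case using 8(3) \<open>tm t \<le> _\<close> u(3) by simp
        qed
      qed (use vt K ny_L in auto)
    qed (use u v s(2) in auto)
    show "ok DECODE s Q"
    proof -
      have "ok (DECODE) s Q" if "0 < base"
        unfolding DECODE_def ok_Seq[of "Put aal (N 0) (N 0)"] ok_Seq[of "When _ _"]
        using that main[of "s\<lparr>ia := (ia s)(1 := (ia s 1)(0 := 1)), tm := tm s + 19\<rparr>"] v K
        by simp
      moreover have "ok (DECODE) s Q" if "base = 0"
        unfolding DECODE_def ok_Seq[of "Put aal (N 0) (N 0)"] ok_Seq[of "When _ _"]
        using that main[of "s\<lparr>ia := (ia s)(1 := (ia s 1)(0 := 0)), tm := tm s + 12\<rparr>"] v K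
        by simp
      ultimately show ?thesis by blast
    qed
  qed
qed

definition tryT :: nat where "tryT = 300 + 100 * ny + scanT"

lemma TRY_ok:
  assumes s: "base_st s" "iv s vmask = int m" "m < 2 ^ ny" "best m s"
  shows "ok TRY s (\<lambda>t. best (Suc m) t \<and> tm t \<le> tm s + (tryT + dpallT * card (lab_of (A m))))"
proof (rule ok_gen)
  fix Q :: "state \<Rightarrow> bool"
  assume Q: "\<And>t. best (Suc m) t \<and> tm t \<le> tm s + (tryT + dpallT * card (lab_of (A m))) \<Longrightarrow> Q t"
  show "ok TRY s Q" unfolding TRY_def ok_Seq
  proof (rule ok_mono[OF DECODE_ok[OF s(1-3)]], goal_cases)
    case (1 t1)
    have B1: "base_st t1" by (rule base_st_fr[OF s(1) 1(1)]) auto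
    have al1: "alst m t1" "scan m 0 t1" using 1(2) by auto
    show ?case
    proof (rule ok_mono[OF SCAN_ok[OF B1 al1]], goal_cases)
      case (1 t)
      have B: "base_st t" by (rule base_st_fr[OF B1 1(1)]) auto
      have al: "alst m t" by (rule alst_fr[OF al1(1) 1(1)]) auto
      have sc: "scan m n t" using 1(2) by simp
      have T: "tm t \<le> tm s + 200 + 100 * ny + scanT" using 1(2) \<open>alst m t1 \<and> _\<close> by linarith
      have bt: "best m t" using s(4) frs[OF 1(1)] frs[OF \<open>fr DECODE s t1\<close>] by (simp add: best_def)
      have v: "iv t vKB = int KB" "iv t vtc = int (length (XL m n))" "iv t vok = of_bool (feas (A m))"
        using B sc by (auto simp: base_st_def scan_def feas_okv)
      show ?case
      proof (cases "feas (A m) \<and> length (XL m n) \<le> KB")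
        case True
        define w where "w = t\<lparr>tm := tm t + 11\<rparr>"
        have "base_st w" "alst m w" "scan m n w" "best m w" using B al sc bt
          by (simp_all add: w_def base_st_def lvs_def alst_def scan_def cpst_def best_def)
        note nf = this
        have "ok DPALL w Q"
        proof (rule ok_mono[OF DPALL_ok[OF nf(1-3) _ _ nf(4)]], goal_cases)
          case (3 u) then show ?case using T by (intro Q) (simp add: w_def tryT_def)
        qed (use True in auto)
        then show ?thesis using True v by (simp add: w_def add.commute)
      next
        case False
        \<comment> \<open>If the subset is infeasible or its prescribed vertices exceed the budget,
          no admissible solution has this trace, so the record remains correct.\<close>
        have no: "\<not> (sol X \<and> card X \<le> KB \<and> X \<inter> Y = A m)" for X
        proof
          assume X: "sol X \<and> card X \<le> KB \<and> X \<inter> Y = A m"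
          then have f: "feas (A m)" "A m \<union> forced (A m) \<subseteq> X" using sol_feas[of X] by auto
          have "finite X" using sol_lt X finite_subset by blast
          then have "card (A m \<union> forced (A m)) \<le> card X" using f(2) by (intro card_mono)
          moreover have "length (XL m n) = card (A m \<union> forced (A m))" using XL_set XL_dist distinct_card by metis
          ultimately show False using False f X by simp
        qed
        have q: "Q u" if "iv u = iv t" "rv u = rv t" "ia u = ia t" "tm u \<le> tm t + 20" for u
        proof (rule Q, intro conjI)
          have "(\<forall>m'<Suc m. \<forall>X. sol X \<longrightarrow> card X \<le> KB \<longrightarrow> X \<inter> Y = A m' \<longrightarrow> b \<and> rv t rbest \<le> wt X) \<longleftrightarrow>
             (\<forall>m'<m. \<forall>X. sol X \<longrightarrow> card X \<le> KB \<longrightarrow> X \<inter> Y = A m' \<longrightarrow> b \<and> rv t rbest \<le> wt X)" for b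
            using no by (auto simp only: less_Suc_eq)
          then show "best (Suc m) u" using bt unfolding best_def that by presburger
          show "tm u \<le> tm s + (tryT + dpallT * card (lab_of (A m)))" using that(4) T by (simp add: tryT_def)
        qed
        show ?thesis using False v by (cases "feas (A m)") (auto intro!: q)
      qed
    qed
  qed
qed

lemma card_Y: "card Y = ny" and finY: "finite Y"
proof -
  have "inj_on lv {base..<len}" using inj_lv by (rule inj_on_subset) auto
  then show "card Y = ny" by (simp add: Y_def ny_def card_image)
  show "finite Y" by (simp add: Y_def)
qed

lemma A_bij: "bij_betw A {..<2 ^ ny} (Pow Y)"
proof -
  have inj: "inj_on A {..<2 ^ ny}"
  proof (rule inj_onI)
    fix m m' assume m: "m \<in> {..<2 ^ ny}" "m' \<in> {..<2 ^ ny}" and e: "A m = A m'"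
    show "m = m'"
    proof (rule bit_eqI)
      fix i
      show "bit m i \<longleftrightarrow> bit m' i"
      proof (cases "i < ny")
        case True
        then have "base \<le> base + i" "base + i < len" by (auto simp: ny_def)
        then show ?thesis using lv_A[of "base + i" m] lv_A[of "base + i" m'] e by simp
      next
        case False
        then have "(2::nat) ^ ny \<le> 2 ^ i" by simp
        then have "m < 2 ^ i" "m' < 2 ^ i" using m by (auto intro: less_le_trans)
        then show ?thesis by (simp add: bit_iff_odd)
      qed
    qed
  qed
  have "card (A ` {..<2 ^ ny}) = card (Pow Y)" using inj by (simp add: card_image card_Pow finY card_Y)
  then have "A ` {..<2 ^ ny} = Pow Y" using A_Y finY by (intro card_subset_eq) auto
  then show ?thesis using inj by (simp add: bij_betw_def)
qed

definition solveT :: nat where "solveT = 300 + 50 * ny + 40 * k + 2 ^ ny * (tryT + 4 + 3 * dpallT)"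

text \<open>The masks below \<open>2 ^ ny\<close> enumerate the subsets of \<open>Y\<close>, so the
  expensive part is paid once per labeling, at most \<open>3 * 2 ^ ny\<close> times altogether,
  instead of once per row of a worst-case table.\<close>

lemma sum_try: "(\<Sum>m<2 ^ ny. tryT + dpallT * card (lab_of (A m)) + 4) \<le> 2 ^ ny * (tryT + 4 + 3 * dpallT)"
proof -
  have "(\<Sum>m<2 ^ ny. card (lab_of (A m))) = (\<Sum>a\<in>Pow Y. card (lab_of a))" by (rule sum.reindex_bij_betw[OF A_bij])
  also have "\<dots> \<le> 3 * 2 ^ ny" using sum_lab_of by (simp add: card_Y)
  finally have "dpallT * (\<Sum>m<2 ^ ny. card (lab_of (A m))) \<le> dpallT * (3 * 2 ^ ny)" by (rule mult_le_mono2)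
  then show ?thesis by (simp add: sum.distrib sum_distrib_left[symmetric] algebra_simps)
qed

lemma SOLVE_ok:
  assumes s: "lvs lv len base s" "iv s vj + int KB = int k"
  shows "ok SOLVE s (\<lambda>t. (if \<exists>X. sol X \<and> card X \<le> KB then iv t vcnt = iv s vcnt \<and>
      (\<exists>xs. distinct xs \<and> length xs \<le> KB \<and> sol (set xs) \<and> (\<forall>X. sol X \<and> card X \<le> KB \<longrightarrow> wt (set xs) \<le> wt X) \<and>
         (\<forall>i<base. ia t aLV i = int (lv i)) \<and> (\<forall>i<length xs. ia t aLV (base + i) = int (xs ! i)) \<and> iv t vlen = int (base + length xs))
      else iv t vcnt = -1) \<and> tm t \<le> tm s + solveT)" (is "ok SOLVE s ?P")
proof (rule ok_gen)
  fix Q :: "state \<Rightarrow> bool" assume Q: "\<And>t. ?P t \<Longrightarrow> Q t"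
  have v: "iv s 6 = int len" "iv s 5 = int base" "iv s (Suc 0) = int k" "iv s 2 = int n" and LV: "\<And>t. t < len \<Longrightarrow> ia s aLV t = int (lv t)"
    and lL: "len \<le> L" using s by (auto simp: lvs_def)
  have nyi: "int len - int base = int ny" using base_len by (simp add: ny_def)
  have KBi: "int k - iv s 4 = int KB" using s(2) by linarith
  have kB: "int k \<le> B" "int len \<le> B" using bigB lL L_B by linarith+
  have K: "int ny \<le> B" "int KB \<le> B" using kB nyi KB_k by linarith+
  have bKB: "base + KB < L"
  proof -
    have "8 * (k + 2) \<le> 2 ^ (k + 3) * (k + 2)" by (intro mult_le_mono1) (simp add: power_add)
    then have "8 * (k + 2) \<le> L" using bigL by (rule order_trans)
    then have "8 * k + 16 \<le> L" by simp
    then show ?thesis using base_len len_k KB_k by linarith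
  qed
  show "ok SOLVE s Q" unfolding SOLVE_def
  proof (simp add: v nyi KBi K, rule ok_For[where n = ny and T = "\<lambda>_. 10" and J = "\<lambda>i t. iv t vP = 2 ^ i"], goal_cases)
    case (7 i t)
    have "(2::nat) ^ Suc i \<le> 2 ^ ny" using 7(1) by (intro power_increasing) auto
    then have "(2::nat) ^ Suc i < L" using m_L by linarith
    then have "int (2 ^ Suc i) \<le> B" using L_B by linarith
    then show ?case using 7(4) by simp
  next
    case (8 t)
    define w where "w = t\<lparr>iv := (iv t)(10 := 0), tm := Suc (Suc (Suc (tm t)))\<rparr>"
    have e: "iv t vny = int ny" "iv t vKB = int KB" "iv t 6 = int len" "iv t 5 = int base" "iv t 1 = int k" "iv t 2 = int n"
      "ia t = ia s" "iv t vcnt = iv s vcnt" using frs[OF 8(2)] v by (auto simp: fun_eq_iff)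
    have B: "base_st w" using e s(1) by (simp add: w_def base_st_def lvs_def)
    have Tw: "tm w \<le> tm s + 50 + 14 * ny" using 8(3) by (simp add: w_def)
    have "(2::int) ^ ny = int (2 ^ ny)" by simp
    then have vP: "iv w vP = int (2 ^ ny)" using 8(1) by (simp add: w_def)
    have "ok (For vmask (V vP) TRY) w (\<lambda>t. ok (Cond (Eq (V vbest) (N 1))
       (For vi (V vsc) (Put aLV (V vbase \<oplus> V vi) (Arr aSV (V vi))) ;; Asg vlen (V vbase \<oplus> V vsc))
       (Asg vcnt (N (-1)))) t Q)"
    proof (rule ok_For[where n = "2 ^ ny" and T = "\<lambda>m. tryT + dpallT * card (lab_of (A m))" and J = best], goal_cases)
      case 5 then show ?case by (auto simp: best_def w_def)
    next
      case (6 i t y z w) then show ?case by (simp add: best_def)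
    next
      case (7 m t)
      have "base_st t" by (rule base_st_fr[OF B 7(2)]) auto
      then show ?case using 7 by (intro TRY_ok)
    next
      case (8 u)
      have Tu: "tm u \<le> tm s + 60 + 14 * ny + 2 ^ ny * (tryT + 4 + 3 * dpallT)"
        using 8(3) Tw sum_try by simp
      have Bu: "base_st u" by (rule base_st_fr[OF B 8(2)]) auto
      have eu: "iv u vcnt = iv s vcnt" "iv u 5 = int base" "ia u aLV = ia s aLV" using frs[OF 8(2)] e by (simp_all add: w_def)
      obtain b where b: "iv u vbest = of_bool b" "\<forall>m<2 ^ ny. \<forall>X. sol X \<longrightarrow> card X \<le> KB \<longrightarrow> X \<inter> Y = A m \<longrightarrow> b \<and> rv u rbest \<le> wt X"
        "b \<longrightarrow> (\<exists>xs. distinct xs \<and> length xs \<le> KB \<and> sol (set xs) \<and> rv u rbest = wt (set xs) \<and>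
        iv u vsc = int (length xs) \<and> (\<forall>i<length xs. ia u aSV i = int (xs ! i)))" using 8(1) unfolding best_def by blast
      have all: "b \<and> rv u rbest \<le> wt X" if "sol X" "card X \<le> KB" for X
      proof -
        \<comment> \<open>The trace of any solution on \<open>Y\<close> is the set of some mask, so
          trying all masks misses nothing.\<close>
        have "X \<inter> Y \<in> A ` {..<2 ^ ny}" using A_bij by (auto simp: bij_betw_def)
        then show ?thesis using b(2) that by blast
      qed
      show ?case
      proof (cases b)
        case False
        then have no: "\<not> (\<exists>X. sol X \<and> card X \<le> KB)" using all by blast
        show ?thesis using b(1) False Tu by (simp, intro Q) (simp add: no solveT_def)
      next
        case True
        then obtain xs where xs: "distinct xs" "length xs \<le> KB" "sol (set xs)" "rv u rbest = wt (set xs)"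
          "iv u vsc = int (length xs)" "\<forall>i<length xs. ia u aSV i = int (xs ! i)" using b(3) by blast
        have ex: "\<exists>X. sol X \<and> card X \<le> KB" using xs(1-3) by (metis distinct_card)
        have lB: "int base + int (length xs) \<le> B" using bKB xs(2) L_B kB base_len KB_k by linarith
        have blt: "i < length xs \<Longrightarrow> base + i < L" "i < length xs \<Longrightarrow> i < L" for i using bKB xs(2) by linarith+
        show ?thesis using b(1) True
        proof (simp, goal_cases)
          case 1
          show ?case
          proof (rule ok_For[where n = "length xs" and T = "\<lambda>_. 25" and
              J = "\<lambda>i t. (\<forall>j<base. ia t aLV j = int (lv j)) \<and> (\<forall>j<i. ia t aLV (base + j) = int (xs ! j))"], goal_cases)
            case (7 i t)
            have "iv t 5 = int base" "ia t aSV = ia u aSV" using frs[OF 7(2)] eu by simp_all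
            moreover have "int base + int i < int L" "int i < int L" "int base + int i \<le> B" using blt[OF 7(1)] L_B by linarith+
            moreover have "nat (int base + int i) = base + i" by linarith
            ultimately show ?case using 7 xs(6) by (auto simp: less_Suc_eq)
          next
            case (8 t)
            have et: "iv t 5 = int base" "iv t vsc = int (length xs)" "iv t vcnt = iv s vcnt" using frs[OF 8(2)] eu xs(5) by simp_all
            have Tt: "tm t \<le> tm s + (100 + 14 * ny + 29 * k) + 2 ^ ny * (tryT + 4 + 3 * dpallT)"
              using 8(3) Tu xs(2) KB_k by simp
            define w where "w = t\<lparr>iv := (iv t)(6 := int base + int (length xs)), tm := tm t + 7\<rparr>"
            have "?P w" unfolding if_P[OF ex]
              by (intro conjI exI[of _ xs]) (use xs et 8(1) all Tt in \<open>auto simp: w_def solveT_def\<close>)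
            then have "Q w" by (rule Q)
            then show ?case using et lB by (simp add: w_def)
          qed (use xs eu base_len LV in auto)
        qed
      qed
    qed (use vP in auto)
    then show ?case by (simp add: w_def)
  qed (use v K in auto)
qed

end

section \<open>Growing a connected set of pairs\<close>

definition NBR :: com where
  "NBR = Cond (Less (V vd) (N 0)) (Asg vfr (N 1) ;; Asg vy (V vu)) (Asg vhas (N 1))"

text \<open>For a vertex outside the list, \<open>vfr\<close> reports a neighbor outside as well,
  that is, an edge avoiding the list, and \<open>vhas\<close> a neighbor inside. Only the
  combination gives a new pair; an avoided edge alone is noted in \<open>vbad\<close>.\<close>

definition PROBE :: com where
  "PROBE = Asg vu (V vv) ;; LOOK ;; When (Less (V vd) (N 0))
     (Asg vhas (N 0) ;; Asg vfr (N 0) ;; FORNB NBR ;;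
      When (Eq (V vfr) (N 1)) (Asg vbad (N 1) ;;
        When (Eq (V vhas) (N 1)) (Asg vfound (N 1) ;; Asg vx (V vv) ;; Asg vz (V vy))))"

text \<open>The flag \<open>vbad\<close> describes the list before a pair is appended, so it is
  meaningful only if nothing has been found.\<close>

definition SEARCH :: com where
  "SEARCH = Asg vfound (N 0) ;; Asg vbad (N 0) ;; For vv (V vn) PROBE ;;
     When (Eq (V vfound) (N 1))
       (Put aLV (V vlen) (V vx) ;; Put aLV (V vlen \<oplus> N 1) (V vz) ;; Asg vlen (V vlen \<oplus> N 2) ;; Asg vl (V vl \<oplus> N 1))"

lemma w_NBR [simp]: "wv NBR = {26, 44, 45}" "wa NBR = {}" "wr NBR = {}" "wra NBR = False"
  by (auto simp: NBR_def)
lemma w_PROBE [simp]: "wv PROBE = {13, 14, 15, 18, 19, 20, 25, 26, 42, 43, 44, 45, 50}" "wa PROBE = {}" "wr PROBE = {}" "wra PROBE = False"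
  by (auto simp: PROBE_def)
lemma w_SEARCH [simp]: "wv SEARCH = {3, 6, 16, 17} \<union> wv PROBE" "wa SEARCH = {0}" "wr SEARCH = {}" "wra SEARCH = False"
  by (auto simp: SEARCH_def)

context prog
begin

lemma ok_gen: "(\<And>Q. (\<And>t. P t \<Longrightarrow> Q t) \<Longrightarrow> ok p s Q) \<Longrightarrow> ok p s P"
  by blast

lemma ex_Suc: "(\<exists>v<Suc i. P v) \<longleftrightarrow> (\<exists>v<i. P v) \<or> P i"
  by (auto simp: less_Suc_eq)

text \<open>The endpoints of edges that are not covered by \<open>Q\<close>.\<close>

definition outer :: "nat set \<Rightarrow> nat \<Rightarrow> bool" where
  "outer Q v \<longleftrightarrow> v < n \<and> v \<notin> Q \<and> (\<exists>u. ad v u \<and> u \<notin> Q)"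

definition fringe :: "nat set \<Rightarrow> nat \<Rightarrow> bool" where
  "fringe Q v \<longleftrightarrow> outer Q v \<and> (\<exists>u\<in>Q. ad v u)"

definition probed :: "nat set \<Rightarrow> nat \<Rightarrow> state \<Rightarrow> bool" where
  "probed Q i t \<longleftrightarrow> iv t vbad = of_bool (\<exists>v<i. outer Q v) \<and> iv t vfound = of_bool (\<exists>v<i. fringe Q v) \<and>
     ((\<exists>v<i. fringe Q v) \<longrightarrow> (\<exists>x y. iv t vx = int x \<and> iv t vz = int y \<and> fringe Q x \<and> y \<notin> Q \<and> ad x y))"

lemma ad_nth: "v < n \<Longrightarrow> ad v u \<longleftrightarrow> (\<exists>i<deg v. adj ! v ! i = u)"
  by (auto simp: ad_def in_set_conv_nth)

lemma NB_ok:
  assumes l: "lvs lv len 0 s" and v: "iv s vv = int v" "v < n" and i: "iv s vhas = 0" "iv s vfr = 0"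
  shows "ok (FORNB NBR) s (\<lambda>t. iv t vhas = of_bool (\<exists>u\<in>lv ` {..<len}. ad v u) \<and>
     iv t vfr = of_bool (\<exists>u. ad v u \<and> u \<notin> lv ` {..<len}) \<and>
     ((\<exists>u. ad v u \<and> u \<notin> lv ` {..<len}) \<longrightarrow> (\<exists>y. iv t vy = int y \<and> y \<notin> lv ` {..<len} \<and> ad v y)) \<and>
     tm t \<le> tm s + 20 + deg v * (50 + CL len))"
proof (rule ok_gen)
  let ?Q = "lv ` {..<len}"
  fix Q :: "state \<Rightarrow> bool" assume Q: "\<And>t. iv t vhas = of_bool (\<exists>u\<in>?Q. ad v u) \<and>
     iv t vfr = of_bool (\<exists>u. ad v u \<and> u \<notin> ?Q) \<and>
     ((\<exists>u. ad v u \<and> u \<notin> ?Q) \<longrightarrow> (\<exists>y. iv t vy = int y \<and> y \<notin> ?Q \<and> ad v y)) \<and>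
     tm t \<le> tm s + 20 + deg v * (50 + CL len) \<Longrightarrow> Q t"
  show "ok (FORNB NBR) s Q"
  proof (rule ok_FORNB[OF l v, where T = 20 and J = "\<lambda>i t. iv t vhas = of_bool (\<exists>j<i. adj ! v ! j \<in> ?Q) \<and>
      iv t vfr = of_bool (\<exists>j<i. adj ! v ! j \<notin> ?Q) \<and> ((\<exists>j<i. adj ! v ! j \<notin> ?Q) \<longrightarrow> (\<exists>y. iv t vy = int y \<and> y \<notin> ?Q \<and> ad v y))"], goal_cases)
    case (5 i t)
    have a: "ad v (adj ! v ! i)" using ad_nth[OF v(2)] 5(1) by blast
    show ?case
    proof (cases "adj ! v ! i \<in> ?Q")
      case True
      then have "\<not> iv t vd < 0" using 5(3) cl_neg_iff[of lv len 0 "adj ! v ! i"] by simp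
      note d = this
      show ?thesis
      proof (rule ok_gen, goal_cases)
        case (1 Q')
        show ?case unfolding NBR_def using d by (simp, intro 1) (use 5 True in \<open>auto simp: ex_Suc\<close>)
      qed
    next
      case False
      then have "iv t vd < 0" using 5(3) cl_neg_iff[of lv len 0 "adj ! v ! i"] by simp
      note d = this
      show ?thesis
      proof (rule ok_gen, goal_cases)
        case (1 Q')
        show ?case unfolding NBR_def using d by (simp, intro 1) (use 5 False a in \<open>auto simp: ex_Suc\<close>)
      qed
    qed
  next
    case (6 t)
    have "(\<exists>j<deg v. adj ! v ! j \<in> ?Q) \<longleftrightarrow> (\<exists>u\<in>?Q. ad v u)" "(\<exists>j<deg v. adj ! v ! j \<notin> ?Q) \<longleftrightarrow> (\<exists>u. ad v u \<and> u \<notin> ?Q)"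
      unfolding ad_nth[OF v(2)] by blast+
    then show ?case using 6(1,3) by (intro Q) simp
  qed (use i in auto)
qed

lemma PROBE_ok:
  assumes l: "lvs lv len 0 s" and v: "iv s vv = int v" "v < n" and p: "probed (lv ` {..<len}) v s"
  shows "ok PROBE s (\<lambda>t. probed (lv ` {..<len}) (Suc v) t \<and> tm t \<le> tm s + (100 + CL len + deg v * (50 + CL len)))"
proof (rule ok_gen)
  let ?Q = "lv ` {..<len}"
  fix Q :: "state \<Rightarrow> bool" assume Q: "\<And>t. probed ?Q (Suc v) t \<and> tm t \<le> tm s + (100 + CL len + deg v * (50 + CL len)) \<Longrightarrow> Q t"
  define s1 where "s1 = s\<lparr>iv := (iv s)(20 := int v), tm := tm s + 4\<rparr>"
  have l1: "lvs lv len 0 s1" using l by (simp add: s1_def lvs_def)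
  have "ok LOOK s1 (\<lambda>t. ok (When (Less (V vd) (N 0))
     (Asg vhas (N 0) ;; Asg vfr (N 0) ;; FORNB NBR ;;
      When (Eq (V vfr) (N 1)) (Asg vbad (N 1) ;;
        When (Eq (V vhas) (N 1)) (Asg vfound (N 1) ;; Asg vx (V vv) ;; Asg vz (V vy))))) t Q)"
  proof (rule ok_mono[OF LOOK_ok[OF l1, of v]], goal_cases)
    case (2 t)
    have e: "iv t vv = int v" "iv t vbad = iv s vbad" "iv t vfound = iv s vfound" "iv t vx = iv s vx" "iv t vz = iv s vz"
      using frs[OF 2(1)] v by (simp_all add: s1_def)
    have lt: "lvs lv len 0 t" by (rule lvs_fr[OF l1 2(1)]) auto
    have Tt: "tm t \<le> tm s + 4 + CL len" using 2(2) by (simp add: s1_def)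
    show ?case
    proof (cases "v \<in> ?Q")
      case True
      then have d: "\<not> iv t vd < 0" using 2(2) cl_neg_iff[of lv len 0 v] by simp
      have q: "Q u" if u: "iv u = iv t" "tm u \<le> tm t + 10" for u
      proof (rule Q, intro conjI)
        have "\<not> outer ?Q v" "\<not> fringe ?Q v" using True by (auto simp: outer_def fringe_def)
        then show "probed ?Q (Suc v) u" using p e u by (simp add: probed_def ex_Suc)
        show "tm u \<le> tm s + (100 + CL len + deg v * (50 + CL len))" using u Tt by simp
      qed
      show ?thesis using d by (simp add: q)
    next
      case False
      then have d: "iv t vd < 0" using 2(2) cl_neg_iff[of lv len 0 v] by simp
      define w where "w = t\<lparr>iv := (iv t)(44 := 0, 45 := 0), tm := 11 + tm t\<rparr>"
      have lw: "lvs lv len 0 w" using lt by (simp add: w_def lvs_def)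
      have "ok (FORNB NBR) w (\<lambda>t. ok (When (Eq (V vfr) (N 1)) (Asg vbad (N 1) ;;
        When (Eq (V vhas) (N 1)) (Asg vfound (N 1) ;; Asg vx (V vv) ;; Asg vz (V vy)))) t Q)"
      proof (rule ok_mono[OF NB_ok[OF lw _ v(2)]], goal_cases)
        case (4 u)
        have eu: "iv u vv = int v" "iv u vbad = iv s vbad" "iv u vfound = iv s vfound" "iv u vx = iv s vx" "iv u vz = iv s vz"
          using frs[OF 4(1)] e by (simp_all add: w_def)
        have o: "outer ?Q v \<longleftrightarrow> (\<exists>u. ad v u \<and> u \<notin> ?Q)" using False v by (simp add: outer_def)
        have Tu: "tm u \<le> tm s + 40 + CL len + deg v * (50 + CL len)" using 4(2) Tt by (simp add: w_def)
        show ?case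
        proof (cases "outer ?Q v")
          case no: False
          have q: "Q x" if x: "iv x = iv u" "tm x \<le> tm u + 10" for x
          proof (rule Q, intro conjI)
            have "\<not> fringe ?Q v" using no by (auto simp: fringe_def)
            then show "probed ?Q (Suc v) x" using p eu x no by (simp add: probed_def ex_Suc)
            show "tm x \<le> tm s + (100 + CL len + deg v * (50 + CL len))" using x Tu by simp
          qed
          have "iv u vfr = 0" using 4(2) no o by simp
          then show ?thesis by (simp add: q)
        next
          case out: True
          then obtain y where y: "iv u vy = int y" "y \<notin> ?Q" "ad v y" using 4(2) o by blast
          have fr: "iv u vfr = 1" using 4(2) out o by simp
          have fg: "fringe ?Q v \<longleftrightarrow> (\<exists>u\<in>?Q. ad v u)" using out by (simp add: fringe_def)
          show ?thesis
          proof (cases "fringe ?Q v")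
            case True
            have q: "Q x" if x: "iv x = (iv u)(43 := 1, 42 := 1, 25 := int v, 50 := int y)" "tm x \<le> tm u + 40" for x
            proof (rule Q, intro conjI)
              show "probed ?Q (Suc v) x" unfolding probed_def x ex_Suc using True out y
                by auto
              show "tm x \<le> tm s + (100 + CL len + deg v * (50 + CL len))" using x Tu by simp
            qed
            have "iv u vhas = 1" using 4(2) True fg by simp
            then show ?thesis using fr eu(1) y(1) by (simp, intro q) auto
          next
            case nf: False
            have q: "Q x" if x: "iv x = (iv u)(43 := 1)" "tm x \<le> tm u + 40" for x
            proof (rule Q, intro conjI)
              show "probed ?Q (Suc v) x" using p eu x out nf by (auto simp: probed_def ex_Suc)
              show "tm x \<le> tm s + (100 + CL len + deg v * (50 + CL len))" using x Tu by simp
            qed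
            have "iv u vhas = 0" using 4(2) nf fg by simp
            then show ?thesis using fr by (simp, intro q) auto
          qed
        qed
      qed (use e in \<open>auto simp: w_def\<close>)
      then show ?thesis using d by (simp add: w_def)
    qed
  qed (simp add: s1_def)
  then show "ok PROBE s Q" unfolding PROBE_def using v by (simp add: s1_def)
qed

definition searchT :: "nat \<Rightarrow> nat" where
  "searchT len = 100 + (\<Sum>v<n. 100 + CL len + deg v * (50 + CL len) + 4)"

text \<open>Connectedness is demanded of every prefix, because the pairs are later released from the
  end and what remains must still be connected.\<close>

definition pairs :: "(nat \<Rightarrow> nat) \<Rightarrow> nat \<Rightarrow> bool" where
  "pairs lv l \<longleftrightarrow> inj_on lv {..<2 * l} \<and> (\<forall>i<l. ad (lv (2 * i)) (lv (2 * i + 1))) \<and> (\<forall>j\<le>l. conn (lv ` {..<2 * j}))"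

definition pst :: "(nat \<Rightarrow> nat) \<Rightarrow> nat \<Rightarrow> state \<Rightarrow> bool" where
  "pst lv l t \<longleftrightarrow> lvs lv (2 * l) 0 t \<and> iv t vl = int l \<and> pairs lv l"

lemma pairs_ext:
  assumes p: "pairs lv l" and f: "fringe (lv ` {..<2 * l}) x" "y \<notin> lv ` {..<2 * l}" "ad x y"
  shows "pairs (lv(2 * l := x, Suc (2 * l) := y)) (Suc l)"
proof -
  let ?g = "lv(2 * l := x, Suc (2 * l) := y)"
  have xy: "x \<noteq> y" using f(3) ad_irr by auto
  obtain u where u: "u \<in> lv ` {..<2 * l}" "ad x u" using f(1) by (auto simp: fringe_def)
  have img: "?g ` {..<2 * j} = lv ` {..<2 * j}" if "j \<le> l" for j using that by (intro image_cong) auto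
  have img2: "?g ` {..<2 * Suc l} = insert y (insert x (lv ` {..<2 * l}))"
  proof -
    have e: "{..<2 * Suc l} = insert (Suc (2 * l)) (insert (2 * l) {..<2 * l})" by auto
    show ?thesis unfolding e image_insert img[OF order_refl] by simp
  qed
  have "conn (lv ` {..<2 * l})" using p by (simp add: pairs_def)
  then have "conn (insert y (insert x (lv ` {..<2 * l})))"
    using conn_insert[of _ u x] conn_insert[of "insert x (lv ` {..<2 * l})" x y] u ad_sym f(3) by blast
  then have c: "conn (?g ` {..<2 * j})" if "j \<le> Suc l" for j
    using that img[of j] img2 p by (cases "j = Suc l") (auto simp: pairs_def)
  have "inj_on lv {..<2 * l}" using p by (simp add: pairs_def)
  moreover have "x \<notin> lv ` {..<2 * l}" using f(1) by (simp add: fringe_def outer_def)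
  ultimately have "inj_on ?g {..<2 * Suc l}"
    using xy f(2) by (auto simp: inj_on_def less_Suc_eq)
  moreover have "ad (?g (2 * i)) (?g (2 * i + 1))" if "i < Suc l" for i
    using that p f(3) by (cases "i = l") (auto simp: pairs_def)
  ultimately show ?thesis using c unfolding pairs_def by blast
qed

lemma k_L': "2 * k + 4 \<le> L"
proof -
  have "8 * (k + 2) \<le> 2 ^ (k + 3) * (k + 2)" by (intro mult_le_mono1) (simp add: power_add)
  then have "8 * (k + 2) \<le> L" using bigL by (rule order_trans)
  then show ?thesis by simp
qed

lemma SEARCH_ok:
  assumes s: "pst lv l s" and lk: "l \<le> k"
  shows "ok SEARCH s (\<lambda>t. (if \<exists>v. fringe (lv ` {..<2 * l}) v then \<exists>lv'. pst lv' (Suc l) t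
      else pst lv l t \<and> iv t vbad = of_bool (\<exists>v. outer (lv ` {..<2 * l}) v)) \<and> tm t \<le> tm s + searchT (2 * l))" (is "ok SEARCH s ?P")
proof (rule ok_gen)
  let ?Q = "lv ` {..<2 * l}"
  fix Q :: "state \<Rightarrow> bool" assume Q: "\<And>t. ?P t \<Longrightarrow> Q t"
  have l: "lvs lv (2 * l) 0 s" "iv s vl = int l" "pairs lv l" using s by (auto simp: pst_def)
  define w where "w = s\<lparr>iv := (iv s)(42 := 0, 43 := 0), tm := Suc (Suc (Suc (Suc (Suc (Suc (tm s))))))\<rparr>"
  have lw: "lvs lv (2 * l) 0 w" using l by (simp add: w_def lvs_def)
  have "ok (For vv (V vn) PROBE) w (\<lambda>t. ok (When (Eq (V vfound) (N 1))
       (Put aLV (V vlen) (V vx) ;; Put aLV (V vlen \<oplus> N 1) (V vz) ;; Asg vlen (V vlen \<oplus> N 2) ;; Asg vl (V vl \<oplus> N 1))) t Q)"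
  proof (rule ok_For[where n = n and T = "\<lambda>v. 100 + CL (2 * l) + deg v * (50 + CL (2 * l))" and J = "probed ?Q"], goal_cases)
    case (6 i t y z w) then show ?case by (simp add: probed_def)
  next
    case (7 v t)
    have "lvs lv (2 * l) 0 t" by (rule lvs_fr[OF lw 7(2)]) auto
    then show ?case using 7 by (intro PROBE_ok)
  next
    case (8 t)
    have lt: "lvs lv (2 * l) 0 t" by (rule lvs_fr[OF lw 8(2)]) auto
    have vl: "iv t 3 = int l" using frs[OF 8(2)] l by (simp add: w_def)
    have ex: "(\<exists>v<n. outer ?Q v) \<longleftrightarrow> (\<exists>v. outer ?Q v)" "(\<exists>v<n. fringe ?Q v) \<longleftrightarrow> (\<exists>v. fringe ?Q v)"
      by (auto simp: outer_def fringe_def)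
    have pr: "iv t vbad = of_bool (\<exists>v. outer ?Q v)" "iv t vfound = of_bool (\<exists>v. fringe ?Q v)"
     "(\<exists>v. fringe ?Q v) \<longrightarrow> (\<exists>x y. iv t vx = int x \<and> iv t vz = int y \<and> fringe ?Q x \<and> y \<notin> ?Q \<and> ad x y)"
      using 8(1) unfolding probed_def ex by auto
    have Tt: "tm t \<le> tm s + 20 + (\<Sum>v<n. 100 + CL (2 * l) + deg v * (50 + CL (2 * l)) + 4)"
      using 8(3) by (simp add: w_def)
    show ?case
    proof (cases "\<exists>v. fringe ?Q v")
      case True
      then obtain x y where xy: "iv t vx = int x" "iv t vz = int y" "fringe ?Q x" "y \<notin> ?Q" "ad x y" using pr(3) by blast
      let ?g = "lv(2 * l := x, Suc (2 * l) := y)"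
      have pg: "pairs ?g (Suc l)" by (rule pairs_ext[OF l(3) xy(3-5)])
      have v6: "iv t 6 = 2 * int l" using lt by (simp add: lvs_def)
      have bL: "2 * l + 2 \<le> L" "int l + 1 \<le> B" "2 * int l + 2 \<le> B" "2 * int l + 1 < int L" using k_L' lk L_B by linarith+
      have nt: "nat (2 * int l) = 2 * l" "nat (2 * int l + 1) = Suc (2 * l)" by simp_all
      have q: "Q u" if u: "iv u = (iv t)(6 := 2 * int l + 2, 3 := int l + 1)" "tm u \<le> tm t + 50"
        "ia u 0 = (ia t 0)(2 * l := int x, Suc (2 * l) := int y)" for u
      proof (rule Q, unfold if_P[OF True], intro conjI exI)
        have "lvs ?g (2 * Suc l) 0 u" using lt bL(1) pg u unfolding lvs_def pairs_def by (auto simp: less_Suc_eq)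
        then show "pst ?g (Suc l) u" using u pg by (simp add: pst_def)
        show "tm u \<le> tm s + searchT (2 * l)" using u Tt by (simp add: searchT_def)
      qed
      show ?thesis using pr(2) True xy(1,2) v6 vl bL nt by (simp, intro q) auto
    next
      case False
      have q: "Q u" if u: "iv u = iv t" "tm u \<le> tm t + 50" "ia u = ia t" for u
      proof (rule Q, unfold if_not_P[OF False], intro conjI)
        show "pst lv l u" using lt vl l(3) u by (simp add: pst_def lvs_def)
        show "iv u vbad = of_bool (\<exists>v. outer ?Q v)" using pr u by simp
        show "tm u \<le> tm s + searchT (2 * l)" using u Tt by (simp add: searchT_def)
      qed
      show ?thesis using pr(2) False by (simp add: q)
    qed
  qed (use lw in \<open>auto simp: probed_def lvs_def w_def\<close>)
  then show "ok SEARCH s Q" unfolding SEARCH_def by (simp add: w_def)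
qed

lemma no_outer_cover:
  assumes "\<not> (\<exists>v. outer Q v)" "Q \<subseteq> {..<n}" shows "cover Q"
  using assms ad_lt ad_sym unfolding outer_def cover_def by blast

text \<open>The outer vertices in \<open>X\<close> form a cut of \<open>X\<close>: the uncovered
  edge makes it nonempty, the edge inside \<open>Q\<close> makes it proper. An edge across it would
  end in \<open>Q\<close>, making its outer end a fringe vertex, or outside \<open>Q\<close>, making
  that end outer too.\<close>

lemma stuck_no_cover:
  assumes Q: "ad a b" "a \<in> Q" "b \<in> Q" and nf: "\<not> (\<exists>v. fringe Q v)" and o: "outer Q v"
  shows "\<not> (cover X \<and> conn X)"
proof
  assume X: "cover X \<and> conn X"
  let ?S = "{v \<in> X. outer Q v}"
  obtain u where u: "ad v u" "u \<notin> Q" using o by (auto simp: outer_def)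
  have "outer Q u" using u o ad_sym ad_lt by (auto simp: outer_def)
  moreover have "v \<in> X \<or> u \<in> X" using X u(1) by (auto simp: cover_def)
  ultimately have "?S \<noteq> {}" using o by blast
  moreover have "?S \<noteq> X" using X Q by (auto simp: cover_def outer_def)
  ultimately obtain x y where xy: "x \<in> ?S" "y \<in> X - ?S" "ad x y" using connD[of X ?S] X by blast
  then show False using nf ad_lt ad_sym by (fastforce simp: fringe_def outer_def)
qed

text \<open>A cover contains an endpoint of each of the first \<open>j\<close> pairs; positions in
  different pairs have different halves, so the chosen endpoints are distinct.\<close>

lemma card_pairs:
  assumes p: "pairs lv l" and X: "cover X" and j: "j \<le> l"
  shows "j \<le> card (X \<inter> lv ` {..<2 * j})"
proof -
  have "\<exists>t. t div 2 = i \<and> lv t \<in> X" if "i < l" for i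
  proof -
    have "ad (lv (2 * i)) (lv (2 * i + 1))" using p that by (auto simp: pairs_def)
    then have "lv (2 * i) \<in> X \<or> lv (2 * i + 1) \<in> X" using X by (auto simp: cover_def)
    moreover have "2 * i div 2 = i" "(2 * i + 1) div 2 = i" by simp_all
    ultimately show ?thesis by blast
  qed
  then obtain f where f: "\<And>i. i < l \<Longrightarrow> f i div 2 = i \<and> lv (f i) \<in> X" by metis
  have flt: "f i < 2 * j" if "i < j" for i using f[of i] that j by linarith
  have inj: "inj_on (\<lambda>i. lv (f i)) {..<j}"
  proof (rule inj_onI)
    fix i i' assume i: "i \<in> {..<j}" "i' \<in> {..<j}" "lv (f i) = lv (f i')"
    have "inj_on lv {..<2 * l}" using p by (simp add: pairs_def)
    moreover have "f i < 2 * l" "f i' < 2 * l" using flt[of i] flt[of i'] i(1,2) j by auto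
    ultimately have "f i = f i'" using i(3) by (auto dest: inj_onD)
    moreover have "i < l" "i' < l" using i(1,2) j by auto
    ultimately show "i = i'" using f[of i] f[of i'] by metis
  qed
  have "card ((\<lambda>i. lv (f i)) ` {..<j}) \<le> card (X \<inter> lv ` {..<2 * j})"
    using f flt j by (intro card_mono) auto
  then show ?thesis using inj by (simp add: card_image)
qed

end

section \<open>Iterative compression\<close>

text \<open>Once a stage has failed, \<open>vcnt\<close> is negative and all later stages are
  skipped.\<close>

definition STAGE :: com where
  "STAGE = Unless (Less (V vcnt) (N 0)) (Asg vj (V vl \<ominus> V vo) ;; Asg vbase (V vj \<otimes> N 2) ;; SOLVE)"

definition ROOT :: com where
  "ROOT = When (Less (Inp (V vv \<oplus> N 2)) (Inp (V vv \<oplus> N 3)))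
     (Put aLV (N 0) (V vv) ;; Put aLV (N 1) (Inp (V vn \<oplus> N 3 \<oplus> Inp (V vv \<oplus> N 2))) ;; Asg vrf (N 1))"

text \<open>The number of pairs is compared with \<open>k\<close> before \<open>vbad\<close> is
  read: if it exceeds \<open>k\<close>, the last search may have found a pair and left an outdated
  flag.\<close>

definition PHASES :: com where
  "PHASES = Asg vlen (N 2) ;; Asg vl (N 1) ;; Asg vbase (N 0) ;; For vi (V vk) SEARCH ;;
     Cond (Less (V vk) (V vl)) (Asg vcnt (N (-1)))
       (Cond (Eq (V vbad) (N 1)) (Asg vcnt (N (-1))) (For vo (V vl \<oplus> N 1) STAGE))"

text \<open>The copy starts at index \<open>k + 2\<close> so that its cells lie behind the initial
  cells \<open>0\<close> to \<open>k\<close>, which receive the answer in the end.\<close>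

definition COPY :: com where
  "COPY = Asg vcnt (V vlen) ;; Put aOUT (V vk \<oplus> N 2) (V vcnt) ;;
     For vi (V vcnt) (Put aOUT (V vk \<oplus> N 3 \<oplus> V vi) (Arr aLV (V vi)))"

definition MAINK :: com where
  "MAINK = Asg vn (Inp (N 1)) ;; Asg vrf (N 0) ;; Asg vlen (N 0) ;; For vv (V vn) ROOT ;;
     When (Eq (V vrf) (N 1)) PHASES ;; Unless (Less (V vcnt) (N 0)) COPY"

definition MAIN :: com where
  "MAIN = Asg vk (Inp (N 0)) ;; Asg vcnt (N 0) ;; Cond (Less (V vk) (N 0)) (Asg vcnt (N (-1))) MAINK"

lemma w_STAGE [simp]: "wv STAGE = {4, 5} \<union> wv SOLVE" "wa STAGE = wa SOLVE" "wr STAGE = wr SOLVE" "wra STAGE"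
  by (auto simp: STAGE_def)
lemma w_ROOT [simp]: "wv ROOT = {46}" "wa ROOT = {0}" "wr ROOT = {}" "wra ROOT = False"
  by (auto simp: ROOT_def)

context prog
begin

lemma sum_deg: "(\<Sum>v<n. deg v) = length (concat adj)"
  by (simp add: length_concat sum_list_sum_nth atLeast0LessThan)

definition KN :: nat where "KN = (k + 1) * (n + length (concat adj) + 1)"

lemma sum_deg_le:
  assumes "\<And>v. v < n \<Longrightarrow> f v \<le> a * (k + 1) + deg v * (b * (k + 1))" "a \<le> c" "b \<le> c"
  shows "sum f {..<n} \<le> c * ((k + 1) * (n + length (concat adj)))"
proof -
  have "sum f {..<n} \<le> (\<Sum>v<n. c * (k + 1) + deg v * (c * (k + 1)))"
  proof (rule sum_mono)
    fix v assume "v \<in> {..<n}"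
    then have "f v \<le> a * (k + 1) + deg v * (b * (k + 1))" using assms(1) by simp
    also have "\<dots> \<le> c * (k + 1) + deg v * (c * (k + 1))" using assms(2,3) by (intro add_mono mult_le_mono) auto
    finally show "f v \<le> c * (k + 1) + deg v * (c * (k + 1))" .
  qed
  also have "\<dots> = n * (c * (k + 1)) + length (concat adj) * (c * (k + 1))"
    by (simp only: sum.distrib sum_distrib_right[symmetric] sum_deg) (simp add: algebra_simps)
  also have "\<dots> = c * ((k + 1) * (n + length (concat adj)))" by (simp only: algebra_simps)
  finally show ?thesis .
qed

lemma KN_eq: "KN = (k + 1) * (n + length (concat adj)) + (k + 1)" by (simp add: KN_def algebra_simps)

lemma searchT_le: "l \<le> k + 1 \<Longrightarrow> searchT (2 * l) \<le> 500 * KN"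
proof -
  assume l: "l \<le> k + 1"
  then have "CL (2 * l) \<le> 120 * (k + 1)" by (simp add: CL_def)
  note C = this
  have "(\<Sum>v<n. 100 + CL (2 * l) + deg v * (50 + CL (2 * l)) + 4) \<le> 400 * ((k + 1) * (n + length (concat adj)))"
  proof (rule sum_deg_le[of _ 400 170])
    fix v
    have P: "deg v * (50 + CL (2 * l)) \<le> deg v * (170 * (k + 1))" using C by (intro mult_le_mono2) simp
    have "100 + CL (2 * l) + 4 \<le> 400 * (k + 1)" using C by simp
    from add_mono[OF this P] show "100 + CL (2 * l) + deg v * (50 + CL (2 * l)) + 4 \<le> 400 * (k + 1) + deg v * (170 * (k + 1))"
      by (simp only: add.assoc add.commute add.left_commute)
  qed auto
  then show ?thesis unfolding searchT_def KN_eq by simp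
qed

end

context solve
begin

lemma solveT_le: "solveT \<le> 2 ^ ny * (6500 * KN)"
proof -
  define K where "K = k + 1"
  define D where "D = length (concat adj)"
  have C: "CL len \<le> 120 * K" using len_k by (simp add: CL_def K_def)
  have b: "ny \<le> K" "KB \<le> K" "1 \<le> K" using ny_L(3) KB_k by (auto simp: K_def)
  have KN: "KN = K * (n + D) + K" by (simp add: KN_eq K_def D_def)
  have "(\<Sum>v<n. (300 + CL len + deg v * (300 + 30 * ny + 2 * CL len)) + 4) \<le> 570 * ((k + 1) * (n + length (concat adj)))"
  proof (rule sum_deg_le[of _ 424 570])
    fix v
    have "deg v * (300 + 30 * ny + 2 * CL len) \<le> deg v * (570 * (k + 1))" using C b unfolding K_def by (intro mult_le_mono2) simp
    note P = this
    have "300 + CL len + 4 \<le> 424 * (k + 1)" using C[unfolded K_def] by simp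
    from add_mono[OF this P] show "(300 + CL len + deg v * (300 + 30 * ny + 2 * CL len)) + 4 \<le> 424 * (k + 1) + deg v * (570 * (k + 1))"
      by (simp only: add.assoc add.commute add.left_commute)
  qed auto
  then have "scanT \<le> 600 * KN" unfolding scanT_def KN using b by (simp add: K_def D_def)
  then have t: "tryT \<le> 1000 * KN" unfolding tryT_def using b KN by simp
  have "(\<Sum>v<n. 150 + CL len + deg v * (130 + CL len) + 144 * KB + 4) \<le> 440 * ((k + 1) * (n + length (concat adj)))"
  proof (rule sum_deg_le[of _ 440 250])
    fix v
    have "deg v * (130 + CL len) \<le> deg v * (250 * (k + 1))" using C unfolding K_def by (intro mult_le_mono2) simp
    note P = this
    have "150 + CL len + 144 * KB + 4 \<le> 440 * (k + 1)" using C[unfolded K_def] b[unfolded K_def] by simp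
    from add_mono[OF this P] show "150 + CL len + deg v * (130 + CL len) + 144 * KB + 4 \<le> 440 * (k + 1) + deg v * (250 * (k + 1))"
      by (simp only: add.assoc add.commute add.left_commute)
  qed auto
  then have "dpU \<le> 460 * KN" unfolding dpU_def KN using b by (simp add: K_def D_def)
  then have d: "dpallT \<le> 1700 * KN" unfolding dpallT_def using b KN by simp
  \<comment> \<open>The constants up to 6500 only add up the preceding estimates and are rounded
    generously.\<close>
  have "tryT + 4 + 3 * dpallT \<le> 6104 * KN" using t d b KN by simp
  then have a: "2 ^ ny * (tryT + 4 + 3 * dpallT) \<le> 2 ^ ny * (6104 * KN)" by (rule mult_le_mono2)
  have "300 + 50 * ny + 40 * k \<le> 390 * KN" using b KN by (simp add: K_def)
  moreover have "1 * (390 * KN) \<le> 2 ^ ny * (390 * KN)" by (rule mult_le_mono1) simp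
  ultimately have "300 + 50 * ny + 40 * k \<le> 2 ^ ny * (390 * KN)" by linarith
  from add_mono[OF this a] have "solveT \<le> 2 ^ ny * (390 * KN) + 2 ^ ny * (6104 * KN)" unfolding solveT_def .
  also have "\<dots> = 2 ^ ny * (6494 * KN)" by (simp add: distrib_left[symmetric])
  also have "\<dots> \<le> 2 ^ ny * (6500 * KN)" by (intro mult_le_mono2 mult_le_mono1) simp
  finally show ?thesis .
qed

end

lemma glue_list:
  fixes f :: "nat \<Rightarrow> nat"
  assumes "inj_on f {..<b}" "distinct xs" "set xs \<inter> f ` {..<b} = {}"
  defines "g \<equiv> \<lambda>t. if t < b then f t else xs ! (t - b)"
  shows "g ` {..<b + length xs} = f ` {..<b} \<union> set xs" "inj_on g {..<b + length xs}"
proof -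
  have split: "{..<b + length xs} = {..<b} \<union> {b..<b + length xs}" by auto
  have 1: "g ` {..<b} = f ` {..<b}" by (intro image_cong) (auto simp: g_def)
  have 2: "g ` {b..<b + length xs} = set xs"
  proof -
    have "set xs = (\<lambda>i. xs ! i) ` {..<length xs}" by (auto simp: set_conv_nth)
    also have "\<dots> = g ` (\<lambda>i. b + i) ` {..<length xs}" unfolding image_image by (intro image_cong) (auto simp: g_def)
    also have "(\<lambda>i. b + i) ` {..<length xs} = {b..<b + length xs}"
      by (simp add: lessThan_atLeast0 add.commute)
    finally show ?thesis by simp
  qed
  show img: "g ` {..<b + length xs} = f ` {..<b} \<union> set xs" unfolding split image_Un 1 2 ..
  have "card (f ` {..<b} \<union> set xs) = b + length xs"
    using assms(1-3) by (subst card_Un_disjoint) (auto simp: card_image distinct_card)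
  then show "inj_on g {..<b + length xs}" using img by (intro eq_card_imp_inj_on) auto
qed

context prog
begin

text \<open>The state after \<open>h\<close> stages, when the next one keeps \<open>l - h\<close>
  pairs. The list still starts with the pairs kept in the previous stage, one more than that; the
  minimum accounts for the beginning, when there are only \<open>l\<close>. Optimality is claimed
  after the last stage only, which keeps no pair.\<close>

definition staged :: "(nat \<Rightarrow> nat) \<Rightarrow> nat \<Rightarrow> nat \<Rightarrow> state \<Rightarrow> bool" where
  "staged lv l h t \<longleftrightarrow> iv t vk = int k \<and> iv t vn = int n \<and> iv t vl = int l \<and>
    ((iv t vcnt = -1 \<and> \<not> (\<exists>X. cover X \<and> conn X \<and> card X \<le> k)) \<or>
     (iv t vcnt = 0 \<and> (\<exists>lv' len. iv t vlen = int len \<and> (\<forall>i<len. ia t aLV i = int (lv' i)) \<and> inj_on lv' {..<len} \<and>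
        2 * min l (l + 1 - h) \<le> len \<and> (\<forall>i<2 * min l (l + 1 - h). lv' i = lv i) \<and>
        cover (lv' ` {..<len}) \<and> conn (lv' ` {..<len}) \<and> (h \<le> l \<longrightarrow> len \<le> k + (l - h) + 1) \<and>
        (h = Suc l \<longrightarrow> len \<le> k \<and> (\<forall>X. cover X \<and> conn X \<and> card X \<le> k \<longrightarrow> (\<Sum>v\<in>lv' ` {..<len}. W ! v) \<le> (\<Sum>v\<in>X. W ! v))))))"

text \<open>Adding \<open>R\<close> to a connected cover keeps it connected, as the two share a
  vertex unless \<open>j = 0\<close>. The cover spends at least \<open>j\<close> vertices on
  \<open>R\<close>, so at most \<open>k - j\<close> remain. Hence a failing stage proves that the
  original problem has no solution.\<close>

lemma cover_minus_sol:
  assumes p: "pairs lv l" and j: "j \<le> l" and s: "cover_split n ad R Y" and R: "R = lv ` {..<2 * j}"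
    and X: "cover X" "conn X" "card X \<le> k"
  shows "cover_split.sol n ad R (X - R)" "card (X - R) \<le> k - j"
proof -
  have fin: "finite X" using X(1) finite_subset by (auto simp: cover_def)
  have c: "j \<le> card (X \<inter> R)" unfolding R by (rule card_pairs[OF p X(1) j])
  have "card X = card (X \<inter> R) + card (X - R)" using card_Int_Diff[OF fin] .
  then show "card (X - R) \<le> k - j" using c X(3) by linarith
  have RX: "R \<union> (X - R) = R \<union> X" by blast
  have sub: "R \<union> X \<subseteq> {..<n}" using X(1) cover_split.cov[OF s] by (auto simp: cover_def)
  have "conn (R \<union> X)"
  proof (cases "j = 0")
    case True then show ?thesis using X(2) R by simp
  next
    case False
    then have "X \<inter> R \<noteq> {}" using c by (metis card.empty le_zero_eq)
    then show ?thesis using conn_Un[OF cover_split.conR[OF s] X(2)] by blast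
  qed
  moreover have "cover (R \<union> X)" using cover_mono[OF X(1) _ sub] by blast
  ultimately show "cover_split.sol n ad R (X - R)" unfolding cover_split.sol_def[OF s] RX by blast
qed

lemma STAGE_ok:
  assumes s: "staged lv l h s" "iv s vo = int h" and p: "pairs lv l" and l: "0 < l" "l \<le> k" "h \<le> l"
  shows "ok STAGE s (\<lambda>t. staged lv l (Suc h) t \<and> tm t \<le> tm s + (30 + 2 ^ (k - (l - h) + 1) * (6500 * KN)))"
proof (rule ok_gen)
  let ?T = "30 + 2 ^ (k - (l - h) + 1) * (6500 * KN)"
  fix Q :: "state \<Rightarrow> bool" assume Q: "\<And>t. staged lv l (Suc h) t \<and> tm t \<le> tm s + ?T \<Longrightarrow> Q t"
  define j where "j = l - h"
  have j: "int l - int h = int j" "j \<le> l" "j \<le> k" using l by (auto simp: j_def)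
  show "ok STAGE s Q"
  proof (cases "iv s vcnt < 0")
    case True
    have "staged lv l (Suc h) (s\<lparr>tm := w\<rparr>)" for w using s(1) True by (auto simp: staged_def)
    then show ?thesis unfolding STAGE_def using True by (simp add: Q)
  next
    case False
    then obtain lv' len where S: "iv s vk = int k" "iv s vn = int n" "iv s vl = int l" "iv s vcnt = 0"
      "iv s vlen = int len" "\<forall>i<len. ia s aLV i = int (lv' i)" "inj_on lv' {..<len}"
      "2 * min l (l + 1 - h) \<le> len" "\<forall>i<2 * min l (l + 1 - h). lv' i = lv i"
      "cover (lv' ` {..<len})" "conn (lv' ` {..<len})" "len \<le> k + j + 1"
      using s(1) l(3) unfolding staged_def j_def by auto
    have bl: "2 * j \<le> len" "\<forall>i<2 * j. lv' i = lv i" using S(8,9) by (auto simp: j_def)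
    have Req: "lv' ` {..<2 * j} = lv ` {..<2 * j}" using bl(2) by (intro image_cong) auto
    have all: "lv' ` {..<2 * j} \<union> lv' ` {2 * j..<len} = lv' ` {..<len}"
      using bl(1) by (simp add: image_Un[symmetric] ivl_disj_un)
    have split: "cover_split n ad (lv' ` {..<2 * j}) (lv' ` {2 * j..<len})"
    proof (unfold_locales, goal_cases)
      case 1 show ?case unfolding all by (rule S(10))
    next
      case 2 show ?case unfolding all by (rule S(11))
    next
      case 3 show ?case unfolding Req using p j(2) by (auto simp: pairs_def)
    next
      case 4
      have "lv' ` {..<2 * j} \<inter> lv' ` {2 * j..<len} = lv' ` ({..<2 * j} \<inter> {2 * j..<len})"
        by (rule inj_on_image_Int[OF S(7), symmetric]) (use bl(1) in auto)
      also have "{..<2 * j} \<inter> {2 * j..<len} = {}" by auto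
      finally show ?case by simp
    next
      case 5
      \<comment> \<open>Empty \<open>R\<close> means the last stage. The list still begins with the
        first pair, kept by the previous stage or, if this is the first one, by the start; this pair
        is the required edge inside \<open>Y\<close>.\<close>
      then have j0: "j = 0" by (simp add: lessThan_empty_iff)
      then have "min l (l + 1 - h) = 1" using l by (auto simp: j_def)
      then have a: "2 \<le> len" "lv' 0 = lv 0" "lv' 1 = lv 1" using S(8,9) by auto
      have "ad (lv 0) (lv (2 * 0 + 1))" using p l(1) unfolding pairs_def by fastforce
      then have "ad (lv' 0) (lv' 1)" using a by simp
      moreover have "0 \<in> {2 * j..<len}" "1 \<in> {2 * j..<len}" using a(1) j0 by simp_all
      ultimately show ?case by blast
    qed
    interpret S: solve B k adj W L lv' len "2 * j" "k - j"
      by (rule solve.intro[OF prog_axioms solve_axioms.intro[OF S(7) bl(1) _ _ _ split]]) (use S(12) bl(1) j(3) in auto)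
    have len2: "len \<le> 2 * k + 2" using S(12) j(3) by simp
    then have lL: "len \<le> L" using k_L' by simp
    define w where "w = s\<lparr>iv := (iv s)(4 := int j, 5 := int j * 2), tm := 18 + tm s\<rparr>"
    have lw: "lvs lv' len (2 * j) w" using S(1,2,5-7) bl(1) lL by (simp add: w_def lvs_def)
    have jw: "iv w vj + int (k - j) = int k" using j(3) by (simp add: w_def)
    have "ok SOLVE w Q"
    proof (rule ok_mono[OF S.SOLVE_ok[OF lw jw]], goal_cases)
      case (1 t)
      have et: "iv t vk = int k" "iv t vn = int n" "iv t vl = int l" using frs[OF 1(1)] S(1-3) by (simp_all add: w_def)
      have "S.ny \<le> k - j + 1" using S(12) bl(1) j(3) by (simp add: S.ny_def)
      then have "2 ^ S.ny * (6500 * KN) \<le> 2 ^ (k - j + 1) * (6500 * KN)" by (intro mult_le_mono1 power_increasing) auto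
      with S.solveT_le have "S.solveT \<le> 2 ^ (k - j + 1) * (6500 * KN)" by (rule order_trans)
      moreover have "tm t \<le> tm s + 18 + S.solveT" using 1(2) by (simp add: w_def)
      ultimately have Tt: "tm t \<le> tm s + ?T" unfolding j_def[symmetric] by linarith
      have toR: "S.sol (X - S.R)" "card (X - S.R) \<le> k - j" if "cover X" "conn X" "card X \<le> k" for X
        using cover_minus_sol[OF p j(2) S.cover_split_axioms _ that] Req by (simp_all add: S.R_def)
      show ?case
      proof (rule Q, intro conjI Tt)
        show "staged lv l (Suc h) t"
        proof (cases "\<exists>X. S.sol X \<and> card X \<le> k - j")
          case False
          then have "iv t vcnt = -1" using 1(2) by auto
          moreover have "\<not> (\<exists>X. cover X \<and> conn X \<and> card X \<le> k)" using toR False by blast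
          ultimately show ?thesis using et by (simp add: staged_def)
        next
          case True
          then have "iv t vcnt = iv w vcnt \<and>
            (\<exists>xs. distinct xs \<and> length xs \<le> k - j \<and> S.sol (set xs) \<and> (\<forall>X. S.sol X \<and> card X \<le> k - j \<longrightarrow> S.wt (set xs) \<le> S.wt X) \<and>
            (\<forall>i<2 * j. ia t aLV i = int (lv' i)) \<and> (\<forall>i<length xs. ia t aLV (2 * j + i) = int (xs ! i)) \<and> iv t vlen = int (2 * j + length xs))"
            using 1(2) by presburger
          then obtain xs where xs: "iv t vcnt = 0" "distinct xs" "length xs \<le> k - j" "S.sol (set xs)"
            "\<And>X. S.sol X \<Longrightarrow> card X \<le> k - j \<Longrightarrow> S.wt (set xs) \<le> S.wt X"
            "\<And>i. i < 2 * j \<Longrightarrow> ia t aLV i = int (lv' i)" "\<And>i. i < length xs \<Longrightarrow> ia t aLV (2 * j + i) = int (xs ! i)"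
            "iv t vlen = int (2 * j + length xs)" using S(4) by (auto simp: w_def)
          define g where "g = (\<lambda>t. if t < 2 * j then lv' t else xs ! (t - 2 * j))"
          have sx: "set xs \<inter> lv' ` {..<2 * j} = {}" "cover (lv' ` {..<2 * j} \<union> set xs)" "conn (lv' ` {..<2 * j} \<union> set xs)"
            using xs(4) unfolding S.sol_def unfolding S.R_def by auto
          have "inj_on lv' {..<2 * j}" using S(7) bl(1) by (auto intro: inj_on_subset)
          note g = glue_list[OF this xs(2) sx(1), folded g_def]
          \<comment> \<open>The prefix promised to the next stage consists of exactly the
            \<open>j\<close> pairs kept in this one.\<close>
          have pf: "min l (l + 1 - Suc h) = j" using j by (simp add: j_def)
          \<comment> \<open>In the last stage \<open>R\<close> is empty, so the solutions of the
            stage are all connected covers and its budget is \<open>k\<close>.\<close>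
          have opt: "2 * j + length xs \<le> k \<and> (\<forall>X. cover X \<and> conn X \<and> card X \<le> k \<longrightarrow>
             (\<Sum>v\<in>g ` {..<2 * j + length xs}. W ! v) \<le> (\<Sum>v\<in>X. W ! v))" if "Suc h = Suc l"
          proof -
            have j0: "j = 0" using that by (simp add: j_def)
            have R0: "S.R = {}" unfolding S.R_def by (simp add: j0)
            have "S.wt (set xs) \<le> S.wt X" if "cover X" "conn X" "card X \<le> k" for X
              using toR[OF that] xs(5)[of X] R0 by simp
            then show ?thesis using xs(3) g(1) j0 by (auto simp: S.wt_def)
          qed
          have gm: "\<forall>i<2 * j + length xs. ia t aLV i = int (g i)"
          proof (intro allI impI)
            fix i assume "i < 2 * j + length xs"
            then show "ia t aLV i = int (g i)" using xs(6)[of i] xs(7)[of "i - 2 * j"]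
              by (cases "i < 2 * j") (auto simp: g_def)
          qed
          have gj: "\<forall>i<2 * j. g i = lv i" using bl(2) by (simp add: g_def)
          have cov: "cover (g ` {..<2 * j + length xs})" "conn (g ` {..<2 * j + length xs})" unfolding g(1) by (rule sx(2,3))+
          have bnd: "Suc h \<le> l \<longrightarrow> 2 * j + length xs \<le> k + (l - Suc h) + 1" using xs(3) l j(3) unfolding j_def by arith
          have le: "2 * j \<le> 2 * j + length xs" by simp
          have opt': "Suc h = Suc l \<longrightarrow> 2 * j + length xs \<le> k \<and> (\<forall>X. cover X \<and> conn X \<and> card X \<le> k \<longrightarrow>
             (\<Sum>v\<in>g ` {..<2 * j + length xs}. W ! v) \<le> (\<Sum>v\<in>X. W ! v))" using opt by blast
          show ?thesis unfolding staged_def pf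
            by (intro conjI et disjI2 xs(1) exI[of _ g] exI[of _ "2 * j + length xs"] xs(8) gm g(2) le gj cov bnd opt')
        qed
      qed
    qed
    moreover have "\<bar>int j\<bar> \<le> B" "\<bar>int j * 2\<bar> \<le> B" using j(3) k_L' L_B by linarith+
    ultimately show ?thesis unfolding STAGE_def using False S(3) s(2) j(1) by (simp add: w_def)
  qed
qed

end

context prog
begin

definition optimal :: "nat set \<Rightarrow> bool" where
  "optimal Q \<longleftrightarrow> cover Q \<and> conn Q \<and> card Q \<le> k \<and>
     (\<forall>X. cover X \<and> conn X \<and> card X \<le> k \<longrightarrow> (\<Sum>v\<in>Q. W ! v) \<le> (\<Sum>v\<in>X. W ! v))"

definition solved :: "state \<Rightarrow> bool" where
  "solved t \<longleftrightarrow> (iv t vcnt = -1 \<and> \<not> (\<exists>X. cover X \<and> conn X \<and> card X \<le> k)) \<or>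
     (iv t vcnt = 0 \<and> (\<exists>xs. distinct xs \<and> optimal (set xs) \<and> iv t vlen = int (length xs) \<and> (\<forall>i<length xs. ia t aLV i = int (xs ! i))))"

text \<open>The exponent grows by one per stage, so the geometric series is at most twice its last
  term, which has exponent \<open>k + 1\<close>.\<close>

lemma stage_sum:
  assumes "l \<le> k"
  shows "(\<Sum>h<Suc l. 30 + 2 ^ (k - (l - h) + 1) * c + 4) \<le> 34 * (k + 1) + 2 ^ (k + 2) * (c::nat)"
proof -
  have "(\<Sum>h<Suc l. 30 + 2 ^ (k - (l - h) + 1) * c + 4) = (\<Sum>h<Suc l. 34 + 2 ^ (k - l + 1) * c * 2 ^ h)"
  proof (rule sum.cong)
    fix h assume "h \<in> {..<Suc l}"
    then have "k - (l - h) + 1 = (k - l + 1) + h" using assms by auto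
    then show "30 + 2 ^ (k - (l - h) + 1) * c + 4 = 34 + 2 ^ (k - l + 1) * c * 2 ^ h"
      by (simp add: power_add)
  qed simp
  also have "\<dots> = 34 * Suc l + 2 ^ (k - l + 1) * c * (\<Sum>h<Suc l. 2 ^ h)"
    by (simp only: sum.distrib sum_distrib_left[symmetric]) simp
  also have "\<dots> \<le> 34 * (k + 1) + 2 ^ (k - l + 1) * c * 2 ^ (l + 1)"
  proof (intro add_mono mult_le_mono2)
    have "(\<Sum>h<Suc l. 2 ^ h) = (2::nat) ^ Suc l - 1" using sum_power2[of "Suc l"] by (simp only: atLeast0LessThan)
    then show "(\<Sum>h<Suc l. 2 ^ h) \<le> (2::nat) ^ (l + 1)" by simp
  qed (use assms in auto)
  also have "2 ^ (k - l + 1) * c * 2 ^ (l + 1) = 2 ^ ((k - l + 1) + (l + 1)) * c" by (simp only: power_add mult.assoc mult.commute mult.left_commute)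
  also have "(k - l + 1) + (l + 1) = k + 2" using assms by simp
  finally show ?thesis .
qed

lemma ROOT_ok:
  assumes "iv s vn = int n" "iv s vv = int v" "v < n"
    and "iv s vrf = of_bool (\<exists>u<v. 0 < deg u)" "(\<exists>u<v. 0 < deg u) \<longrightarrow> (\<exists>x y. ia s 0 0 = int x \<and> ia s 0 1 = int y \<and> ad x y)"
  shows "ok ROOT s (\<lambda>t. iv t vrf = of_bool (\<exists>u<Suc v. 0 < deg u) \<and>
     ((\<exists>u<Suc v. 0 < deg u) \<longrightarrow> (\<exists>x y. ia t 0 0 = int x \<and> ia t 0 1 = int y \<and> ad x y)) \<and> tm t \<le> tm s + 60)"
proof (rule ok_gen)
  fix Q :: "state \<Rightarrow> bool"
  assume Q: "\<And>t. iv t vrf = of_bool (\<exists>u<Suc v. 0 < deg u) \<and>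
     ((\<exists>u<Suc v. 0 < deg u) \<longrightarrow> (\<exists>x y. ia t 0 0 = int x \<and> ia t 0 1 = int y \<and> ad x y)) \<and> tm t \<le> tm s + 60 \<Longrightarrow> Q t"
  have o: "off (Suc v) = off v + deg v" "int (off v) \<le> int (length (concat adj))" "int (off (Suc v)) \<le> int (length (concat adj))"
    using off_Suc[OF assms(3)] off_le[of v] off_le[of "Suc v"] assms(3) by auto
  have L1: "1 < L" using k_L' by simp
  have nt: "nat (int v + 3) = v + 3" "nat (int v + 2) = Suc (Suc v)" by simp_all
  show "ok ROOT s Q"
  proof (cases "0 < deg v")
    case True
    define y where "y = adj ! v ! 0"
    have c: "concat adj ! (off v) = y" "off v < length (concat adj)" using concat_nth[OF assms(3) True] by (auto simp: y_def)
    have "nat (int n + 3 + int (off v)) = 3 + n + off v" by simp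
    then have i: "I ! nat (int n + 3 + int (off v)) = int y" using I_adj[OF c(2)] c(1) by simp
    have yn: "y < n" "ad v y" using adj_nth_lt[OF assms(3) True] True assms(3) by (auto simp: y_def ad_def)
    have q: "Q t" if "iv t vrf = 1" "ia t 0 0 = int v" "ia t 0 1 = int y" "tm t \<le> tm s + 60" for t
      by (rule Q) (use that yn True in \<open>auto simp: ex_Suc\<close>)
    show ?thesis unfolding ROOT_def using assms(1-3) o bigB i c(2) True yn L1 nt
      by (auto simp: in_range_def len_I intro!: q simp del: length_greater_0_conv)
  next
    case False
    have q: "Q t" if "iv t = iv s" "ia t = ia s" "tm t \<le> tm s + 60" for t
      by (rule Q) (use that assms(4,5) False in \<open>auto simp: ex_Suc\<close>)
    show ?thesis unfolding ROOT_def using assms(1-3) o bigB False nt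
      by (auto simp: in_range_def len_I intro!: q)
  qed
qed

definition phasesT :: nat where "phasesT = 100 + k * (500 * KN + 4) + 34 * (k + 1) + 2 ^ (k + 2) * (6500 * KN)"

lemma PHASES_ok:
  assumes s: "iv s vk = int k" "iv s vn = int n" "iv s vcnt = 0" "ia s 0 0 = int x" "ia s 0 1 = int y" "ad x y"
  shows "ok PHASES s (\<lambda>t. solved t \<and> tm t \<le> tm s + phasesT)"
proof (rule ok_gen)
  fix Q :: "state \<Rightarrow> bool" assume Q: "\<And>t. solved t \<and> tm t \<le> tm s + phasesT \<Longrightarrow> Q t"
  define w where "w = s\<lparr>iv := (iv s)(6 := 2, 3 := 1, 5 := 0), tm := tm s + 9\<rparr>"
  define lv0 where "lv0 i = (if i = 0 then x else y)" for i :: nat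
  have xy: "x \<noteq> y" using s(6) ad_irr by auto
  have two: "{..<2} = {0, 1::nat}" by auto
  have "pairs lv0 1" unfolding pairs_def
  proof (intro conjI allI impI)
    show "inj_on lv0 {..<2 * 1}" using xy by (auto simp: inj_on_def lv0_def)
    show "ad (lv0 (2 * i)) (lv0 (2 * i + 1))" if "i < 1" for i using that s(6) by (simp add: lv0_def)
    show "conn (lv0 ` {..<2 * j})" if "j \<le> 1" for j
    proof (cases "j = 0")
      case False
      then have "j = 1" using that by simp
      then have "lv0 ` {..<2 * j} = {x, y}" by (auto simp: two lv0_def)
      then show ?thesis using conn_pair[OF s(6)] by simp
    qed simp
  qed
  moreover have "lvs lv0 2 0 w" using s calculation k_L' unfolding lvs_def pairs_def
    by (auto simp: w_def lv0_def less_2_cases_iff)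
  ultimately have p0: "pst lv0 1 w" by (simp add: pst_def w_def)
  \<comment> \<open>Either every round so far has added a pair, or the search is stuck; once stuck
    it stays so, since further rounds see the same list.\<close>
  let ?J = "\<lambda>i t. \<exists>lv l. pst lv l t \<and> 0 < l \<and> l \<le> Suc i \<and> (l = Suc i \<or>
        (\<not> (\<exists>v. fringe (lv ` {..<2 * l}) v) \<and> iv t vbad = of_bool (\<exists>v. outer (lv ` {..<2 * l}) v)))"
  have "ok (For vi (V vk) SEARCH) w (\<lambda>t. ok (Cond (Less (V vk) (V vl)) (Asg vcnt (N (-1)))
       (Cond (Eq (V vbad) (N 1)) (Asg vcnt (N (-1))) (For vo (V vl \<oplus> N 1) STAGE))) t Q)"
  proof (rule ok_For[where n = k and T = "\<lambda>_. 500 * KN" and J = ?J], goal_cases)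
    case 5 show ?case using p0 by (intro exI[of _ lv0] exI[of _ 1]) simp
  next
    case (6 i t y z w) then show ?case by (simp add: pst_def lvs_def)
  next
    case (7 i t)
    then obtain lv l where l: "pst lv l t" "0 < l" "l \<le> Suc i" "l = Suc i \<or>
        (\<not> (\<exists>v. fringe (lv ` {..<2 * l}) v) \<and> iv t vbad = of_bool (\<exists>v. outer (lv ` {..<2 * l}) v))" by blast
    have lk: "l \<le> k" using l(3) 7(1) by simp
    have T: "searchT (2 * l) \<le> 500 * KN" using lk by (intro searchT_le) simp
    show ?case
    proof (rule ok_mono[OF SEARCH_ok[OF l(1) lk]], goal_cases)
      case (1 u)
      show ?case
      proof (cases "\<exists>v. fringe (lv ` {..<2 * l}) v")
        case True
        then obtain lv' where "pst lv' (Suc l) u" using 1(2) by auto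
        moreover have "l = Suc i" using l(4) True by blast
        ultimately have "?J (Suc i) u" by (intro exI[of _ lv'] exI[of _ "Suc l"]) simp
        moreover have "tm u \<le> tm t + 500 * KN" using 1(2) T by linarith
        ultimately show ?thesis by blast
      next
        case False
        then have "pst lv l u \<and> iv u vbad = of_bool (\<exists>v. outer (lv ` {..<2 * l}) v)" using 1(2) by auto
        then have "?J (Suc i) u" using False l(2,3) by (intro exI[of _ lv] exI[of _ l]) simp
        moreover have "tm u \<le> tm t + 500 * KN" using 1(2) T by linarith
        ultimately show ?thesis by blast
      qed
    qed
  next
    case (8 t)
    then obtain lv l where l: "pst lv l t" "0 < l" "l \<le> Suc k" "l = Suc k \<or>
        (\<not> (\<exists>v. fringe (lv ` {..<2 * l}) v) \<and> iv t vbad = of_bool (\<exists>v. outer (lv ` {..<2 * l}) v))" by blast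
    let ?Q = "lv ` {..<2 * l}"
    have p: "pairs lv l" "lvs lv (2 * l) 0 t" "iv t vl = int l" using l(1) by (auto simp: pst_def)
    have vk: "iv t vk = int k" "iv t vn = int n" using p by (auto simp: lvs_def)
    have vc: "iv t vcnt = 0" using frs[OF 8(2)] s by (simp add: w_def)
    have Tt: "tm t \<le> tm s + 16 + k * (500 * KN + 4)" using 8(3) by (simp add: w_def)
    have none: "Q u" if "\<not> (\<exists>X. cover X \<and> conn X \<and> card X \<le> k)" "iv u vcnt = -1" "tm u \<le> tm t + 50" for u
      using that Tt by (intro Q) (simp add: solved_def phasesT_def)
    show ?case
    proof (cases "l \<le> k")
      case False
      have "\<not> card X \<le> k" if "cover X" for X
      proof
        assume "card X \<le> k"
        moreover have "finite X" using that finite_subset by (auto simp: cover_def)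
        then have "card (X \<inter> ?Q) \<le> card X" by (intro card_mono) auto
        ultimately show False using card_pairs[OF p(1) that order_refl] False by linarith
      qed
      then have "\<not> (\<exists>X. cover X \<and> conn X \<and> card X \<le> k)" by blast
      then show ?thesis using False vk p(3) none by simp
    next
      case lk: True
      then have nf: "\<not> (\<exists>v. fringe ?Q v)" "iv t vbad = of_bool (\<exists>v. outer ?Q v)" using l(4) by auto
      show ?thesis
      proof (cases "\<exists>v. outer ?Q v")
        case True
        then obtain v where v: "outer ?Q v" by blast
        have "ad (lv 0) (lv 1)" using p(1) l(2) by (auto simp: pairs_def)
        then have "\<not> (cover X \<and> conn X)" for X using l(2) by (intro stuck_no_cover[OF _ _ _ nf(1) v]) auto
        then have "\<not> (\<exists>X. cover X \<and> conn X \<and> card X \<le> k)" by blast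
        then show ?thesis using lk True nf vk p(3) none by simp
      next
        case False
        define u where "u = t\<lparr>tm := 11 + tm t\<rparr>"
        have sub: "?Q \<subseteq> {..<n}"
        proof
          fix z assume "z \<in> ?Q"
          then obtain i where i: "i < 2 * l" "z = lv i" by auto
          have "ad (lv (2 * (i div 2))) (lv (2 * (i div 2) + 1))" using p(1) i(1) by (auto simp: pairs_def)
          moreover have "i = 2 * (i div 2) \<or> i = 2 * (i div 2) + 1" by presburger
          ultimately show "z \<in> {..<n}" using i(2) ad_lt ad_sym by (metis lessThan_iff)
        qed
        have cov: "cover ?Q" by (rule no_outer_cover[OF False sub])
        have st: "staged lv l 0 u" unfolding staged_def u_def
          using vk p vc cov lk by (auto simp: lvs_def pairs_def intro!: exI[of _ lv] exI[of _ "2 * l"])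
        have "ok (For vo (V vl \<oplus> N 1) STAGE) u Q"
        proof (rule ok_For[where n = "Suc l" and T = "\<lambda>h. 30 + 2 ^ (k - (l - h) + 1) * (6500 * KN)" and J = "staged lv l"], goal_cases)
          case 1 show ?case using p(3) lk k_L' L_B by (simp add: u_def)
        next
          case (6 h t y z w) then show ?case by (simp add: staged_def)
        next
          case (7 h r)
          then show ?case using p(1) l(2) lk by (intro STAGE_ok) auto
        next
          case (8 r)
          have "tm r \<le> tm u + 9 + (\<Sum>h<Suc l. 30 + 2 ^ (k - (l - h) + 1) * (6500 * KN) + 4)"
            using 8(3) unfolding esize.simps by linarith
          moreover have "tm u = 11 + tm t" by (simp add: u_def)
          ultimately have Tr: "tm r \<le> tm s + phasesT" using Tt stage_sum[OF lk, of "6500 * KN"] unfolding phasesT_def by linarith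
          have "solved r"
          proof (cases "iv r vcnt = 0")
            case False
            then show ?thesis using 8(1) by (auto simp: staged_def solved_def)
          next
            case True
            then obtain g len where g: "iv r vlen = int len" "\<forall>i<len. ia r aLV i = int (g i)" "inj_on g {..<len}"
              "cover (g ` {..<len})" "conn (g ` {..<len})" "len \<le> k"
              "\<forall>X. cover X \<and> conn X \<and> card X \<le> k \<longrightarrow> (\<Sum>v\<in>g ` {..<len}. W ! v) \<le> (\<Sum>v\<in>X. W ! v)"
              using 8(1) unfolding staged_def by auto
            have "set (map g [0..<len]) = g ` {..<len}" by (simp add: atLeast0LessThan)
            moreover have "distinct (map g [0..<len])" using g(3) by (simp add: distinct_map atLeast0LessThan)
            moreover have "card (g ` {..<len}) \<le> k" using g(3,6) by (simp add: card_image)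
            ultimately show ?thesis using g True unfolding solved_def optimal_def
              by (intro disjI2 conjI exI[of _ "map g [0..<len]"]) auto
          qed
          with Tr show ?case by (intro Q) simp
        qed (use p(3) st in \<open>auto simp: u_def\<close>)
        then show ?thesis using lk False nf vk p(3) by ((simp add: u_def; fail) | (simp add: u_def eval_nat_numeral))
      qed
    qed
  qed (use s in \<open>auto simp: w_def\<close>)
  then show "ok PHASES s Q" unfolding PHASES_def by ((simp add: w_def; fail) | (simp add: w_def eval_nat_numeral))
qed

definition answered :: "state \<Rightarrow> bool" where
  "answered t \<longleftrightarrow> (iv t vcnt = -1 \<and> \<not> (\<exists>X. cover X \<and> conn X \<and> card X \<le> k)) \<or>
     (\<exists>xs. distinct xs \<and> optimal (set xs) \<and> iv t vcnt = int (length xs) \<and> ia t aOUT (k + 2) = int (length xs) \<and>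
        (\<forall>i<length xs. ia t aOUT (k + 3 + i) = int (xs ! i)))"

lemma opt_len: "distinct xs \<Longrightarrow> optimal (set xs) \<Longrightarrow> length xs \<le> k"
  by (metis distinct_card optimal_def)

lemma COPY_ok:
  assumes s: "iv s vk = int k" "distinct xs" "optimal (set xs)" "iv s vlen = int (length xs)"
    "\<forall>i<length xs. ia s aLV i = int (xs ! i)"
  shows "ok COPY s (\<lambda>t. answered t \<and> tm t \<le> tm s + 30 + 40 * k)"
proof (rule ok_gen)
  fix Q :: "state \<Rightarrow> bool" assume Q: "\<And>t. answered t \<and> tm t \<le> tm s + 30 + 40 * k \<Longrightarrow> Q t"
  have l: "length xs \<le> k" using opt_len[OF s(2,3)] .
  have b: "int k + 2 \<le> B" "int k + 3 \<le> B" "int k + 2 < int L" using k_L' L_B by linarith+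
  have nk: "nat (int k + 2) = k + 2" by simp
  have v1: "iv s (Suc 0) = int k" using s(1) by simp
  show "ok COPY s Q" unfolding COPY_def
  proof (simp add: v1 s(4) b nk, rule ok_For[where n = "length xs" and T = "\<lambda>_. 25" and
      J = "\<lambda>i t. ia t aOUT (k + 2) = int (length xs) \<and> (\<forall>j<i. ia t aOUT (k + 3 + j) = int (xs ! j))"], goal_cases)
    case (7 i t)
    have "iv t vk = int k" "ia t aLV = ia s aLV" using frs[OF 7(2)] s by (simp_all)
    moreover have "int k + 3 + int i < int L" "int k + 3 + int i \<le> B" "i < L" using 7(1) l k_L' L_B by linarith+
    moreover have "nat (int k + 3 + int i) = k + 3 + i" by simp
    ultimately show ?case using 7 s(5) b by (auto simp: less_Suc_eq)
  next
    case (8 t)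
    have "iv t vcnt = int (length xs)" using frs[OF 8(2)] by simp
    then have "answered t" using 8(1) s(2,3) unfolding answered_def by blast
    then show ?case using 8(3) l by (intro Q) simp
  qed auto
qed

lemma MAINK_ok:
  assumes s: "iv s vk = int k" "iv s vcnt = 0"
  shows "ok MAINK s (\<lambda>t. answered t \<and> tm t \<le> tm s + 2 ^ k * (30000 * KN))"
proof (rule ok_gen)
  fix Q :: "state \<Rightarrow> bool" assume Q: "\<And>t. answered t \<and> tm t \<le> tm s + 2 ^ k * (30000 * KN) \<Longrightarrow> Q t"
  \<comment> \<open>The growing phase has no exponential factor and is absorbed by
    \<open>k \<le> 2 ^ k\<close>. The stages contribute \<open>2 ^ (k + 2) * 6500\<close>, that is,
    26000 per unit of \<open>2 ^ k\<close>.\<close>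
  have time: "200 + 64 * n + phasesT + 40 * k \<le> 2 ^ k * (30000 * KN)"
  proof -
    have f1: "k * (500 * KN) \<le> 2 ^ k * (500 * KN)" by (intro mult_le_mono1) (simp add: less_imp_le)
    have "1 * (400 * KN) \<le> 2 ^ k * (400 * KN)" by (intro mult_le_mono1) simp
    moreover have "k + 1 \<le> KN" "n \<le> KN" by (simp_all add: KN_def)
    then have "334 + 78 * k + 64 * n \<le> 400 * KN" by simp
    ultimately have f2: "334 + 78 * k + 64 * n \<le> 2 ^ k * (400 * KN)" by linarith
    have f3: "200 + 64 * n + phasesT + 40 * k = (334 + 78 * k + 64 * n) + k * (500 * KN) + 2 ^ k * (26000 * KN)"
      by (simp add: phasesT_def power_add algebra_simps)
    have "\<dots> \<le> 2 ^ k * (400 * KN) + 2 ^ k * (500 * KN) + 2 ^ k * (26000 * KN)" by (intro add_mono f1 f2 order_refl)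
    also have "\<dots> = 2 ^ k * (26900 * KN)" by (simp add: algebra_simps)
    also have "\<dots> \<le> 2 ^ k * (30000 * KN)" by (intro mult_le_mono2 mult_le_mono1) simp
    finally show ?thesis unfolding f3 .
  qed
  define w where "w = s\<lparr>iv := (iv s)(2 := int n, 46 := 0, 6 := 0), tm := Suc (Suc (Suc (Suc (Suc (Suc (Suc (Suc (Suc (Suc (tm s))))))))))\<rparr>"
  let ?J = "\<lambda>i t. iv t vrf = of_bool (\<exists>u<i. 0 < deg u) \<and>
     ((\<exists>u<i. 0 < deg u) \<longrightarrow> (\<exists>x y. ia t 0 0 = int x \<and> ia t 0 1 = int y \<and> ad x y))"
  let ?R = "\<lambda>t. ok (Unless (Less (V vcnt) (N 0)) COPY) t Q"
  have copy: "?R t" if t: "solved t" "iv t vk = int k" "tm t \<le> tm s + 100 + 64 * n + phasesT" for t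
  proof (cases "iv t vcnt < 0")
    case True
    then have "answered (t\<lparr>tm := z\<rparr>)" for z using t(1) by (auto simp: solved_def answered_def)
    then show ?thesis using True t(3) time by (simp add: Q)
  next
    case False
    then obtain xs where xs: "distinct xs" "optimal (set xs)" "iv t vlen = int (length xs)" "\<forall>i<length xs. ia t aLV i = int (xs ! i)"
      using t(1) by (auto simp: solved_def)
    have "ok COPY (t\<lparr>tm := tm t + 5\<rparr>) Q"
    proof (rule ok_mono[OF COPY_ok[of _ xs]], goal_cases)
      case (6 u) then show ?case using t(3) time by (intro Q) simp
    qed (use t(2) xs in auto)
    then show ?thesis using False by simp
  qed
  have "ok (For vv (V vn) ROOT) w (\<lambda>t. ok (When (Eq (V vrf) (N 1)) PHASES ;; Unless (Less (V vcnt) (N 0)) COPY) t Q)"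
  proof (rule ok_For[where n = n and T = "\<lambda>_. 60" and J = ?J], goal_cases)
    case (7 v t)
    have "iv t vn = int n" using frs[OF 7(2)] by (simp add: w_def)
    from ROOT_ok[OF this 7(3,1) conjunct1[OF 7(4)] conjunct2[OF 7(4)]] show ?case by (rule ok_mono) blast
  next
    case (8 t)
    have et: "iv t vk = int k" "iv t vcnt = 0" "iv t vn = int n" "iv t vlen = 0" using frs[OF 8(2)] s by (simp_all add: w_def)
    have Tt: "tm t \<le> tm s + 20 + 64 * n" using 8(3) by (simp add: w_def)
    have "ok (When (Eq (V vrf) (N 1)) PHASES) t ?R"
    proof (cases "\<exists>u<n. 0 < deg u")
      case False
      have ne: "\<not> ad u v" for u v using False by (auto simp: ad_def)
      have "(\<Sum>v\<in>X. W ! v) \<ge> 0" if "cover X" for X using that W_pos lenW by (intro sum_nonneg) (auto simp: cover_def)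
      \<comment> \<open>Without edges the empty set is a connected cover of weight 0, which
        nonnegative weights cannot beat; no pairs are grown in this case.\<close>
      then have "optimal {}" using ne by (simp add: optimal_def cover_def)
      then have "solved (t\<lparr>tm := z\<rparr>)" for z using et unfolding solved_def by (intro disjI2) (auto intro!: exI[of _ "[]"])
      then have R: "?R (t\<lparr>tm := tm t + 5\<rparr>)" using et Tt by (intro copy) auto
      have "iv t vrf = 0" using 8(1) False by simp
      then show ?thesis using R by simp
    next
      case True
      then obtain x y where xy: "ia t 0 0 = int x" "ia t 0 1 = int y" "ad x y" using 8(1) by blast
      have R: "ok PHASES (t\<lparr>tm := tm t + 5\<rparr>) ?R"
      proof (rule ok_mono[OF PHASES_ok[of _ x y]], goal_cases)
        case (7 u)
        have "iv u vk = int k" using frs[OF 7(1)] et by (simp add: PHASES_def)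
        then show ?case using 7(2) Tt by (intro copy) auto
      qed (use et xy in auto)
      have "iv t vrf = 1" using 8(1) True by simp
      then show ?thesis using R by simp
    qed
    then show ?case unfolding ok_Seq .
  qed (auto simp: w_def)
  moreover have "I ! 1 = int n" using I_1 by simp
  ultimately show "ok MAINK s Q" unfolding MAINK_def using I_1 bigB by (simp add: w_def in_range_def len_I)
qed

lemma MAIN_ok: "ok MAIN s (\<lambda>t. iv t vk = int k \<and> answered t \<and> tm t \<le> tm s + 20 + 2 ^ k * (30000 * KN))"
proof (rule ok_gen)
  fix Q :: "state \<Rightarrow> bool" assume Q: "\<And>t. iv t vk = int k \<and> answered t \<and> tm t \<le> tm s + 20 + 2 ^ k * (30000 * KN) \<Longrightarrow> Q t"
  define w where "w = s\<lparr>iv := (iv s)(1 := int k, 0 := 0), tm := 12 + tm s\<rparr>"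
  have "ok MAINK w Q"
  proof (rule ok_mono[OF MAINK_ok], goal_cases)
    case (3 t)
    have "iv t vk = iv w vk" by (rule fr_iv[OF 3(1)]) (simp add: MAINK_def PHASES_def COPY_def)
    then show ?case using 3(2) by (intro Q) (simp add: w_def)
  qed (simp_all add: w_def)
  then show "ok MAIN s Q" unfolding MAIN_def using I_0 bigB by ((simp add: w_def in_range_def len_I; fail) | (simp add: w_def in_range_def len_I eval_nat_numeral))
qed

end

section \<open>Moving the answer to the beginning of the memory\<close>

text \<open>Compiled for a single array, so that array index \<open>i\<close> is cell
  \<open>70 + i\<close> of the same memory. Variable 3 holds the address \<open>10 * k + 99\<close>
  of the stored length, and consecutive entries are 10 cells apart; index \<open>10 * i\<close> plus
  that address plus 630 is the entry that belongs into cell \<open>70 + i\<close>. The cells below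
  70 are left to the code that follows.\<close>

definition OUTP :: com where
  "OUTP = Asg 2 (N 0) ;; Unless (Less (V 0) (N 0)) (Asg 3 (N 10 \<otimes> V 1 \<oplus> N 99) ;;
    When (Less (N 69) (V 0)) (For 4 (V 0 \<ominus> N 69)
      (Put 0 (V 4) (Arr 0 (N 10 \<otimes> V 4 \<oplus> (V 3 \<oplus> N 630))))))"

lemma w_OUTP [simp]: "wv OUTP = {2, 3, 4, 5}" "wa OUTP = {0}" "wr OUTP = {}" "wra OUTP = False"
  by (auto simp: OUTP_def)

text \<open>Cells 1 to 69 contain variables and scratch values, so they can be filled only by plain
  machine code. Cell 0 holds the base address, and each target cell first holds the address of its
  own source.\<close>

definition fetch :: "nat \<Rightarrow> instr list" where
  "fetch m = concat (map (\<lambda>d. [Const d (10 * int d), Op Plus d d 0, Load d d]) [1..<Suc m])"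

lemma fetch_0 [simp]: "fetch 0 = []" by (simp add: fetch_def)
lemma fetch_Suc: "fetch (Suc m) = fetch m @ [Const (Suc m) (10 * int (Suc m)), Op Plus (Suc m) (Suc m) 0, Load (Suc m) (Suc m)]"
  by (simp add: fetch_def)
lemma length_fetch [simp]: "length (fetch m) = 3 * m"
  by (induction m) (simp_all add: fetch_Suc)

text \<open>Cell 2 contains 0, so the first jump ends the program exactly for the answer -1.
  Otherwise cell 0 becomes the base address and is replaced by the length at the very end. The
  offset 210 is the number of instructions: 3 around the 207 of the fetching part.\<close>

definition outp_end :: "nat \<Rightarrow> instr list" where
  "outp_end e = [JumpLess 0 2 (e + 210), Op Plus 0 3 2] @ fetch 69 @ [Load 0 0]"

definition cvc_prog :: "instr list" where
  "cvc_prog = ccomp 10 0 MAIN @ ccomp 1 (csize MAIN) OUTP @ outp_end (csize MAIN + csize OUTP)"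

definition zero_state :: state where
  "zero_state = \<lparr>iv = \<lambda>_. 0, ia = \<lambda>_ _. 0, rv = \<lambda>_. 0, ra = \<lambda>_. 0, tm = 0\<rparr>"

lemmas com_defs = MAIN_def MAINK_def PHASES_def COPY_def ROOT_def STAGE_def SEARCH_def PROBE_def NBR_def SOLVE_def TRY_def DECODE_def
  VERT_def VERT2_def COLLECT_def STATUS_def LINK_def HASB_def MERGE_def FORNB_def LOOK_def DPALL_def EXTRACT_def EXT1_def SELECT_def SEL1_def
  DPMAIN_def EXPAND_def RELAX1_def TOUCH_def DPINIT_def NUM1_def NUM2_def

lemma wf_MAIN: "wf 10 MAIN"
  by (simp add: com_defs)

lemma wf_OUTP: "wf 1 OUTP"
  by (simp add: OUTP_def)

lemma length_prog: "length cvc_prog = csize MAIN + csize OUTP + 210"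
  by (simp add: cvc_prog_def outp_end_def)

lemma code_prog: "code_at cvc_prog 0 (ccomp 10 0 MAIN)" "code_at cvc_prog (csize MAIN) (ccomp 1 (csize MAIN) OUTP)"
  "code_at cvc_prog (csize MAIN + csize OUTP) (outp_end (csize MAIN + csize OUTP))"
proof -
  have "code_at cvc_prog 0 cvc_prog" unfolding code_at_def by (intro exI[of _ "[]"]) simp
  from this[unfolded cvc_prog_def[THEN arg_cong[of _ _ "code_at cvc_prog 0"], unfolded code_at_append]]
  show "code_at cvc_prog 0 (ccomp 10 0 MAIN)" "code_at cvc_prog (csize MAIN) (ccomp 1 (csize MAIN) OUTP)"
    "code_at cvc_prog (csize MAIN + csize OUTP) (outp_end (csize MAIN + csize OUTP))" by simp_all
qed

context machine
begin

text \<open>All sources lie above \<open>q\<close>, all targets below it, so no load reads a cell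
  that has been overwritten.\<close>

lemma fetch_runs:
  assumes "code_at p pc (fetch m)" "M ! 0 = int q" "q + 10 * m < length M" "int (q + 10 * m) \<le> B" "m < q"
  shows "\<exists>M'. runs p (3 * m) (pc, M, R) (pc + 3 * m, M', R) \<and> length M' = length M \<and> M' ! 0 = int q \<and>
     (\<forall>d. 1 \<le> d \<and> d \<le> m \<longrightarrow> M' ! d = M ! (q + 10 * d)) \<and> (\<forall>d>m. M' ! d = M ! d)"
  using assms
proof (induction m)
  case 0
  then show ?case by (intro exI[of _ M]) auto
next
  case (Suc m)
  have c: "code_at p pc (fetch m)" "code_at p (pc + 3 * m) [Const (Suc m) (10 * int (Suc m))]"
    "code_at p (pc + 3 * m + 1) [Op Plus (Suc m) (Suc m) 0]" "code_at p (pc + 3 * m + 2) [Load (Suc m) (Suc m)]"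
    using Suc.prems(1) unfolding fetch_Suc code_at_append
    by (auto simp: code_at_Cons[of p _ _ "[_, _]"] code_at_Cons[of p _ _ "[_]"])
  obtain M' where M': "runs p (3 * m) (pc, M, R) (pc + 3 * m, M', R)" "length M' = length M" "M' ! 0 = int q"
    "\<forall>d. 1 \<le> d \<and> d \<le> m \<longrightarrow> M' ! d = M ! (q + 10 * d)" "\<forall>d>m. M' ! d = M ! d"
    using Suc.IH[OF c(1)] Suc.prems by auto
  define d where "d = Suc m"
  define M1 where "M1 = M'[d := 10 * int d]"
  define M2 where "M2 = M1[d := int (q + 10 * d)]"
  define M3 where "M3 = M2[d := M ! (q + 10 * d)]"
  have d: "d < length M" "0 < d" "q + 10 * d < length M" "int (q + 10 * d) \<le> B" "d < q" using Suc.prems by (simp_all add: d_def)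
  have e1: "exec B I W (Const d (10 * int d)) (pc + 3 * m, M', R) (Suc (pc + 3 * m), M1, R)"
    unfolding M1_def by (rule exec.intros) (use d M'(2) in auto)
  have e2: "exec B I W (Op Plus d d 0) (Suc (pc + 3 * m), M1, R) (Suc (Suc (pc + 3 * m)), M2, R)"
    unfolding M2_def by (rule exec.intros) (use d M'(2,3) in \<open>auto simp: M1_def\<close>)
  have m2: "M2 ! d = int (q + 10 * d)" "M2 ! (q + 10 * d) = M ! (q + 10 * d)"
    using d M'(2,5) by (auto simp: M2_def M1_def d_def)
  have "exec B I W (Load d d) (Suc (Suc (pc + 3 * m)), M2, R) (Suc (Suc (Suc (pc + 3 * m))), M2[d := M2 ! nat (M2 ! d)], R)"
    by (rule exec.intros) (use d M'(2) m2 in \<open>auto simp: M2_def M1_def in_range_def\<close>)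
  moreover have "nat (M2 ! d) = q + 10 * d" using m2(1) by simp
  ultimately have e3: "exec B I W (Load d d) (Suc (Suc (pc + 3 * m)), M2, R) (Suc (Suc (Suc (pc + 3 * m))), M3, R)"
    using m2(2) by (simp add: M3_def)
  have "runs p 1 (pc + 3 * m, M', R) (Suc (pc + 3 * m), M1, R)" by (rule runs_step[OF c(2) e1[unfolded d_def[THEN eq_reflection]], folded d_def])
  note r1 = runs_trans[OF M'(1) this]
  have "runs p 1 (Suc (pc + 3 * m), M1, R) (Suc (Suc (pc + 3 * m)), M2, R)" using runs_step[of p "Suc (pc + 3 * m)"] c(3) e2 by (simp add: d_def)
  note r2 = runs_trans[OF r1 this]
  have "runs p 1 (Suc (Suc (pc + 3 * m)), M2, R) (Suc (Suc (Suc (pc + 3 * m))), M3, R)" using runs_step[of p "Suc (Suc (pc + 3 * m))"] c(4) e3 by (simp add: d_def)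
  note r3 = runs_trans[OF r2 this]
  have "3 * m + 1 + 1 + 1 = 3 * Suc m" "Suc (Suc (Suc (pc + 3 * m))) = pc + 3 * Suc m" by simp_all
  then have "runs p (3 * Suc m) (pc, M, R) (pc + 3 * Suc m, M3, R)" using r3 by metis
  moreover have "length M3 = length M" "M3 ! 0 = int q" using M'(2,3) d by (simp_all add: M3_def M2_def M1_def)
  moreover have "\<forall>x. 1 \<le> x \<and> x \<le> Suc m \<longrightarrow> M3 ! x = M ! (q + 10 * x)"
    using M'(2,4) d by (auto simp: M3_def M2_def M1_def d_def nth_list_update le_Suc_eq)
  moreover have "\<forall>x>Suc m. M3 ! x = M ! x" using M'(5) by (simp add: M3_def M2_def M1_def d_def)
  ultimately show ?case by blast
qed

text \<open>Target indices stay below \<open>k\<close> while source indices start at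
  \<open>10 * k + 729\<close>, so nothing is overwritten before it has been read.\<close>

lemma OUTP_ok:
  assumes "iv s 0 = int len" "iv s 1 = int k" "len \<le> k" "20 * k + 2000 \<le> L"
  shows "ok OUTP s (\<lambda>t. iv t 0 = int len \<and> iv t 2 = 0 \<and> iv t 3 = int (10 * k + 99) \<and>
    (\<forall>i<len - 69. ia t 0 i = ia s 0 (10 * k + 729 + 10 * i)) \<and> (\<forall>i\<ge>k. ia t 0 i = ia s 0 i) \<and> tm t \<le> tm s + 100 + 40 * k)"
    (is "ok OUTP s ?P")
proof (rule ccontr, erule notE)
  have "1 * L \<le> na * L" using na_pos by (intro mult_le_mono1) simp
  then have "int L \<le> int (na * L)" by (simp only: of_nat_le_iff mult_1)
  then have LB: "int L + 70 \<le> B" using room by linarith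
  have v1: "iv s (Suc 0) = int k" using assms(2) by simp
  have b: "10 * int k + 99 \<le> B" using LB assms(4) by linarith
  have b': "10 * int k \<le> B" using b by linarith
  show "ok OUTP s ?P"
  proof (cases "69 < len")
    case False
    then show ?thesis unfolding OUTP_def using assms(1) v1 b b' by simp
  next
    case True
    define w where "w = s\<lparr>iv := (iv s)(2 := 0, 3 := 10 * int k + 99), tm := 21 + tm s\<rparr>"
    have "ok (For 4 (V 0 \<ominus> N 69) (Put 0 (V 4) (Arr 0 (N 10 \<otimes> V 4 \<oplus> (V 3 \<oplus> N 630))))) w ?P"
    proof (rule ok_For[where n = "len - 69" and T = "\<lambda>_. 30" and J = "\<lambda>i t. (\<forall>j<i. ia t 0 j = ia s 0 (10 * k + 729 + 10 * j)) \<and>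
        (\<forall>j\<ge>i. ia t 0 j = ia s 0 j)"], goal_cases)
      case 1 show ?case using assms(1,3) b by (simp add: w_def)
    next
      case 2 show ?case using assms(1) True by (simp add: w_def of_nat_diff)
    next
      case (7 i t)
      have "iv t 3 = 10 * int k + 99" using frs[OF 7(2)] by (simp add: w_def)
      moreover have "10 * int i + (10 * int k + 729) < int L" "int i < int L" using 7(1) assms(3,4) by linarith+
      moreover have "10 * int i \<le> B" "10 * int i + (10 * int k + 729) \<le> B" "10 * int k + 729 \<le> B" using calculation LB by linarith+
      moreover have "nat (10 * int i + (10 * int k + 729)) = 10 * k + 729 + 10 * i"
        "nat (10 * int i + (729 + 10 * int k)) = 10 * k + 729 + 10 * i" by simp_all
      ultimately show ?case using 7(3,4) by (auto simp: less_Suc_eq)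
    next
      case (8 t)
      have "iv t 0 = int len" "iv t 2 = 0" "iv t 3 = int (10 * k + 99)" using frs[OF 8(2)] assms(1) by (simp_all add: w_def)
      moreover have "\<forall>i\<ge>k. ia t 0 i = ia s 0 i" using 8(1) assms(3) by auto
      moreover have "tm t \<le> tm s + 100 + 40 * k" using 8(3) assms(3) by (simp add: w_def)
      ultimately show ?case using 8(1) by blast
    qed (auto simp: w_def)
    then show ?thesis unfolding OUTP_def using True assms(1) v1 b b' by ((simp add: w_def; fail) | (simp add: w_def eval_nat_numeral))
  qed
qed

lemma prog_end:
  assumes na: "na = 10" and s: "safe MAIN zero_state" "t = sem MAIN zero_state"
    and S: "70 + 10 * L \<le> S" "10 + 10 * L \<le> S"
  shows "iv t 0 = -1 \<Longrightarrow> \<exists>u M. halts_in cvc_prog B S I W u M \<and> u \<le> tm t + 200 \<and> outputs_none M"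
    and "distinct xs \<Longrightarrow> length xs \<le> k \<Longrightarrow> iv t 0 = int (length xs) \<Longrightarrow> iv t 1 = int k \<Longrightarrow> 2 * k + 200 \<le> L \<Longrightarrow>
      ia t 9 (k + 2) = int (length xs) \<Longrightarrow> \<forall>i<length xs. ia t 9 (k + 3 + i) = int (xs ! i) \<Longrightarrow>
      \<exists>u M rest. halts_in cvc_prog B S I W u M \<and> u \<le> tm t + 500 + 40 * k \<and> M = int (length xs) # map int xs @ rest"
proof -
  have c0: "code_at cvc_prog 0 (ccomp na 0 MAIN)" and w0: "wf na MAIN" using code_prog(1) wf_MAIN na by simp_all
  have rep0: "rep zero_state (replicate S 0) (replicate S 0)" unfolding rep_def unfolding na
  proof (intro conjI allI impI)
    fix a i :: nat assume "a < 10" "i < L"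
    then show "replicate S 0 ! (70 + 10 * i + a) = ia zero_state a i" using S by (simp add: zero_state_def)
  qed (use S B_ge in \<open>auto simp: zero_state_def\<close>)
  obtain u1 M1 R1 where r1: "u1 + tm zero_state \<le> tm t" "runs cvc_prog u1 (0, replicate S 0, replicate S 0) (csize MAIN, M1, R1)"
    "rep t M1 R1" "length M1 = S" "length R1 = S"
    using ccomp_runs[OF c0 rep0 s(1) w0] unfolding s(2)[symmetric] by auto
  \<comment> \<open>The memory left by the first program is read anew as that of a machine with one
    array of ten times the length, which covers the same cells.\<close>
  have m1: "machine B 1 (10 * L)" using room na by unfold_locales simp_all
  interpret M1: machine B I W 1 "10 * L" by (rule m1)
  define s1 where "s1 = \<lparr>iv = (\<lambda>v. M1 ! v), ia = (\<lambda>_ i. M1 ! (70 + i)), rv = (\<lambda>r. R1 ! r), ra = (\<lambda>i. R1 ! (10 + i)), tm = 0\<rparr>"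
  have rep1: "M1.rep s1 M1 R1" unfolding M1.rep_def using S r1(3-5) by (auto simp: s1_def rep_def)
  have iv1: "iv s1 v = iv t v" if "v < 60" for v using r1(3) that by (simp add: s1_def rep_def)
  have outp: "\<exists>u2 M2 R2. u2 \<le> tm (M1.sem OUTP s1) \<and> runs cvc_prog u2 (csize MAIN, M1, R1) (csize MAIN + csize OUTP, M2, R2) \<and>
     M1.rep (M1.sem OUTP s1) M2 R2 \<and> length M2 = S" if "M1.safe OUTP s1"
    using M1.ccomp_runs[OF code_prog(2) rep1 that wf_OUTP] r1(4) by (auto simp: s1_def M1.runs_def runs_def)
  let ?e = "csize MAIN + csize OUTP"
  note code = code_prog(3)[unfolded outp_end_def code_at_append]
  have jmp: "code_at cvc_prog ?e [JumpLess 0 2 (?e + 210)]" "code_at cvc_prog (Suc ?e) [Op Plus 0 3 2]"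
    "code_at cvc_prog (?e + 2) (fetch 69)" "code_at cvc_prog (?e + 209) [Load 0 0]"
    using code by (simp_all add: code_at_Cons[of cvc_prog _ _ "[_]"] numeral_2_eq_2 add.commute[of "csize MAIN + csize OUTP" 209])
  have halt: "runs cvc_prog u (0, replicate S 0, replicate S 0) (?e + 210, M, R) \<Longrightarrow> halts_in cvc_prog B S I W u M" for u M R
    unfolding halts_in_def runs_def length_prog by blast
  show "\<exists>u M. halts_in cvc_prog B S I W u M \<and> u \<le> tm t + 200 \<and> outputs_none M" if neg: "iv t 0 = -1"
  proof -
    have "M1.ok OUTP s1 (\<lambda>w. iv w 0 = -1 \<and> iv w 2 = 0 \<and> tm w \<le> 50)" unfolding OUTP_def
      using iv1[of 0] neg by (simp add: s1_def)
    then have w: "M1.safe OUTP s1" "iv (M1.sem OUTP s1) 0 = -1" "iv (M1.sem OUTP s1) 2 = 0" "tm (M1.sem OUTP s1) \<le> 50" by (auto simp: M1.ok_def)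
    then obtain u2 M2 R2 where r2: "u2 \<le> 50" "runs cvc_prog u2 (csize MAIN, M1, R1) (?e, M2, R2)"
       "M1.rep (M1.sem OUTP s1) M2 R2" "length M2 = S" using outp by (meson order_trans)
    have m: "M2 ! 0 = -1" "M2 ! 2 = 0" using r2(3) w unfolding M1.rep_def by auto
    have "exec B I W (JumpLess 0 2 (?e + 210)) (?e, M2, R2) (if M2 ! 0 < M2 ! 2 then ?e + 210 else Suc ?e, M2, R2)"
      by (rule exec.intros) (use S r2(4) in auto)
    then have "exec B I W (JumpLess 0 2 (?e + 210)) (?e, M2, R2) (?e + 210, M2, R2)" using m by simp
    from halt[OF runs_trans[OF runs_trans[OF r1(2) r2(2)] runs_step[OF jmp(1) this]]]
    have "halts_in cvc_prog B S I W (u1 + u2 + 1) M2" .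
    moreover have "outputs_none M2" using m(1) r2(4) S unfolding outputs_none_def by (cases M2) auto
    moreover have "u1 + u2 + 1 \<le> tm t + 200" using r1(1) r2(1) by simp
    ultimately show ?thesis by blast
  qed
  show "\<exists>u M rest. halts_in cvc_prog B S I W u M \<and> u \<le> tm t + 500 + 40 * k \<and> M = int (length xs) # map int xs @ rest"
    if x: "distinct xs" "length xs \<le> k" "iv t 0 = int (length xs)" "iv t 1 = int k" "2 * k + 200 \<le> L"
      "ia t 9 (k + 2) = int (length xs)" "\<forall>i<length xs. ia t 9 (k + 3 + i) = int (xs ! i)"
  proof -
    define q where "q = 10 * k + 99"
    have all10: "\<forall>a<10. \<forall>i<L. M1 ! (70 + 10 * i + a) = ia t a i" using r1(3) unfolding rep_def unfolding na by blast
    have cell: "M1 ! (70 + 10 * i + 9) = ia t 9 i" if "i < L" for i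
      by (rule all10[rule_format]) (use that in simp_all)
    have cells: "M1 ! q = int (length xs)" "c \<in> {1..length xs} \<Longrightarrow> M1 ! (q + 10 * c) = int (xs ! (c - 1))" for c
    proof -
      have e: "q = 70 + 10 * (k + 2) + 9" by (simp add: q_def)
      show "M1 ! q = int (length xs)" unfolding e using cell[of "k + 2"] x(5,6) by simp
      assume c: "c \<in> {1..length xs}"
      then have e2: "q + 10 * c = 70 + 10 * (k + 3 + (c - 1)) + 9" by (auto simp: q_def)
      have lc: "c - 1 < length xs" using c by auto
      have lt: "k + 3 + (c - 1) < L" using lc x(2,5) by linarith
      show "M1 ! (q + 10 * c) = int (xs ! (c - 1))" unfolding e2 cell[OF lt] using x(7) lc by blast
    qed
    have "M1.ok OUTP s1 (\<lambda>t. iv t 0 = int (length xs) \<and> iv t 2 = 0 \<and> iv t 3 = int (10 * k + 99) \<and>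
      (\<forall>i<length xs - 69. ia t 0 i = ia s1 0 (10 * k + 729 + 10 * i)) \<and> (\<forall>i\<ge>k. ia t 0 i = ia s1 0 i) \<and> tm t \<le> tm s1 + 100 + 40 * k)"
      using iv1[of 0] iv1[of 1] x by (intro M1.OUTP_ok) auto
    then obtain w where w: "w = M1.sem OUTP s1" "M1.safe OUTP s1" "iv w 0 = int (length xs)" "iv w 2 = 0" "iv w 3 = int q"
      "\<forall>i<length xs - 69. ia w 0 i = ia s1 0 (10 * k + 729 + 10 * i)" "\<forall>i\<ge>k. ia w 0 i = ia s1 0 i" "tm w \<le> 100 + 40 * k"
      by (auto simp: M1.ok_def s1_def q_def)
    obtain u2 M2 R2 where r2': "u2 \<le> tm w" "runs cvc_prog u2 (csize MAIN, M1, R1) (?e, M2, R2)"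
       "M1.rep w M2 R2" "length M2 = S" using outp[OF w(2)] unfolding w(1)[symmetric] by blast
    have r2: "u2 \<le> 100 + 40 * k" "runs cvc_prog u2 (csize MAIN, M1, R1) (?e, M2, R2)"
       "M1.rep w M2 R2" "length M2 = S" using r2' w(8) by (blast intro: order_trans)+
    have m: "M2 ! 0 = int (length xs)" "M2 ! 2 = 0" "M2 ! 3 = int q" using r2(3) w(3-5) unfolding M1.rep_def by auto
    have m2: "M2 ! (70 + i) = ia w 0 i" if "i < 10 * L" for i using r2(3) that unfolding M1.rep_def by auto
    have qS: "q + 10 * 69 < S" "int (q + 10 * 69) \<le> B" using S x(5) room na by (auto simp: q_def)
    \<comment> \<open>The stored answer lies at array indices from \<open>k\<close> on, where the
      copying loop does not write.\<close>
    have far: "M2 ! (q + 10 * c) = M1 ! (q + 10 * c)" if "c \<le> 69 \<or> c \<le> k" for c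
    proof -
      define j where "j = 10 * k + 29 + 10 * c"
      have e: "q + 10 * c = 70 + j" by (simp add: q_def j_def)
      have "j < 10 * L" "k \<le> j" using that x(5) by (auto simp: j_def)
      then have "M2 ! (70 + j) = M1 ! (70 + j)" using m2[of j] w(7) by (simp add: s1_def)
      then show ?thesis unfolding e .
    qed
    define M3 where "M3 = M2[0 := int q]"
    have "exec B I W (JumpLess 0 2 (?e + 210)) (?e, M2, R2) (if M2 ! 0 < M2 ! 2 then ?e + 210 else Suc ?e, M2, R2)"
      by (rule exec.intros) (use S r2(4) in auto)
    then have "exec B I W (JumpLess 0 2 (?e + 210)) (?e, M2, R2) (Suc ?e, M2, R2)" using m by simp
    note run1 = runs_trans[OF runs_trans[OF r1(2) r2(2)] runs_step[OF jmp(1) this]]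
    have "exec B I W (Op Plus 0 3 2) (Suc ?e, M2, R2) (Suc (Suc ?e), M3, R2)" unfolding M3_def
      by (rule exec.intros) (use S r2(4) m qS in auto)
    note run2 = runs_trans[OF run1 runs_step[OF jmp(2) this]]
    have l3: "length M3 = S" "M3 ! 0 = int q" using r2(4) S by (simp_all add: M3_def)
    have q69: "69 < q" by (simp add: q_def)
    have qM: "q + 10 * 69 < length M3" using qS(1) l3(1) by simp
    obtain M4 where M4: "runs cvc_prog (3 * 69) (?e + 2, M3, R2) (?e + 2 + 3 * 69, M4, R2)" "length M4 = S" "M4 ! 0 = int q"
      "\<forall>d. 1 \<le> d \<and> d \<le> 69 \<longrightarrow> M4 ! d = M3 ! (q + 10 * d)" "\<forall>d>69. M4 ! d = M3 ! d"
      using fetch_runs[OF jmp(3) l3(2) qM qS(2) q69, of R2] unfolding l3(1) by blast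
    have ee: "Suc (Suc ?e) = ?e + 2" "?e + 2 + 3 * 69 = ?e + 209" by simp_all
    note run3 = runs_trans[OF run2[unfolded ee] M4(1)[unfolded ee]]
    define M5 where "M5 = M4[0 := M4 ! q]"
    have "exec B I W (Load 0 0) (?e + 209, M4, R2) (Suc (?e + 209), M4[0 := M4 ! nat (M4 ! 0)], R2)"
      by (rule exec.intros) (use S M4(2,3) qS in \<open>auto simp: in_range_def\<close>)
    moreover have "Suc (?e + 209) = ?e + 210" "nat (M4 ! 0) = q" using M4(3) by simp_all
    ultimately have "exec B I W (Load 0 0) (?e + 209, M4, R2) (?e + 210, M5, R2)" unfolding M5_def by metis
    note run4 = runs_trans[OF run3 runs_step[OF jmp(4) this]]
    have h: "halts_in cvc_prog B S I W (u1 + u2 + 1 + 1 + 3 * 69 + 1) M5" by (rule halt[OF run4])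
    have lx: "length xs < S" using x(2,5) S by simp
    have q70: "69 < q" by (simp add: q_def)
    have c0: "M5 ! 0 = int (length xs)" using cells(1) far[of 0] M4(2,5) q70 S by (simp add: M5_def M3_def)
    have cs: "M5 ! Suc i = int (xs ! i)" if i: "i < length xs" for i
    proof (cases "Suc i \<le> 69")
      case True
      then have "M5 ! Suc i = M2 ! (q + 10 * Suc i)" using M4(4) q70 by (simp add: M5_def M3_def)
      also have "\<dots> = M1 ! (q + 10 * Suc i)" using True by (intro far) simp
      also have "\<dots> = int (xs ! i)" using cells(2)[of "Suc i"] i by simp
      finally show ?thesis .
    next
      case False
      define j where "j = i - 69"
      have j: "Suc i = 70 + j" "j < length xs - 69" using False i by (auto simp: j_def)
      have "M5 ! Suc i = M2 ! (70 + j)" using M4(5) False unfolding j(1) by (simp add: M5_def M3_def)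
      also have "\<dots> = ia w 0 j" using j(2) x(2,5) by (intro m2) simp
      also have "\<dots> = M1 ! (70 + (10 * k + 729 + 10 * j))" using w(6) j(2) by (simp add: s1_def)
      also have "70 + (10 * k + 729 + 10 * j) = q + 10 * Suc i" unfolding j(1) by (simp add: q_def)
      also have "M1 ! (q + 10 * Suc i) = int (xs ! i)" using cells(2)[of "Suc i"] i by simp
      finally show ?thesis .
    qed
    have l5: "length M5 = S" using M4(2) by (simp add: M5_def)
    have "take (Suc (length xs)) M5 = int (length xs) # map int xs"
    proof (rule nth_equalityI)
      show "length (take (Suc (length xs)) M5) = length (int (length xs) # map int xs)" using l5 lx by simp
      fix i assume "i < length (take (Suc (length xs)) M5)"
      then show "take (Suc (length xs)) M5 ! i = (int (length xs) # map int xs) ! i"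
        using c0 cs by (cases i) auto
    qed
    then have "M5 = int (length xs) # map int xs @ drop (Suc (length xs)) M5" by (metis append_Cons append_take_drop_id)
    moreover have "u1 + u2 + 1 + 1 + 3 * 69 + 1 \<le> tm t + 500 + 40 * k" using r1(1) r2(1) by simp
    ultimately show ?thesis using h by blast
  qed
qed

end

section \<open>The theorem\<close>

text \<open>Links the given graph with the graph on list positions on which the program
  works.\<close>

locale listed = prog B k adj W L for B k adj W L +
  fixes V :: "nat set" and E :: "nat set set" and vs :: "nat list" and \<omega> :: "nat \<Rightarrow> real"
  assumes g: "graph V E" and a: "adjacency_lists V E vs adj" and W: "W = map \<omega> vs"
begin

lemma n_vs: "length vs = n" and vs: "distinct vs" "set vs = V"
  using a by (auto simp: adjacency_lists_def)

lemma ad_iff: "ad i j \<longleftrightarrow> i < n \<and> j < n \<and> {vs ! i, vs ! j} \<in> E"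
  using a by (auto simp: adjacency_lists_def ad_def)

lemma inj_vs: "i < n \<Longrightarrow> j < n \<Longrightarrow> vs ! i = vs ! j \<longleftrightarrow> i = j"
  using vs n_vs by (simp add: nth_eq_iff_index_eq)

lemma vs_inj_on: "X \<subseteq> {..<n} \<Longrightarrow> inj_on ((!) vs) X"
  using inj_vs by (auto simp: inj_on_def)

lemma vs_ex: "x \<in> V \<Longrightarrow> \<exists>i<n. x = vs ! i"
  using vs(2) n_vs by (metis in_set_conv_nth)

lemma vs_V: "i < n \<Longrightarrow> vs ! i \<in> V"
  using vs(2) n_vs by auto

lemma cover_iff:
  assumes X: "X \<subseteq> {..<n}" shows "vertex_cover V E ((!) vs ` X) \<longleftrightarrow> cover X"
proof
  assume v: "vertex_cover V E ((!) vs ` X)"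
  have "i \<in> X \<or> j \<in> X" if "ad i j" for i j
  proof -
    have ij: "i < n" "j < n" "{vs ! i, vs ! j} \<in> E" using that ad_iff by auto
    have "\<forall>e\<in>E. e \<inter> (!) vs ` X \<noteq> {}" using v unfolding vertex_cover_def by (rule conjunct2)
    from bspec[OF this ij(3)] obtain x where x: "x \<in> X" "vs ! x = vs ! i \<or> vs ! x = vs ! j" by auto
    have "x < n" using x(1) X by auto
    then have "x = i \<or> x = j" using x(2) inj_vs[OF _ ij(1), of x] inj_vs[OF _ ij(2), of x] by blast
    then show ?thesis using x(1) by blast
  qed
  then show "cover X" using X by (simp add: cover_def)
next
  assume c: "cover X"
  have h: "e \<inter> (!) vs ` X \<noteq> {}" if e: "e \<in> E" for e
  proof -
    have "card e = 2" "e \<subseteq> V" using g e by (auto simp: graph_def)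
    then obtain x y where xy: "e = {x, y}" "x \<in> V" "y \<in> V" by (auto simp: card_2_iff)
    then obtain i j where ij: "i < n" "x = vs ! i" "j < n" "y = vs ! j" using vs_ex by blast
    then have "ad i j" using e xy ad_iff by simp
    then have "i \<in> X \<or> j \<in> X" using c unfolding cover_def by blast
    then show ?thesis using xy(1) ij(2,4) by auto
  qed
  have "(!) vs ` X \<subseteq> V" using X vs_V by (intro image_subsetI) auto
  then show "vertex_cover V E ((!) vs ` X)" unfolding vertex_cover_def by (intro conjI ballI h)
qed

lemma conn_iff:
  assumes X: "X \<subseteq> {..<n}" shows "induced_connected E ((!) vs ` X) \<longleftrightarrow> conn X"
proof -
  let ?R = "{(a, b). a \<in> (!) vs ` X \<and> b \<in> (!) vs ` X \<and> {a, b} \<in> E}"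
  have 1: "(vs ! u, vs ! v) \<in> ?R\<^sup>*" if "(u, v) \<in> (edges X)\<^sup>*" for u v
    using that
  proof (induction rule: rtrancl_induct)
    case (step y z)
    then have "(vs ! y, vs ! z) \<in> ?R" using ad_iff by auto
    with step.IH show ?case by (rule rtrancl_into_rtrancl)
  qed simp
  have 2: "\<exists>v\<in>X. b = vs ! v \<and> (u, v) \<in> (edges X)\<^sup>*" if "(vs ! u, b) \<in> ?R\<^sup>*" "u \<in> X" for u b
    using that(1)
  proof (induction rule: rtrancl_induct)
    case base then show ?case using that(2) by blast
  next
    case (step y z)
    then obtain v where v: "v \<in> X" "y = vs ! v" "(u, v) \<in> (edges X)\<^sup>*" by blast
    obtain w where w: "w \<in> X" "z = vs ! w" "{y, z} \<in> E" using step.hyps(2) by blast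
    have "(v, w) \<in> edges X" using v(1,2) w X ad_iff by auto
    then have "(u, w) \<in> (edges X)\<^sup>*" by (rule rtrancl_into_rtrancl[OF v(3)])
    then show ?case using w by blast
  qed
  show ?thesis unfolding conn_iff_rtrancl induced_connected_def
  proof (intro iffI ballI)
    fix u v assume h: "\<forall>u\<in>(!) vs ` X. \<forall>v\<in>(!) vs ` X. (u, v) \<in> ?R\<^sup>*" and uv: "u \<in> X" "v \<in> X"
    then have "(vs ! u, vs ! v) \<in> ?R\<^sup>*" by blast
    then obtain w where "w \<in> X" "vs ! v = vs ! w" "(u, w) \<in> (edges X)\<^sup>*" using 2[OF _ uv(1)] by blast
    moreover have "w = v" using calculation(1,2) uv X inj_vs by (metis lessThan_iff subsetD)
    ultimately show "(u, v) \<in> (edges X)\<^sup>*" by simp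
  next
    fix x y assume "\<forall>u\<in>X. \<forall>v\<in>X. (u, v) \<in> (edges X)\<^sup>*" "x \<in> (!) vs ` X" "y \<in> (!) vs ` X"
    then show "(x, y) \<in> ?R\<^sup>*" using 1 by blast
  qed
qed

text \<open>An adjacency entry is determined by its edge together with the information which
  endpoint comes first in the list.\<close>

lemma handshake: "length (concat adj) \<le> 2 * card E"
proof -
  have fE: "finite E" using g finite_subset[of E "Pow V"] by (auto simp: graph_def)
  let ?A = "SIGMA i:{..<n}. set (adj ! i)"
  have A: "p \<in> ?A \<longleftrightarrow> ad (fst p) (snd p)" for p by (cases p) (auto simp: ad_def)
  let ?h = "\<lambda>(i, j). ({vs ! i, vs ! j}, i < j)"
  have "length (concat adj) = (\<Sum>i<n. card (set (adj ! i)))"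
    unfolding sum_deg[symmetric] using adj_dist by (intro sum.cong) (auto simp: distinct_card)
  also have "\<dots> = card ?A" by simp
  also have "\<dots> \<le> card (E \<times> (UNIV :: bool set))"
  proof (rule card_inj_on_le[of ?h])
    show "inj_on ?h ?A"
    proof (rule inj_onI)
      fix p q assume pq: "p \<in> ?A" "q \<in> ?A" "?h p = ?h q"
      obtain i j i' j' where e: "p = (i, j)" "q = (i', j')" by (metis surj_pair)
      have ij: "i < n" "j < n" "i' < n" "j' < n" "i \<noteq> j" using pq(1,2) e A ad_iff ad_irr by auto
      have "{vs ! i, vs ! j} = {vs ! i', vs ! j'}" "(i < j) = (i' < j')" using pq(3) e by auto
      then have "i = i' \<and> j = j' \<or> i = j' \<and> j = i'" "(i < j) = (i' < j')"
        using inj_vs ij by (auto simp: doubleton_eq_iff)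
      then show "p = q" using e ij(5) by auto
    qed
    show "?h ` ?A \<subseteq> E \<times> UNIV"
    proof
      fix x assume "x \<in> ?h ` ?A"
      then obtain p where "p \<in> ?A" "x = ?h p" by blast
      then show "x \<in> E \<times> UNIV" using A[of p] ad_iff by (cases p) auto
    qed
    show "finite (E \<times> (UNIV :: bool set))" using fE by simp
  qed
  also have "\<dots> = 2 * card E" by (simp add: card_cartesian_product)
  finally show ?thesis .
qed

lemma card_V: "card V = n"
  using vs n_vs distinct_card by metis

lemma cvc_iff: "X \<subseteq> {..<n} \<Longrightarrow> connected_vertex_cover V E ((!) vs ` X) \<longleftrightarrow> cover X \<and> conn X"
  by (simp add: connected_vertex_cover_def cover_iff conn_iff)

lemma cvcE:
  assumes "connected_vertex_cover V E Y" "int (card Y) \<le> int k"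
  obtains X where "X \<subseteq> {..<n}" "Y = (!) vs ` X" "cover X" "conn X" "card X \<le> k"
proof -
  define X where "X = {i. i < n \<and> vs ! i \<in> Y}"
  have Y: "Y \<subseteq> V" using assms(1) by (simp add: connected_vertex_cover_def vertex_cover_def)
  have X: "X \<subseteq> {..<n}" "Y = (!) vs ` X" using Y vs_ex by (auto simp: X_def)
  have "card Y = card X" unfolding X(2) by (rule card_image[OF vs_inj_on[OF X(1)]])
  then show thesis using that[OF X] cvc_iff[OF X(1)] assms X(2) by simp
qed

lemma weight_img: "X \<subseteq> {..<n} \<Longrightarrow> weight \<omega> ((!) vs ` X) = (\<Sum>v\<in>X. W ! v)"
  unfolding weight_def using vs_inj_on[of X] n_vs W by (auto simp: sum.reindex intro!: sum.cong)

lemma optimal_min: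
  assumes "optimal Q" shows "min_weight_cvc V E \<omega> (int k) ((!) vs ` Q)"
proof -
  have Q: "Q \<subseteq> {..<n}" "cover Q" "conn Q" "card Q \<le> k" using assms by (auto simp: optimal_def cover_def)
  have "weight \<omega> ((!) vs ` Q) \<le> weight \<omega> Y" if "connected_vertex_cover V E Y" "int (card Y) \<le> int k" for Y
    using cvcE[OF that] assms Q(1) weight_img unfolding optimal_def by metis
  then show ?thesis unfolding min_weight_cvc_def using cvc_iff[OF Q(1)] Q card_image[OF vs_inj_on[OF Q(1)]] by simp
qed

lemma run_prog:
  assumes S: "70 + 10 * L \<le> S" "2 * k + 200 \<le> L"
  shows "\<exists>t M. halts_in cvc_prog B S (input_words (int k) adj) (map \<omega> vs) t M \<and>
     t \<le> 520 + 2 ^ k * (30000 * KN) + 40 * k \<and>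
     ((\<exists>X. min_weight_cvc V E \<omega> (int k) X \<and> outputs_set vs M X) \<or>
      ((\<nexists>X. connected_vertex_cover V E X \<and> int (card X) \<le> int k) \<and> outputs_none M))"
proof -
  define t where "t = sem MAIN zero_state"
  have m: "safe MAIN zero_state" "iv t 1 = int k" "answered t" "tm t \<le> 20 + 2 ^ k * (30000 * KN)"
    using MAIN_ok[of zero_state] by (auto simp: ok_def t_def zero_state_def)
  have S2: "10 + 10 * L \<le> S" using S by simp
  note fin = prog_end[OF refl m(1) t_def S(1) S2, unfolded W]
  from m(3) consider (none) "iv t 0 = -1" "\<not> (\<exists>X. cover X \<and> conn X \<and> card X \<le> k)"
    | (some) xs where "distinct xs" "optimal (set xs)" "iv t 0 = int (length xs)" "ia t 9 (k + 2) = int (length xs)"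
        "\<forall>i<length xs. ia t 9 (k + 3 + i) = int (xs ! i)"
    unfolding answered_def by blast
  then show ?thesis
  proof cases
    case none
    have "\<nexists>X. connected_vertex_cover V E X \<and> int (card X) \<le> int k" using none(2) cvcE by metis
    moreover obtain u M where "halts_in cvc_prog B S (input_words (int k) adj) (map \<omega> vs) u M" "u \<le> tm t + 200" "outputs_none M"
      using fin(1)[OF none(1)] by blast
    ultimately show ?thesis using m(4) by (intro exI[of _ u] exI[of _ M]) auto
  next
    case some
    obtain u M rest where u: "halts_in cvc_prog B S (input_words (int k) adj) (map \<omega> vs) u M" "u \<le> tm t + 500 + 40 * k"
      "M = int (length xs) # map int xs @ rest"
      using fin(2)[OF some(1) opt_len[OF some(1,2)] some(3) m(2) S(2) some(4,5)] by blast
    have "set xs \<subseteq> {..<length vs}" using some(2) n_vs by (simp add: optimal_def cover_def)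
    then have "outputs_set vs M ((!) vs ` set xs)" unfolding outputs_set_def using u(3) some(1) by blast
    then show ?thesis using u m(4) optimal_min[OF some(2)] by (intro exI[of _ u] exI[of _ M]) auto
  qed
qed

end

theorem theorem1:
  "\<exists>(p :: instr list) (C :: nat).
     \<forall>(V :: nat set) (E :: nat set set) (\<omega> :: nat \<Rightarrow> real) (k :: int)
       (vs :: nat list) (adj :: nat list list).
       graph V E \<longrightarrow> (\<forall>v\<in>V. 0 \<le> \<omega> v) \<longrightarrow> adjacency_lists V E vs adj \<longrightarrow>
       (\<exists>t M.
          halts_in p (word_bound C V E k) (C * space_bound k)
            (input_words k adj) (map \<omega> vs) t M \<and>
          t \<le> C * time_bound V E k \<and>
          ((\<exists>X. min_weight_cvc V E \<omega> k X \<and> outputs_set vs M X) \<or>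
           ((\<nexists>X. connected_vertex_cover V E X \<and> int (card X) \<le> k) \<and> outputs_none M)))"
proof -
  \<comment> \<open>Time needs the most: 30000 per unit, times 2 for \<open>k + 1\<close> against
    \<open>k\<close>, times 3 for the adjacency entries and the added 1, gives 180000, and at most
    560 more for input and output. Space needs only 70 plus ten arrays of 300 units.\<close>
  define C :: nat where "C = 200000"
  have C: "200000 \<le> C" by (simp add: C_def)
  have "\<exists>t M. halts_in cvc_prog (word_bound C V E k) (C * space_bound k) (input_words k adj) (map \<omega> vs) t M \<and>
          t \<le> C * time_bound V E k \<and>
          ((\<exists>X. min_weight_cvc V E \<omega> k X \<and> outputs_set vs M X) \<or>
           ((\<nexists>X. connected_vertex_cover V E X \<and> int (card X) \<le> k) \<and> outputs_none M))"
    if g: "graph V E" and pos: "\<forall>v\<in>V. 0 \<le> \<omega> v" and a: "adjacency_lists V E vs adj"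
    for V :: "nat set" and E :: "nat set set" and \<omega> :: "nat \<Rightarrow> real" and k :: int and vs :: "nat list" and adj :: "nat list list"
  proof -
    define N where "N = card V + card E"
    define m where "m = max 1 (nat k)"
    define b :: int where "b = 2 ^ nat \<bar>k\<bar> * (int N + 2)"
    define B where "B = word_bound C V E k"
    \<comment> \<open>The table takes at most \<open>2 ^ K * (8 * K + 16)\<close> cells, that is, 24
      units; the rest covers the constant 200 required for moving the answer.\<close>
    define L where "L = 300 * space_bound k"
    define S where "S = C * space_bound k"
    have p1: "1 \<le> (2::int) ^ nat \<bar>k\<bar>" by simp
    have bN: "int N + 2 \<le> b" unfolding b_def using mult_right_mono[OF p1, of "int N + 2"] by simp
    have "2 ^ nat \<bar>k\<bar> * 1 \<le> b" unfolding b_def by (intro mult_left_mono) auto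
    then have b2: "2 ^ nat \<bar>k\<bar> \<le> b" by simp
    have "int (nat \<bar>k\<bar>) < int (2 ^ nat \<bar>k\<bar>)" unfolding of_nat_less_iff by (rule less_exp)
    then have bk: "\<bar>k\<bar> \<le> b" using b2 by simp
    have sb: "space_bound k = 2 ^ nat k * m" by (simp add: space_bound_def m_def)
    have mk: "nat k \<le> 2 ^ nat k" by (rule less_imp_le[OF less_exp])
    have mm: "1 \<le> m" "nat k \<le> m" by (simp_all add: m_def)
    have NN: "1 \<le> max 1 N" "N \<le> max 1 N" by simp_all
    have "m \<le> 2 ^ nat k" unfolding m_def by (rule max.boundedI[OF _ mk]) simp
    then have "space_bound k \<le> 2 ^ nat k * 2 ^ nat k" unfolding sb by (rule mult_le_mono2)
    then have "int (space_bound k) \<le> int (2 ^ nat k * 2 ^ nat k)" unfolding of_nat_le_iff .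
    also have "\<dots> = 2 ^ nat k * 2 ^ nat k" by simp
    also have "\<dots> \<le> b * b"
    proof -
      have "(2::int) ^ nat k \<le> 2 ^ nat \<bar>k\<bar>" by (rule power_increasing) auto
      then have "(2::int) ^ nat k \<le> b" using b2 by linarith
      then show ?thesis using bN by (intro mult_mono) auto
    qed
    finally have sbb: "int (space_bound k) \<le> b * b" .
    have sb1: "1 \<le> space_bound k" unfolding sb using mm(1) by simp
    \<comment> \<open>As \<open>b\<close> is at least 2, twelve of its factors already exceed the
      constants in all address bounds, and two more are needed to bound the space.\<close>
    have b14: "4096 * (b * b) \<le> B"
    proof -
      have "(2::int) ^ 12 \<le> b ^ 12" using bN by (intro power_mono) auto
      then have "4096 * (b * b) \<le> b ^ 12 * (b * b)" by (intro mult_right_mono) auto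
      also have "\<dots> = b ^ 14" by (simp add: eval_nat_numeral)
      also have "\<dots> \<le> b ^ C" using bN C by (intro power_increasing) auto
      also have "\<dots> = B" by (simp only: B_def word_bound_def b_def N_def)
      finally show ?thesis .
    qed
    have bb: "2 * b \<le> b * b" using bN by (intro mult_right_mono) auto
    have room: "int (70 + 10 * L) \<le> B" using sbb sb1 b14 unfolding L_def by linarith
    have m10: "machine B 10 L" by unfold_locales (use room in simp_all)
    have S: "70 + 10 * L \<le> S" "10 + 10 * L \<le> S"
    proof -
      have "200000 * space_bound k \<le> S" unfolding S_def using C by (rule mult_le_mono1)
      then show "70 + 10 * L \<le> S" "10 + 10 * L \<le> S" using sb1 unfolding L_def by linarith+
    qed
    have T1: "1 \<le> 2 ^ nat k * m * max 1 N" using mm(1) NN(1) by simp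
    have T: "200000 * (2 ^ nat k * m * max 1 N) \<le> C * time_bound V E k"
      unfolding time_bound_def m_def N_def using C by (rule mult_le_mono1)
    show ?thesis
    proof (cases "k < 0")
      case True
      interpret M: machine B "input_words k adj" "map \<omega> vs" 10 L by (rule m10)
      have kB: "\<bar>k\<bar> \<le> B" using bk bb b14 bN by linarith
      have i0: "input_words k adj ! 0 = k" "0 < length (input_words k adj)" by (simp_all add: input_words_def)
      have "M.ok MAIN zero_state (\<lambda>t. iv t 0 = -1 \<and> tm t \<le> 50)" unfolding MAIN_def
        using True kB i0 by (simp add: zero_state_def in_range_def)
      then have o: "M.safe MAIN zero_state" "iv (M.sem MAIN zero_state) 0 = -1" "tm (M.sem MAIN zero_state) \<le> 50" by (auto simp: M.ok_def)
      obtain u Mm where u: "halts_in cvc_prog B S (input_words k adj) (map \<omega> vs) u Mm" "u \<le> tm (M.sem MAIN zero_state) + 200" "outputs_none Mm"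
        using M.prog_end(1)[OF refl o(1) refl S o(2)] by blast
      have "u \<le> C * time_bound V E k" using u(2) o(3) T T1 by linarith
      moreover have "\<nexists>X. connected_vertex_cover V E X \<and> int (card X) \<le> k" using True by auto
      ultimately show ?thesis using u unfolding B_def S_def by blast
    next
      case False
      define K where "K = nat k"
      have k: "k = int K" using False by (simp add: K_def)
      have al: "length adj = length vs" "distinct vs" "set vs = V" and
        adi: "\<And>i. i < length vs \<Longrightarrow> distinct (adj ! i) \<and> set (adj ! i) = {j. j < length vs \<and> {vs ! i, vs ! j} \<in> E}"
        using a by (auto simp: adjacency_lists_def)
      have irr: "{x} \<notin> E" for x using g by (auto simp: graph_def)
      have KL: "2 ^ (K + 3) * (K + 2) \<le> L" "2 * K + 200 \<le> L"
      proof -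
        have "2 ^ (K + 3) * (K + 2) = 2 ^ K * (8 * K + 16)" by (simp add: power_add algebra_simps)
        also have "\<dots> \<le> 2 ^ K * (300 * m)" by (intro mult_le_mono2) (use mm[folded K_def] in linarith)
        finally show "2 ^ (K + 3) * (K + 2) \<le> L" by (simp add: L_def sb K_def)
        have "2 * K + 200 \<le> 300 * m" using mm[folded K_def] by linarith
        also have "1 * (300 * m) \<le> 2 ^ nat k * (300 * m)" by (intro mult_le_mono1) simp
        finally show "2 * K + 200 \<le> L" by (simp add: L_def sb)
      qed
      \<comment> \<open>A provisional word bound breaks a circle: that the input fits into words of
        size \<open>B\<close> depends on the bound on the adjacency lists by the edges, which is
        available only inside the locale that assumes such a word bound.\<close>
      define B' where "B' = int L * 10 + 70 + int (length adj + length (concat adj) + K + 100)"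
      have p: "prog B' K adj (map \<omega> vs) L"
      proof (intro prog.intro prog_axioms.intro, goal_cases)
        case 1 show ?case by unfold_locales (simp_all add: B'_def)
      next
        case (3 i j) then show ?case using adi[of i] adi[of j] al by (auto simp: insert_commute)
      next
        case (4 i) then show ?case using adi[of i] al irr by auto
      next
        case (7 i) then show ?case using pos al by auto
      qed (use al adi KL in \<open>auto simp: B'_def\<close>)
      interpret P: listed B' K adj "map \<omega> vs" L V E vs \<omega> by (rule listed.intro[OF p listed_axioms.intro]) (use g a in auto)
      have D: "length adj + length (concat adj) \<le> 2 * N" using P.handshake P.card_V by (simp add: N_def)
      then have "int (length adj + length (concat adj)) \<le> int (2 * N)" unfolding of_nat_le_iff .
      moreover have "int K \<le> b" using bk k by simp
      ultimately have "int (length adj + length (concat adj) + K + 100) \<le> B" using bN bb b14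
        unfolding of_nat_add of_nat_mult of_nat_numeral by linarith
      then have p': "prog B K adj (map \<omega> vs) L"
        using p m10 unfolding prog_def prog_axioms_def by blast
      interpret Q: listed B K adj "map \<omega> vs" L V E vs \<omega> by (rule listed.intro[OF p' listed_axioms.intro]) (use g a in auto)
      obtain t M where t: "halts_in cvc_prog B S (input_words (int K) adj) (map \<omega> vs) t M"
        "t \<le> 520 + 2 ^ K * (30000 * Q.KN) + 40 * K"
        "(\<exists>X. min_weight_cvc V E \<omega> (int K) X \<and> outputs_set vs M X) \<or>
         ((\<nexists>X. connected_vertex_cover V E X \<and> int (card X) \<le> int K) \<and> outputs_none M)"
        using Q.run_prog[OF S(1) KL(2)] by blast
      have "t \<le> C * time_bound V E k"
      proof -
        have "Q.KN \<le> (2 * m) * (3 * max 1 N)" unfolding Q.KN_def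
          by (intro mult_le_mono) (use D mm[folded K_def] NN in linarith)+
        then have "2 ^ K * (30000 * Q.KN) \<le> 2 ^ K * (30000 * ((2 * m) * (3 * max 1 N)))" by (intro mult_le_mono2)
        also have "\<dots> = 180000 * (2 ^ nat k * m * max 1 N)" by (simp add: K_def)
        finally have 1: "2 ^ K * (30000 * Q.KN) \<le> 180000 * (2 ^ nat k * m * max 1 N)" .
        have "m * 1 \<le> m * (2 ^ nat k * max 1 N)" by (intro mult_le_mono2) simp
        also have "\<dots> = 2 ^ nat k * m * max 1 N" by (simp only: mult.assoc mult.commute mult.left_commute)
        finally have "m \<le> 2 ^ nat k * m * max 1 N" by simp
        moreover have "520 + 40 * K \<le> 560 * m" using mm[folded K_def] by linarith
        ultimately show ?thesis using t(2) 1 T by linarith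
      qed
      then show ?thesis using t unfolding B_def S_def k by blast
    qed
  qed
  then show ?thesis by blast
qed

end
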